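(* For every integer $m \geq 3$: (1) there exists a complete minimal surface immersed in $\mathbb{R}^m$ whose (generalized) Gauss map is non-degenerate and omits $\frac{m(m+1)}{2}$ hyperplanes in $\mathbb{P}^{m-1}$ in general position; moreover, this surface can be chosen to be a pseudo-algebraic minimal surface in $\mathbb{R}^m$; (2) there exists a complete Riemann surface holomorphically immersed in $\mathbb{C}^m$, not contained in any affine hyperplane of $\mathbb{C}^m$, whose complex Gauss map omits $\frac{m(m+1)}{2}$ hyperplanes in $\mathbb{P}^{m-1}$ in general position.
   Context: $\mathbb{P}^{m-1}$ is complex projective space. Hyperplanes in $\mathbb{P}^{m-1}$ are in general position if any $m$ of them have linearly independent coefficient vectors. A map omits a hyperplane if its image is disjoint from it. A holomorphic map $G$ from a Riemann surface $S$ to $\mathbb{P}^{m-1}$ is non-degenerate if $G(S)$ is not contained in any hyperplane. A minimal surface $x = (x_1, \ldots, x_m): S \to \mathbb{R}^m$ immersed in $\mathbb{R}^m$ is a connected oriented surface $S$ with an immersion $x$ of mean curvature zero; $S$ is a Riemann surface via the conformal structure of the induced metric, and it is complete if the induced metric is complete. The set of oriented $2$-dimensional subspaces of $\mathbb{R}^m$ is identified with the quadric $Q_{m-2} = \{(w_1 : \cdots : w_m) \in \mathbb{P}^{m-1} \mid w_1^2 + \cdots + w_m^2 = 0\}$. The (generalized) Gauss map $G: S \to Q_{m-2} \subset \mathbb{P}^{m-1}$ sends $p$ to the oriented tangent plane $T_p(S)$; it is holomorphic and in a local complex coordinate $z$ is $G = (\partial x_1/\partial z : \cdots : \partial x_m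 / \partial z)$. A Riemann surface $S$ is holomorphically immersed in $\mathbb{C}^m$ if there is a holomorphic map $f: S \to \mathbb{C}^m$ with $df$ nowhere vanishing; it is complete if the metric induced from the Euclidean metric of $\mathbb{C}^m$ is complete. Its complex Gauss map sends $p \in S$ to the point of $\mathbb{P}^{m-1}$ corresponding to the complex tangent line of $f$ at $p$, i.e. $G = (f_1' : \cdots : f_m')$ in a local coordinate. "Not contained in an affine hyperplane" means that $f(S)$ is not contained in one. A complete minimal surface $x: \widetilde{M} \to \mathbb{R}^m$ is pseudo-algebraic if there exist a compact Riemann surface $\overline{M}$, a finite set $\{p_1, \ldots, p_k\} \subset \overline{M}$, a covering $\pi: \widetilde{M} \to M := \overline{M} \setminus \{p_1, \ldots, p_k\}$ (possibly the universal covering), and holomorphic $1$-forms $\phi_1, \ldots, \phi_m$ on $M$ without common zeros, with $\sum_k \phi_k^2 = 0$, extending meromorphically to $\overline{M}$, such that $x_k = \Re \int \pi^*\phi_k$ (up to additive constants) for all $k$ and the metric $\frac{1}{2}\sum_k |\phi_k|^2$ is complete on $M$. *)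

theory Defs
  imports "HOL-Complex_Analysis.Complex_Analysis"
begin

section \<open>Riemann surfaces\<close>

text \<open>
  A chart is a pair of its domain and its coordinate map; an atlas is a set of charts on an
  abstract topological space whose carrier may be a proper subset of the ambient type.
\<close>

type_synonym 'a chart = "'a set \<times> ('a \<Rightarrow> complex)"

definition coords :: "'a chart \<Rightarrow> complex set" where
  "coords C = snd C ` fst C"

definition param :: "'a chart \<Rightarrow> complex \<Rightarrow> 'a" where
  "param C = inv_into (fst C) (snd C)"

text \<open>
  No countability axiom is imposed: a connected Riemann surface is second countable by
  Rado's theorem, and in particular has at most the cardinality of the continuum.
\<close>

definition riemann_surface :: "'a topology \<Rightarrow> 'a chart set \<Rightarrow> bool" where
  "riemann_surface X A \<longleftrightarrow>
     topspace X \<noteq> {} \<and> connected_space X \<and> Hausdorff_space X \<and>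
     (\<Union>C\<in>A. fst C) = topspace X \<and>
     (\<forall>C\<in>A. openin X (fst C) \<and> open (coords C) \<and>
        homeomorphic_map (subtopology X (fst C)) (top_of_set (coords C)) (snd C)) \<and>
     (\<forall>C\<in>A. \<forall>D\<in>A. (snd D \<circ> param C) holomorphic_on (snd C ` (fst C \<inter> fst D)))"

definition puncture_atlas :: "'a chart set \<Rightarrow> 'a set \<Rightarrow> 'a chart set" where
  "puncture_atlas A P = (\<lambda>C. (fst C - P, snd C)) ` A"

text \<open>
  Below, this choice is used only for quantities whose value at \<open>p\<close> is the same in every chart
  around \<open>p\<close>.
\<close>

definition chart_at :: "'a chart set \<Rightarrow> 'a \<Rightarrow> 'a chart" where
  "chart_at A p = (SOME C. C \<in> A \<and> p \<in> fst C)"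

definition holomorphic_surface_map ::
    "'a topology \<Rightarrow> 'a chart set \<Rightarrow> 'b topology \<Rightarrow> 'b chart set \<Rightarrow> ('a \<Rightarrow> 'b) \<Rightarrow> bool" where
  "holomorphic_surface_map X A Y B \<pi> \<longleftrightarrow>
     continuous_map X Y \<pi> \<and>
     (\<forall>C\<in>A. \<forall>D\<in>B. (snd D \<circ> \<pi> \<circ> param C) holomorphic_on (snd C ` {p \<in> fst C. \<pi> p \<in> fst D}))"

text \<open>The analogue of \<open>covering_space\<close> for abstract topologies.\<close>

definition covering_of :: "'a topology \<Rightarrow> 'b topology \<Rightarrow> ('a \<Rightarrow> 'b) \<Rightarrow> bool" where
  "covering_of X Y \<pi> \<longleftrightarrow>
     continuous_map X Y \<pi> \<and> \<pi> ` topspace X = topspace Y \<and>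
     (\<forall>y\<in>topspace Y. \<exists>V. openin Y V \<and> y \<in> V \<and>
        (\<exists>\<U>. (\<forall>U\<in>\<U>. openin X U) \<and> pairwise disjnt \<U> \<and>
              \<Union>\<U> = {p \<in> topspace X. \<pi> p \<in> V} \<and>
              (\<forall>U\<in>\<U>. homeomorphic_map (subtopology X U) (subtopology Y V) \<pi>)))"


section \<open>Curves, Riemannian metrics, completeness\<close>

definition C1_curve_on :: "'a chart set \<Rightarrow> real \<Rightarrow> real \<Rightarrow> (real \<Rightarrow> 'a) \<Rightarrow> bool" where
  "C1_curve_on A a b \<gamma> \<longleftrightarrow>
     (\<forall>C\<in>A. \<exists>D. continuous_on {t\<in>{a..b}. \<gamma> t \<in> fst C} D \<and>
        (\<forall>t\<in>{a..b}. \<gamma> t \<in> fst C \<longrightarrow>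
           ((snd C \<circ> \<gamma>) has_vector_derivative D t) (at t within {a..b})))"

text \<open>
  The pieces are continuously differentiable up to and including their end points, so the
  integrals below never suffer from the value \<open>0\<close> of \<^const>\<open>integral\<close> on functions that
  are not integrable.
\<close>

definition piecewise_C1_curve :: "'a topology \<Rightarrow> 'a chart set \<Rightarrow> (real \<Rightarrow> 'a) \<Rightarrow> bool" where
  "piecewise_C1_curve X A \<gamma> \<longleftrightarrow>
     pathin X \<gamma> \<and>
     (\<exists>F. finite F \<and>
        (\<forall>a b. 0 \<le> a \<and> a < b \<and> b \<le> 1 \<and> {a<..<b} \<inter> F = {} \<longrightarrow> C1_curve_on A a b \<gamma>))"

text \<open>
  \<open>ds C z v\<close> is the length of the tangent vector with coordinate \<open>v\<close> at the point with
  coordinate \<open>z\<close>, both with respect to the chart \<open>C\<close>.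
\<close>

type_synonym 'a line_element = "'a chart \<Rightarrow> complex \<Rightarrow> complex \<Rightarrow> real"

definition curve_length :: "'a chart set \<Rightarrow> 'a line_element \<Rightarrow> (real \<Rightarrow> 'a) \<Rightarrow> real" where
  "curve_length A ds \<gamma> =
     integral {0..1} (\<lambda>t. let C = chart_at A (\<gamma> t)
                          in ds C (snd C (\<gamma> t)) (vector_derivative (snd C \<circ> \<gamma>) (at t)))"

definition surface_dist ::
    "'a topology \<Rightarrow> 'a chart set \<Rightarrow> 'a line_element \<Rightarrow> 'a \<Rightarrow> 'a \<Rightarrow> real" where
  "surface_dist X A ds p q =
     (if p \<in> topspace X \<and> q \<in> topspace X
      then Inf (curve_length A ds ` {\<gamma>. piecewise_C1_curve X A \<gamma> \<and> \<gamma> 0 = p \<and> \<gamma> 1 = q})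
      else 0)"

text \<open>
  The first conjunct holds for every Riemannian metric on a connected surface; it is stated
  because \<open>mcomplete\<close> is only meaningful inside the locale.
\<close>

definition complete_surface :: "'a topology \<Rightarrow> 'a chart set \<Rightarrow> 'a line_element \<Rightarrow> bool" where
  "complete_surface X A ds \<longleftrightarrow>
     Metric_space (topspace X) (surface_dist X A ds) \<and>
     Metric_space.mcomplete (topspace X) (surface_dist X A ds)"

definition induced_metric :: "('a \<Rightarrow> 'v::real_normed_vector) \<Rightarrow> 'a line_element" where
  "induced_metric f C z v = norm (frechet_derivative (f \<circ> param C) (at z) v)"


section \<open>Holomorphic one-forms\<close>

text \<open>A one-form \<open>\<omega>\<close> is given in the chart \<open>C\<close> with coordinate \<open>z\<close> by \<open>\<omega> C z dz\<close>.\<close>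

type_synonym 'a one_form = "'a chart \<Rightarrow> complex \<Rightarrow> complex"

definition holomorphic_form :: "'a chart set \<Rightarrow> 'a one_form \<Rightarrow> bool" where
  "holomorphic_form A \<omega> \<longleftrightarrow>
     (\<forall>C\<in>A. \<omega> C holomorphic_on coords C) \<and>
     (\<forall>C\<in>A. \<forall>D\<in>A. \<forall>z \<in> snd C ` (fst C \<inter> fst D).
        \<omega> C z = \<omega> D ((snd D \<circ> param C) z) * deriv (snd D \<circ> param C) z)"

text \<open>For a form on the complement of the finite set \<open>P\<close> in the surface with atlas \<open>B\<close>.\<close>

definition extends_meromorphically :: "'a chart set \<Rightarrow> 'a set \<Rightarrow> 'a one_form \<Rightarrow> bool" where
  "extends_meromorphically B P \<omega> \<longleftrightarrow>
     (\<forall>C\<in>B. \<omega> (fst C - P, snd C) meromorphic_on coords C)"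

definition pullback_form :: "'b chart set \<Rightarrow> ('a \<Rightarrow> 'b) \<Rightarrow> 'b one_form \<Rightarrow> 'a one_form" where
  "pullback_form B \<pi> \<omega> C z =
     (let D = chart_at B (\<pi> (param C z))
      in \<omega> D ((snd D \<circ> \<pi> \<circ> param C) z) * deriv (snd D \<circ> \<pi> \<circ> param C) z)"

definition form_integral :: "'a chart set \<Rightarrow> 'a one_form \<Rightarrow> (real \<Rightarrow> 'a) \<Rightarrow> complex" where
  "form_integral A \<omega> \<gamma> =
     integral {0..1} (\<lambda>t. let C = chart_at A (\<gamma> t)
                          in \<omega> C (snd C (\<gamma> t)) * vector_derivative (snd C \<circ> \<gamma>) (at t))"

definition weierstrass_metric :: "('m::finite \<Rightarrow> 'a one_form) \<Rightarrow> 'a line_element" where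
  "weierstrass_metric \<phi> C z v = sqrt (1/2 * (\<Sum>k\<in>UNIV. (cmod (\<phi> k C z))\<^sup>2)) * cmod v"


section \<open>Projective space\<close>

text \<open>A point of projective space is a one-dimensional complex subspace of \<open>complex ^ 'm\<close>.\<close>

definition proj_point :: "complex ^ 'm \<Rightarrow> (complex ^ 'm) set" where
  "proj_point w = vec.span {w}"

definition proj_hyperplane :: "complex ^ 'm \<Rightarrow> (complex ^ 'm) set set" where
  "proj_hyperplane a = {proj_point w | w. w \<noteq> 0 \<and> (\<Sum>k\<in>UNIV. a $ k * w $ k) = 0}"

text \<open>
  The hyperplanes with coefficient vectors \<open>a 0, \<dots>, a (N - 1)\<close>; for \<open>N \<ge> CARD('m)\<close> the
  condition forces all these vectors to be nonzero.
\<close>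

definition in_general_position :: "nat \<Rightarrow> (nat \<Rightarrow> complex ^ 'm) \<Rightarrow> bool" where
  "in_general_position N a \<longleftrightarrow>
     (\<forall>I \<subseteq> {..<N}. card I = CARD('m) \<longrightarrow> inj_on a I \<and> vec.independent (a ` I))"

definition omits_hyperplane ::
    "'a topology \<Rightarrow> ('a \<Rightarrow> (complex ^ 'm) set) \<Rightarrow> complex ^ 'm \<Rightarrow> bool" where
  "omits_hyperplane X G a \<longleftrightarrow> G ` topspace X \<inter> proj_hyperplane a = {}"

definition nondegenerate_map :: "'a topology \<Rightarrow> ('a \<Rightarrow> (complex ^ 'm) set) \<Rightarrow> bool" where
  "nondegenerate_map X G \<longleftrightarrow> \<not> (\<exists>a. a \<noteq> 0 \<and> G ` topspace X \<subseteq> proj_hyperplane a)"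


section \<open>Minimal surfaces\<close>

text \<open>Directional derivative; the directions \<open>1\<close> and \<open>\<i>\<close> give \<open>\<partial>/\<partial>u\<close> and \<open>\<partial>/\<partial>v\<close> for \<open>z = u + \<i> v\<close>.\<close>

definition pd :: "complex \<Rightarrow> (complex \<Rightarrow> 'v::real_normed_vector) \<Rightarrow> complex \<Rightarrow> 'v" where
  "pd e f z = frechet_derivative f (at z) e"

definition smooth_on_open :: "complex set \<Rightarrow> (complex \<Rightarrow> 'v::real_normed_vector) \<Rightarrow> bool" where
  "smooth_on_open S f \<longleftrightarrow> open S \<and> (\<forall>es. \<forall>z\<in>S. fold pd es f differentiable (at z))"

definition normal_part ::
    "(complex \<Rightarrow> 'v::euclidean_space) \<Rightarrow> complex \<Rightarrow> 'v \<Rightarrow> 'v" where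
  "normal_part g z w = w - closest_point (span {pd 1 g z, pd \<i> g z}) w"

text \<open>
  Half the trace, with respect to the first fundamental form, of the vector-valued second
  fundamental form of a parametrized surface; the coordinates need not be isothermal.
\<close>

definition mean_curvature_vector ::
    "(complex \<Rightarrow> 'v::euclidean_space) \<Rightarrow> complex \<Rightarrow> 'v" where
  "mean_curvature_vector g z =
     (let E = pd 1 g z \<bullet> pd 1 g z; F = pd 1 g z \<bullet> pd \<i> g z; G = pd \<i> g z \<bullet> pd \<i> g z;
          L = normal_part g z (pd 1 (pd 1 g) z);
          M = normal_part g z (pd \<i> (pd 1 g) z);
          N = normal_part g z (pd \<i> (pd \<i> g) z)
      in (1 / (2 * (E * G - F\<^sup>2))) *\<^sub>R (G *\<^sub>R L - (2 * F) *\<^sub>R M + E *\<^sub>R N))"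

text \<open>
  The complex structure being the one determined by the induced metric and the orientation
  means that every chart is isothermal (the orientation is that of the complex structure).
\<close>

definition minimal_surface ::
    "'a topology \<Rightarrow> 'a chart set \<Rightarrow> ('a \<Rightarrow> real ^ 'm) \<Rightarrow> bool" where
  "minimal_surface X A x \<longleftrightarrow>
     riemann_surface X A \<and>
     (\<forall>C\<in>A. let g = x \<circ> param C in
        smooth_on_open (coords C) g \<and>
        (\<forall>z\<in>coords C.
           inj (frechet_derivative g (at z)) \<and>
           norm (pd 1 g z) = norm (pd \<i> g z) \<and> pd 1 g z \<bullet> pd \<i> g z = 0 \<and>
           mean_curvature_vector g z = 0))"

definition complete_minimal_surface ::
    "'a topology \<Rightarrow> 'a chart set \<Rightarrow> ('a \<Rightarrow> real ^ 'm) \<Rightarrow> bool" where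
  "complete_minimal_surface X A x \<longleftrightarrow>
     minimal_surface X A x \<and> complete_surface X A (induced_metric x)"

text \<open>The vector of the Wirtinger derivatives \<open>\<partial>g\<^sub>k/\<partial>z = (\<partial>g\<^sub>k/\<partial>u - \<i> \<partial>g\<^sub>k/\<partial>v) / 2\<close>.\<close>

definition wirtinger :: "(complex \<Rightarrow> real ^ 'm) \<Rightarrow> complex \<Rightarrow> complex ^ 'm" where
  "wirtinger g z =
     (\<chi> k. (complex_of_real (pd 1 g z $ k) - \<i> * complex_of_real (pd \<i> g z $ k)) / 2)"

definition gauss_map ::
    "'a chart set \<Rightarrow> ('a \<Rightarrow> real ^ 'm) \<Rightarrow> 'a \<Rightarrow> (complex ^ 'm) set" where
  "gauss_map A x p =
     (let C = chart_at A p in proj_point (wirtinger (x \<circ> param C) (snd C p)))"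

text \<open>
  The compactification has the topology \<open>Y\<close> and the atlas \<open>B\<close>; the punctures are \<open>P\<close>. The type
  argument only provides a carrier for it; by the cardinality remark above, every type with at
  least continuum many elements gives the same notion.
\<close>

definition pseudo_algebraic ::
    "'b itself \<Rightarrow> 'a topology \<Rightarrow> 'a chart set \<Rightarrow> ('a \<Rightarrow> real ^ 'm) \<Rightarrow> bool" where
  "pseudo_algebraic (_ :: 'b itself) X A x \<longleftrightarrow>
     complete_minimal_surface X A x \<and>
     (\<exists>(Y :: 'b topology) B P \<pi> (\<phi> :: 'm \<Rightarrow> 'b one_form).
        riemann_surface Y B \<and> compact_space Y \<and> finite P \<and> P \<subseteq> topspace Y \<and>
        (let M = subtopology Y (topspace Y - P); BM = puncture_atlas B P in
          covering_of X M \<pi> \<and> holomorphic_surface_map X A M BM \<pi> \<and>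
          (\<forall>k. holomorphic_form BM (\<phi> k) \<and> extends_meromorphically B P (\<phi> k)) \<and>
          (\<forall>C\<in>BM. \<forall>z\<in>coords C.
             (\<exists>k. \<phi> k C z \<noteq> 0) \<and> (\<Sum>k\<in>UNIV. (\<phi> k C z)\<^sup>2) = 0) \<and>
          (\<forall>\<gamma> k. piecewise_C1_curve X A \<gamma> \<longrightarrow>
             x (\<gamma> 1) $ k - x (\<gamma> 0) $ k = Re (form_integral A (pullback_form BM \<pi> (\<phi> k)) \<gamma>)) \<and>
          complete_surface M BM (weierstrass_metric \<phi>)))"


section \<open>Holomorphic curves in complex space\<close>

definition holomorphic_immersion ::
    "'a chart set \<Rightarrow> ('a \<Rightarrow> complex ^ 'm) \<Rightarrow> bool" where
  "holomorphic_immersion A f \<longleftrightarrow>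
     (\<forall>C\<in>A. (\<forall>k. (\<lambda>z. f (param C z) $ k) holomorphic_on coords C) \<and>
        (\<forall>z\<in>coords C. \<exists>k. deriv (\<lambda>z. f (param C z) $ k) z \<noteq> 0))"

definition complex_gauss_map ::
    "'a chart set \<Rightarrow> ('a \<Rightarrow> complex ^ 'm) \<Rightarrow> 'a \<Rightarrow> (complex ^ 'm) set" where
  "complex_gauss_map A f p =
     (let C = chart_at A p in proj_point (\<chi> k. deriv (\<lambda>z. f (param C z) $ k) (snd C p)))"

definition in_affine_hyperplane :: "(complex ^ 'm) set \<Rightarrow> bool" where
  "in_affine_hyperplane S \<longleftrightarrow> (\<exists>a b. a \<noteq> 0 \<and> (\<forall>w\<in>S. (\<Sum>k\<in>UNIV. a $ k * w $ k) = b))"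

end

theory Submission
  imports Defs "Jordan_Normal_Form.Determinant"
begin

no_notation Matrix.vec_index (infixl \<open>$\<close> 100)
no_notation Matrix.scalar_prod (infix \<open>\<bullet>\<close> 70)
no_notation fps_nth (infixl \<open>$\<close> 75)
hide_const (open) module.smult
hide_fact (open) Matrix.vec_eq_iff

text \<open>
  Write \<open>m = CARD('m)\<close> and \<open>N = m (m + 1) / 2\<close>. Everything comes from one rational null curve on the sphere.

  \<^item> \<open>exists_general_position_family\<close>: there are a set \<open>Z\<close> of \<open>m\<close> points of the plane and \<open>N\<close> polynomials of degree
  less than \<open>m\<close>, any \<open>m\<close> of them linearly independent, whose zeros all lie in \<open>Z\<close>.

  \<^item> \<open>sum_null_poly_squares\<close>, \<open>dual_vec_null_poly\<close>: the polynomials of degree less than \<open>m\<close> have a basis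
  \<open>g\<^sub>1, \<dots>, g\<^sub>m\<close> with \<open>g\<^sub>1\<^sup>2 + \<dots> + g\<^sub>m\<^sup>2 = 0\<close>.

  The curve \<open>(g\<^sub>1 : \<dots> : g\<^sub>m)\<close> lies in the quadric and in no hyperplane. A hyperplane with coefficients \<open>a\<close> meets it
  where \<open>a\<^sub>1 g\<^sub>1 + \<dots> + a\<^sub>m g\<^sub>m\<close> vanishes, and this combination is an arbitrary polynomial of degree less than \<open>m\<close>.
  Hence the \<open>N\<close> polynomials of the first item are \<open>N\<close> hyperplanes in general position, none of which is met over the
  complement of \<open>Z\<close>.

  It remains to find a complete surface with this Gauss map. The forms \<open>g\<^sub>k(z) dz / \<Prod>\<^sub>i (z - z\<^sub>i)\<close>, where
  \<open>Z = {z\<^sub>1, \<dots>, z\<^sub>m}\<close>, have at most simple poles on the sphere, and their partial fractions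
  \<open>\<Sum>\<^sub>i c\<^sub>k\<^sub>i dz / (z - z\<^sub>i)\<close> have an invertible matrix \<open>c\<close>. Consequently the metric that they define dominates
  \<open>\<bar>dz\<bar> / \<bar>z - z\<^sub>i\<bar>\<close> for every \<open>i\<close> (\<open>R_vec_lower_bound\<close>), so that every \<open>log (z - z\<^sub>i)\<close> is a Lipschitz function.
  A curve of finite length therefore stays away from \<open>Z\<close> and from infinity, which is completeness
  (\<open>complete_cover\<close>, \<open>complete_base\<close>).

  The forms have residues; their primitives exist on the covering surface on which all the logarithms
  \<open>w\<^sub>i = log (z - z\<^sub>i)\<close> are functions, namely \<open>S = {(z, w). exp w\<^sub>i = z - z\<^sub>i for all i}\<close>. There the holomorphic curve is
  the linear map \<open>f\<^sub>k = \<Sum>\<^sub>i c\<^sub>k\<^sub>i w\<^sub>i\<close>, and the minimal surface is its real part. By construction it is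
  pseudo-algebraic: it covers the sphere minus \<open>Z\<close> and infinity.

  The count \<open>N\<close> arises as follows. Two points \<open>a, b\<close> of the sphere carry the \<open>m\<close> polynomials
  \<open>(z - a)\<^sup>e (z - b)\<^sup>m\<^sup>-\<^sup>1\<^sup>-\<^sup>e\<close>, and \<open>Z\<close> together with infinity has \<open>m + 1\<close> points. For odd \<open>m\<close> these form
  \<open>(m + 1) / 2\<close> pairs. For even \<open>m\<close> three of the points, \<open>0\<close>, \<open>-1\<close> and infinity, are treated together and carry
  \<open>3 m / 2\<close> polynomials; the rest form pairs.
\<close>

section \<open>Total positivity of binomial coefficient matrices\<close>

definition coeff_minor :: "nat \<Rightarrow> (nat \<Rightarrow> real poly) \<Rightarrow> (nat \<Rightarrow> nat) \<Rightarrow> real" where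
  "coeff_minor n r t = Determinant.det (Matrix.mat n n (\<lambda>(i,j). coeff (r i) (t j)))"

lemma det_mat_column_add:
  fixes M :: "nat \<Rightarrow> nat \<Rightarrow> 'a :: comm_ring_1"
  assumes "k < n"
  shows "Determinant.det (Matrix.mat n n (\<lambda>(i,j). if j = k then x i + y i else M i j)) =
    Determinant.det (Matrix.mat n n (\<lambda>(i,j). if j = k then x i else M i j)) +
    Determinant.det (Matrix.mat n n (\<lambda>(i,j). if j = k then y i else M i j))"
proof -
  define A where "A z = Matrix.mat n n (\<lambda>(i,j). if j = k then z i else M i j)" for z :: "nat \<Rightarrow> 'a"
  have Ac: "A z \<in> carrier_mat n n" for z by (simp add: A_def)
  have cof: "cofactor (A z) i k = cofactor (A z') i k" if "i < n" for z z' i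
  proof -
    have "mat_delete (A z) i k = mat_delete (A z') i k"
      using that assms by (intro eq_matI) (auto simp: mat_delete_def A_def)
    then show ?thesis by (simp add: cofactor_def)
  qed
  have e: "Determinant.det (A z) = (\<Sum>i<n. z i * cofactor (A x) i k)" for z
    unfolding laplace_expansion_column[OF Ac assms]
  proof (rule sum.cong[OF refl])
    fix i assume "i \<in> {..<n}"
    then show "A z $$ (i,k) * cofactor (A z) i k = z i * cofactor (A x) i k"
      using cof[of i z x] assms by (simp add: A_def[of z])
  qed
  have "Determinant.det (A (\<lambda>i. x i + y i)) = Determinant.det (A x) + Determinant.det (A y)"
    unfolding e by (simp add: ring_distribs sum.distrib)
  then show ?thesis by (simp add: A_def)
qed

lemma coeff_minor_zero_column:
  assumes "k < n" "\<And>i. i < n \<Longrightarrow> coeff (r i) (t k) = 0"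
  shows "coeff_minor n r t = 0"
proof -
  have "coeff_minor n r t = (\<Sum>i<n. coeff (r i) (t k) * cofactor (Matrix.mat n n (\<lambda>(i,j). coeff (r i) (t j))) i k)"
    unfolding coeff_minor_def
    by (subst laplace_expansion_column[of _ n k]) (use assms in auto)
  then show ?thesis using assms by simp
qed

text \<open>
  Multiplication of all rows by \<open>1 + z\<close> adds to every column of the coefficient matrix the column on its left. A minor
  of the product is therefore, by linearity in each column, the sum of the minors of the original matrix in which every
  column index \<open>t i\<close> is kept or lowered by one. Column sets with a repetition contribute zero, and the others
  are still increasing, so all summands are nonnegative and each of them is a lower bound.
\<close>

lemma coeff_minor_mult_linear:
  fixes r :: "nat \<Rightarrow> real poly"
  assumes nonneg: "\<And>s. strict_mono_on {..<n} s \<Longrightarrow> 0 \<le> coeff_minor n r s"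
    and t: "strict_mono_on {..<n} t"
  shows "0 \<le> coeff_minor n (\<lambda>i. [:1,1:] * r i) t"
    and "\<lbrakk>strict_mono_on {..<n} s; \<And>i. i < n \<Longrightarrow> s i = t i \<or> Suc (s i) = t i\<rbrakk> \<Longrightarrow>
      coeff_minor n r s \<le> coeff_minor n (\<lambda>i. [:1,1:] * r i) t"
proof -
  \<comment> \<open>The columns before \<open>k\<close> are expanded already, with the choice \<open>s\<close>.\<close>
  define mix where "mix k s = Determinant.det (Matrix.mat n n (\<lambda>(i,j).
      if j < k then coeff (r i) (s j) else coeff ([:1,1:] * r i) (t j)))" for k and s :: "nat \<Rightarrow> nat"
  have mix0: "mix 0 s = coeff_minor n (\<lambda>i. [:1,1:] * r i) t" for s
    by (simp add: mix_def coeff_minor_def)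
  have mixn: "mix n s = coeff_minor n r s" for s
    unfolding mix_def coeff_minor_def by (intro arg_cong[where f=Determinant.det] eq_matI) auto
  have step: "mix k s = mix (Suc k) (s(k := t k)) + (if t k = 0 then 0 else mix (Suc k) (s(k := t k - 1)))"
    if k: "k < n" for k s
  proof -
    define M where "M i j = (if j < k then coeff (r i) (s j) else coeff ([:1,1:] * r i) (t j))" for i j
    have "mix k s = Determinant.det (Matrix.mat n n (\<lambda>(i,j). if j = k then coeff (r i) (t k) +
        (if t k = 0 then 0 else coeff (r i) (t k - 1)) else M i j))"
      unfolding mix_def M_def
      by (intro arg_cong[where f=Determinant.det] eq_matI) (auto simp: coeff_pCons split: nat.splits)
    also have "\<dots> = Determinant.det (Matrix.mat n n (\<lambda>(i,j). if j = k then coeff (r i) (t k) else M i j)) +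
       Determinant.det (Matrix.mat n n (\<lambda>(i,j). if j = k then (if t k = 0 then 0 else coeff (r i) (t k - 1)) else M i j))"
      by (rule det_mat_column_add[OF k])
    also have "Determinant.det (Matrix.mat n n (\<lambda>(i,j). if j = k then coeff (r i) (t k) else M i j)) = mix (Suc k) (s(k := t k))"
      unfolding mix_def M_def by (intro arg_cong[where f=Determinant.det] eq_matI) auto
    also have "Determinant.det (Matrix.mat n n (\<lambda>(i,j). if j = k then (if t k = 0 then 0 else coeff (r i) (t k - 1)) else M i j)) =
       (if t k = 0 then 0 else mix (Suc k) (s(k := t k - 1)))"
    proof (cases "t k = 0")
      case True
      have "Determinant.det (Matrix.mat n n (\<lambda>(i,j). if j = k then 0 else M i j)) = 0"
        by (subst laplace_expansion_column[of _ n k]) (use k in auto)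
      then show ?thesis unfolding True simp_thms if_True .
    next
      case False
      then show ?thesis
        unfolding mix_def M_def by simp (intro arg_cong[where f=Determinant.det] eq_matI; auto)
    qed
    finally show ?thesis .
  qed
  have tk: "t i < t j" if "i < j" "j < n" for i j
    using strict_mono_onD[OF t, of i j] that by auto
  have mix_nonneg: "0 \<le> mix k s" if "k \<le> n" "strict_mono_on {..<k} s" "\<And>i. i < k \<Longrightarrow> s i \<le> t i" for k s
    using that
  proof (induction "n - k" arbitrary: k s)
    case 0
    then have "k = n" by simp
    then show ?case using nonneg[of s] 0 mixn[of s] by simp
  next
    case (Suc l)
    then have k: "k < n" by simp
    have upd: "strict_mono_on {..<Suc k} (s(k := v))" if "\<And>i. i < k \<Longrightarrow> s i < v" for v
      using Suc.prems(2) that by (auto simp: strict_mono_on_def less_Suc_eq)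
    have lt: "s i < t k" if "i < k" for i
      using Suc.prems(3)[OF that] tk[OF that k] by simp
    have 1: "0 \<le> mix (Suc k) (s(k := t k))"
      by (rule Suc.hyps(1)) (use Suc.hyps(2) Suc.prems k lt upd in \<open>auto simp: less_Suc_eq\<close>)
    \<comment> \<open>Lowering the index may repeat the previous column; then the minor vanishes.\<close>
    have 2: "0 \<le> mix (Suc k) (s(k := t k - 1))" if nz: "t k \<noteq> 0"
    proof (cases "\<exists>i<k. s i = t k - 1")
      case True
      then obtain i where i: "i < k" "s i = t k - 1" by auto
      have "mix (Suc k) (s(k := t k - 1)) = 0"
        unfolding mix_def
        by (rule det_identical_columns[of _ n i k]) (use i k in \<open>auto simp: col_def\<close>)
      then show ?thesis by simp
    next
      case False
      have "s i < t k - 1" if "i < k" for i using lt[OF that] False that nz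
        by (metis One_nat_def Suc_leI le_neq_implies_less less_Suc_eq_le Suc_pred' gr0I)
      then show ?thesis
        by (intro Suc.hyps(1)) (use Suc.hyps(2) Suc.prems k upd in \<open>auto simp: less_Suc_eq\<close>)
    qed
    show ?case unfolding step[OF k] using 1 2 by auto
  qed
  show "0 \<le> coeff_minor n (\<lambda>i. [:1,1:] * r i) t"
    using mix_nonneg[of 0] by (simp add: mix0 strict_mono_on_def)
  assume s: "strict_mono_on {..<n} s" and st: "\<And>i. i < n \<Longrightarrow> s i = t i \<or> Suc (s i) = t i"
  have mixcong: "mix k u = mix k v" if "\<And>i. i < k \<Longrightarrow> u i = v i" for k u v
    unfolding mix_def using that by (intro arg_cong[where f=Determinant.det] eq_matI) auto
  have "coeff_minor n r s \<le> mix k s" if "k \<le> n" for k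
    using that
  proof (induction "n - k" arbitrary: k)
    case 0
    then have "k = n" by simp
    then show ?case using mixn[of s] by simp
  next
    case (Suc l)
    then have k: "k < n" by simp
    have ih: "coeff_minor n r s \<le> mix (Suc k) s"
      by (rule Suc.hyps(1)) (use Suc.hyps(2) k in auto)
    have mono: "strict_mono_on {..<Suc k} s"
      using s k by (auto simp: strict_mono_on_def)
    have sle: "s i \<le> t i" if "i < n" for i using st[OF that] by auto
    have lt: "s i < t k" if "i < k" for i
      using sle[of i] tk[OF that k] that k by simp
    have upd: "strict_mono_on {..<Suc k} (s(k := v))" if "\<And>i. i < k \<Longrightarrow> s i < v" for v
      using mono that by (auto simp: strict_mono_on_def less_Suc_eq)
    have 1: "0 \<le> mix (Suc k) (s(k := t k))"
      by (rule mix_nonneg) (use k lt upd sle in \<open>auto simp: less_Suc_eq\<close>)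
    show ?case
    proof (cases "s k = t k")
      case True
      have a: "mix (Suc k) (s(k := t k)) = mix (Suc k) s" using True by (intro mixcong) auto
      have 2: "0 \<le> mix (Suc k) (s(k := t k - 1))" if nz: "t k \<noteq> 0"
      proof (cases "\<exists>i<k. s i = t k - 1")
        case True
        then obtain i where i: "i < k" "s i = t k - 1" by auto
        have "mix (Suc k) (s(k := t k - 1)) = 0"
          unfolding mix_def
          by (rule det_identical_columns[of _ n i k]) (use i k in \<open>auto simp: col_def\<close>)
        then show ?thesis by simp
      next
        case False
        have "s i < t k - 1" if "i < k" for i using lt[OF that] False that nz
          by (metis Suc_diff_1 gr0I less_antisym)
        then show ?thesis
          by (intro mix_nonneg) (use k sle upd in \<open>auto simp: less_Suc_eq\<close>)
      qed
      show ?thesis unfolding step[OF k] using a 2 ih by auto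
    next
      case False
      then have b: "Suc (s k) = t k" using st[OF k] by auto
      then have "mix (Suc k) (s(k := t k - 1)) = mix (Suc k) s" by (intro mixcong) auto
      then show ?thesis unfolding step[OF k] using 1 ih b by auto
    qed
  qed
  from this[of 0] show "coeff_minor n r s \<le> coeff_minor n (\<lambda>i. [:1,1:] * r i) t" by (simp add: mix0)
qed

lemma coeff_minor_peel_first:
  assumes "r 0 = 1" and t: "strict_mono_on {..<Suc n} t"
  shows "coeff_minor (Suc n) r t = (if t 0 = 0 then coeff_minor n (r \<circ> Suc) (t \<circ> Suc) else 0)"
proof -
  define A where "A = Matrix.mat (Suc n) (Suc n) (\<lambda>(i,j). coeff (r i) (t j))"
  have pos: "t j > 0" if "0 < j" "j < Suc n" for j
    using strict_mono_onD[OF t, of 0 j] that by auto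
  have "coeff_minor (Suc n) r t = (\<Sum>j<Suc n. A $$ (0,j) * cofactor A 0 j)"
    unfolding coeff_minor_def A_def by (rule laplace_expansion_row) auto
  also have "\<dots> = (\<Sum>j\<in>{0}. A $$ (0,j) * cofactor A 0 j)"
    by (rule sum.mono_neutral_right) (use pos assms(1) in \<open>auto simp: A_def\<close>)
  finally have "coeff_minor (Suc n) r t = A $$ (0,0) * cofactor A 0 0" by simp
  moreover have "cofactor A 0 0 = coeff_minor n (r \<circ> Suc) (t \<circ> Suc)"
    unfolding cofactor_def coeff_minor_def A_def mat_delete_def
    by simp (intro arg_cong[where f=Determinant.det] eq_matI; auto)
  ultimately show ?thesis using assms(1) by (auto simp: A_def)
qed

lemma coeff_minor_peel_last:
  assumes "r n = monom 1 D" and t: "strict_mono_on {..<Suc n} t"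
  shows "coeff_minor (Suc n) r t =
    (if t n = D then coeff_minor n r t else if t n < D then 0 else coeff_minor (Suc n) r t)"
proof (cases "t n \<le> D")
  case True
  define A where "A = Matrix.mat (Suc n) (Suc n) (\<lambda>(i,j). coeff (r i) (t j))"
  have less: "t j < D" if "j < n" for j
    using strict_mono_onD[OF t, of j n] that True by auto
  have "coeff_minor (Suc n) r t = (\<Sum>j<Suc n. A $$ (n,j) * cofactor A n j)"
    unfolding coeff_minor_def A_def by (rule laplace_expansion_row) auto
  also have "\<dots> = (\<Sum>j\<in>{n}. A $$ (n,j) * cofactor A n j)"
  proof (rule sum.mono_neutral_right)
    have "A $$ (n,j) = 0" if "j < n" for j
      using less[OF that] assms(1) that by (simp add: A_def)
    then show "\<forall>i\<in>{..<Suc n} - {n}. A $$ (n,i) * cofactor A n i = 0" by auto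
  qed auto
  finally have "coeff_minor (Suc n) r t = A $$ (n,n) * cofactor A n n" by simp
  moreover have "cofactor A n n = coeff_minor n r t"
    unfolding cofactor_def coeff_minor_def A_def mat_delete_def
    by simp (intro arg_cong[where f=Determinant.det] eq_matI; auto)
  ultimately show ?thesis using assms(1) True by (auto simp: A_def)
qed auto

text \<open>
  As sections of degree \<open>D\<close> on the sphere, the rows \<open>(1 + z)\<^sup>f\<close> have their zeros in \<open>-1\<close> and infinity, and the rows
  \<open>z\<^sup>e (1 + z)\<^sup>D\<^sup>-\<^sup>e\<close> in \<open>0\<close> and \<open>-1\<close>. The function \<open>e\<close> is indexed from zero, after the \<open>p\<close> rows of the first kind.
\<close>

definition edge_row :: "nat \<Rightarrow> nat \<Rightarrow> (nat \<Rightarrow> nat) \<Rightarrow> (nat \<Rightarrow> nat) \<Rightarrow> nat \<Rightarrow> real poly" where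
  "edge_row D p f e i = (if i < p then [:1,1:] ^ f i else monom 1 (e (i - p)) * [:1,1:] ^ (D - e (i - p)))"

lemma degree_edge_row:
  assumes "\<And>i. i < p \<Longrightarrow> f i \<le> D" "\<And>i. i < q \<Longrightarrow> e i \<le> D" "i < p + q"
  shows "degree (edge_row D p f e i) \<le> D"
proof -
  have l: "degree ([:1,1:] ^ k :: real poly) \<le> k" for k
    using degree_power_le[of "[:1,1:] :: real poly" k] by simp
  show ?thesis
  proof (cases "i < p")
    case True
    then show ?thesis using l[of "f i"] assms(1)[of i] by (simp add: edge_row_def)
  next
    case False
    then have e: "e (i - p) \<le> D" using assms by auto
    have "degree (monom (1::real) (e (i - p)) * [:1,1:] ^ (D - e (i - p))) \<le> e (i-p) + (D - e (i-p))"
      by (rule order.trans[OF degree_mult_le]) (use l in \<open>simp add: degree_monom_eq\<close>)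
    then show ?thesis using e False by (simp add: edge_row_def)
  qed
qed

lemma coeff_minor_cong:
  assumes "\<And>i. i < n \<Longrightarrow> r i = r' i"
  shows "coeff_minor n r t = coeff_minor n r' t"
  unfolding coeff_minor_def using assms by (intro arg_cong[where f=Determinant.det] eq_matI) auto

lemma max_less_max: "max a i < max b j \<Longrightarrow> x < y \<Longrightarrow> max (max a x) i < max (max b y) (j :: nat)"
  by linarith

text \<open>
  The matrix of the rows is totally nonnegative, and a minor is positive as soon as it is not forced to vanish: the columns
  must meet the supports of the rows, and for every \<open>y\<close> the rows divisible by \<open>(1 + z)\<^sup>y\<close> must not exceed the
  dimension \<open>D + 1 - y\<close> of the space that contains them. The proof removes a row \<open>1\<close> or \<open>z\<^sup>D\<close> by expansion if there is one;
  otherwise all rows are divisible by \<open>1 + z\<close>, and the factor is removed by \<open>coeff_minor_mult_linear\<close>.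
\<close>

lemma edge_minor_total_positivity:
  assumes "strict_mono_on {..<p} f" "\<And>i. i < p \<Longrightarrow> f i \<le> D"
    and "strict_mono_on {..<q} e" "\<And>i. i < q \<Longrightarrow> e i \<le> D"
    and "strict_mono_on {..<p + q} t"
  shows "0 \<le> coeff_minor (p + q) (edge_row D p f e) t \<and>
    ((\<forall>i<p. t i \<le> f i) \<and> (\<forall>i<q. e i \<le> t (p + i) \<and> t (p + i) \<le> D) \<and>
     (\<forall>y\<le>D. card {i. i < p \<and> y \<le> f i} + card {i. i < q \<and> e i + y \<le> D} \<le> Suc D - y) \<longrightarrow>
     0 < coeff_minor (p + q) (edge_row D p f e) t)"
  using assms
proof (induction "D + p + q" arbitrary: D p q f e t rule: less_induct)
  case less
  note fs = less.prems(1,2) and es = less.prems(3,4) and t = less.prems(5)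
  let ?cond = "(\<forall>i<p. t i \<le> f i) \<and> (\<forall>i<q. e i \<le> t (p + i) \<and> t (p + i) \<le> D) \<and>
     (\<forall>y\<le>D. card {i. i < p \<and> y \<le> f i} + card {i. i < q \<and> e i + y \<le> D} \<le> Suc D - y)"
  consider (empty) "p + q = 0" | (first) "0 < p" "f 0 = 0" | (last) "0 < q" "e (q - 1) = D"
    | (mult) "p + q > 0" "\<And>i. i < p \<Longrightarrow> 0 < f i" "\<And>i. i < q \<Longrightarrow> e i < D"
  proof -
    have a: "f 0 < f i" if "0 < i" "i < p" for i
      using strict_mono_onD[OF fs(1), of 0 i] that by auto
    have b: "e i < e (q - 1)" if "i < q - 1" for i
      using strict_mono_onD[OF es(1), of i "q - 1"] that by auto
    show thesis
    proof (cases "p + q = 0 \<or> (0 < p \<and> f 0 = 0) \<or> (0 < q \<and> e (q - 1) = D)")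
      case False
      show thesis
      proof (rule mult)
        show "p + q > 0" using False by auto
        show "0 < f i" if "i < p" for i using False a[of i] that by (cases "i = 0") auto
        show "e i < D" if iq: "i < q" for i
        proof (cases "i = q - 1")
          case True
          then show ?thesis using False es(2)[of i] iq by auto
        next
          case ne: False
          then have "i < q - 1" using iq by linarith
          then show ?thesis using b[of i] es(2)[of "q - 1"] iq by linarith
        qed
      qed
    qed (use that in blast)
  qed
  then show ?case
  proof cases
    case empty
    then have "coeff_minor (p + q) (edge_row D p f e) t = 1" by (simp add: coeff_minor_def)
    then show ?thesis by simp
  next
    case first
    then obtain p' where p': "p = Suc p'" by (cases p) auto
    have r0: "edge_row D p f e 0 = 1" using first by (simp add: edge_row_def)
    have t': "strict_mono_on {..<Suc (p' + q)} t" using t p' by simp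
    have pe: "coeff_minor (p + q) (edge_row D p f e) t =
       (if t 0 = 0 then coeff_minor (p' + q) (edge_row D p' (f \<circ> Suc) e) (t \<circ> Suc) else 0)"
    proof -
      have "edge_row D p f e \<circ> Suc = edge_row D p' (f \<circ> Suc) e"
        by (auto simp: edge_row_def p' fun_eq_iff)
      then show ?thesis using coeff_minor_peel_first[of "edge_row D p f e", OF r0 t'] p' by simp
    qed
    have IH: "0 \<le> coeff_minor (p' + q) (edge_row D p' (f \<circ> Suc) e) (t \<circ> Suc) \<and>
      ((\<forall>i<p'. (t \<circ> Suc) i \<le> (f \<circ> Suc) i) \<and> (\<forall>i<q. e i \<le> (t \<circ> Suc) (p' + i) \<and> (t \<circ> Suc) (p' + i) \<le> D) \<and>
       (\<forall>y\<le>D. card {i. i < p' \<and> y \<le> (f \<circ> Suc) i} + card {i. i < q \<and> e i + y \<le> D} \<le> Suc D - y) \<longrightarrow>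
       0 < coeff_minor (p' + q) (edge_row D p' (f \<circ> Suc) e) (t \<circ> Suc))"
      using fs es t p' by (intro less.hyps) (auto simp: strict_mono_on_def)
    show ?thesis
    proof (intro conjI impI)
      show "0 \<le> coeff_minor (p + q) (edge_row D p f e) t" using IH pe by simp
      assume c: ?cond
      then have "t 0 \<le> f 0" using first by blast
      then have "t 0 = 0" using first by simp
      have "card {i. i < p' \<and> y \<le> (f \<circ> Suc) i} \<le> card {i. i < p \<and> y \<le> f i}" for y
        by (rule card_inj_on_le[where f=Suc]) (auto simp: p')
      then have c3: "\<forall>y\<le>D. card {i. i < p' \<and> y \<le> (f \<circ> Suc) i} + card {i. i < q \<and> e i + y \<le> D} \<le> Suc D - y"
      proof (intro allI impI)
        fix y assume "y \<le> D"
        then have "card {i. i < p \<and> y \<le> f i} + card {i. i < q \<and> e i + y \<le> D} \<le> Suc D - y"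
          by (rule c[THEN conjunct2, THEN conjunct2, rule_format])
        then show "card {i. i < p' \<and> y \<le> (f \<circ> Suc) i} + card {i. i < q \<and> e i + y \<le> D} \<le> Suc D - y"
          using \<open>card {i. i < p' \<and> y \<le> (f \<circ> Suc) i} \<le> card {i. i < p \<and> y \<le> f i}\<close> by linarith
      qed
      have "0 < coeff_minor (p' + q) (edge_row D p' (f \<circ> Suc) e) (t \<circ> Suc)"
      proof (rule IH[THEN conjunct2, THEN mp], intro conjI allI impI)
        show "(t \<circ> Suc) i \<le> (f \<circ> Suc) i" if "i < p'" for i
          using c[THEN conjunct1, rule_format, of "Suc i"] that p' by simp
        show "e i \<le> (t \<circ> Suc) (p' + i)" "(t \<circ> Suc) (p' + i) \<le> D" if "i < q" for i
          using c[THEN conjunct2, THEN conjunct1, rule_format, of i] that p' by simp_all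
      qed (rule c3[rule_format])
      then show "0 < coeff_minor (p + q) (edge_row D p f e) t" unfolding pe using \<open>t 0 = 0\<close> by simp
    qed
  next
    case last
    then obtain q' where q': "q = Suc q'" by (cases q) auto
    have r0: "edge_row D p f e (p + q') = monom 1 D" using last q' by (simp add: edge_row_def)
    have t': "strict_mono_on {..<Suc (p + q')} t" using t q' by simp
    have pe: "coeff_minor (p + q) (edge_row D p f e) t =
       (if t (p + q') = D then coeff_minor (p + q') (edge_row D p f e) t else 0)"
    proof (cases "t (p + q') \<le> D")
      case True
      then show ?thesis using coeff_minor_peel_last[of "edge_row D p f e", OF r0 t'] q' by auto
    next
      case False
      have "coeff (edge_row D p f e i) (t (p + q')) = 0" if "i < p + q" for i
        using degree_edge_row[of p f D q e i] fs es that False by (intro coeff_eq_0) auto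
      then have "coeff_minor (p + q) (edge_row D p f e) t = 0"
        by (intro coeff_minor_zero_column[of "p + q'"]) (auto simp: q')
      then show ?thesis using False by simp
    qed
    have IH: "0 \<le> coeff_minor (p + q') (edge_row D p f e) t \<and>
      ((\<forall>i<p. t i \<le> f i) \<and> (\<forall>i<q'. e i \<le> t (p + i) \<and> t (p + i) \<le> D) \<and>
       (\<forall>y\<le>D. card {i. i < p \<and> y \<le> f i} + card {i. i < q' \<and> e i + y \<le> D} \<le> Suc D - y) \<longrightarrow>
       0 < coeff_minor (p + q') (edge_row D p f e) t)"
      using fs es t q' by (intro less.hyps) (auto simp: strict_mono_on_def)
    show ?thesis
    proof (intro conjI impI)
      show "0 \<le> coeff_minor (p + q) (edge_row D p f e) t" using IH pe by simp
      assume c: ?cond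
      then have "e q' \<le> t (p + q') \<and> t (p + q') \<le> D" using q' by blast
      then have "t (p + q') = D" using last q' by simp
      have "card {i. i < q' \<and> e i + y \<le> D} \<le> card {i. i < q \<and> e i + y \<le> D}" for y
        by (rule card_mono) (auto simp: q')
      then have c3: "\<forall>y\<le>D. card {i. i < p \<and> y \<le> f i} + card {i. i < q' \<and> e i + y \<le> D} \<le> Suc D - y"
      proof (intro allI impI)
        fix y assume "y \<le> D"
        then have "card {i. i < p \<and> y \<le> f i} + card {i. i < q \<and> e i + y \<le> D} \<le> Suc D - y"
          by (rule c[THEN conjunct2, THEN conjunct2, rule_format])
        then show "card {i. i < p \<and> y \<le> f i} + card {i. i < q' \<and> e i + y \<le> D} \<le> Suc D - y"
          using \<open>card {i. i < q' \<and> e i + y \<le> D} \<le> card {i. i < q \<and> e i + y \<le> D}\<close> by linarith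
      qed
      have "0 < coeff_minor (p + q') (edge_row D p f e) t"
      proof (rule IH[THEN conjunct2, THEN mp], intro conjI allI impI)
        show "t i \<le> f i" if "i < p" for i
          using c[THEN conjunct1, rule_format, of i] that by simp
        show "e i \<le> t (p + i)" "t (p + i) \<le> D" if "i < q'" for i
          using c[THEN conjunct2, THEN conjunct1, rule_format, of i] that q' by simp_all
      qed (rule c3[rule_format])
      then show "0 < coeff_minor (p + q) (edge_row D p f e) t" unfolding pe using \<open>t (p + q') = D\<close> by simp
    qed
  next
    case mult
    have D: "0 < D" using mult(1) mult(2)[of 0] fs(2)[of 0] mult(3)[of 0] by (cases "p = 0") auto
    then obtain E where E: "D = Suc E" by (cases D) auto
    define f' where "f' i = f i - 1" for i
    define r where "r = edge_row E p f' e"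
    have rr: "edge_row D p f e i = [:1,1:] * r i" if "i < p + q" for i
    proof (cases "i < p")
      case True
      then have "f i = Suc (f' i)" using mult(2) by (simp add: f'_def)
      then show ?thesis using True by (simp add: edge_row_def r_def)
    next
      case False
      then have "e (i - p) < D" using mult(3) that by simp
      then have "D - e (i - p) = Suc (E - e (i - p))" using E by simp
      then show ?thesis using False by (simp add: edge_row_def r_def algebra_simps)
    qed
    have eq: "coeff_minor (p + q) (edge_row D p f e) t = coeff_minor (p + q) (\<lambda>i. [:1,1:] * r i) t"
      by (rule coeff_minor_cong) (rule rr)
    have f': "strict_mono_on {..<p} f'" "\<And>i. i < p \<Longrightarrow> f' i \<le> E"
    proof -
      show "strict_mono_on {..<p} f'"
      proof (rule strict_mono_onI)
        fix i j assume ij: "i \<in> {..<p}" "j \<in> {..<p}" "i < j"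
        then show "f' i < f' j"
          using strict_mono_onD[OF fs(1), of i j] mult(2)[of i] by (auto simp: f'_def)
      qed
      show "f' i \<le> E" if "i < p" for i using fs(2)[OF that] E by (simp add: f'_def)
    qed
    have e': "\<And>i. i < q \<Longrightarrow> e i \<le> E" using mult(3) E by fastforce
    have IH: "0 \<le> coeff_minor (p + q) r s \<and>
      ((\<forall>i<p. s i \<le> f' i) \<and> (\<forall>i<q. e i \<le> s (p + i) \<and> s (p + i) \<le> E) \<and>
       (\<forall>y\<le>E. card {i. i < p \<and> y \<le> f' i} + card {i. i < q \<and> e i + y \<le> E} \<le> Suc E - y) \<longrightarrow>
       0 < coeff_minor (p + q) r s)" if "strict_mono_on {..<p + q} s" for s
      unfolding r_def using f' es e' E that by (intro less.hyps) auto
    show ?thesis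
    proof (intro conjI impI)
      show "0 \<le> coeff_minor (p + q) (edge_row D p f e) t"
        unfolding eq by (rule coeff_minor_mult_linear(1)[OF IH[THEN conjunct1] t])
      assume c: ?cond
      have all1: "{i. i < p \<and> 1 \<le> f i} = {..<p}" "{i. i < q \<and> e i + 1 \<le> D} = {..<q}"
        using mult(2,3) by (auto simp: Suc_le_eq)
      have pq: "p + q \<le> D" using c[THEN conjunct2, THEN conjunct2, rule_format, of 1] D
        unfolding all1 by simp
      \<comment> \<open>The least choice of lowered indices that still satisfies the support conditions for the rows
        divided by \<open>1 + z\<close>; the bound \<open>i\<close> leaves an initial segment with \<open>t i = i\<close> unchanged, below which there is
        no increasing choice.\<close>
      define s where "s i = (if i < p then max (t i - 1) i else max (max (t i - 1) (e (i - p))) i)" for i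
      have ti: "i \<le> t i" if "i < p + q" for i
        using that
      proof (induction i)
        case (Suc i)
        then show ?case using strict_mono_onD[OF t, of i "Suc i"] by simp
      qed simp
      have tlt: "t i < t j" if "i < j" "j < p + q" for i j
        using strict_mono_onD[OF t, of i j] that by auto
      have s: "strict_mono_on {..<p + q} s"
      proof (rule strict_mono_onI)
        fix i j assume ij: "i \<in> {..<p + q}" "j \<in> {..<p + q}" "i < j"
        have m: "max (t i - 1) i < max (t j - 1) j"
          using tlt[of i j] ti[of i] ti[of j] ij by (auto simp: max_def)
        show "s i < s j"
        proof (cases "i < p")
          case True
          moreover have "max (t j - 1) j \<le> s j" by (auto simp: s_def)
          moreover have "s i = max (t i - 1) i" using True by (simp add: s_def)
          ultimately show ?thesis using m by (metis order.strict_trans2)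
        next
          case False
          have "i - p < j - p" using False ij(3) by linarith
          moreover have "j - p < q" using False ij unfolding lessThan_iff by linarith
          ultimately have "e (i - p) < e (j - p)" by (intro strict_mono_onD[OF es(1)]) simp_all
          moreover have "s i = max (max (t i - 1) (e (i - p))) i" "s j = max (max (t j - 1) (e (j - p))) j"
            using False ij by (auto simp: s_def)
          ultimately show ?thesis using max_less_max[OF m] by metis
        qed
      qed
      have st: "s i = t i \<or> Suc (s i) = t i" if "i < p + q" for i
      proof -
        have "e (i - p) \<le> t i" if "\<not> i < p"
        proof -
          have "i - p < q" "p + (i - p) = i" using that \<open>i < p + q\<close> by linarith+
          then show ?thesis using c[THEN conjunct2, THEN conjunct1, rule_format, of "i - p"] by simp
        qed
        then show ?thesis using ti[OF that] by (auto simp: s_def max_def)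
      qed
      have fi: "i < f i" if "i < p" for i
        using that
      proof (induction i)
        case (Suc i)
        then show ?case using strict_mono_onD[OF fs(1), of i "Suc i"] by simp
      qed (use mult in auto)
      have c1: "\<forall>i<p. s i \<le> f' i"
      proof (intro allI impI)
        fix i assume i: "i < p"
        have "t i \<le> f i" "i < f i" using c[THEN conjunct1, rule_format, OF i] fi[OF i] by simp_all
        moreover have "s i = max (t i - 1) i" using i by (simp add: s_def)
        moreover have "f' i = f i - 1" by (simp add: f'_def)
        ultimately show "s i \<le> f' i" by linarith
      qed
      have c2: "\<forall>i<q. e i \<le> s (p + i) \<and> s (p + i) \<le> E"
      proof (intro allI impI)
        fix i assume i: "i < q"
        have "t (p + i) \<le> D" "e i \<le> E"
          using c[THEN conjunct2, THEN conjunct1, rule_format, OF i] e'[OF i] by simp_all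
        moreover have "s (p + i) = max (max (t (p + i) - 1) (e i)) (p + i)" by (simp add: s_def)
        ultimately show "e i \<le> s (p + i) \<and> s (p + i) \<le> E" using i pq E by linarith
      qed
      have c3: "\<forall>y\<le>E. card {i. i < p \<and> y \<le> f' i} + card {i. i < q \<and> e i + y \<le> E} \<le> Suc E - y"
      proof (intro allI impI)
        fix y assume "y \<le> E"
        have a: "{i. i < p \<and> y \<le> f' i} = {i. i < p \<and> Suc y \<le> f i}"
        proof -
          have "y \<le> f' i \<longleftrightarrow> Suc y \<le> f i" if "i < p" for i using mult(2)[OF that] by (auto simp: f'_def)
          then show ?thesis by auto
        qed
        have b: "{i. i < q \<and> e i + y \<le> E} = {i. i < q \<and> e i + Suc y \<le> D}" unfolding E by simp
        show "card {i. i < p \<and> y \<le> f' i} + card {i. i < q \<and> e i + y \<le> E} \<le> Suc E - y"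
          unfolding a b using c[THEN conjunct2, THEN conjunct2, rule_format, of "Suc y"] E \<open>y \<le> E\<close> by simp
      qed
      have "0 < coeff_minor (p + q) r s"
        by (rule IH[OF s, THEN conjunct2, THEN mp]) (intro conjI c1 c2 c3)
      also have "\<dots> \<le> coeff_minor (p + q) (\<lambda>i. [:1,1:] * r i) t"
        by (rule coeff_minor_mult_linear(2)[OF IH[THEN conjunct1] t s st])
      finally show "0 < coeff_minor (p + q) (edge_row D p f e) t" unfolding eq .
    qed
  qed
qed

section \<open>Degrees and scaling of spaces of polynomials\<close>

lemma smult_sum_right: "smult c (\<Sum>i\<in>I. f i) = (\<Sum>i\<in>I. smult c (f i))"
  by (induction I rule: infinite_finite_induct) (auto simp: smult_add_right)

lemma pderiv_sum': "pderiv (\<Sum>i\<in>I. f i) = (\<Sum>i\<in>I. pderiv (f i))"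
  by (induction I rule: infinite_finite_induct) (auto simp: pderiv_add)

lemma power_dvd_pderiv:
  fixes p :: "'a :: field_char_0 poly"
  assumes "[:-a, 1:] ^ Suc k dvd p"
  shows "[:-a, 1:] ^ k dvd pderiv p"
proof -
  from assms obtain r where "p = [:-a, 1:] ^ Suc k * r" by (elim dvdE)
  then have "pderiv p = [:-a, 1:] ^ k * ([:-a, 1:] * pderiv r + smult (of_nat (Suc k)) r)"
    by (simp add: pderiv_mult pderiv_power_Suc pderiv_pCons algebra_simps del: power_Suc)
       (simp add: algebra_simps)
  then show ?thesis by simp
qed

text \<open>
  A nonzero polynomial with \<open>n\<close> terms vanishes at \<open>1\<close> to an order less than \<open>n\<close> in characteristic zero: applying
  \<open>z d/dz - n\<^sub>0\<close> removes the term of exponent \<open>n\<^sub>0\<close> and lowers the order by at most one.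
\<close>

lemma sparse_poly_order_at_one:
  fixes x :: "nat \<Rightarrow> complex"
  assumes "finite N" "[:-1, 1:] ^ card N dvd (\<Sum>n\<in>N. monom (x n) n)"
  shows "\<forall>n\<in>N. x n = 0"
  using assms
proof (induction N arbitrary: x rule: finite_induct)
  case empty
  then show ?case by simp
next
  case (insert n0 N)
  define q where "q = (\<Sum>n\<in>insert n0 N. monom (x n) n)"
  have dv: "[:-1, 1:] ^ Suc (card N) dvd q" using insert by (simp add: q_def)
  have "[:0,1:] * pderiv q - smult (of_nat n0) q = (\<Sum>n\<in>insert n0 N. monom (x n * (of_nat n - of_nat n0)) n)"
  proof -
    have e: "[:0,1:] * pderiv (monom c n) = monom (c * of_nat n) n" for c :: complex and n
      by (cases n) (simp_all add: pderiv_monom monom_0 monom_Suc[symmetric] mult.commute pderiv_pCons del: monom_Suc of_nat_Suc)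
    show ?thesis
      unfolding q_def pderiv_sum' sum_distrib_left smult_sum_right sum_subtractf[symmetric]
      by (intro sum.cong refl) (simp only: e smult_monom diff_monom, simp add: algebra_simps)
  qed
  also have "\<dots> = (\<Sum>n\<in>N. monom (x n * (of_nat n - of_nat n0)) n)"
    using insert by simp
  finally have eq: "(\<Sum>n\<in>N. monom (x n * (of_nat n - of_nat n0)) n) = [:0,1:] * pderiv q - smult (of_nat n0) q" ..
  have "[:-1, 1:] ^ card N dvd q" using dv by (rule power_le_dvd) simp
  then have "[:-1, 1:] ^ card N dvd [:0,1:] * pderiv q - smult (of_nat n0) q"
    using power_dvd_pderiv[OF dv] by (intro dvd_diff dvd_mult dvd_smult)
  then have "\<forall>n\<in>N. x n * (of_nat n - of_nat n0) = 0"
    unfolding eq[symmetric] by (rule insert.IH)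
  then have N: "\<forall>n\<in>N. x n = 0" using insert.hyps by auto
  then have "q = monom (x n0) n0" using insert.hyps by (simp add: q_def)
  moreover have "[:-1, 1:] dvd q" using dv by (metis dvd_power dvd_trans zero_less_Suc)
  ultimately have "x n0 = 0" using poly_eq_0_iff_dvd[of q 1] by (simp add: poly_monom)
  then show ?case using N by simp
qed

definition pair_row :: "nat \<Rightarrow> complex \<Rightarrow> complex \<Rightarrow> nat \<Rightarrow> complex poly" where
  "pair_row d a b e = [:-a, 1:] ^ e * [:-b, 1:] ^ (d - e)"

lemma degree_pair_row: "e \<le> d \<Longrightarrow> degree (pair_row d a b e) = d"
  by (simp add: pair_row_def degree_mult_eq degree_linear_power)

text \<open>
  The substitution \<open>z = s / (s - 1)\<close>, which sends the zeros \<open>0\<close> and \<open>1\<close> to \<open>0\<close> and infinity, turns the rows into the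
  monomials \<open>s\<^sup>e\<close>, after multiplication by \<open>(s - 1)\<^sup>d\<close>. A combination of degree \<open>n\<close> keeps a factor
  \<open>(s - 1)\<^sup>d\<^sup>-\<^sup>n\<close>, so the claim is \<open>sparse_poly_order_at_one\<close>.
\<close>

lemma pair_combination_low_degree:
  fixes c :: "nat \<Rightarrow> complex"
  assumes E: "E \<subseteq> {..d}" and f: "f = (\<Sum>e\<in>E. smult (c e) (pair_row d 0 1 e))"
    and deg: "f = 0 \<or> degree f + card E \<le> d"
  shows "\<forall>e\<in>E. c e = 0"
proof -
  have fin: "finite E" using E finite_subset by blast
  define q where "q = (\<Sum>e\<in>E. monom (c e) e)"
  define r where "r = (\<Sum>k\<le>degree f. smult (coeff f k) ([:0,1:] ^ k * [:-1,1:] ^ (d - k)))"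
  have df: "f = 0 \<or> degree f \<le> d" using deg by auto
  have "poly q s = poly r s" if s: "s \<noteq> 1" for s
  proof -
    have z: "(s - 1) ^ d * (s / (s - 1)) ^ k = s ^ k * (s - 1) ^ (d - k)" if "k \<le> d" for k
      using s that by (simp add: power_divide power_diff field_simps)
    have "poly r s = (s - 1) ^ d * poly f (s / (s - 1))"
    proof (cases "f = 0")
      case False
      then have "degree f \<le> d" using df by simp
      then show ?thesis
        unfolding r_def poly_altdef[of f] poly_sum sum_distrib_left
        by (intro sum.cong refl) (use z in \<open>simp add: algebra_simps\<close>)
    qed (simp add: r_def)
    also have "\<dots> = poly q s"
      unfolding f q_def poly_sum sum_distrib_left
    proof (intro sum.cong refl)
      fix e assume "e \<in> E"
      then have e: "e \<le> d" using E by auto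
      have w: "s / (s - 1) - 1 = 1 / (s - 1)" using s by (simp add: field_simps)
      have "(s - 1) ^ d * poly (pair_row d 0 1 e) (s / (s - 1)) = (s - 1) ^ d * ((s / (s - 1)) ^ e * (1 / (s - 1)) ^ (d - e))"
        unfolding pair_row_def using w by (simp add: algebra_simps)
      also have "\<dots> = s ^ e" using s e by (simp add: power_divide power_diff field_simps)
      finally show "(s - 1) ^ d * poly (smult (c e) (pair_row d 0 1 e)) (s / (s - 1)) = poly (monom (c e) e) s"
        by (simp add: poly_monom algebra_simps)
    qed
    finally show ?thesis by simp
  qed
  then have sub: "UNIV - {1} \<subseteq> {s. poly (q - r) s = 0}" by auto
  have qr: "q = r"
  proof (rule ccontr)
    assume "q \<noteq> r"
    then have "finite {s. poly (q - r) s = 0}" by (intro poly_roots_finite) simp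
    then have "finite (UNIV - {1::complex})" using sub finite_subset by blast
    then show False using infinite_UNIV_char_0[where 'a=complex] by simp
  qed
  have "[:-1,1:] ^ card E dvd r"
  proof (cases "f = 0")
    case False
    then show ?thesis unfolding r_def
      using deg by (intro dvd_sum dvd_smult dvd_mult le_imp_power_dvd) auto
  qed (simp add: r_def)
  then show ?thesis using sparse_poly_order_at_one[OF fin, of c] qr by (simp add: q_def)
qed

definition poly_indep :: "'i set \<Rightarrow> ('i \<Rightarrow> complex poly) \<Rightarrow> bool" where
  "poly_indep I P \<longleftrightarrow> (\<forall>c. (\<Sum>i\<in>I. smult (c i) (P i)) = 0 \<longrightarrow> (\<forall>i\<in>I. c i = 0))"

definition poly_span :: "'i set \<Rightarrow> ('i \<Rightarrow> complex poly) \<Rightarrow> complex poly set" where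
  "poly_span I P = range (\<lambda>c. \<Sum>i\<in>I. smult (c i) (P i))"

definition poly_subspace :: "complex poly set \<Rightarrow> bool" where
  "poly_subspace U \<longleftrightarrow> 0 \<in> U \<and> (\<forall>f\<in>U. \<forall>g\<in>U. f + g \<in> U) \<and> (\<forall>f\<in>U. \<forall>c. smult c f \<in> U)"

definition degrees_of :: "complex poly set \<Rightarrow> nat set" where
  "degrees_of U = degree ` (U - {0})"

lemma poly_subspace_span: "poly_subspace (poly_span I P)"
  unfolding poly_subspace_def poly_span_def
proof (intro conjI ballI allI)
  show "0 \<in> range (\<lambda>c. \<Sum>i\<in>I. smult (c i) (P i))"
    by (rule image_eqI[of _ _ "\<lambda>_. 0"]) auto
next
  fix f g assume "f \<in> range (\<lambda>c. \<Sum>i\<in>I. smult (c i) (P i))" "g \<in> range (\<lambda>c. \<Sum>i\<in>I. smult (c i) (P i))"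
  then obtain c c' where "f = (\<Sum>i\<in>I. smult (c i) (P i))" "g = (\<Sum>i\<in>I. smult (c' i) (P i))" by auto
  then show "f + g \<in> range (\<lambda>c. \<Sum>i\<in>I. smult (c i) (P i))"
    by (intro image_eqI[of _ _ "\<lambda>i. c i + c' i"]) (auto simp: smult_add_left sum.distrib)
next
  fix f c assume "f \<in> range (\<lambda>c. \<Sum>i\<in>I. smult (c i) (P i))"
  then obtain c' where "f = (\<Sum>i\<in>I. smult (c' i) (P i))" by auto
  then show "smult c f \<in> range (\<lambda>c. \<Sum>i\<in>I. smult (c i) (P i))"
    by (intro image_eqI[of _ _ "\<lambda>i. c * c' i"]) (auto simp: smult_sum_right)
qed

lemma poly_subspace_diff: "poly_subspace U \<Longrightarrow> f \<in> U \<Longrightarrow> g \<in> U \<Longrightarrow> f - g \<in> U"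
  unfolding poly_subspace_def by (metis diff_conv_add_uminus smult_minus_left smult_1_left)

lemma degree_poly_span:
  assumes "\<And>i. i \<in> I \<Longrightarrow> degree (P i) < m" "f \<in> poly_span I P" "0 < m"
  shows "degree f < m"
proof -
  obtain c where f: "f = (\<Sum>i\<in>I. smult (c i) (P i))" using assms(2) by (auto simp: poly_span_def)
  have "degree f \<le> m - 1"
    unfolding f
  proof (cases "finite I")
    case True
    show "degree (\<Sum>i\<in>I. smult (c i) (P i)) \<le> m - 1"
    proof (rule degree_sum_le[OF True])
      fix i assume "i \<in> I"
      then show "degree (smult (c i) (P i)) \<le> m - 1"
        using assms(1)[of i] degree_smult_le[of "c i" "P i"] by linarith
    qed
  qed simp
  then show ?thesis using assms(3) by linarith
qed

text \<open>
  An arbitrary numbering of the coordinates; it identifies coefficient sequences with vectors.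
\<close>

definition ix :: "'m::finite \<Rightarrow> nat" where
  "ix = (SOME h. bij_betw h UNIV {..<CARD('m)})"

lemma bij_ix: "bij_betw (ix :: 'm::finite \<Rightarrow> nat) UNIV {..<CARD('m)}"
proof -
  have "\<exists>h. bij_betw h (UNIV :: 'm set) {..<CARD('m)}"
    using ex_bij_betw_finite_nat[of "UNIV :: 'm set"] by (auto simp: atLeast0LessThan)
  then show ?thesis unfolding ix_def by (rule someI_ex)
qed

lemma ix_less: "ix (k :: 'm::finite) < CARD('m)"
  using bij_betwE[OF bij_ix] by auto

lemma ix_surj: "n < CARD('m::finite) \<Longrightarrow> \<exists>k::'m. ix k = n"
  using bij_betw_imp_surj_on[OF bij_ix[where 'm='m]] by (metis imageE lessThan_iff)

lemma sum_ix: "(\<Sum>k\<in>UNIV. F (ix (k::'m::finite))) = (\<Sum>n<CARD('m). F n)"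
  using sum.reindex_bij_betw[OF bij_ix] by auto

definition coeff_vec :: "complex poly \<Rightarrow> complex ^ 'm::finite" where
  "coeff_vec p = (\<chi> k. coeff p (ix k))"

lemma coeff_vec_add: "coeff_vec (p + q) = coeff_vec p + coeff_vec q"
  by (simp add: coeff_vec_def vec_eq_iff)
lemma coeff_vec_smult: "coeff_vec (smult c p) = c *s coeff_vec p"
  by (simp add: coeff_vec_def vec_eq_iff)
lemma coeff_vec_0: "coeff_vec 0 = 0"
  by (simp add: coeff_vec_def vec_eq_iff)
lemma coeff_vec_eq_0:
  assumes "degree p < CARD('m::finite)" "coeff_vec p = (0 :: complex ^ 'm)"
  shows "p = 0"
proof (rule poly_eqI)
  fix n show "coeff p n = coeff 0 n"
  proof (cases "n < CARD('m)")
    case True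
    then obtain k :: 'm where "ix k = n" using ix_surj by blast
    then show ?thesis using assms(2) by (auto simp: coeff_vec_def vec_eq_iff)
  qed (use assms in \<open>auto intro: coeff_eq_0\<close>)
qed

lemma additive_sum_smult:
  fixes T :: "complex poly \<Rightarrow> complex ^ 'm::finite"
  assumes "\<And>p q. T (p + q) = T p + T q" "\<And>c p. T (smult c p) = c *s T p"
  shows "T (\<Sum>i\<in>I. smult (c i) (P i)) = (\<Sum>i\<in>I. c i *s T (P i))"
proof -
  have z: "T 0 = 0" using assms(2)[of 0 0] by simp
  show ?thesis by (induction I rule: infinite_finite_induct) (auto simp: z assms)
qed

lemma independent_image_of_poly_indep:
  fixes T :: "complex poly \<Rightarrow> complex ^ 'm::finite"
  assumes T: "\<And>p q. T (p + q) = T p + T q" "\<And>c p. T (smult c p) = c *s T p"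
    and inj: "\<And>p. degree p < CARD('m) \<Longrightarrow> T p = 0 \<Longrightarrow> p = 0"
    and I: "finite I" "\<And>i. i \<in> I \<Longrightarrow> degree (P i) < CARD('m)" "poly_indep I P"
  shows "inj_on (\<lambda>i. T (P i)) I \<and> vec.independent ((\<lambda>i. T (P i)) ` I)"
proof
  have zero: "\<forall>i\<in>I. c i = 0" if "(\<Sum>i\<in>I. c i *s T (P i)) = 0" for c
  proof -
    have "T (\<Sum>i\<in>I. smult (c i) (P i)) = 0" using that by (simp add: additive_sum_smult T)
    moreover have "degree (\<Sum>i\<in>I. smult (c i) (P i)) < CARD('m)"
      by (rule degree_poly_span[OF I(2)]) (auto simp: poly_span_def)
    ultimately show ?thesis using inj I(3) by (auto simp: poly_indep_def)
  qed
  show inj': "inj_on (\<lambda>i. T (P i)) I"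
  proof (rule inj_onI, rule ccontr)
    fix i j assume ij: "i \<in> I" "j \<in> I" "T (P i) = T (P j)" "i \<noteq> j"
    define c where "c k = (if k = i then 1 else if k = j then -1 else 0 :: complex)" for k
    have "(\<Sum>k\<in>I. c k *s T (P k)) = (\<Sum>k\<in>{i,j}. c k *s T (P k))"
      by (rule sum.mono_neutral_right) (use ij I(1) in \<open>auto simp: c_def\<close>)
    also have "\<dots> = 0" using ij by (simp add: c_def)
    finally have "c i = 0" using zero ij by blast
    then show False by (simp add: c_def)
  qed
  show "vec.independent ((\<lambda>i. T (P i)) ` I)"
  proof (rule vec.independent_if_scalars_zero)
    fix g x assume s: "(\<Sum>x\<in>(\<lambda>i. T (P i)) ` I. g x *s x) = 0" and x: "x \<in> (\<lambda>i. T (P i)) ` I"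
    have "(\<Sum>i\<in>I. g (T (P i)) *s T (P i)) = 0" using s by (simp add: sum.reindex[OF inj'] o_def)
    then show "g x = 0" using zero[of "\<lambda>i. g (T (P i))"] x by auto
  qed (use I in auto)
qed

lemma monic_representatives:
  assumes U: "poly_subspace U"
  obtains F where "\<And>n. n \<in> degrees_of U \<Longrightarrow> F n \<in> U \<and> degree (F n) = n \<and> coeff (F n) n = 1"
proof -
  have "\<exists>f. f \<in> U \<and> degree f = n \<and> coeff f n = 1" if "n \<in> degrees_of U" for n
  proof -
    from that obtain f where f: "f \<in> U" "f \<noteq> 0" "n = degree f" by (auto simp: degrees_of_def)
    then show ?thesis using U
      by (intro exI[of _ "smult (inverse (lead_coeff f)) f"]) (auto simp: poly_subspace_def)
  qed
  then show thesis using that by metis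
qed

lemma subspace_by_degrees:
  assumes U: "poly_subspace U" and fin: "finite (degrees_of U)"
    and F: "\<And>n. n \<in> degrees_of U \<Longrightarrow> F n \<in> U \<and> degree (F n) = n \<and> coeff (F n) n = 1"
    and "f \<in> U"
  shows "f \<in> poly_span (degrees_of U) F"
  using assms(4)
proof (induction "degree f" arbitrary: f rule: less_induct)
  case less
  let ?S = "poly_span (degrees_of U) F"
  note S = poly_subspace_span[of "degrees_of U" F]
  show ?case
  proof (cases "f = 0")
    case True
    then show ?thesis using S by (simp add: poly_subspace_def)
  next
    case False
    then have n: "degree f \<in> degrees_of U" using less.prems by (auto simp: degrees_of_def)
    define g where "g = smult (lead_coeff f) (F (degree f))"
    have Fs: "F (degree f) \<in> ?S"
      unfolding poly_span_def
      by (rule image_eqI[of _ _ "\<lambda>i. if i = degree f then 1 else 0"])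
        (use n fin in \<open>auto simp: if_distrib[of "\<lambda>c. smult c _"] cong: if_cong\<close>)
    have gS: "g \<in> ?S" using S Fs by (simp add: g_def poly_subspace_def)
    have gU: "g \<in> U" using U F[OF n] by (simp add: g_def poly_subspace_def)
    have dU: "f - g \<in> U" using U less.prems gU by (rule poly_subspace_diff)
    have "f - g \<in> ?S"
    proof (cases "f - g = 0")
      case True
      then show ?thesis using S by (simp add: poly_subspace_def)
    next
      case nz: False
      have "degree g \<le> degree f" unfolding g_def using F[OF n] degree_smult_le by metis
      moreover have "coeff (f - g) (degree f) = 0" using F[OF n] by (simp add: g_def)
      ultimately have "degree (f - g) < degree f"
        using nz by (metis degree_diff_le eq_zero_or_degree_less order_refl)
      then show ?thesis using dU by (rule less.hyps)
    qed
    then have "(f - g) + g \<in> ?S" using S gS unfolding poly_subspace_def by blast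
    then show ?thesis by simp
  qed
qed

lemma poly_indep_distinct_degrees:
  assumes fin: "finite N" and F: "\<And>n. n \<in> N \<Longrightarrow> degree (F n) = n \<and> coeff (F n) n = 1"
  shows "poly_indep N F"
  unfolding poly_indep_def
proof (intro allI impI, rule ccontr)
  fix c assume s: "(\<Sum>n\<in>N. smult (c n) (F n)) = 0" and "\<not> (\<forall>n\<in>N. c n = 0)"
  define B where "B = {n\<in>N. c n \<noteq> 0}"
  have B: "finite B" "B \<noteq> {}" using fin \<open>\<not> _\<close> by (auto simp: B_def)
  define n where "n = Max B"
  have n: "n \<in> N" "c n \<noteq> 0" using Max_in[OF B] by (auto simp: n_def B_def)
  have "0 = coeff (\<Sum>n\<in>N. smult (c n) (F n)) n" by (simp add: s)
  also have "\<dots> = (\<Sum>k\<in>N. c k * coeff (F k) n)" by (simp add: coeff_sum)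
  also have "\<dots> = (\<Sum>k\<in>{n}. c k * coeff (F k) n)"
  proof (rule sum.mono_neutral_right[OF fin])
    show "\<forall>k\<in>N - {n}. c k * coeff (F k) n = 0"
    proof
      fix k assume k: "k \<in> N - {n}"
      show "c k * coeff (F k) n = 0"
      proof (cases "c k = 0")
        case False
        then have "k \<le> n" unfolding n_def using k B by (intro Max_ge) (auto simp: B_def)
        then have "k < n" using k by auto
        then show ?thesis using F[of k] k by (simp add: coeff_eq_0)
      qed simp
    qed
  qed (use n in auto)
  also have "\<dots> = c n" using F n by simp
  finally show False using n by simp
qed

text \<open>
  Monic representatives of different degrees are linearly independent, so there are no more degrees than the dimension.
\<close>

lemma degrees_of_span_bound:
  assumes I: "finite I" "\<And>i. i \<in> I \<Longrightarrow> degree (P i) < CARD('m::finite)"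
  shows "degrees_of (poly_span I P) \<subseteq> {..<CARD('m)}" "card (degrees_of (poly_span I P)) \<le> card I"
proof -
  let ?U = "poly_span I P" and ?cv = "coeff_vec :: complex poly \<Rightarrow> complex ^ 'm"
  show sub: "degrees_of ?U \<subseteq> {..<CARD('m)}"
    using degree_poly_span[of I P "CARD('m)", OF I(2)] by (auto simp: degrees_of_def)
  then have fin: "finite (degrees_of ?U)" using finite_subset by blast
  obtain F where F: "\<And>n. n \<in> degrees_of ?U \<Longrightarrow> F n \<in> ?U \<and> degree (F n) = n \<and> coeff (F n) n = 1"
    using monic_representatives[OF poly_subspace_span] by metis
  have ind: "inj_on (\<lambda>n. ?cv (F n)) (degrees_of ?U) \<and> vec.independent ((\<lambda>n. ?cv (F n)) ` degrees_of ?U)"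
    by (rule independent_image_of_poly_indep)
      (use F fin sub in \<open>simp_all add: coeff_vec_add coeff_vec_smult coeff_vec_eq_0 poly_indep_distinct_degrees subset_iff\<close>)
  have "(\<lambda>n. ?cv (F n)) ` degrees_of ?U \<subseteq> vec.span (?cv ` P ` I)"
  proof safe
    fix n assume "n \<in> degrees_of ?U"
    then obtain c where c: "F n = (\<Sum>i\<in>I. smult (c i) (P i))" using F by (auto simp: poly_span_def)
    have "?cv (F n) = (\<Sum>i\<in>I. c i *s ?cv (P i))"
      unfolding c by (rule additive_sum_smult) (auto simp: coeff_vec_add coeff_vec_smult)
    also have "\<dots> \<in> vec.span (?cv ` P ` I)"
      by (intro vec.span_sum vec.span_scale vec.span_base) auto
    finally show "?cv (F n) \<in> vec.span (?cv ` P ` I)" .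
  qed
  then have "card ((\<lambda>n. ?cv (F n)) ` degrees_of ?U) \<le> card (?cv ` P ` I)"
    using vec.independent_span_bound[of "?cv ` P ` I"] ind I(1) by blast
  also have "\<dots> \<le> card I" using I(1) by (metis card_image_le finite_imageI order_trans)
  finally show "card (degrees_of ?U) \<le> card I" using ind by (simp add: card_image)
qed

text \<open>
  As \<open>t\<close> tends to infinity, \<open>f(t z) / t\<^sup>n\<close> tends to \<open>z\<^sup>n\<close> for a monic \<open>f\<close> of degree \<open>n\<close>. So the rescaled space \<open>U\<close> tends to the
  span of the monomials \<open>z\<^sup>n\<close>, where \<open>n\<close> runs through the degrees that occur in \<open>U\<close>. If this limit meets \<open>W\<close> only in zero, then
  so does the rescaled space for all large \<open>t\<close>. This reduces transversality to one degenerate position in which it can be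
  decided from exponents alone.
\<close>

lemma scaled_subspace_eventually_disjoint:
  assumes U: "poly_subspace U" and W: "poly_subspace W"
    and deg: "\<And>f. f \<in> U \<Longrightarrow> degree f < CARD('m::finite)" "\<And>f. f \<in> W \<Longrightarrow> degree f < CARD('m)"
    and disj: "\<And>g. g \<in> W \<Longrightarrow> (\<And>n. coeff g n \<noteq> 0 \<Longrightarrow> n \<in> degrees_of U) \<Longrightarrow> g = 0"
  shows "eventually (\<lambda>t::real. \<forall>f\<in>U. pcompose f [:0, of_real t:] \<in> W \<longrightarrow> f = 0) at_top"
proof -
  let ?N = "degrees_of U" and ?cv = "coeff_vec :: complex poly \<Rightarrow> complex ^ 'm"
  have sub: "?N \<subseteq> {..<CARD('m)}" using deg(1) by (auto simp: degrees_of_def)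
  then have fin: "finite ?N" using finite_subset by blast
  obtain F where F: "\<And>n. n \<in> ?N \<Longrightarrow> F n \<in> U \<and> degree (F n) = n \<and> coeff (F n) n = 1"
    using monic_representatives[OF U] by metis
  define S where "S = {v :: complex ^ 'm. \<forall>k. ix k \<notin> ?N \<longrightarrow> v $ k = 0}"
  have Sclosed: "closed S"
  proof -
    have "S = (\<Inter>k\<in>{k. ix k \<notin> ?N}. {v. v $ k = 0})" by (auto simp: S_def)
    also have "closed \<dots>"
      by (intro closed_INT ballI closed_Collect_eq continuous_intros)
    finally show ?thesis .
  qed
  have scR: "r *\<^sub>R x = of_real r *s x" for r and x :: "complex ^ 'm" by (simp add: vec_eq_iff) (metis scaleR_conv_of_real)
  have Wsub: "subspace (?cv ` W)"
  proof (rule subspaceI)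
    show "0 \<in> ?cv ` W" using W coeff_vec_0 by (metis image_eqI poly_subspace_def)
    show "x + y \<in> ?cv ` W" if xy: "x \<in> ?cv ` W" "y \<in> ?cv ` W" for x y
    proof -
      from xy obtain p q where pq: "p \<in> W" "q \<in> W" "x = ?cv p" "y = ?cv q" by blast
      then have "p + q \<in> W" using W by (auto simp: poly_subspace_def)
      moreover have "?cv (p + q) = x + y" unfolding pq by (rule coeff_vec_add)
      ultimately show ?thesis by (metis image_eqI)
    qed
    show "c *\<^sub>R x \<in> ?cv ` W" if x: "x \<in> ?cv ` W" for c x
    proof -
      from x obtain p where p: "p \<in> W" "x = ?cv p" by blast
      then have "smult (of_real c) p \<in> W" using W by (auto simp: poly_subspace_def)
      moreover have "?cv (smult (of_real c) p) = c *\<^sub>R x" unfolding scR p by (rule coeff_vec_smult)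
      ultimately show ?thesis by (metis image_eqI)
    qed
  qed
  have comp: "compact (sphere 0 1 \<inter> S)" using Sclosed by (intro compact_Int_closed) auto
  have dis: "(sphere 0 1 \<inter> S) \<inter> ?cv ` W = {}"
  proof (rule equals0I)
    fix v assume "v \<in> (sphere 0 1 \<inter> S) \<inter> ?cv ` W"
    then obtain g where g: "g \<in> W" "v = ?cv g" "v \<in> S" "norm v = 1" by auto
    have "g = 0"
    proof (rule disj[OF g(1)])
      fix n assume n: "coeff g n \<noteq> 0"
      then have "n < CARD('m)" using deg(2)[OF g(1)] le_degree[OF n] by simp
      then obtain k :: 'm where k: "ix k = n" using ix_surj by blast
      then have "v $ k \<noteq> 0" using n g(2) by (simp add: coeff_vec_def)
      then show "n \<in> ?N" using g(3) k by (auto simp: S_def)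
    qed
    have "v = 0" unfolding g(2) \<open>g = 0\<close> by (rule coeff_vec_0)
    then show False using g(4) by simp
  qed
  \<comment> \<open>The unit sphere of the limit space is compact, so it has positive distance from \<open>W\<close>.\<close>
  obtain \<delta> where \<delta>: "\<delta> > 0" "\<And>x y. x \<in> sphere 0 1 \<inter> S \<Longrightarrow> y \<in> ?cv ` W \<Longrightarrow> \<delta> \<le> dist x y"
    using separate_compact_closed[OF comp closed_subspace[OF Wsub] dis] by blast
  have \<delta>': "\<delta> * norm v \<le> norm (v - y)" if v: "v \<in> S" and y: "y \<in> ?cv ` W" for v y
  proof (cases "v = 0")
    case False
    have "(1 / norm v) *\<^sub>R v \<in> sphere 0 1 \<inter> S" using False v by (auto simp: S_def)
    moreover have "(1 / norm v) *\<^sub>R y \<in> ?cv ` W" using Wsub y by (rule subspace_scale)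
    ultimately have "\<delta> \<le> dist ((1 / norm v) *\<^sub>R v) ((1 / norm v) *\<^sub>R y)" by (rule \<delta>(2))
    also have "\<dots> = norm ((1 / norm v) *\<^sub>R (v - y))" by (simp add: dist_norm scaleR_diff_right)
    also have "\<dots> = norm (v - y) / norm v" by simp
    finally show ?thesis using False by (simp add: field_simps)
  qed simp
  \<comment> \<open>The coefficient vector of \<open>F\<^sub>n(t z) / t\<^sup>n - z\<^sup>n\<close>.\<close>
  define err where "err t n = ((\<chi> k. coeff (F n) (ix k) * of_real t ^ ix k / of_real t ^ n - (if ix k = n then 1 else 0)) :: complex ^ 'm)"
    for t :: real and n
  have err: "((\<lambda>t. \<Sum>n\<in>?N. norm (err t n)) \<longlongrightarrow> 0) at_top"
  proof (rule tendsto_null_sum, rule tendsto_norm_zero)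
    fix n assume n: "n \<in> ?N"
    have "((\<lambda>t. coeff (F n) j * of_real t ^ j / of_real t ^ n - (if j = n then 1 else 0) :: complex) \<longlongrightarrow> 0) at_top" for j
    proof -
      consider "j = n" | "j < n" | "j > n" by linarith
      then show ?thesis
      proof cases
        case 1
        have "eventually (\<lambda>t::real. coeff (F n) j * of_real t ^ j / of_real t ^ n - (if j = n then 1 else 0) = (0::complex)) at_top"
          using eventually_gt_at_top[of 0] by eventually_elim (use F[OF n] 1 in auto)
        then show ?thesis by (rule tendsto_eventually)
      next
        case 2
        have "((\<lambda>t::real. inverse t ^ (n - j)) \<longlongrightarrow> 0 ^ (n - j)) at_top"
          by (intro tendsto_power tendsto_inverse_0_at_top filterlim_ident)
        then have "((\<lambda>t::real. coeff (F n) j * of_real (inverse t ^ (n - j))) \<longlongrightarrow> coeff (F n) j * of_real 0) at_top"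
          using 2 by (intro tendsto_intros) (simp add: power_0_left)
        moreover have "eventually (\<lambda>t::real. coeff (F n) j * of_real (inverse t ^ (n - j)) =
            coeff (F n) j * of_real t ^ j / of_real t ^ n - (if j = n then 1 else 0)) at_top"
          using eventually_gt_at_top[of 0]
        proof eventually_elim
          case (elim t)
          have "inverse t ^ (n - j) = t ^ j / t ^ n"
            using 2 elim by (simp add: power_diff field_simps power_inverse)
          then show ?case using 2 by simp
        qed
        ultimately show ?thesis by (simp add: Lim_transform_eventually)
      next
        case 3
        then have "coeff (F n) j = 0" using F[OF n] by (simp add: coeff_eq_0)
        then show ?thesis using 3 by simp
      qed
    qed
    then show "((\<lambda>t. err t n) \<longlongrightarrow> 0) at_top"
      unfolding err_def by (intro vec_tendstoI) simp
  qed
  show ?thesis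
    using order_tendstoD(2)[OF err \<delta>(1)] eventually_gt_at_top[of 0]
  proof eventually_elim
    case (elim t)
    show ?case
    proof (intro ballI impI)
      fix f assume f: "f \<in> U" and fW: "pcompose f [:0, of_real t:] \<in> W"
      obtain x where x: "f = (\<Sum>n\<in>?N. smult (x n) (F n))"
        using subspace_by_degrees[OF U fin F f] by (auto simp: poly_span_def)
      define v :: "complex ^ 'm" where "v = (\<chi> k. if ix k \<in> ?N then x (ix k) * of_real t ^ ix k else 0)"
      have vS: "v \<in> S" by (simp add: v_def S_def)
      have "?cv (pcompose f [:0, of_real t:]) - v = (\<Sum>n\<in>?N. (x n * of_real t ^ n) *s err t n)"
      proof (rule vec_eq_iff[THEN iffD2], rule allI)
        fix k :: 'm
        have "(\<Sum>n\<in>?N. (x n * of_real t ^ n) *s err t n) $ k =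
           (\<Sum>n\<in>?N. x n * coeff (F n) (ix k) * of_real t ^ ix k - (if ix k = n then x n * of_real t ^ n else 0))"
          unfolding sum_component err_def using elim(2)
          by (intro sum.cong refl) (simp add: field_simps)
        also have "\<dots> = coeff f (ix k) * of_real t ^ ix k - v $ k"
          unfolding sum_subtractf x coeff_sum v_def using fin by (simp add: sum_distrib_right)
        finally show "(?cv (pcompose f [:0, of_real t:]) - v) $ k = (\<Sum>n\<in>?N. (x n * of_real t ^ n) *s err t n) $ k"
          by (simp add: coeff_vec_def coeff_pcompose_linear mult.commute)
      qed
      then have "norm (v - ?cv (pcompose f [:0, of_real t:])) \<le> (\<Sum>n\<in>?N. norm ((x n * of_real t ^ n) *s err t n))"
        by (metis norm_minus_commute norm_sum)
      also have "\<dots> \<le> (\<Sum>n\<in>?N. norm v * norm (err t n))"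
      proof (rule sum_mono)
        fix n assume n: "n \<in> ?N"
        then obtain k :: 'm where k: "ix k = n" using sub ix_surj by blast
        have "norm ((x n * of_real t ^ n) *s err t n) = cmod (x n * of_real t ^ n) * norm (err t n)"
          by (simp add: norm_vec_def vector_scalar_mult_def L2_set_right_distrib norm_mult)
        also have "cmod (x n * of_real t ^ n) = norm (v $ k)" using k n by (simp add: v_def)
        also have "\<dots> * norm (err t n) \<le> norm v * norm (err t n)"
          by (intro mult_right_mono Finite_Cartesian_Product.norm_nth_le) auto
        finally show "norm ((x n * of_real t ^ n) *s err t n) \<le> norm v * norm (err t n)" .
      qed
      also have "\<dots> = norm v * (\<Sum>n\<in>?N. norm (err t n))" by (simp add: sum_distrib_left)
      finally have "\<delta> * norm v \<le> norm v * (\<Sum>n\<in>?N. norm (err t n))"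
        using \<delta>'[OF vS, of "?cv (pcompose f [:0, of_real t:])"] fW by force
      then have "v = 0" using elim(1) by (cases "norm v = 0") (auto simp: mult.commute)
      have "x n = 0" if n: "n \<in> ?N" for n
      proof -
        obtain k :: 'm where k: "ix k = n" using sub ix_surj n by blast
        have "v $ k = 0" using \<open>v = 0\<close> by simp
        then show ?thesis using k n elim(2) by (simp add: v_def)
      qed
      then show "f = 0" unfolding x by simp
    qed
  qed
qed

section \<open>Polynomials in general position with few zeros\<close>

lemma poly_ext: "(\<And>z. poly p z = poly q z) \<Longrightarrow> p = (q :: complex poly)"
  using poly_eq_poly_eq_iff[of p q] by blast

lemma poly_indep_subset:
  assumes "poly_indep I P" "J \<subseteq> I" "finite I"
  shows "poly_indep J P"
  unfolding poly_indep_def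
proof (intro allI impI)
  fix c assume s: "(\<Sum>i\<in>J. smult (c i) (P i)) = 0"
  have "(\<Sum>i\<in>I. smult (if i \<in> J then c i else 0) (P i)) = (\<Sum>i\<in>J. smult (c i) (P i))"
    using assms by (intro sum.mono_neutral_cong_right) auto
  then have "\<forall>i\<in>I. (if i \<in> J then c i else 0) = 0"
    using assms(1)[unfolded poly_indep_def, rule_format, of "\<lambda>i. if i \<in> J then c i else 0"] s by simp
  moreover have "i \<in> I" if "i \<in> J" for i using assms(2) that by auto
  ultimately show "\<forall>i\<in>J. c i = 0" by fastforce
qed

text \<open>
  With \<open>l = 1 + 1/t\<close>, the affine map \<open>z \<mapsto> t (z - 1)\<close> carries
  the pair \<open>1, l\<close> to the pair \<open>0, 1\<close>, and \<open>t\<close> is taken large by \<open>scaled_subspace_eventually_disjoint\<close>. In the limit, a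
  polynomial in the span of \<open>z\<^sup>n\<close> with \<open>n \<ge> card N\<close> (\<open>pair_combination_low_degree\<close>) has order at least \<open>card N\<close> at zero; but translated by
  one it has at most \<open>card N\<close> terms, so it is zero by \<open>sparse_poly_order_at_one\<close>.
\<close>

lemma exists_generic_ratio:
  "\<exists>l. l \<noteq> 0 \<and> l \<noteq> 1 \<and> (\<forall>N E c. N \<subseteq> {..<CARD('m::finite)} \<longrightarrow> E \<subseteq> {..<CARD('m)} \<longrightarrow> card N + card E = CARD('m) \<longrightarrow>
     (\<forall>k. coeff (\<Sum>e\<in>E. smult (c e) (pair_row (CARD('m) - 1) 1 l e)) k \<noteq> 0 \<longrightarrow> k \<in> N) \<longrightarrow> (\<forall>e\<in>E. c e = 0))"
proof -
  define d where "d = CARD('m) - 1"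
  have m: "CARD('m) = Suc d" by (simp add: d_def)
  define U where "U E = poly_span E (pair_row d 0 1)" for E
  define W where "W N = {f :: complex poly. degree f < CARD('m) \<and> (\<forall>k. coeff (pcompose f [:-1,1:]) k \<noteq> 0 \<longrightarrow> k \<in> N)}" for N
  have ev: "eventually (\<lambda>t::real. \<forall>f\<in>U E. pcompose f [:0, of_real t:] \<in> W N \<longrightarrow> f = 0) at_top"
    if NE: "N \<subseteq> {..<CARD('m)}" "E \<subseteq> {..<CARD('m)}" "card N + card E = CARD('m)" for N E
  proof (rule scaled_subspace_eventually_disjoint[where 'm='m])
    have finN: "finite N" using NE finite_subset by blast
    show "poly_subspace (U E)" unfolding U_def by (rule poly_subspace_span)
    show "poly_subspace (W N)"
      unfolding poly_subspace_def W_def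
      by (auto simp: pcompose_add pcompose_smult intro: degree_add_less le_less_trans[OF degree_smult_le])
         (metis add.right_neutral)
    show "degree f < CARD('m)" if "f \<in> U E" for f
      by (rule degree_poly_span[of E "pair_row d 0 1"]) (use that NE in \<open>auto simp: degree_pair_row m U_def\<close>)
    show "degree f < CARD('m)" if "f \<in> W N" for f using that by (simp add: W_def)
    fix g assume g: "g \<in> W N" and supp: "\<And>n. coeff g n \<noteq> 0 \<Longrightarrow> n \<in> degrees_of (U E)"
    have "card N \<le> n" if "n \<in> degrees_of (U E)" for n
    proof -
      from that obtain f where f: "f \<in> U E" "f \<noteq> 0" "n = degree f" by (auto simp: degrees_of_def)
      then obtain c where c: "f = (\<Sum>e\<in>E. smult (c e) (pair_row d 0 1 e))" by (auto simp: U_def poly_span_def)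
      have "\<not> degree f + card E \<le> d"
      proof
        assume "degree f + card E \<le> d"
        then have "\<forall>e\<in>E. c e = 0" using NE c by (intro pair_combination_low_degree[of E d f]) (auto simp: m)
        then show False using c f by simp
      qed
      then show ?thesis using NE f m by linarith
    qed
    then have "\<forall>k<card N. coeff g k = 0" using supp by (metis not_less)
    then have "monom 1 (card N) dvd g" by (simp add: monom_1_dvd_iff')
    then obtain h where h: "g = monom 1 (card N) * h" by (elim dvdE)
    define q where "q = pcompose g [:-1,1:]"
    have "q = [:-1,1:] ^ card N * pcompose h [:-1,1:]"
      by (rule poly_ext) (simp add: q_def h poly_pcompose poly_monom)
    then have dv: "[:-1,1:] ^ card N dvd q" by simp
    have qs: "q = (\<Sum>n\<in>N. monom (coeff q n) n)"
    proof (rule poly_eqI)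
      fix k
      have "coeff q k \<noteq> 0 \<Longrightarrow> k \<in> N" using g by (auto simp: W_def q_def)
      then show "coeff q k = coeff (\<Sum>n\<in>N. monom (coeff q n) n) k"
        using finN by (auto simp: coeff_sum)
    qed
    have "\<forall>n\<in>N. coeff q n = 0" by (rule sparse_poly_order_at_one[OF finN]) (use dv qs in simp)
    then have "q = 0" using qs by simp
    moreover have "g = pcompose q [:1,1:]" by (rule poly_ext) (simp add: q_def poly_pcompose)
    ultimately show "g = 0" by simp
  qed
  define S where "S = {(N,E). N \<subseteq> {..<CARD('m)} \<and> E \<subseteq> {..<CARD('m)} \<and> card N + card E = CARD('m)}"
  have "S \<subseteq> Pow {..<CARD('m)} \<times> Pow {..<CARD('m)}" by (auto simp: S_def)
  then have "finite S" by (rule finite_subset) auto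
  then have "eventually (\<lambda>t::real. \<forall>x\<in>S. \<forall>f\<in>U (snd x). pcompose f [:0, of_real t:] \<in> W (fst x) \<longrightarrow> f = 0) at_top"
    by (intro eventually_ball_finite) (auto simp: S_def intro!: ev)
  with eventually_gt_at_top[of 0]
  have "eventually (\<lambda>t::real. 0 < t \<and> (\<forall>x\<in>S. \<forall>f\<in>U (snd x). pcompose f [:0, of_real t:] \<in> W (fst x) \<longrightarrow> f = 0)) at_top"
    by eventually_elim auto
  from eventually_happens'[OF trivial_limit_at_top_linorder this] obtain t :: real
    where tt: "0 < t \<and> (\<forall>x\<in>S. \<forall>f\<in>U (snd x). pcompose f [:0, of_real t:] \<in> W (fst x) \<longrightarrow> f = 0)" by (rule exE)
  then have t1: "0 < t" by simp
  have t2: "f = 0" if "(N,E) \<in> S" "f \<in> U E" "pcompose f [:0, of_real t:] \<in> W N" for N E f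
    using tt[THEN conjunct2, rule_format, of "(N,E)" f] that by simp
  note t = t1
  define T where "T = complex_of_real t"
  have T: "T \<noteq> 0" using t by (simp add: T_def)
  define l where "l = 1 + 1 / T"
  have "l = of_real (1 + 1/t)" by (simp add: l_def T_def)
  moreover have "1 / t > 0" using t by simp
  then have "1 + 1/t \<noteq> 0" "1 + 1/t \<noteq> 1" by linarith+
  ultimately have l: "l \<noteq> 0" "l \<noteq> 1" by (simp_all only: of_real_eq_0_iff of_real_eq_1_iff) auto
  have "\<forall>e\<in>E. c e = 0" if NE: "N \<subseteq> {..<CARD('m)}" "E \<subseteq> {..<CARD('m)}" "card N + card E = CARD('m)"
    and supp: "\<And>k. coeff (\<Sum>e\<in>E. smult (c e) (pair_row d 1 l e)) k \<noteq> 0 \<Longrightarrow> k \<in> N" for N E c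
  proof -
    define f where "f = (\<Sum>e\<in>E. smult (c e) (pair_row d 0 1 e))"
    have fU: "f \<in> U E" by (auto simp: f_def U_def poly_span_def)
    have "pcompose (pcompose f [:0, T:]) [:-1,1:] = smult (T ^ d) (\<Sum>e\<in>E. smult (c e) (pair_row d 1 l e))"
    proof (rule poly_ext)
      fix z
      have "poly (pair_row d 0 1 e) (T * (z - 1)) = T ^ d * poly (pair_row d 1 l e) z" if "e \<in> E" for e
      proof -
        have e: "e \<le> d" using that NE m by auto
        have "T * (z - 1) - 1 = T * (z - l)" using T by (simp add: l_def field_simps)
        then have "poly (pair_row d 0 1 e) (T * (z - 1)) = (T * (z - 1)) ^ e * (T * (z - l)) ^ (d - e)"
          by (simp add: pair_row_def)
        also have "\<dots> = T ^ (e + (d - e)) * ((z - 1) ^ e * (z - l) ^ (d - e))"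
          by (simp add: power_mult_distrib power_add)
        finally show ?thesis using e by (simp add: pair_row_def)
      qed
      then show "poly (pcompose (pcompose f [:0, T:]) [:-1,1:]) z = poly (smult (T ^ d) (\<Sum>e\<in>E. smult (c e) (pair_row d 1 l e))) z"
        by (simp add: poly_pcompose f_def poly_sum sum_distrib_left algebra_simps)
    qed
    moreover have "degree (pcompose f [:0, T:]) < CARD('m)"
    proof -
      have "degree f < CARD('m)"
        by (rule degree_poly_span[of E "pair_row d 0 1"]) (use fU NE in \<open>auto simp: degree_pair_row m U_def\<close>)
      then show ?thesis using T by (simp add: degree_pcompose)
    qed
    ultimately have "pcompose f [:0, T:] \<in> W N" using supp by (auto simp: W_def)
    moreover have "(N,E) \<in> S" using NE by (simp add: S_def)
    ultimately have "f = 0" using t2[of N E f] fU by (simp add: T_def)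
    then show ?thesis using NE by (intro pair_combination_low_degree[of E d f]) (auto simp: m f_def)
  qed
  then show ?thesis using l unfolding d_def by blast
qed

definition poly_general_position :: "nat \<Rightarrow> nat \<Rightarrow> (nat \<Rightarrow> complex poly) \<Rightarrow> bool" where
  "poly_general_position m N P \<longleftrightarrow> (\<forall>I\<subseteq>{..<N}. card I = m \<longrightarrow> poly_indep I P)"

text \<open>
  The new zeros are \<open>t\<close> and \<open>l t\<close> with \<open>l\<close> from \<open>exists_generic_ratio\<close> and \<open>t\<close> large. Scaling by \<open>t\<close> fixes the new rows up to factors and
  pushes the span of the old ones towards a span of monomials. That limit is in general position to the rows of the pair
  \<open>1, l\<close>, whatever monomials occur; there are only finitely many selections to be considered, so a single \<open>t\<close> serves all.
\<close>

lemma general_position_add_pair: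
  assumes gp: "poly_general_position CARD('m::finite) N P" and deg: "\<And>j. j < N \<Longrightarrow> degree (P j) < CARD('m)"
    and N: "CARD('m) \<le> N" and Z: "finite Z"
  obtains a b where "a \<notin> Z" "b \<notin> Z" "a \<noteq> b"
    "poly_general_position CARD('m) (N + CARD('m)) (\<lambda>j. if j < N then P j else pair_row (CARD('m) - 1) a b (j - N))"
proof -
  define m where "m = CARD('m)"
  define d where "d = m - 1"
  have m: "m = Suc d" by (simp add: d_def m_def)
  obtain l where l: "l \<noteq> 0" "l \<noteq> 1" and gen': "\<forall>N E c. N \<subseteq> {..<m} \<longrightarrow> E \<subseteq> {..<m} \<longrightarrow> card N + card E = m \<longrightarrow>
     (\<forall>k. coeff (\<Sum>e\<in>E. smult (c e) (pair_row d 1 l e)) k \<noteq> 0 \<longrightarrow> k \<in> N) \<longrightarrow> (\<forall>e\<in>E. c e = 0)"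
    using exists_generic_ratio[where 'm='m] unfolding m_def[symmetric] d_def[symmetric] by (elim exE conjE)
  have gen: "\<And>M E c e. \<lbrakk>M \<subseteq> {..<m}; E \<subseteq> {..<m}; card M + card E = m;
     \<And>k. coeff (\<Sum>e\<in>E. smult (c e) (pair_row d 1 l e)) k \<noteq> 0 \<Longrightarrow> k \<in> M; e \<in> E\<rbrakk> \<Longrightarrow> c e = 0"
  proof -
    fix M E c e assume a: "M \<subseteq> {..<m}" "E \<subseteq> {..<m}" "card M + card E = m"
      "\<And>k. coeff (\<Sum>e\<in>E. smult (c e) (pair_row d 1 l e)) k \<noteq> 0 \<Longrightarrow> k \<in> M" "e \<in> E"
    then show "c e = 0" using gen'[rule_format, of M E c e] by blast
  qed
  define U where "U I = poly_span I P" for I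
  define W where "W E = poly_span E (pair_row d 1 l)" for E
  have ev: "eventually (\<lambda>t::real. \<forall>f\<in>U I. pcompose f [:0, of_real t:] \<in> W E \<longrightarrow> f = 0) at_top"
    if IE: "I \<subseteq> {..<N}" "E \<subseteq> {..<m}" "card I + card E = m" for I E
  proof (rule scaled_subspace_eventually_disjoint[where 'm='m])
    have finI: "finite I" using IE finite_subset by blast
    show "poly_subspace (U I)" "poly_subspace (W E)" unfolding U_def W_def by (rule poly_subspace_span)+
    show "degree f < CARD('m)" if "f \<in> U I" for f
      by (rule degree_poly_span[of I P]) (use that IE deg in \<open>auto simp: U_def\<close>)
    show "degree f < CARD('m)" if "f \<in> W E" for f
      unfolding m_def[symmetric]
      by (rule degree_poly_span[of E "pair_row d 1 l"]) (use that IE m in \<open>auto simp: degree_pair_row W_def\<close>)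
    fix g assume g: "g \<in> W E" and supp: "\<And>n. coeff g n \<noteq> 0 \<Longrightarrow> n \<in> degrees_of (U I)"
    have D: "degrees_of (U I) \<subseteq> {..<m}" "card (degrees_of (U I)) \<le> card I"
      unfolding U_def m_def using degrees_of_span_bound[where 'm='m, of I P] finI IE deg by (metis lessThan_iff subsetD)+
    \<comment> \<open>The old rows may span fewer degrees than there are rows; the exponents are filled up to the exact number.\<close>
    obtain M where M: "degrees_of (U I) \<subseteq> M" "M \<subseteq> {..<m}" "card M = card I"
      using exists_subset_between[of "degrees_of (U I)" "card I" "{..<m}"] D IE by auto
    obtain c where c: "g = (\<Sum>e\<in>E. smult (c e) (pair_row d 1 l e))" using g by (auto simp: W_def poly_span_def)
    have "c e = 0" if "e \<in> E" for e
      by (rule gen[of M E c e]) (use M IE supp c that in auto)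
    then show "g = 0" by (simp add: c)
  qed
  define S where "S = {(I,E). I \<subseteq> {..<N} \<and> E \<subseteq> {..<m} \<and> card I + card E = m}"
  have "S \<subseteq> Pow {..<N} \<times> Pow {..<m}" by (auto simp: S_def)
  then have "finite S" by (rule finite_subset) auto
  then have ev1: "eventually (\<lambda>t::real. \<forall>x\<in>S. \<forall>f\<in>U (fst x). pcompose f [:0, of_real t:] \<in> W (snd x) \<longrightarrow> f = 0) at_top"
    by (intro eventually_ball_finite) (auto simp: S_def intro!: ev)
  obtain B where B: "\<And>z. z \<in> Z \<Longrightarrow> cmod z \<le> B"
    using finite_imp_bounded[OF Z] by (auto simp: bounded_iff)
  have "eventually (\<lambda>t::real. t > 0 \<and> of_real t \<notin> Z \<and> l * of_real t \<notin> Z \<and>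
     (\<forall>x\<in>S. \<forall>f\<in>U (fst x). pcompose f [:0, of_real t:] \<in> W (snd x) \<longrightarrow> f = 0)) at_top"
    using ev1 eventually_gt_at_top[of 0] eventually_gt_at_top[of B] eventually_gt_at_top[of "B / cmod l"]
  proof eventually_elim
    case (elim t)
    have "of_real t \<notin> Z" using B[of "of_real t"] elim by auto
    moreover have "cmod (l * of_real t) > B" using elim l by (simp add: norm_mult field_simps)
    then have "l * of_real t \<notin> Z" using B[of "l * of_real t"] by auto
    ultimately show ?case using elim by auto
  qed
  from eventually_happens'[OF trivial_limit_at_top_linorder this] obtain t :: real
    where tt: "0 < t \<and> of_real t \<notin> Z \<and> l * of_real t \<notin> Z \<and>
     (\<forall>x\<in>S. \<forall>f\<in>U (fst x). pcompose f [:0, of_real t:] \<in> W (snd x) \<longrightarrow> f = 0)" by (rule exE)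
  then have t: "0 < t" "of_real t \<notin> Z" "l * of_real t \<notin> Z" by simp_all
  have t4: "f = 0" if "(I,E) \<in> S" "f \<in> U I" "pcompose f [:0, of_real t:] \<in> W E" for I E f
    using tt[THEN conjunct2, THEN conjunct2, THEN conjunct2, rule_format, of "(I,E)" f] that by simp
  define T where "T = complex_of_real t"
  have T: "T \<noteq> 0" using t by (simp add: T_def)
  define Q where "Q j = (if j < N then P j else pair_row d T (l * T) (j - N))" for j
  have scale: "pcompose (\<Sum>e\<in>E. smult (c e) (pair_row d T (l * T) e)) [:0, T:] = smult (T ^ d) (\<Sum>e\<in>E. smult (c e) (pair_row d 1 l e))"
    if "E \<subseteq> {..<m}" for E c
  proof (rule poly_ext)
    fix z
    have "poly (pair_row d T (l * T) e) (T * z) = T ^ d * poly (pair_row d 1 l e) z" if "e \<in> E" for e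
    proof -
      have e: "e \<le> d" using that \<open>E \<subseteq> {..<m}\<close> m by auto
      have "poly (pair_row d T (l * T) e) (T * z) = (T * (z - 1)) ^ e * (T * (z - l)) ^ (d - e)"
        by (simp add: pair_row_def algebra_simps)
      also have "\<dots> = T ^ (e + (d - e)) * ((z - 1) ^ e * (z - l) ^ (d - e))"
        by (simp add: power_mult_distrib power_add)
      finally show ?thesis using e by (simp add: pair_row_def)
    qed
    then show "poly (pcompose (\<Sum>e\<in>E. smult (c e) (pair_row d T (l * T) e)) [:0, T:]) z =
       poly (smult (T ^ d) (\<Sum>e\<in>E. smult (c e) (pair_row d 1 l e))) z"
      by (simp add: poly_pcompose poly_sum sum_distrib_left algebra_simps)
  qed
  have "poly_indep K Q" if K: "K \<subseteq> {..<N + m}" "card K = m" for K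
    unfolding poly_indep_def
  proof (intro allI impI)
    fix c assume s: "(\<Sum>j\<in>K. smult (c j) (Q j)) = 0"
    have finK: "finite K" using K finite_subset by blast
    define I where "I = K \<inter> {..<N}"
    define E where "E = (\<lambda>j. j - N) ` (K - {..<N})"
    have inj: "inj_on (\<lambda>j. j - N) (K - {..<N})" by (auto intro!: inj_onI)
    have E: "E \<subseteq> {..<m}" using K by (auto simp: E_def)
    have I: "I \<subseteq> {..<N}" "finite I" using finK by (auto simp: I_def)
    have "card K = card I + card E"
      using card_Un_disjoint[of I "K - {..<N}"] finK card_image[OF inj]
      by (auto simp: I_def E_def Int_Diff_Un)
    then have cIE: "card I + card E = m" using K by simp
    define f where "f = (\<Sum>i\<in>I. smult (c i) (P i))"
    define g where "g = (\<Sum>e\<in>E. smult (c (e + N)) (pair_row d T (l * T) e))"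
    have "(\<Sum>j\<in>K. smult (c j) (Q j)) = (\<Sum>j\<in>I. smult (c j) (Q j)) + (\<Sum>j\<in>K - {..<N}. smult (c j) (Q j))"
      using sum.Int_Diff[OF finK, of "\<lambda>j. smult (c j) (Q j)" "{..<N}"] by (simp add: I_def)
    also have "(\<Sum>j\<in>I. smult (c j) (Q j)) = f"
      unfolding f_def by (intro sum.cong) (auto simp: Q_def I_def)
    also have "(\<Sum>j\<in>K - {..<N}. smult (c j) (Q j)) = g"
      unfolding g_def E_def sum.reindex[OF inj] o_def by (intro sum.cong) (auto simp: Q_def)
    finally have fg: "f + g = 0" using s by simp
    have "f = - g" using fg by (simp add: eq_neg_iff_add_eq_0)
    then have "pcompose f [:0, T:] = smult (- (T ^ d)) (\<Sum>e\<in>E. smult (c (e + N)) (pair_row d 1 l e))"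
      using scale[OF E, of "\<lambda>e. c (e + N)"] by (simp add: g_def pcompose_uminus)
    moreover have "(\<Sum>e\<in>E. smult (c (e + N)) (pair_row d 1 l e)) \<in> W E" by (auto simp: W_def poly_span_def)
    then have "smult (- (T ^ d)) (\<Sum>e\<in>E. smult (c (e + N)) (pair_row d 1 l e)) \<in> W E"
      using poly_subspace_span[of E "pair_row d 1 l"] unfolding W_def poly_subspace_def by blast
    ultimately have "pcompose f [:0, T:] \<in> W E" by simp
    moreover have "f \<in> U I" by (auto simp: U_def f_def poly_span_def)
    moreover have "(I,E) \<in> S" using I E cIE by (auto simp: S_def)
    ultimately have f0: "f = 0" using t4[of I E f] by (simp add: T_def)
    have "card I \<le> m" using cIE by simp
    then obtain I' where I': "I \<subseteq> I'" "I' \<subseteq> {..<N}" "card I' = m"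
      using exists_subset_between[of I m "{..<N}"] I N by (auto simp: m_def)
    then have "poly_indep I' P" using gp by (auto simp: poly_general_position_def m_def)
    then have "poly_indep I P" using I' by (metis poly_indep_subset finite_lessThan finite_subset)
    then have cI: "\<forall>i\<in>I. c i = 0" using f0 by (auto simp: poly_indep_def f_def)
    have "g = 0" using fg f0 by simp
    then have g0: "(\<Sum>e\<in>E. smult (c (e + N)) (pair_row d 1 l e)) = 0"
      using scale[OF E, of "\<lambda>e. c (e + N)"] T by (simp add: g_def)
    have "c (e + N) = 0" if "e \<in> E" for e
    proof (rule gen[of "{..<card I}" E "\<lambda>e. c (e + N)"])
      show "{..<card I} \<subseteq> {..<m}" using cIE by auto
    qed (use E cIE that g0 in auto)
    moreover have "j - N \<in> E" "(j - N) + N = j" if "j \<in> K - {..<N}" for j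
      using that by (auto simp: E_def)
    ultimately have cE: "\<forall>j\<in>K - {..<N}. c j = 0" by metis
    show "\<forall>j\<in>K. c j = 0" using cI cE by (auto simp: I_def)
  qed
  then have "poly_general_position m (N + m) Q" by (auto simp: poly_general_position_def)
  then show thesis
    using that[of T "l * T"] t l T unfolding Q_def m_def[symmetric] d_def[symmetric] by (auto simp: T_def)
qed

lemma monomials_general_position: "poly_general_position m m (monom 1)"
  unfolding poly_general_position_def
proof (intro allI impI)
  fix I :: "nat set" assume "I \<subseteq> {..<m}"
  then have "finite I" using finite_subset by blast
  then show "poly_indep I (monom 1)"
    by (intro poly_indep_distinct_degrees) (auto simp: degree_monom_eq)
qed

lemma coeff_minor_nonzero_imp_zero:
  assumes "coeff_minor n r t \<noteq> 0" "\<And>j. j < n \<Longrightarrow> (\<Sum>i<n. x i * coeff (r i) (t j)) = 0" "i < n"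
  shows "x i = 0"
proof -
  define B where "B = Matrix.mat n n (\<lambda>(j,i). coeff (r i) (t j))"
  have B: "B \<in> carrier_mat n n" by (simp add: B_def)
  have "B = transpose_mat (Matrix.mat n n (\<lambda>(i,j). coeff (r i) (t j)))"
    by (intro eq_matI) (auto simp: B_def)
  then have "Determinant.det B \<noteq> 0"
    using assms(1) by (simp add: coeff_minor_def det_transpose[of _ n])
  moreover have "B *\<^sub>v Matrix.vec n x = 0\<^sub>v n"
    using assms(2) by (intro eq_vecI) (auto simp: B_def scalar_prod_def atLeast0LessThan mult.commute)
  ultimately have "Matrix.vec n x = 0\<^sub>v n"
    using det_0_iff_vec_prod_zero_field[OF B] by (metis vec_carrier)
  then show ?thesis using assms(3) by (metis index_vec index_zero_vec(1))
qed

lemma finite_set_enumeration: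
  fixes S :: "nat set"
  assumes "finite S"
  obtains g where "strict_mono_on {..<card S} g" "g ` {..<card S} = S"
proof
  let ?l = "sorted_list_of_set S"
  show "strict_mono_on {..<card S} (\<lambda>i. ?l ! i)"
    by (rule strict_mono_onI) (use sorted_wrt_nth_less[OF strict_sorted_list_of_set[of S]] in simp)
  have "(\<lambda>i. ?l ! i) ` {..<length ?l} = set ?l" by (auto simp: set_conv_nth)
  then show "(\<lambda>i. ?l ! i) ` {..<card S} = S" using assms by simp
qed

lemma enumeration_lower:
  assumes "strict_mono_on {..<n} g" "\<And>i. i < n \<Longrightarrow> a \<le> g i" "i < n" shows "a + i \<le> (g i :: nat)"
  using assms(3)
proof (induction i)
  case (Suc i)
  then show ?case using strict_mono_onD[OF assms(1), of i "Suc i"] by simp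
qed (use assms in auto)

lemma enumeration_upper:
  assumes "strict_mono_on {..<n} g" "\<And>i. i < n \<Longrightarrow> g i < b" "i < n" shows "(g i :: nat) + (n - i) \<le> b"
  using assms(3)
proof (induction "n - i" arbitrary: i)
  case (Suc k)
  show ?case
  proof (cases "Suc i < n")
    case True
    have "g (Suc i) + (n - Suc i) \<le> b" using Suc.hyps(2) True by (intro Suc.hyps(1)) auto
    then show ?thesis using strict_mono_onD[OF assms(1), of i "Suc i"] True by simp
  next
    case False
    then have "n - i = 1" using Suc.prems by simp
    then show ?thesis using assms(2)[OF Suc.prems] by simp
  qed
qed simp

lemma enumeration_rank:
  fixes g :: "nat \<Rightarrow> nat"
  assumes "strict_mono_on {..<n} g" "i < n"
  shows "card {x \<in> g ` {..<n}. x < g i} = (i::nat)"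
proof -
  have inj: "inj_on g {..<i}" using assms strict_mono_on_imp_inj_on[OF assms(1)] by (rule_tac inj_on_subset) auto
  have "{x \<in> g ` {..<n}. x < (g i :: nat)} = g ` {..<i}"
  proof (intro equalityI subsetI)
    fix x assume "x \<in> {x \<in> g ` {..<n}. x < g i}"
    then obtain j where j: "j < n" "x = g j" "g j < g i" by auto
    then have "j < i" using strict_mono_onD[OF assms(1), of i j] assms(2) by (metis lessThan_iff less_asym linorder_neqE_nat)
    then show "x \<in> g ` {..<i}" using j by auto
  next
    fix x assume "x \<in> g ` {..<i}"
    then obtain j where "j < i" "x = g j" by auto
    then show "x \<in> {x \<in> g ` {..<n}. x < g i}" using strict_mono_onD[OF assms(1), of j i] assms(2) by auto
  qed
  then show ?thesis using card_image[OF inj] by simp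
qed

text \<open>
  On the sphere, \<open>z\<^sup>j\<close> has its \<open>2 h - 1\<close> zeros in \<open>0\<close> and infinity, \<open>(1 + z)\<^sup>j\<close> in \<open>-1\<close> and infinity, and the last
  rows in \<open>0\<close> and \<open>-1\<close>. From each pair of the three points only the \<open>h\<close> rows are taken that have their larger order at
  infinity, \<open>-1\<close> and \<open>0\<close>, respectively.
\<close>

definition triple_row :: "nat \<Rightarrow> nat \<Rightarrow> complex poly" where
  "triple_row h j = (if j < h then monom 1 j else if j < 2 * h then [:1,1:] ^ j
     else monom 1 (j - h) * [:1,1:] ^ (2 * h - 1 - (j - h)))"

lemma coeff_linear_power_of_real:
  "coeff ([:1,1:] ^ n :: complex poly) k = of_real (coeff ([:1,1:] ^ n :: real poly) k)"
proof (induction n arbitrary: k)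
  case 0
  then show ?case by (simp add: coeff_eq_0)
next
  case (Suc n)
  show ?case
    by (cases k) (simp_all add: Suc.IH coeff_pCons)
qed

lemma coeff_monom_linear_power_of_real:
  "coeff (monom 1 e * [:1,1:] ^ n :: complex poly) k = of_real (coeff (monom 1 e * [:1,1:] ^ n :: real poly) k)"
  by (simp add: coeff_monom_mult coeff_linear_power_of_real)

text \<open>
  The chosen monomials eliminate their own columns. What remains is a square matrix of rows as in
  \<open>edge_minor_total_positivity\<close>, restricted to the columns outside \<open>J\<close>. Since all exponents \<open>f\<close> and \<open>e\<close> lie in the
  upper half \<open>{h..<2 h}\<close>, which contains no index of \<open>J\<close>, the conditions for positivity follow by counting.
\<close>

lemma triple_general_position: "poly_general_position (2 * h) (3 * h) (triple_row h)"
  unfolding poly_general_position_def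
proof (intro allI impI)
  fix K assume K: "K \<subseteq> {..<3 * h}" "card K = 2 * h"
  have finK: "finite K" using K finite_subset by blast
  define J where "J = K \<inter> {..<h}"
  define F where "F = K \<inter> {h..<2*h}"
  define E where "E = (\<lambda>j. j - h) ` (K \<inter> {2*h..<3*h})"
  have injE: "inj_on (\<lambda>j. j - h) (K \<inter> {2*h..<3*h})" by (auto intro!: inj_onI)
  have fin: "finite J" "finite F" "finite E" using finK by (auto simp: J_def F_def E_def)
  have Ksplit: "K = J \<union> (F \<union> (K \<inter> {2*h..<3*h}))" using K by (auto simp: J_def F_def)
  have disj: "J \<inter> (F \<union> (K \<inter> {2*h..<3*h})) = {}" "F \<inter> (K \<inter> {2*h..<3*h}) = {}" by (auto simp: J_def F_def)
  have "card K = card J + card (F \<union> (K \<inter> {2*h..<3*h}))"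
    by (subst Ksplit, rule card_Un_disjoint) (use disj finK fin in auto)
  also have "card (F \<union> (K \<inter> {2*h..<3*h})) = card F + card (K \<inter> {2*h..<3*h})"
    by (rule card_Un_disjoint) (use disj finK fin in auto)
  also have "card (K \<inter> {2*h..<3*h}) = card E" unfolding E_def by (simp add: card_image[OF injE])
  finally have cards: "card J + (card F + card E) = 2 * h" using K by simp
  have Fsub: "F \<subseteq> {h..<2*h}" by (auto simp: F_def)
  have Esub: "E \<subseteq> {h..<2*h}" by (auto simp: E_def)
  define p q where "p = card F" and "q = card E"
  have ph: "p \<le> h" and qh: "q \<le> h"
    using card_mono[OF _ Fsub] card_mono[OF _ Esub] by (auto simp: p_def q_def)
  define k where "k = h - card J"
  have Jh: "card J \<le> h" using card_mono[of "{..<h}" J] by (auto simp: J_def)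
  have pqk: "p + q = h + k" using cards Jh by (simp add: p_def q_def k_def)
  define D where "D = 2 * h - 1"
  obtain f where f: "strict_mono_on {..<p} f" "f ` {..<p} = F"
    using finite_set_enumeration[OF fin(2)] p_def by blast
  obtain e where e: "strict_mono_on {..<q} e" "e ` {..<q} = E"
    using finite_set_enumeration[OF fin(3)] q_def by blast
  define Tt where "Tt = {..<2*h} - J"
  have cT: "card Tt = p + q"
  proof -
    have "card Tt = 2 * h - card J" unfolding Tt_def
      by (subst card_Diff_subset) (use fin in \<open>auto simp: J_def\<close>)
    then show ?thesis using cards by (simp add: p_def q_def)
  qed
  obtain t where t: "strict_mono_on {..<p+q} t" "t ` {..<p+q} = Tt"
    using finite_set_enumeration[of Tt] cT by (auto simp: Tt_def)
  have fr: "h \<le> f i" "f i < 2*h" if "i < p" for i using f(2) Fsub that by auto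
  have er: "h \<le> e i" "e i < 2*h" if "i < q" for i using e(2) Esub that by auto
  have tr: "t i < 2*h" "t i \<notin> J" if "i < p + q" for i using t(2) that by (auto simp: Tt_def)
  have low: "card (Tt \<inter> {..<h}) = k"
  proof -
    have "Tt \<inter> {..<h} = {..<h} - J" by (auto simp: Tt_def)
    also have "card ({..<h} - J) = h - card J" by (subst card_Diff_subset) (use fin in \<open>auto simp: J_def\<close>)
    finally show ?thesis by (simp add: k_def)
  qed
  have rank: "i = k + (t i - h)" if i: "i < p + q" "h \<le> t i" for i
  proof -
    have "{x \<in> Tt. x < t i} = (Tt \<inter> {..<h}) \<union> {h..<t i}"
      using i tr(1)[OF i(1)] by (auto simp: Tt_def J_def)
    moreover have "card ((Tt \<inter> {..<h}) \<union> {h..<t i}) = card (Tt \<inter> {..<h}) + card {h..<t i}"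
      by (rule card_Un_disjoint) auto
    ultimately have "card {x \<in> Tt. x < t i} = k + (t i - h)"
      using low by simp
    then show ?thesis using enumeration_rank[OF t(1) i(1)] t(2) by simp
  qed
  have tf: "t i \<le> f i" if i: "i < p" for i
  proof (cases "h \<le> t i")
    case True
    then have "t i \<le> h + i" using rank[of i] i by simp
    also have "\<dots> \<le> f i" by (rule enumeration_lower[OF f(1) fr(1) i])
    finally show ?thesis .
  next
    case False
    then show ?thesis using fr(1)[OF i] by simp
  qed
  have et: "e i \<le> t (p + i)" if i: "i < q" for i
  proof -
    have pi: "p + i < p + q" using i by simp
    have "h \<le> t (p + i)"
    proof (rule ccontr)
      assume "\<not> h \<le> t (p + i)"
      then have "insert (t (p + i)) {x \<in> t ` {..<p+q}. x < t (p + i)} \<subseteq> Tt \<inter> {..<h}" using t(2) pi by auto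
      then have "card (insert (t (p + i)) {x \<in> t ` {..<p+q}. x < t (p + i)}) \<le> k"
        unfolding low[symmetric] by (intro card_mono) auto
      then have "Suc (p + i) \<le> k" using enumeration_rank[OF t(1) pi] by (subst (asm) card_insert_disjoint) auto
      then show False using pqk qh by linarith
    qed
    from rank[OF pi this] this have "t (p + i) = h + (p + i - k)" by linarith
    moreover have "e i + (q - i) \<le> 2 * h" by (rule enumeration_upper[OF e(1) er(2) i])
    ultimately show ?thesis using pqk qh i by linarith
  qed
  have h0: "0 < h" if "0 < p + q" using that pqk ph qh by linarith
  have DS: "Suc D = 2 * h" if "0 < p + q" using h0[OF that] by (simp add: D_def)
  have count: "card {i. i < p \<and> y \<le> f i} + card {i. i < q \<and> e i + y \<le> D} \<le> Suc D - y" if y: "y \<le> D" and pos: "0 < p + q" for y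
  proof -
    have inj: "inj_on f {..<p}" "inj_on e {..<q}" using f(1) e(1) by (auto intro: strict_mono_on_imp_inj_on)
    have a: "card {i. i < p \<and> y \<le> f i} \<le> Suc D - y"
    proof -
      have "card {i. i < p \<and> y \<le> f i} \<le> card {y..<2*h}"
        by (rule card_inj_on_le[of f]) (use fr in \<open>auto intro: inj_on_subset[OF inj(1)]\<close>)
      then show ?thesis using DS[OF pos] by simp
    qed
    have b: "card {i. i < p \<and> y \<le> f i} \<le> h"
    proof -
      have "card {i. i < p \<and> y \<le> f i} \<le> card {..<p}" by (rule card_mono) auto
      then show ?thesis using ph by simp
    qed
    \<comment> \<open>Both \<open>y \<le> h\<close> and \<open>y > h\<close> are covered: in the second case there is no such row and the difference is zero.\<close>
    have c: "card {i. i < q \<and> e i + y \<le> D} \<le> h - y"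
    proof -
      have "card {i. i < q \<and> e i + y \<le> D} \<le> card {h..<2*h-y}"
        by (rule card_inj_on_le[of e]) (use er DS[OF pos] in \<open>fastforce intro: inj_on_subset[OF inj(2)]\<close>)+
      then show ?thesis by simp
    qed
    show ?thesis using a b c DS[OF pos] by linarith
  qed
  have pos: "0 < coeff_minor (p + q) (edge_row D p f e) t"
  proof (cases "p + q = 0")
    case True
    then show ?thesis by (simp add: coeff_minor_def)
  next
    case False
    then have pos: "0 < p + q" by simp
    show ?thesis
    proof (rule edge_minor_total_positivity[THEN conjunct2, THEN mp])
      show "strict_mono_on {..<p} f" "strict_mono_on {..<q} e" "strict_mono_on {..<p+q} t" by fact+
      show "f i \<le> D" if "i < p" for i using fr(2)[OF that] by (simp add: D_def)
      show "e i \<le> D" if "i < q" for i using er(2)[OF that] by (simp add: D_def)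
      have "t (p + i) \<le> D" if "i < q" for i using tr(1)[of "p + i"] that by (simp add: D_def)
      then show "(\<forall>i<p. t i \<le> f i) \<and> (\<forall>i<q. e i \<le> t (p + i) \<and> t (p + i) \<le> D) \<and>
        (\<forall>y\<le>D. card {i. i < p \<and> y \<le> f i} + card {i. i < q \<and> e i + y \<le> D} \<le> Suc D - y)"
        using tf et count[OF _ pos] by blast
    qed
  qed
  show "poly_indep K (triple_row h)"
    unfolding poly_indep_def
  proof (intro allI impI)
    fix c assume s: "(\<Sum>j\<in>K. smult (c j) (triple_row h j)) = 0"
    define x where "x i = (if i < p then c (f i) else c (e (i - p) + h))" for i
    have sumK: "(\<Sum>j\<in>K. c j * coeff (triple_row h j) n) = (\<Sum>j\<in>J. c j * coeff (monom 1 j) n) +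
       (\<Sum>i<p+q. x i * of_real (coeff (edge_row D p f e i) n))" for n
    proof -
      have "(\<Sum>j\<in>K. c j * coeff (triple_row h j) n) = (\<Sum>j\<in>J. c j * coeff (triple_row h j) n) +
        (\<Sum>j\<in>F \<union> (K \<inter> {2*h..<3*h}). c j * coeff (triple_row h j) n)"
        by (subst Ksplit, rule sum.union_disjoint) (use disj finK fin in auto)
      also have "(\<Sum>j\<in>F \<union> (K \<inter> {2*h..<3*h}). c j * coeff (triple_row h j) n) =
        (\<Sum>j\<in>F. c j * coeff (triple_row h j) n) + (\<Sum>j\<in>K \<inter> {2*h..<3*h}. c j * coeff (triple_row h j) n)"
        by (rule sum.union_disjoint) (use disj finK fin in auto)
      also have "(\<Sum>j\<in>J. c j * coeff (triple_row h j) n) = (\<Sum>j\<in>J. c j * coeff (monom 1 j) n)"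
        by (rule sum.cong) (auto simp: triple_row_def J_def)
      also have "(\<Sum>j\<in>F. c j * coeff (triple_row h j) n) = (\<Sum>i<p. x i * of_real (coeff (edge_row D p f e i) n))"
      proof (rule sum.reindex_bij_betw[of f "{..<p}" F, THEN trans[OF sym]])
        show "bij_betw f {..<p} F" using f strict_mono_on_imp_inj_on[OF f(1)] by (simp add: bij_betw_def)
        show "(\<Sum>i<p. c (f i) * coeff (triple_row h (f i)) n) = (\<Sum>i<p. x i * of_real (coeff (edge_row D p f e i) n))"
        proof (rule sum.cong[OF refl])
          fix i assume "i \<in> {..<p}"
          then have "i < p" by simp
          then have "triple_row h (f i) = [:1,1:] ^ f i" "edge_row D p f e i = [:1,1:] ^ f i"
            using fr[of i] by (auto simp: triple_row_def edge_row_def)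
          then show "c (f i) * coeff (triple_row h (f i)) n = x i * of_real (coeff (edge_row D p f e i) n)"
            using \<open>i < p\<close> by (simp add: x_def coeff_linear_power_of_real)
        qed
      qed
      also have "(\<Sum>j\<in>K \<inter> {2*h..<3*h}. c j * coeff (triple_row h j) n) = (\<Sum>i=p..<p+q. x i * of_real (coeff (edge_row D p f e i) n))"
      proof -
        have "(\<Sum>j\<in>K \<inter> {2*h..<3*h}. c j * coeff (triple_row h j) n) = (\<Sum>j\<in>E. c (j + h) * coeff (triple_row h (j + h)) n)"
          unfolding E_def sum.reindex[OF injE] o_def by (rule sum.cong) auto
        also have "\<dots> = (\<Sum>i<q. c (e i + h) * coeff (triple_row h (e i + h)) n)"
          by (rule sum.reindex_bij_betw[of e "{..<q}" E, symmetric]) (use e strict_mono_on_imp_inj_on[OF e(1)] in \<open>simp add: bij_betw_def\<close>)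
        also have "\<dots> = (\<Sum>i<q. x (i + p) * of_real (coeff (edge_row D p f e (i + p)) n))"
        proof (rule sum.cong[OF refl])
          fix i assume "i \<in> {..<q}"
          then have "i < q" by simp
          then have "triple_row h (e i + h) = monom 1 (e i) * [:1,1:] ^ (D - e i)"
            "edge_row D p f e (i + p) = monom 1 (e i) * [:1,1:] ^ (D - e i)"
            using er[of i] by (auto simp: triple_row_def edge_row_def D_def)
          then show "c (e i + h) * coeff (triple_row h (e i + h)) n = x (i + p) * of_real (coeff (edge_row D p f e (i + p)) n)"
            by (simp add: x_def coeff_monom_linear_power_of_real)
        qed
        also have "\<dots> = (\<Sum>i=p..<p+q. x i * of_real (coeff (edge_row D p f e i) n))"
          using sum.shift_bounds_nat_ivl[of "\<lambda>i. x i * of_real (coeff (edge_row D p f e i) n)" 0 p q]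
          by (simp add: add.commute atLeast0LessThan)
        finally show ?thesis .
      qed
      also have "(\<Sum>i<p. x i * of_real (coeff (edge_row D p f e i) n)) + (\<Sum>i=p..<p+q. x i * of_real (coeff (edge_row D p f e i) n)) =
         (\<Sum>i<p+q. x i * of_real (coeff (edge_row D p f e i) n))"
        using sum.atLeastLessThan_concat[of 0 p "p+q" "\<lambda>i. x i * of_real (coeff (edge_row D p f e i) n)"]
        by (simp add: atLeast0LessThan)
      finally show ?thesis .
    qed
    have all0: "(\<Sum>j\<in>J. c j * coeff (monom 1 j) n) + (\<Sum>i<p+q. x i * of_real (coeff (edge_row D p f e i) n)) = 0" for n
      using arg_cong[OF s, of "\<lambda>P. coeff P n"] unfolding sumK[symmetric] by (simp add: coeff_sum)
    have tz: "(\<Sum>i<p+q. x i * of_real (coeff (edge_row D p f e i) (t j))) = 0" if "j < p + q" for j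
    proof -
      have "(\<Sum>i\<in>J. c i * coeff (monom 1 i) (t j)) = 0"
        by (rule sum.neutral) (use tr(2)[OF that] in auto)
      then show ?thesis using all0[of "t j"] by simp
    qed
    have x0: "x i = 0" if i: "i < p + q" for i
    proof (rule complex_eqI)
      have "Re (x i) = 0"
      proof (rule coeff_minor_nonzero_imp_zero[of "p+q" "edge_row D p f e" t "\<lambda>i. Re (x i)"])
        show "(\<Sum>i<p+q. Re (x i) * coeff (edge_row D p f e i) (t j)) = 0" if "j < p + q" for j
          using arg_cong[OF tz[OF that], of Re] by simp
      qed (use pos i in auto)
      then show "Re (x i) = Re 0" by simp
      have "Im (x i) = 0"
      proof (rule coeff_minor_nonzero_imp_zero[of "p+q" "edge_row D p f e" t "\<lambda>i. Im (x i)"])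
        show "(\<Sum>i<p+q. Im (x i) * coeff (edge_row D p f e i) (t j)) = 0" if "j < p + q" for j
          using arg_cong[OF tz[OF that], of Im] by simp
      qed (use pos i in auto)
      then show "Im (x i) = Im 0" by simp
    qed
    have cJ: "c j = 0" if "j \<in> J" for j
    proof -
      have "(\<Sum>i\<in>J. c i * coeff (monom 1 i) j) = 0" using all0[of j] x0 by simp
      moreover have "(\<Sum>i\<in>J. c i * coeff (monom 1 i) j) = (\<Sum>i\<in>{j}. c i * coeff (monom 1 i) j)"
        by (rule sum.mono_neutral_right) (use fin that in auto)
      ultimately show ?thesis by simp
    qed
    have cF: "c j = 0" if jF: "j \<in> F" for j
    proof -
      obtain i where "i < p" "j = f i" using f(2) jF by auto
      then show ?thesis using x0[of i] by (simp add: x_def)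
    qed
    have cE: "c j = 0" if "j \<in> K \<inter> {2*h..<3*h}" for j
    proof -
      have "j - h \<in> E" using that by (auto simp: E_def)
      then obtain i where i: "i < q" "j - h = e i" using e(2) by auto
      then have "j = e i + h" using that by auto
      then show ?thesis using x0[of "i + p"] i by (simp add: x_def)
    qed
    show "\<forall>j\<in>K. c j = 0" using cJ cF cE Ksplit by blast
  qed
qed

text \<open>
  Induction over pairs of points, starting for odd \<open>m\<close> with the monomials, which belong to the pair \<open>0\<close>, infinity, and for
  even \<open>m\<close> with the rows of the triple \<open>0\<close>, \<open>-1\<close>, infinity. Infinity is not counted in \<open>Z\<close>.
\<close>

lemma exists_general_position_family:
  assumes m: "CARD('m::finite) \<ge> 2"
  shows "\<exists>Z P. finite Z \<and> card Z = CARD('m) \<and> 0 \<in> Z \<and>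
     poly_general_position CARD('m) (CARD('m) * (CARD('m) + 1) div 2) P \<and>
     (\<forall>j < CARD('m) * (CARD('m) + 1) div 2. degree (P j) < CARD('m) \<and> (\<forall>z. poly (P j) z = 0 \<longrightarrow> z \<in> Z))"
proof -
  define m where "m = CARD('m)"
  define good where "good Z N P \<longleftrightarrow> finite Z \<and> 0 \<in> Z \<and> poly_general_position m N P \<and>
     (\<forall>j<N. degree (P j) < m \<and> (\<forall>z. poly (P j) z = 0 \<longrightarrow> z \<in> Z))" for Z N and P :: "nat \<Rightarrow> complex poly"
  have add: "\<exists>Z' P'. good Z' (N + m) P' \<and> card Z' = card Z + 2" if g: "good Z N P" and N: "m \<le> N" for Z N P
  proof -
    obtain a b where ab: "a \<notin> Z" "b \<notin> Z" "a \<noteq> b"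
      "poly_general_position m (N + m) (\<lambda>j. if j < N then P j else pair_row (m - 1) a b (j - N))"
      unfolding m_def by (rule general_position_add_pair[where 'm='m, of N P Z]) (use g N in \<open>auto simp: good_def m_def\<close>)
    have "good (insert a (insert b Z)) (N + m) (\<lambda>j. if j < N then P j else pair_row (m - 1) a b (j - N))"
      unfolding good_def
    proof (intro conjI allI impI)
      fix j assume j: "j < N + m"
      show "degree (if j < N then P j else pair_row (m - 1) a b (j - N)) < m"
        using g j by (auto simp: good_def degree_pair_row)
      fix z assume "poly (if j < N then P j else pair_row (m - 1) a b (j - N)) z = 0"
      then show "z \<in> insert a (insert b Z)"
        using g by (auto simp: good_def pair_row_def split: if_splits)
    qed (use g ab in \<open>auto simp: good_def\<close>)
    moreover have "card (insert a (insert b Z)) = card Z + 2" using ab g by (simp add: good_def)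
    ultimately show ?thesis by blast
  qed
  have iter: "\<exists>Z' P'. good Z' (N + n * m) P' \<and> card Z' = card Z + 2 * n" if g: "good Z N P" and N: "m \<le> N" for Z N P n
  proof (induction n)
    case 0
    then show ?case using g by auto
  next
    case (Suc n)
    then obtain Z' P' where "good Z' (N + n * m) P'" "card Z' = card Z + 2 * n" by blast
    with add[of Z' "N + n * m" P'] N obtain Z'' P'' where "good Z'' (N + n * m + m) P''" "card Z'' = card Z' + 2" by auto
    then show ?case using \<open>card Z' = card Z + 2 * n\<close> by (intro exI[of _ Z''] exI[of _ P'']) (auto simp: algebra_simps)
  qed
  have "\<exists>Z P. good Z (m * (m + 1) div 2) P \<and> card Z = m"
  proof (cases "even m")
    case True
    then obtain h where h: "m = 2 * h" by auto
    then have h1: "h \<ge> 1" using m by (simp add: m_def)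
    have "good {0,-1} (3 * h) (triple_row h)"
      unfolding good_def
    proof (intro conjI allI impI)
      show "poly_general_position m (3 * h) (triple_row h)" unfolding h by (rule triple_general_position)
      fix j assume j: "j < 3 * h"
      have "degree (monom 1 (j - h) * [:1,1:] ^ (2 * h - 1 - (j - h)) :: complex poly) \<le> (j - h) + (2 * h - 1 - (j - h))"
        by (rule order.trans[OF degree_mult_le]) (simp add: degree_monom_eq degree_linear_power)
      then show "degree (triple_row h j) < m"
        using j h h1 by (auto simp: triple_row_def degree_monom_eq degree_linear_power)
      fix z :: complex assume "poly (triple_row h j) z = 0"
      then show "z \<in> {0,-1}"
        by (auto simp: triple_row_def poly_monom add_eq_0_iff split: if_splits)
    qed auto
    from iter[OF this, of "h - 1"] obtain Z P where "good Z (3 * h + (h - 1) * m) P" "card Z = card {0,-1::complex} + 2 * (h - 1)"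
      using h by auto
    moreover have "3 * h + (h - 1) * m = m * (m + 1) div 2"
    proof -
      obtain g where g: "h = Suc g" using h1 by (cases h) auto
      show ?thesis unfolding h g by (simp add: algebra_simps)
    qed
    moreover have "card {0,-1::complex} + 2 * (h - 1) = m" using h h1 by simp
    ultimately show ?thesis by auto
  next
    case False
    then obtain h where h: "m = 2 * h + 1" by (elim oddE)
    have "good {0} m (monom 1)"
      unfolding good_def by (auto simp: monomials_general_position degree_monom_eq poly_monom)
    from iter[OF this, of h] obtain Z P where "good Z (m + h * m) P" "card Z = card {0::complex} + 2 * h" by auto
    moreover have "m + h * m = m * (m + 1) div 2" unfolding h by (simp add: algebra_simps)
    moreover have "card {0::complex} + 2 * h = m" using h by simp
    ultimately show ?thesis by auto
  qed
  then show ?thesis unfolding good_def m_def[symmetric] by blast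
qed

section \<open>A null curve spanning all polynomials of small degree\<close>

text \<open>
  A primitive root of unity of order \<open>2 m\<close>. Its odd powers occur below, because the exponents \<open>2 l + 1\<close> and \<open>2 l' + 1\<close>
  add up to a multiple of \<open>2 m\<close> exactly if \<open>l + l' = m - 1\<close>, for \<open>l, l' < m\<close>.
\<close>

definition half_root :: "nat \<Rightarrow> complex" where
  "half_root m = exp (of_real pi * \<i> / of_nat m)"

lemma half_root_nonzero: "half_root m \<noteq> 0"
  by (simp add: half_root_def)

lemma half_root_even_power:
  "half_root m ^ (2 * j) = exp (2 * of_real pi * \<i> * of_nat j / of_nat m)"
  unfolding half_root_def exp_of_nat_mult[symmetric] by (simp add: mult_ac)

lemma half_root_even_power_eq:
  assumes "m \<ge> 1"
  shows "half_root m ^ (2 * j) = half_root m ^ (2 * k) \<longleftrightarrow> j mod m = k mod m"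
  unfolding half_root_even_power by (rule complex_root_unity_eq[OF assms])

lemma sum_half_root_powers:
  assumes m: "m \<ge> 1"
  shows "(\<Sum>k<m. (half_root m ^ (2 * a) / half_root m ^ (2 * b)) ^ k) = (if a mod m = b mod m then of_nat m else 0)"
proof (cases "a mod m = b mod m")
  case True
  then show ?thesis using half_root_even_power_eq[OF m, of a b] half_root_nonzero by simp
next
  case False
  define u where "u = half_root m ^ (2 * a) / half_root m ^ (2 * b)"
  have "u \<noteq> 1" using False half_root_even_power_eq[OF m, of a b] half_root_nonzero by (simp add: u_def)
  moreover have "u ^ m = 1"
  proof -
    have one: "(half_root m ^ (2 * j)) ^ m = 1" for j
    proof -
      have "(half_root m ^ (2 * j)) ^ m = half_root m ^ (2 * (j * m))" by (simp only: power_mult[symmetric] mult.assoc)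
      also have "\<dots> = half_root m ^ (2 * 0)" unfolding half_root_even_power_eq[OF m] by simp
      finally show ?thesis by simp
    qed
    show ?thesis by (simp only: u_def power_divide one) simp
  qed
  ultimately have "(\<Sum>k<m. u ^ k) = 0" using geometric_sum[of u m] by simp
  then show ?thesis using False by (simp add: u_def)
qed

text \<open>
  The first weight cancels the others in \<open>\<Sum>\<^sub>l weight m l * weight m (m - 1 - l)\<close>; it is nonzero as \<open>m \<noteq> 2\<close>.
\<close>

definition weight :: "nat \<Rightarrow> nat \<Rightarrow> complex" where
  "weight m l = (if l = 0 then - (of_nat m - 2) / 2 else 1)"

lemma weight_nonzero: "m \<ge> 3 \<Longrightarrow> weight m l \<noteq> 0"
proof -
  assume "m \<ge> 3"
  then have "of_nat m \<noteq> (of_nat 2 :: complex)" unfolding of_nat_eq_iff by simp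
  then show ?thesis by (simp add: weight_def)
qed

lemma sum_weight_reversed:
  assumes "m \<ge> 3"
  shows "(\<Sum>l<m. weight m l * weight m (m - 1 - l)) = 0"
proof -
  obtain n where n: "m = Suc (Suc n)" "n \<ge> 1" using assms by (cases m; cases "m - 1") auto
  have ends: "(\<Sum>l<Suc (Suc n). h l) = h 0 + (\<Sum>l<n. h (Suc l)) + h (Suc n)" for h :: "nat \<Rightarrow> complex"
    by (subst sum.lessThan_Suc_shift) simp
  have "(\<Sum>l<m. weight m l * weight m (m - 1 - l)) =
      weight m 0 * weight m (Suc n) + (\<Sum>l<n. weight m (Suc l) * weight m (n - l)) + weight m (Suc n) * weight m 0"
    using ends[of "\<lambda>l. weight m l * weight m (m - 1 - l)"] by (simp add: n(1))
  also have "(\<Sum>l<n. weight m (Suc l) * weight m (n - l)) = (\<Sum>l<n. 1)"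
    by (rule sum.cong) (auto simp: weight_def)
  finally show ?thesis by (simp add: weight_def n field_simps)
qed

definition null_poly :: "'m::finite \<Rightarrow> complex poly" where
  "null_poly k = (\<Sum>l<CARD('m). monom (half_root CARD('m) ^ (ix k * (2 * l + 1)) * weight CARD('m) l) l)"

lemma poly_null_poly:
  "poly (null_poly (k::'m::finite)) z = (\<Sum>l<CARD('m). half_root CARD('m) ^ (ix k * (2 * l + 1)) * weight CARD('m) l * z ^ l)"
  by (simp add: null_poly_def poly_sum poly_monom)

lemma coeff_null_poly:
  assumes "l < CARD('m)"
  shows "coeff (null_poly (k::'m::finite)) l = half_root CARD('m) ^ (ix k * (2 * l + 1)) * weight CARD('m) l"
proof -
  have "coeff (null_poly k) l = (\<Sum>l'<CARD('m). if l = l' then half_root CARD('m) ^ (ix k * (2 * l' + 1)) * weight CARD('m) l' else 0)"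
    unfolding null_poly_def coeff_sum by (rule sum.cong) auto
  then show ?thesis using assms by (simp add: sum.delta')
qed

lemma degree_null_poly: "degree (null_poly (k::'m::finite)) < CARD('m)"
proof -
  have "degree (null_poly k) \<le> CARD('m) - 1"
    unfolding null_poly_def by (intro degree_sum_le) (auto intro: order.trans[OF degree_monom_le])
  then show ?thesis using zero_less_card_finite[where 'a='m] by linarith
qed

text \<open>
  Summation over \<open>k\<close> leaves of the double sum for the squares only the terms with \<open>l + l' = m - 1\<close>. All of these belong
  to the single monomial \<open>z\<^sup>m\<^sup>-\<^sup>1\<close>, whose coefficient vanishes by \<open>sum_weight_reversed\<close>.
\<close>

lemma sum_null_poly_squares:
  assumes m3: "CARD('m::finite) \<ge> 3"
  shows "(\<Sum>k\<in>UNIV. (poly (null_poly (k::'m)) z)\<^sup>2) = 0"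
proof -
  define m where "m = CARD('m)"
  define \<zeta> where "\<zeta> = half_root m"
  have m: "m \<ge> 1" using m3 by (simp add: m_def)
  have inner: "(\<Sum>k<m. \<zeta> ^ (k * (2 * l + 1)) * \<zeta> ^ (k * (2 * l' + 1))) = (if l' = m - 1 - l then of_nat m else 0)"
    if l: "l < m" "l' < m" for l l'
  proof -
    have "(\<Sum>k<m. \<zeta> ^ (k * (2 * l + 1)) * \<zeta> ^ (k * (2 * l' + 1))) = (\<Sum>k<m. (\<zeta> ^ (2 * (l + l' + 1)) / \<zeta> ^ (2 * 0)) ^ k)"
    proof (rule sum.cong[OF refl])
      fix k
      have "\<zeta> ^ (k * (2 * l + 1)) * \<zeta> ^ (k * (2 * l' + 1)) = \<zeta> ^ (k * (2 * l + 1) + k * (2 * l' + 1))" by (simp only: power_add)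
      also have "k * (2 * l + 1) + k * (2 * l' + 1) = 2 * (l + l' + 1) * k" by (simp add: algebra_simps)
      finally show "\<zeta> ^ (k * (2 * l + 1)) * \<zeta> ^ (k * (2 * l' + 1)) = (\<zeta> ^ (2 * (l + l' + 1)) / \<zeta> ^ (2 * 0)) ^ k"
        by (simp only: mult_0_right power_0 div_by_1 power_mult)
    qed
    also have "\<dots> = (if (l + l' + 1) mod m = 0 mod m then of_nat m else 0)"
      unfolding \<zeta>_def by (rule sum_half_root_powers[OF m])
    also have "(l + l' + 1) mod m = 0 mod m \<longleftrightarrow> l' = m - 1 - l"
    proof
      assume "(l + l' + 1) mod m = 0 mod m"
      then obtain t where t: "l + l' + 1 = m * t" by (metis mod_0 mod_0_imp_dvd dvdE)
      have "m * t < m * 2" using t l by linarith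
      then have "t < 2" by simp
      moreover have "t \<noteq> 0" using t by (cases t) auto
      ultimately have "t = 1" by linarith
      then show "l' = m - 1 - l" using t by simp
    next
      assume "l' = m - 1 - l"
      then have "l + l' + 1 = m" using l by simp
      then show "(l + l' + 1) mod m = 0 mod m" by simp
    qed
    finally show ?thesis .
  qed
  have "(\<Sum>k\<in>UNIV. (poly (null_poly (k::'m)) z)\<^sup>2) =
      (\<Sum>k<m. (\<Sum>l<m. \<zeta> ^ (k * (2 * l + 1)) * weight m l * z ^ l)\<^sup>2)"
    unfolding poly_null_poly m_def \<zeta>_def
    by (rule sum_ix[of "\<lambda>k. (\<Sum>l<CARD('m). half_root CARD('m) ^ (k * (2 * l + 1)) * weight CARD('m) l * z ^ l)\<^sup>2"])
  also have "\<dots> = (\<Sum>k<m. \<Sum>l<m. \<Sum>l'<m. weight m l * weight m l' * z ^ (l + l') * (\<zeta> ^ (k * (2 * l + 1)) * \<zeta> ^ (k * (2 * l' + 1))))"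
    unfolding power2_eq_square sum_product by (intro sum.cong refl) (simp add: power_add mult_ac)
  also have "\<dots> = (\<Sum>l<m. \<Sum>k<m. \<Sum>l'<m. weight m l * weight m l' * z ^ (l + l') * (\<zeta> ^ (k * (2 * l + 1)) * \<zeta> ^ (k * (2 * l' + 1))))"
    by (rule sum.swap)
  also have "\<dots> = (\<Sum>l<m. \<Sum>l'<m. \<Sum>k<m. weight m l * weight m l' * z ^ (l + l') * (\<zeta> ^ (k * (2 * l + 1)) * \<zeta> ^ (k * (2 * l' + 1))))"
    by (rule sum.cong[OF refl], rule sum.swap)
  also have "\<dots> = (\<Sum>l<m. \<Sum>l'<m. if l' = m - 1 - l then weight m l * weight m l' * z ^ (l + l') * of_nat m else 0)"
  proof (intro sum.cong refl)
    fix l l' assume l: "l \<in> {..<m}" "l' \<in> {..<m}"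
    show "(\<Sum>k<m. weight m l * weight m l' * z ^ (l + l') * (\<zeta> ^ (k * (2 * l + 1)) * \<zeta> ^ (k * (2 * l' + 1)))) =
        (if l' = m - 1 - l then weight m l * weight m l' * z ^ (l + l') * of_nat m else 0)"
      unfolding sum_distrib_left[symmetric] inner[OF l[unfolded lessThan_iff]] by simp
  qed
  also have "\<dots> = (\<Sum>l<m. (weight m l * weight m (m - 1 - l)) * (z ^ (m - 1) * of_nat m))"
    by (rule sum.cong[OF refl]) (auto simp: sum.delta mult_ac)
  also have "\<dots> = 0" unfolding sum_distrib_right[symmetric] using sum_weight_reversed m3 by (simp add: m_def)
  finally show ?thesis .
qed

text \<open>
  The coordinates of \<open>Q\<close> in the basis of the polynomials \<open>null_poly k\<close>, by discrete Fourier inversion. As a vector, it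
  is the hyperplane that the curve \<open>(null_poly k)\<^sub>k\<close> meets in the zeros of \<open>Q\<close>.
\<close>

definition dual_vec :: "complex poly \<Rightarrow> complex ^ 'm::finite" where
  "dual_vec Q = (\<chi> k. (\<Sum>l<CARD('m). coeff Q l / (weight CARD('m) l * half_root CARD('m) ^ (ix k * (2 * l + 1)))) / of_nat CARD('m))"

lemma dual_vec_add: "dual_vec (p + q) = dual_vec p + dual_vec q"
  by (simp add: dual_vec_def Finite_Cartesian_Product.vec_eq_iff add_divide_distrib sum.distrib)

lemma dual_vec_smult: "dual_vec (smult c p) = c *s dual_vec p"
  by (simp add: dual_vec_def Finite_Cartesian_Product.vec_eq_iff sum_distrib_left)

lemma half_root_orthogonality:
  assumes m: "m \<ge> 1" and l: "l < m" "l' < m"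
  shows "(\<Sum>k<m. half_root m ^ (k * (2 * l' + 1)) / half_root m ^ (k * (2 * l + 1))) = (if l' = l then of_nat m else 0)"
    and "(\<Sum>k<m. half_root m ^ (l' * (2 * k + 1)) / half_root m ^ (l * (2 * k + 1))) = (if l' = l then of_nat m else 0)"
proof -

  have ll: "l' mod m = l mod m \<longleftrightarrow> l' = l" using l by simp
  have "half_root m ^ (k * (2 * l' + 1)) / half_root m ^ (k * (2 * l + 1)) = (half_root m ^ (2 * l') / half_root m ^ (2 * l)) ^ k" for k
    using half_root_nonzero[of m] by (simp add: power_divide power_mult[symmetric] power_add distrib_left mult_ac)
  then show "(\<Sum>k<m. half_root m ^ (k * (2 * l' + 1)) / half_root m ^ (k * (2 * l + 1))) = (if l' = l then of_nat m else 0)"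
    using sum_half_root_powers[OF m, of l' l] ll by simp
  have e: "half_root m ^ (l' * (2 * k + 1)) / half_root m ^ (l * (2 * k + 1)) =
      half_root m ^ l' / half_root m ^ l * (half_root m ^ (2 * l') / half_root m ^ (2 * l)) ^ k" for k
    by (simp add: power_divide power_mult[symmetric] power_add distrib_left mult_ac)
  show "(\<Sum>k<m. half_root m ^ (l' * (2 * k + 1)) / half_root m ^ (l * (2 * k + 1))) = (if l' = l then of_nat m else 0)"
    unfolding e sum_distrib_left[symmetric] sum_half_root_powers[OF m] ll using half_root_nonzero[of m] by simp
qed

lemma dual_vec_null_poly:
  assumes m3: "CARD('m::finite) \<ge> 3" and Q: "degree Q < CARD('m)"
  shows "(\<Sum>k\<in>UNIV. dual_vec Q $ k * poly (null_poly (k::'m)) z) = poly Q z"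
proof -
  define m where "m = CARD('m)"
  have m: "m \<ge> 1" using m3 by (simp add: m_def)
  let ?\<zeta> = "half_root m"
  have "(\<Sum>k\<in>UNIV. dual_vec Q $ k * poly (null_poly (k::'m)) z) =
      (\<Sum>k<m. (\<Sum>l<m. coeff Q l / (weight m l * ?\<zeta> ^ (k * (2 * l + 1)))) / of_nat m *
        (\<Sum>l'<m. ?\<zeta> ^ (k * (2 * l' + 1)) * weight m l' * z ^ l'))"
    unfolding poly_null_poly m_def dual_vec_def vec_lambda_beta
    by (rule sum_ix[of "\<lambda>k. (\<Sum>l<CARD('m). coeff Q l / (weight CARD('m) l * half_root CARD('m) ^ (k * (2 * l + 1)))) / of_nat CARD('m) *
        (\<Sum>l'<CARD('m). half_root CARD('m) ^ (k * (2 * l' + 1)) * weight CARD('m) l' * z ^ l')"])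
  also have "\<dots> = (\<Sum>k<m. \<Sum>l<m. \<Sum>l'<m. coeff Q l / weight m l * weight m l' * z ^ l' / of_nat m *
        (?\<zeta> ^ (k * (2 * l' + 1)) / ?\<zeta> ^ (k * (2 * l + 1))))"
    unfolding sum_divide_distrib sum_product by (intro sum.cong refl) (simp add: field_simps)
  also have "\<dots> = (\<Sum>l<m. \<Sum>k<m. \<Sum>l'<m. coeff Q l / weight m l * weight m l' * z ^ l' / of_nat m *
        (?\<zeta> ^ (k * (2 * l' + 1)) / ?\<zeta> ^ (k * (2 * l + 1))))" by (rule sum.swap)
  also have "\<dots> = (\<Sum>l<m. \<Sum>l'<m. \<Sum>k<m. coeff Q l / weight m l * weight m l' * z ^ l' / of_nat m *
        (?\<zeta> ^ (k * (2 * l' + 1)) / ?\<zeta> ^ (k * (2 * l + 1))))" by (rule sum.cong[OF refl], rule sum.swap)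
  also have "\<dots> = (\<Sum>l<m. \<Sum>l'<m. if l' = l then coeff Q l / weight m l * weight m l' * z ^ l' else 0)"
  proof (intro sum.cong refl)
    fix l l' assume l: "l \<in> {..<m}" "l' \<in> {..<m}"
    show "(\<Sum>k<m. coeff Q l / weight m l * weight m l' * z ^ l' / of_nat m *
        (?\<zeta> ^ (k * (2 * l' + 1)) / ?\<zeta> ^ (k * (2 * l + 1)))) =
        (if l' = l then coeff Q l / weight m l * weight m l' * z ^ l' else 0)"
      unfolding sum_distrib_left[symmetric] half_root_orthogonality(1)[OF m l[unfolded lessThan_iff]] using m by simp
  qed
  also have "\<dots> = (\<Sum>l<m. coeff Q l * z ^ l)"
    using m3 by (intro sum.cong refl) (simp add: sum.delta weight_nonzero m_def)
  also have "\<dots> = poly Q z"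
    unfolding poly_altdef by (rule sum.mono_neutral_right) (use Q in \<open>auto simp: m_def coeff_eq_0\<close>)
  finally show ?thesis .
qed

lemma null_polys_independent:
  fixes a :: "complex ^ 'm::finite"
  assumes m3: "CARD('m) \<ge> 3" and z: "(\<Sum>k\<in>UNIV. smult (a $ k) (null_poly k)) = 0"
  shows "a = 0"
proof -
  define m where "m = CARD('m)"
  have m: "m \<ge> 1" using m3 by (simp add: m_def)
  have 0: "(\<Sum>k\<in>UNIV. a $ k * half_root m ^ (ix k * (2 * l + 1))) = 0" if l: "l < m" for l
  proof -
    have "0 = coeff (\<Sum>k\<in>UNIV. smult (a $ k) (null_poly k)) l" unfolding z by simp
    also have "\<dots> = (\<Sum>k\<in>UNIV. a $ k * half_root m ^ (ix k * (2 * l + 1)) * weight m l)"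
      using l by (simp add: coeff_sum coeff_null_poly m_def mult.assoc)
    also have "\<dots> = (\<Sum>k\<in>UNIV. a $ k * half_root m ^ (ix k * (2 * l + 1))) * weight m l"
      by (rule sum_distrib_right[symmetric])
    finally show ?thesis using weight_nonzero[OF m3, of l] by (simp add: m_def)
  qed
  have "a $ i = 0" for i
  proof -
    have "0 = (\<Sum>l<m. (\<Sum>k\<in>UNIV. a $ k * half_root m ^ (ix k * (2 * l + 1))) / half_root m ^ (ix i * (2 * l + 1)))"
      using 0 by simp
    also have "\<dots> = (\<Sum>l<m. \<Sum>k\<in>UNIV. a $ k * (half_root m ^ (ix k * (2 * l + 1)) / half_root m ^ (ix i * (2 * l + 1))))"
      by (simp add: sum_divide_distrib)
    also have "\<dots> = (\<Sum>k\<in>UNIV. \<Sum>l<m. a $ k * (half_root m ^ (ix k * (2 * l + 1)) / half_root m ^ (ix i * (2 * l + 1))))"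
      by (rule sum.swap)
    also have "\<dots> = (\<Sum>k\<in>UNIV. if k = i then a $ k * of_nat m else 0)"
    proof (rule sum.cong[OF refl])
      fix k :: 'm
      have "ix k = ix i \<longleftrightarrow> k = i" using bij_ix[where 'm='m] by (auto simp: bij_betw_def inj_on_def)
      then show "(\<Sum>l<m. a $ k * (half_root m ^ (ix k * (2 * l + 1)) / half_root m ^ (ix i * (2 * l + 1)))) = (if k = i then a $ k * of_nat m else 0)"
        unfolding sum_distrib_left[symmetric]
          half_root_orthogonality(2)[OF m ix_less[of i, folded m_def] ix_less[of k, folded m_def]] by simp
    qed
    also have "\<dots> = a $ i * of_nat m" by simp
    finally show ?thesis using m by simp
  qed
  then show ?thesis by (simp add: Finite_Cartesian_Product.vec_eq_iff)
qed

lemma general_position_dual_vec: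
  assumes m3: "CARD('m::finite) \<ge> 3" and gp: "poly_general_position CARD('m) N P"
    and deg: "\<And>j. j < N \<Longrightarrow> degree (P j) < CARD('m)"
  shows "in_general_position N (\<lambda>j. dual_vec (P j) :: complex ^ 'm)"
  unfolding in_general_position_def
proof (intro allI impI)
  fix I assume I: "I \<subseteq> {..<N}" "card I = CARD('m)"
  have "Q = 0" if "degree Q < CARD('m)" "(dual_vec Q :: complex ^ 'm) = 0" for Q
  proof -
    have "poly Q z = 0" for z using dual_vec_null_poly[OF m3 that(1), of z] that(2) by simp
    then show ?thesis using poly_all_0_iff_0 by blast
  qed
  moreover have "finite I" using finite_subset[OF I(1)] by simp
  moreover have "poly_indep I P" using gp I by (simp add: poly_general_position_def)
  moreover have "degree (P i) < CARD('m)" if "i \<in> I" for i using deg I(1) that by auto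
  ultimately show "inj_on (\<lambda>j. dual_vec (P j) :: complex ^ 'm) I \<and> vec.independent ((\<lambda>j. dual_vec (P j) :: complex ^ 'm) ` I)"
    using independent_image_of_poly_indep[of "dual_vec :: complex poly \<Rightarrow> complex ^ 'm" I P] dual_vec_add dual_vec_smult by blast
qed

section \<open>Piecewise smooth curves in the plane\<close>

definition C1_on :: "real \<Rightarrow> real \<Rightarrow> (real \<Rightarrow> complex) \<Rightarrow> bool" where
  "C1_on a b g \<longleftrightarrow> (\<exists>D. continuous_on {a..b} D \<and>
     (\<forall>t\<in>{a..b}. (g has_vector_derivative D t) (at t within {a..b})))"

text \<open>
  The condition on piecewise smooth curves of a surface, for their expression in one global coordinate.
\<close>

definition C1_off :: "real set \<Rightarrow> (real \<Rightarrow> complex) \<Rightarrow> bool" where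
  "C1_off F g \<longleftrightarrow> finite F \<and> (\<forall>a b. 0 \<le> a \<and> a < b \<and> b \<le> 1 \<and> {a<..<b} \<inter> F = {} \<longrightarrow> C1_on a b g)"

definition speed :: "(complex \<Rightarrow> real) \<Rightarrow> (real \<Rightarrow> complex) \<Rightarrow> real \<Rightarrow> real" where
  "speed \<rho> g t = \<rho> (g t) * cmod (vector_derivative g (at t))"

lemma at_within_Icc_interior: "a < t \<Longrightarrow> t < b \<Longrightarrow> at t within {a..b} = at (t::real)"
  by (rule at_within_interior) auto

lemma C1_on_cong:
  assumes "C1_on a b g" "\<And>t. t \<in> {a..b} \<Longrightarrow> h t = g t"
  shows "C1_on a b h"
proof -
  from assms(1) obtain D where D: "continuous_on {a..b} D" "\<And>t. t \<in> {a..b} \<Longrightarrow> (g has_vector_derivative D t) (at t within {a..b})"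
    by (auto simp: C1_on_def)
  have "(h has_vector_derivative D t) (at t within {a..b})" if "t \<in> {a..b}" for t
    by (rule has_vector_derivative_transform[OF that _ D(2)[OF that]]) (rule assms(2))
  then show ?thesis using D(1) by (auto simp: C1_on_def)
qed

lemma C1_on_affine:
  assumes "C1_on a' b' g" "(\<lambda>t. c * t + e) ` {a..b} \<subseteq> {a'..b'}"
  shows "C1_on a b (\<lambda>t. g (c * t + e))"
proof -
  from assms(1) obtain D where D: "continuous_on {a'..b'} D" "\<And>t. t \<in> {a'..b'} \<Longrightarrow> (g has_vector_derivative D t) (at t within {a'..b'})"
    by (auto simp: C1_on_def)
  have "((\<lambda>t. g (c * t + e)) has_vector_derivative c *\<^sub>R D (c * t + e)) (at t within {a..b})" if t: "t \<in> {a..b}" for t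
  proof -
    have "((\<lambda>t. c * t + e) has_vector_derivative c) (at t within {a..b})"
      by (auto intro!: derivative_eq_intros simp flip: has_real_derivative_iff_has_vector_derivative)
    moreover have "(g has_vector_derivative D (c * t + e)) (at (c * t + e) within (\<lambda>t. c * t + e) ` {a..b})"
    proof -
      have "c * t + e \<in> {a'..b'}" using t assms(2) by (simp only: image_subset_iff)
      then show ?thesis by (intro has_vector_derivative_within_subset[OF D(2) assms(2)])
    qed
    ultimately show ?thesis using vector_diff_chain_within[of "\<lambda>t. c * t + e" c t "{a..b}" g "D (c * t + e)"] by (simp add: o_def)
  qed
  moreover have "continuous_on {a..b} (\<lambda>t. c *\<^sub>R D (c * t + e))"
    by (intro continuous_intros continuous_on_compose2[OF D(1)]) (use assms(2) in auto)
  ultimately show ?thesis unfolding C1_on_def by (intro exI[of _ "\<lambda>t. c *\<^sub>R D (c * t + e)"]) auto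
qed

lemma C1_off_derivative:
  assumes g: "C1_off F g" and t: "0 < t" "t < 1" "t \<notin> F"
  shows "(g has_vector_derivative vector_derivative g (at t)) (at t)"
proof -
  have "finite F" using g by (simp add: C1_off_def)
  then obtain d where d: "d > 0" "\<And>x. x \<in> F \<Longrightarrow> x \<noteq> t \<Longrightarrow> d \<le> dist t x" using finite_set_avoid by metis
  define a b where "a = max 0 (t - d)" and "b = min 1 (t + d)"
  have ab: "0 \<le> a" "a < t" "t < b" "b \<le> 1" using t d by (auto simp: a_def b_def)
  have "{a<..<b} \<inter> F = {}" using d(2) t(3) by (fastforce simp: a_def b_def dist_real_def)
  then have "C1_on a b g" using g ab by (auto simp: C1_off_def)
  then obtain D where "(g has_vector_derivative D t) (at t within {a..b})" using ab by (fastforce simp: C1_on_def)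
  then have "(g has_vector_derivative D t) (at t)" using ab by (simp add: at_within_Icc_interior)
  then show ?thesis by (metis vector_derivative_at)
qed

text \<open>
  The value of \<open>speed\<close> at break points is arbitrary, so the speed is integrable piece by piece only after a change at
  finitely many points.
\<close>

lemma C1_off_speed_integrable:
  assumes g: "C1_off F g" and h: "continuous_on {0..1} (\<lambda>t. \<rho> (g t))"
  shows "speed \<rho> g integrable_on {0..1}"
proof -
  have piece: "speed \<rho> g integrable_on {a..b}" if ab: "0 \<le> a" "a \<le> b" "b \<le> 1" "{a<..<b} \<inter> F = {}" for a b
  proof (cases "a = b")
    case False
    then have "C1_on a b g" using g ab by (auto simp: C1_off_def)
    then obtain D where D: "continuous_on {a..b} D" "\<And>t. t \<in> {a..b} \<Longrightarrow> (g has_vector_derivative D t) (at t within {a..b})"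
      by (auto simp: C1_on_def)
    have "(\<lambda>t. \<rho> (g t) * cmod (D t)) integrable_on {a..b}"
      using ab by (intro integrable_continuous_real continuous_intros D continuous_on_subset[OF h]) auto
    moreover have "speed \<rho> g t = \<rho> (g t) * cmod (D t)" if "t \<in> {a..b} - {a,b}" for t
    proof -
      have "(g has_vector_derivative D t) (at t)" using D(2)[of t] that by (auto simp: at_within_Icc_interior)
      then have "vector_derivative g (at t) = D t" by (rule vector_derivative_at)
      then show ?thesis by (simp add: speed_def)
    qed
    ultimately show ?thesis by (intro integrable_spike_finite[of "{a,b}" "{a..b}" "speed \<rho> g"]) auto
  qed (use integrable_on_refl[of "speed \<rho> g" a] in simp)
  have finF: "finite F" using g by (simp add: C1_off_def)
  have "\<forall>x\<in>cbox 0 (1::real). \<exists>d>0. \<forall>u v. x \<in> cbox u v \<and> cbox u v \<subseteq> ball x d \<and> cbox u v \<subseteq> cbox 0 1 \<longrightarrow> speed \<rho> g integrable_on cbox u v"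
  proof
    fix t :: real assume "t \<in> cbox 0 1"
    obtain d where d: "d > 0" "\<And>x. x \<in> F \<Longrightarrow> x \<noteq> t \<Longrightarrow> d \<le> dist t x" using finite_set_avoid[OF finF] by metis
    show "\<exists>d>0. \<forall>u v. t \<in> cbox u v \<and> cbox u v \<subseteq> ball t d \<and> cbox u v \<subseteq> cbox 0 1 \<longrightarrow> speed \<rho> g integrable_on cbox u v"
    proof (intro exI conjI allI impI)
      fix u v assume "t \<in> cbox u v \<and> cbox u v \<subseteq> ball t d \<and> cbox u v \<subseteq> cbox 0 1"
      then have uv': "t \<in> {u..v}" "{u..v} \<subseteq> ball t d" "{u..v} \<subseteq> {0..1}" by simp_all
      then have "u \<in> {u..v}" "v \<in> {u..v}" by auto
      then have b: "u \<le> t" "t \<le> v" "0 \<le> u" "v \<le> 1" "u \<in> ball t d" "v \<in> ball t d"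
        using uv' by (auto simp only: subset_iff atLeastAtMost_iff)
      have "x \<notin> F" if "x \<in> {u<..<t}" for x using d(2)[of x] that b by (auto simp: dist_real_def)
      then have "speed \<rho> g integrable_on {u..t}" using b by (intro piece) auto
      moreover have "x \<notin> F" if "x \<in> {t<..<v}" for x using d(2)[of x] that b by (auto simp: dist_real_def)
      then have "speed \<rho> g integrable_on {t..v}" using b by (intro piece) auto
      ultimately show "speed \<rho> g integrable_on cbox u v" using Henstock_Kurzweil_Integration.integrable_combine[OF b(1,2)] by simp
    qed (use d in auto)
  qed
  then have "speed \<rho> g integrable_on cbox 0 1" by (rule integrable_on_little_subintervals)
  then show ?thesis by simp
qed

text \<open>
  The estimate behind all completeness proofs below: a function whose derivative is bounded by a multiple of the speed
  varies at most by that multiple of the length.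
\<close>

lemma Lipschitz_along_curve:
  fixes \<psi> :: "real \<Rightarrow> 'e::banach"
  assumes "finite S" and \<psi>: "continuous_on {0..1} \<psi>"
    and d: "\<And>t. t \<in> {0<..<1} - S \<Longrightarrow> (\<psi> has_vector_derivative \<psi>' t) (at t) \<and> norm (\<psi>' t) \<le> K * k t"
    and k: "k integrable_on {0..1}" "\<And>t. 0 \<le> k t" and K: "0 \<le> K"
  shows "norm (\<psi> 1 - \<psi> 0) \<le> K * integral {0..1} k"
proof -
  define \<phi> where "\<phi> t = (if t \<in> S \<union> {0,1} then 0 else \<psi>' t)" for t
  have i: "(\<psi>' has_integral (\<psi> 1 - \<psi> 0)) {0..1}"
    by (rule fundamental_theorem_of_calculus_interior_strong[OF assms(1)]) (use \<psi> d in auto)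
  have i': "(\<phi> has_integral (\<psi> 1 - \<psi> 0)) {0..1}"
    by (rule has_integral_spike_finite[OF _ _ i, of "S \<union> {0,1}"]) (use assms(1) in \<open>auto simp: \<phi>_def\<close>)
  have "norm (integral {0..1} \<phi>) \<le> integral {0..1} (\<lambda>t. K * k t)"
  proof (rule integral_norm_bound_integral)
    show "norm (\<phi> t) \<le> K * k t" if "t \<in> {0..1}" for t
      using d[of t] that k(2)[of t] K by (auto simp: \<phi>_def)
    show "(\<lambda>t. K * k t) integrable_on {0..1}" using integrable_cmul[OF k(1), of K] by simp
  qed (use i' in auto)
  then show ?thesis using i' k(1) by (simp add: integral_unique)
qed

lemma speed_affine_has_integral:
  assumes I: "(speed \<rho> g has_integral I) {0..1}" and g: "C1_off F g" and c: "c \<noteq> 0"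
    and ab: "{a..b} = (\<lambda>x. (x - e) / c) ` {0..1}"
    and h: "\<And>t. a < t \<Longrightarrow> t < b \<Longrightarrow> h t = g (c * t + e)"
  shows "(speed \<rho> h has_integral I) {a..b}"
proof -
  have "((\<lambda>x. speed \<rho> g (c *\<^sub>R x + e)) has_integral (1 / (\<bar>c\<bar> ^ DIM(real))) *\<^sub>R I) ((\<lambda>x. (1 / c) *\<^sub>R x + -((1 / c) *\<^sub>R e)) ` cbox 0 1)"
    using I c by (intro has_integral_affinity) auto
  also have "(\<lambda>x. (1 / c) *\<^sub>R x + -((1 / c) *\<^sub>R e)) ` cbox 0 1 = {a..b}"
    unfolding ab by (simp add: diff_divide_distrib)
  finally have "((\<lambda>x. \<bar>c\<bar> * speed \<rho> g (c * x + e)) has_integral (\<bar>c\<bar> * (1 / \<bar>c\<bar> * I))) {a..b}"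
    by (intro has_integral_mult_right) simp
  then have i: "((\<lambda>x. \<bar>c\<bar> * speed \<rho> g (c * x + e)) has_integral I) {a..b}" using c by simp
  have finF: "finite F" using g by (simp add: C1_off_def)
  show ?thesis
  proof (rule has_integral_spike_finite[OF _ _ i])
    show "finite ((\<lambda>x. (x - e) / c) ` (F \<union> {0,1}) \<union> {a,b})" using finF by auto
    fix t assume t: "t \<in> {a..b} - ((\<lambda>x. (x - e) / c) ` (F \<union> {0,1}) \<union> {a,b})"
    obtain x where x: "x \<in> {0..1}" "t = (x - e) / c" using t ab by auto
    then have ct: "c * t + e = x" using c by simp
    have "x \<notin> F \<union> {0,1}" using t x by auto
    then have "(g has_vector_derivative vector_derivative g (at x)) (at x)"
      using x by (intro C1_off_derivative[OF g]) auto
    then have "(g has_vector_derivative vector_derivative g (at x)) (at (c * t + e))" using ct by simp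
    moreover have "((\<lambda>t. c * t + e) has_vector_derivative c) (at t)"
      by (auto intro!: derivative_eq_intros simp flip: has_real_derivative_iff_has_vector_derivative)
    ultimately have "((\<lambda>t. g (c * t + e)) has_vector_derivative c *\<^sub>R vector_derivative g (at x)) (at t)"
      using vector_diff_chain_at[of "\<lambda>t. c * t + e" c t g] by (simp add: o_def)
    then have "(h has_vector_derivative c *\<^sub>R vector_derivative g (at x)) (at t)"
      by (rule has_vector_derivative_transform_within_open[of _ _ _ "{a<..<b}"]) (use t h in auto)
    then have "vector_derivative h (at t) = c *\<^sub>R vector_derivative g (at x)" by (rule vector_derivative_at)
    then show "speed \<rho> h t = \<bar>c\<bar> * speed \<rho> g (c * t + e)" using t h[of t] ct by (simp add: speed_def)
  qed
qed

lemma C1_off_reversepath: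
  assumes "C1_off F g" shows "C1_off ((\<lambda>t. 1 - t) ` F) (reversepath g)"
  unfolding C1_off_def
proof (intro conjI allI impI)
  show "finite ((\<lambda>t. 1 - t) ` F)" using assms by (simp add: C1_off_def)
  fix a b :: real assume ab: "0 \<le> a \<and> a < b \<and> b \<le> 1 \<and> {a<..<b} \<inter> (\<lambda>t. 1 - t) ` F = {}"
  have "{1 - b<..<1 - a} \<inter> F = {}"
  proof (rule equals0I)
    fix x assume x: "x \<in> {1 - b<..<1 - a} \<inter> F"
    then have "1 - x \<in> {a<..<b} \<inter> (\<lambda>t. 1 - t) ` F" by auto
    then show False using ab by blast
  qed
  then have "C1_on (1 - b) (1 - a) g" using assms ab by (auto simp: C1_off_def)
  then have "C1_on a b (\<lambda>t. g (-1 * t + 1))" by (rule C1_on_affine) auto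
  then show "C1_on a b (reversepath g)" by (rule C1_on_cong) (simp add: reversepath_def)
qed

lemma C1_off_joinpaths:
  assumes g1: "C1_off F1 g1" and g2: "C1_off F2 g2" and e: "g1 1 = g2 0"
  shows "C1_off ({1/2} \<union> (\<lambda>t. t / 2) ` F1 \<union> (\<lambda>t. (t + 1) / 2) ` F2) (g1 +++ g2)"
  unfolding C1_off_def
proof (intro conjI allI impI)
  let ?F = "{1/2} \<union> (\<lambda>t. t / 2) ` F1 \<union> (\<lambda>t. (t + 1) / 2) ` F2"
  show "finite ?F" using assms by (simp add: C1_off_def)
  fix a b :: real assume ab: "0 \<le> a \<and> a < b \<and> b \<le> 1 \<and> {a<..<b} \<inter> ?F = {}"
  then have "1/2 \<notin> {a<..<b}" by blast
  then consider "b \<le> 1/2" | "1/2 \<le> a" by fastforce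
  then show "C1_on a b (g1 +++ g2)"
  proof cases
    case 1
    have "{2 * a<..<2 * b} \<inter> F1 = {}"
    proof (rule equals0I)
      fix x assume "x \<in> {2 * a<..<2 * b} \<inter> F1"
      then have "x / 2 \<in> {a<..<b} \<inter> ?F" by auto
      then show False using ab by blast
    qed
    then have "C1_on (2 * a) (2 * b) g1" using g1 ab 1 by (auto simp: C1_off_def)
    then have "C1_on a b (\<lambda>t. g1 (2 * t + 0))" by (rule C1_on_affine) auto
    then show ?thesis by (rule C1_on_cong) (use 1 in \<open>auto simp: joinpaths_def\<close>)
  next
    case 2
    have "{2 * a - 1<..<2 * b - 1} \<inter> F2 = {}"
    proof (rule equals0I)
      fix x assume "x \<in> {2 * a - 1<..<2 * b - 1} \<inter> F2"
      then have "(x + 1) / 2 \<in> {a<..<b} \<inter> ?F" by auto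
      then show False using ab by blast
    qed
    then have "C1_on (2 * a - 1) (2 * b - 1) g2" using g2 ab 2 by (auto simp: C1_off_def)
    then have "C1_on a b (\<lambda>t. g2 (2 * t + -1))" by (rule C1_on_affine) auto
    then show ?thesis
    proof (rule C1_on_cong)
      fix t assume "t \<in> {a..b}"
      then have "t = 1/2 \<or> t > 1/2" using 2 by auto
      then show "(g1 +++ g2) t = g2 (2 * t + -1)"
      proof
        assume t: "t = 1/2"
        show ?thesis unfolding t using e by (simp add: joinpaths_def)
      qed (simp add: joinpaths_def)
    qed
  qed
qed

lemma speed_reversepath:
  assumes I: "(speed \<rho> g has_integral I) {0..1}" and g: "C1_off F g"
  shows "(speed \<rho> (reversepath g) has_integral I) {0..1}"
proof (rule speed_affine_has_integral[OF I g, of "-1" 0 1 1])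
  show "{0..1} = (\<lambda>x. (x - 1) / - 1) ` {0..1::real}"
    using image_affinity_atLeastAtMost[of "-1" 1 0 "1::real"] by (simp add: minus_divide_left[symmetric])
qed (auto simp: reversepath_def)

lemma speed_joinpaths:
  assumes I1: "(speed \<rho> g1 has_integral I1) {0..1}" and g1: "C1_off F1 g1"
    and I2: "(speed \<rho> g2 has_integral I2) {0..1}" and g2: "C1_off F2 g2"
  shows "(speed \<rho> (g1 +++ g2) has_integral (I1 + I2)) {0..1}"
proof (rule has_integral_combine[of 0 "1/2" 1])
  show "(speed \<rho> (g1 +++ g2) has_integral I1) {0..1/2}"
  proof (rule speed_affine_has_integral[OF I1 g1, of 2 0 "1/2" 0])
    show "{0..1/2} = (\<lambda>x. (x - 0) / 2) ` {0..1::real}"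
      using image_affinity_atLeastAtMost_div[of 2 0 0 "1::real"] by simp
  qed (auto simp: joinpaths_def)
  show "(speed \<rho> (g1 +++ g2) has_integral I2) {1/2..1}"
  proof (rule speed_affine_has_integral[OF I2 g2, of 2 "1/2" 1 "-1"])
    show "{1/2..1} = (\<lambda>x. (x - - 1) / 2) ` {0..1::real}"
      using image_affinity_atLeastAtMost_div[of 2 "1/2" 0 "1::real"] by (simp add: add_divide_distrib)
  qed (auto simp: joinpaths_def)
qed auto

section \<open>Completeness of conformal metrics\<close>

text \<open>
  Times at which a curve is in a chart are relatively open in the parameter interval, so derivatives within the
  interval can be computed inside the chart.
\<close>

lemma at_within_openin:
  assumes "openin (top_of_set I) J" "t \<in> J"
  shows "at t within J = at t within I"
proof -
  obtain U where U: "open U" "J = I \<inter> U" using assms(1) by (auto simp: openin_open)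
  show ?thesis by (rule at_within_nhd[of t U]) (use U assms in auto)
qed

text \<open>
  A surface \<open>S\<close> with a conformal metric that is given by a density \<open>\<rho>\<close> in one globally defined, locally injective
  coordinate \<open>\<zeta>\<close>. Every chart \<open>C\<close> is related to \<open>\<zeta>\<close> by a holomorphic map \<open>T C\<close> that is its own inverse, and \<open>T' C\<close> is its derivative:
  the identity or \<open>z \<mapsto> 1/z\<close> in the two applications. Lengths and distances then depend on \<open>\<zeta>\<close> alone, and the choice
  of charts disappears from the definitions of curves, length and distance.
\<close>

locale conformal_coordinate =
  fixes S :: "'a::metric_space set" and \<zeta> :: "'a \<Rightarrow> complex" and A :: "'a chart set"
    and ds :: "'a line_element" and \<rho> :: "complex \<Rightarrow> real"
    and T T' :: "'a chart \<Rightarrow> complex \<Rightarrow> complex"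
  assumes coord_cont: "continuous_on S \<zeta>"
    and cover: "(\<Union>C\<in>A. fst C) = S"
    and chart_open: "C \<in> A \<Longrightarrow> openin (top_of_set S) (fst C)"
    and trans: "C \<in> A \<Longrightarrow> q \<in> fst C \<Longrightarrow> snd C q = T C (\<zeta> q) \<and> \<zeta> q = T C (snd C q)"
    and trans_deriv: "C \<in> A \<Longrightarrow> q \<in> fst C \<Longrightarrow> (T C has_field_derivative T' C (\<zeta> q)) (at (\<zeta> q)) \<and>
        (T C has_field_derivative T' C (snd C q)) (at (snd C q))"
    and trans_cont: "C \<in> A \<Longrightarrow> continuous_on (\<zeta> ` fst C) (T' C) \<and> continuous_on (snd C ` fst C) (T' C)"
    and ds: "C \<in> A \<Longrightarrow> q \<in> fst C \<Longrightarrow> ds C (snd C q) v = \<rho> (\<zeta> q) * cmod (v * T' C (snd C q))"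
    and density_cont: "continuous_on (\<zeta> ` S) \<rho>" and density_pos: "q \<in> S \<Longrightarrow> 0 < \<rho> (\<zeta> q)"
    and local_section: "q \<in> S \<Longrightarrow> \<exists>r>0. \<exists>s. continuous_on (ball (\<zeta> q) r) s \<and> s (\<zeta> q) = q \<and>
        (\<forall>z\<in>ball (\<zeta> q) r. s z \<in> S \<and> \<zeta> (s z) = z) \<and> openin (top_of_set S) (s ` ball (\<zeta> q) r)"
    and joined: "p \<in> S \<Longrightarrow> q \<in> S \<Longrightarrow> \<exists>\<gamma> F. path \<gamma> \<and> path_image \<gamma> \<subseteq> S \<and> C1_off F (\<zeta> \<circ> \<gamma>) \<and> \<gamma> 0 = p \<and> \<gamma> 1 = q"
begin

definition curves :: "'a \<Rightarrow> 'a \<Rightarrow> (real \<Rightarrow> 'a) set" where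
  "curves p q = {\<gamma>. path \<gamma> \<and> path_image \<gamma> \<subseteq> S \<and> (\<exists>F. C1_off F (\<zeta> \<circ> \<gamma>)) \<and> \<gamma> 0 = p \<and> \<gamma> 1 = q}"

definition len :: "(real \<Rightarrow> 'a) \<Rightarrow> real" where
  "len \<gamma> = integral {0..1} (speed \<rho> (\<zeta> \<circ> \<gamma>))"

definition chart_times :: "real \<Rightarrow> real \<Rightarrow> (real \<Rightarrow> 'a) \<Rightarrow> 'a chart \<Rightarrow> real set" where
  "chart_times a b \<gamma> C = {t\<in>{a..b}. \<gamma> t \<in> fst C}"

lemma chart_times_openin:
  assumes "continuous_on {a..b} \<gamma>" "\<gamma> ` {a..b} \<subseteq> S" "C \<in> A"
  shows "openin (top_of_set {a..b}) (chart_times a b \<gamma> C)"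
proof -
  have "openin (top_of_set {a..b}) ({a..b} \<inter> \<gamma> -` fst C)"
    by (rule continuous_openin_preimage[OF assms(1) _ chart_open[OF assms(3)]]) (use assms(2) in auto)
  also have "{a..b} \<inter> \<gamma> -` fst C = chart_times a b \<gamma> C" by (auto simp: chart_times_def)
  finally show ?thesis .
qed

lemma deriv_chart_of_coord:
  assumes c: "continuous_on {a..b} \<gamma>" "\<gamma> ` {a..b} \<subseteq> S" "C \<in> A" and t: "t \<in> {a..b}" "\<gamma> t \<in> fst C"
    and d: "((\<zeta> \<circ> \<gamma>) has_vector_derivative D) (at t within {a..b})"
  shows "((snd C \<circ> \<gamma>) has_vector_derivative D * T' C (\<zeta> (\<gamma> t))) (at t within {a..b})"
proof -
  let ?J = "chart_times a b \<gamma> C"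
  have tJ: "t \<in> ?J" using t by (simp add: chart_times_def)
  have w: "at t within ?J = at t within {a..b}" by (rule at_within_openin[OF chart_times_openin[OF c] tJ])
  have "((T C \<circ> (\<zeta> \<circ> \<gamma>)) has_vector_derivative D * T' C ((\<zeta> \<circ> \<gamma>) t)) (at t within ?J)"
    by (rule field_vector_diff_chain_within[OF d[folded w]])
      (use trans_deriv[OF c(3) t(2)] in \<open>auto intro: has_field_derivative_at_within\<close>)
  then have "((snd C \<circ> \<gamma>) has_vector_derivative D * T' C ((\<zeta> \<circ> \<gamma>) t)) (at t within ?J)"
  proof (rule has_vector_derivative_transform[OF tJ, rotated])
    fix s assume "s \<in> ?J"
    then have "\<gamma> s \<in> fst C" by (simp add: chart_times_def)
    then show "(snd C \<circ> \<gamma>) s = (T C \<circ> (\<zeta> \<circ> \<gamma>)) s" using trans[OF c(3), THEN conjunct1] by simp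
  qed
  then show ?thesis by (simp add: w)
qed

lemma deriv_coord_of_chart:
  assumes c: "continuous_on {a..b} \<gamma>" "\<gamma> ` {a..b} \<subseteq> S" "C \<in> A" and t: "t \<in> {a..b}" "\<gamma> t \<in> fst C"
    and d: "((snd C \<circ> \<gamma>) has_vector_derivative D) (at t within {a..b})"
  shows "((\<zeta> \<circ> \<gamma>) has_vector_derivative D * T' C (snd C (\<gamma> t))) (at t within {a..b})"
proof -
  let ?J = "chart_times a b \<gamma> C"
  have tJ: "t \<in> ?J" using t by (simp add: chart_times_def)
  have w: "at t within ?J = at t within {a..b}" by (rule at_within_openin[OF chart_times_openin[OF c] tJ])
  have "((T C \<circ> (snd C \<circ> \<gamma>)) has_vector_derivative D * T' C ((snd C \<circ> \<gamma>) t)) (at t within ?J)"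
    by (rule field_vector_diff_chain_within[OF d[folded w]])
      (use trans_deriv[OF c(3) t(2)] in \<open>auto intro: has_field_derivative_at_within\<close>)
  then have "((\<zeta> \<circ> \<gamma>) has_vector_derivative D * T' C ((snd C \<circ> \<gamma>) t)) (at t within ?J)"
  proof (rule has_vector_derivative_transform[OF tJ, rotated])
    fix s assume "s \<in> ?J"
    then have "\<gamma> s \<in> fst C" by (simp add: chart_times_def)
    then have "\<zeta> (\<gamma> s) = T C (snd C (\<gamma> s))" by (rule trans[OF c(3), THEN conjunct2])
    then show "(\<zeta> \<circ> \<gamma>) s = (T C \<circ> (snd C \<circ> \<gamma>)) s" by simp
  qed
  then show ?thesis by (simp add: w)
qed

text \<open>
  If the curve is continuously differentiable in every chart, the derivatives of its coordinate are glued from those in the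
  charts; they agree because derivatives within a nondegenerate interval are unique.
\<close>

lemma C1_curve_on_iff:
  assumes ab: "a < b" and c: "continuous_on {a..b} \<gamma>" "\<gamma> ` {a..b} \<subseteq> S"
  shows "C1_curve_on A a b \<gamma> \<longleftrightarrow> C1_on a b (\<zeta> \<circ> \<gamma>)"
proof
  assume L: "C1_on a b (\<zeta> \<circ> \<gamma>)"
  then obtain D where D: "continuous_on {a..b} D" "\<And>t. t \<in> {a..b} \<Longrightarrow> ((\<zeta> \<circ> \<gamma>) has_vector_derivative D t) (at t within {a..b})"
    by (auto simp: C1_on_def)
  show "C1_curve_on A a b \<gamma>"
    unfolding C1_curve_on_def
  proof
    fix C assume C: "C \<in> A"
    define E where "E t = D t * T' C (\<zeta> (\<gamma> t))" for t
    have "continuous_on {t \<in> {a..b}. \<gamma> t \<in> fst C} (\<lambda>t. \<zeta> (\<gamma> t))"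
    proof (rule continuous_on_compose2[OF coord_cont])
      show "continuous_on {t \<in> {a..b}. \<gamma> t \<in> fst C} \<gamma>" by (rule continuous_on_subset[OF c(1)]) auto
    qed (use c(2) in auto)
    then have "continuous_on {t \<in> {a..b}. \<gamma> t \<in> fst C} (\<lambda>t. T' C (\<zeta> (\<gamma> t)))"
      by (rule continuous_on_compose2[OF trans_cont[OF C, THEN conjunct1]]) auto
    then have "continuous_on {t \<in> {a..b}. \<gamma> t \<in> fst C} E"
      unfolding E_def by (intro continuous_on_mult continuous_on_subset[OF D(1)]) auto
    moreover have "((snd C \<circ> \<gamma>) has_vector_derivative E t) (at t within {a..b})" if "t \<in> {a..b}" "\<gamma> t \<in> fst C" for t
      unfolding E_def by (rule deriv_chart_of_coord[OF c C that D(2)[OF that(1)]])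
    ultimately show "\<exists>D. continuous_on {t \<in> {a..b}. \<gamma> t \<in> fst C} D \<and>
       (\<forall>t\<in>{a..b}. \<gamma> t \<in> fst C \<longrightarrow> (snd C \<circ> \<gamma> has_vector_derivative D t) (at t within {a..b}))" by blast
  qed
next
  assume R: "C1_curve_on A a b \<gamma>"
  define D where "D t = vector_derivative (\<zeta> \<circ> \<gamma>) (at t within {a..b})" for t
  have *: "((\<zeta> \<circ> \<gamma>) has_vector_derivative D t) (at t within {a..b}) \<and> continuous (at t within {a..b}) D" if t: "t \<in> {a..b}" for t
  proof -
    have "\<gamma> t \<in> S" using t c(2) by auto
    then obtain C where C: "C \<in> A" "\<gamma> t \<in> fst C" using cover by blast
    obtain E where E: "continuous_on (chart_times a b \<gamma> C) E"
      "\<And>s. s \<in> chart_times a b \<gamma> C \<Longrightarrow> ((snd C \<circ> \<gamma>) has_vector_derivative E s) (at s within {a..b})"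
      using R C(1) unfolding C1_curve_on_def chart_times_def by auto
    let ?J = "chart_times a b \<gamma> C"
    have J: "openin (top_of_set {a..b}) ?J" by (rule chart_times_openin[OF c C(1)])
    have tJ: "t \<in> ?J" using t C by (simp add: chart_times_def)
    have d: "((\<zeta> \<circ> \<gamma>) has_vector_derivative E s * T' C (snd C (\<gamma> s))) (at s within {a..b})" if "s \<in> ?J" for s
      by (rule deriv_coord_of_chart[OF c C(1) _ _ E(2)[OF that]]) (use that in \<open>auto simp: chart_times_def\<close>)
    have Ds: "D s = E s * T' C (snd C (\<gamma> s))" if "s \<in> ?J" for s
      unfolding D_def
      by (rule vector_derivative_within_cbox[of a b s, unfolded cbox_interval])
        (use d[OF that] that ab in \<open>simp_all add: chart_times_def\<close>)
    have "continuous_on ?J (snd C \<circ> \<gamma>)"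
    proof (unfold continuous_on_eq_continuous_within, rule ballI)
      fix s assume "s \<in> ?J"
      then have "continuous (at s within {a..b}) (snd C \<circ> \<gamma>)" using E(2) has_vector_derivative_continuous by blast
      then show "continuous (at s within ?J) (snd C \<circ> \<gamma>)"
        by (rule continuous_within_subset) (auto simp: chart_times_def)
    qed
    then have "continuous_on ?J (\<lambda>s. T' C (snd C (\<gamma> s)))"
      by (intro continuous_on_compose2[OF trans_cont[OF C(1), THEN conjunct2]]) (auto simp: chart_times_def o_def)
    then have "continuous_on ?J (\<lambda>s. E s * T' C (snd C (\<gamma> s)))" by (intro continuous_on_mult E(1))
    then have "continuous_on ?J D" using Ds by (simp cong: continuous_on_cong)
    then have "continuous (at t within ?J) D" using tJ by (simp add: continuous_on_eq_continuous_within)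
    then show ?thesis using d[OF tJ] Ds[OF tJ] at_within_openin[OF J tJ] by simp
  qed
  then have "continuous_on {a..b} D" by (simp add: continuous_on_eq_continuous_within)
  then show "C1_on a b (\<zeta> \<circ> \<gamma>)" using * unfolding C1_on_def by blast
qed

lemma piecewise_C1_curve_iff:
  "piecewise_C1_curve (top_of_set S) A \<gamma> \<longleftrightarrow> path \<gamma> \<and> path_image \<gamma> \<subseteq> S \<and> (\<exists>F. C1_off F (\<zeta> \<circ> \<gamma>))"
proof -
  have "C1_curve_on A a b \<gamma> \<longleftrightarrow> C1_on a b (\<zeta> \<circ> \<gamma>)"
    if "path \<gamma>" "path_image \<gamma> \<subseteq> S" "0 \<le> a" "a < b" "b \<le> 1" for a b
    using that by (intro C1_curve_on_iff) (auto simp: path_def path_image_def intro: continuous_on_subset)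
  then have "(\<exists>F. finite F \<and> (\<forall>a b. 0 \<le> a \<and> a < b \<and> b \<le> 1 \<and> {a<..<b} \<inter> F = {} \<longrightarrow> C1_curve_on A a b \<gamma>)) \<longleftrightarrow>
     (\<exists>F. C1_off F (\<zeta> \<circ> \<gamma>))" if "path \<gamma>" "path_image \<gamma> \<subseteq> S"
    using that unfolding C1_off_def by metis
  moreover have "pathin (top_of_set S) \<gamma> \<longleftrightarrow> path \<gamma> \<and> path_image \<gamma> \<subseteq> S"
    by (auto simp: pathin_canon_iff path_image_def)
  ultimately show ?thesis unfolding piecewise_C1_curve_def by blast
qed

lemma coord_path_cont: "path \<gamma> \<Longrightarrow> path_image \<gamma> \<subseteq> S \<Longrightarrow> continuous_on {0..1} (\<zeta> \<circ> \<gamma>)"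
  by (intro continuous_on_compose continuous_on_subset[OF coord_cont]) (auto simp: path_def path_image_def)

lemma density_path_cont: "path \<gamma> \<Longrightarrow> path_image \<gamma> \<subseteq> S \<Longrightarrow> continuous_on {0..1} (\<lambda>t. \<rho> ((\<zeta> \<circ> \<gamma>) t))"
  by (rule continuous_on_compose2[OF density_cont coord_path_cont]) (auto simp: path_image_def)

lemma len_has_integral:
  assumes "\<gamma> \<in> curves p q"
  shows "(speed \<rho> (\<zeta> \<circ> \<gamma>) has_integral len \<gamma>) {0..1}"
proof -
  obtain F where "C1_off F (\<zeta> \<circ> \<gamma>)" using assms by (auto simp: curves_def)
  then have "speed \<rho> (\<zeta> \<circ> \<gamma>) integrable_on {0..1}"
    by (rule C1_off_speed_integrable) (use assms density_path_cont in \<open>auto simp: curves_def\<close>)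
  then show ?thesis unfolding len_def by (rule integrable_integral)
qed

lemma speed_nonneg: "\<gamma> \<in> curves p q \<Longrightarrow> t \<in> {0..1} \<Longrightarrow> 0 \<le> speed \<rho> (\<zeta> \<circ> \<gamma>) t"
proof -
  assume "\<gamma> \<in> curves p q" "t \<in> {0..1}"
  then have "\<gamma> t \<in> S" by (auto simp: curves_def path_image_def)
  then have "0 \<le> \<rho> (\<zeta> (\<gamma> t))" using density_pos less_imp_le by blast
  then show ?thesis by (simp add: speed_def)
qed

lemma len_nonneg: "\<gamma> \<in> curves p q \<Longrightarrow> 0 \<le> len \<gamma>"
  using has_integral_nonneg[OF len_has_integral] speed_nonneg by blast

text \<open>
  The integrands agree off the break points, whatever chart is selected at each time.
\<close>

lemma curve_length_eq:
  assumes \<gamma>: "\<gamma> \<in> curves p q"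
  shows "curve_length A ds \<gamma> = len \<gamma>"
proof -
  obtain F where F: "C1_off F (\<zeta> \<circ> \<gamma>)" using \<gamma> by (auto simp: curves_def)
  have c: "continuous_on {0..1} \<gamma>" "\<gamma> ` {0..1} \<subseteq> S" using \<gamma> by (auto simp: curves_def path_def path_image_def)
  show ?thesis
    unfolding curve_length_def len_def Let_def
  proof (rule integral_spike[of "F \<union> {0,1}"])
    show "negligible (F \<union> {0,1})" using F by (intro negligible_finite) (auto simp: C1_off_def)
    fix t assume t: "t \<in> {0..1} - (F \<union> {0,1})"
    define C where "C = chart_at A (\<gamma> t)"
    have "\<gamma> t \<in> S" using t c(2) by auto
    then have "\<exists>C. C \<in> A \<and> \<gamma> t \<in> fst C" using cover by blast
    then have C: "C \<in> A" "\<gamma> t \<in> fst C" unfolding C_def chart_at_def by (metis (mono_tags, lifting) someI_ex)+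
    have i: "at t within {0..1} = at t" using t by (intro at_within_Icc_interior) auto
    have t': "t \<in> {0..1}" using t by simp
    have "((\<zeta> \<circ> \<gamma>) has_vector_derivative vector_derivative (\<zeta> \<circ> \<gamma>) (at t)) (at t within {0..1})"
      unfolding i by (rule C1_off_derivative[OF F]) (use t in auto)
    note d = deriv_chart_of_coord[OF c C(1) t' C(2) this]
    then have v: "vector_derivative (snd C \<circ> \<gamma>) (at t) = vector_derivative (\<zeta> \<circ> \<gamma>) (at t) * T' C (\<zeta> (\<gamma> t))"
      unfolding i by (rule vector_derivative_at)
    have "((\<zeta> \<circ> \<gamma>) has_vector_derivative vector_derivative (snd C \<circ> \<gamma>) (at t) * T' C (snd C (\<gamma> t))) (at t)"
      using deriv_coord_of_chart[OF c C(1) t' C(2) d] unfolding i v .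
    then have "vector_derivative (\<zeta> \<circ> \<gamma>) (at t) = vector_derivative (snd C \<circ> \<gamma>) (at t) * T' C (snd C (\<gamma> t))"
      by (rule vector_derivative_at)
    then show "speed \<rho> (\<zeta> \<circ> \<gamma>) t = ds (chart_at A (\<gamma> t)) (snd (chart_at A (\<gamma> t)) (\<gamma> t)) (vector_derivative (snd (chart_at A (\<gamma> t)) \<circ> \<gamma>) (at t))"
      unfolding C_def[symmetric] ds[OF C] speed_def by simp
  qed
qed

definition dst :: "'a \<Rightarrow> 'a \<Rightarrow> real" where "dst p q = Inf (len ` curves p q)"

lemma surface_dist_eq: "p \<in> S \<Longrightarrow> q \<in> S \<Longrightarrow> surface_dist (top_of_set S) A ds p q = dst p q"
proof -
  assume pq: "p \<in> S" "q \<in> S"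
  have "{\<gamma>. piecewise_C1_curve (top_of_set S) A \<gamma> \<and> \<gamma> 0 = p \<and> \<gamma> 1 = q} = curves p q"
    by (auto simp: piecewise_C1_curve_iff curves_def)
  moreover have "curve_length A ds ` curves p q = len ` curves p q"
    using curve_length_eq by (intro image_cong) auto
  ultimately show ?thesis using pq by (simp add: surface_dist_def dst_def)
qed

lemma curves_nonempty: "p \<in> S \<Longrightarrow> q \<in> S \<Longrightarrow> curves p q \<noteq> {}"
  using joined[of p q] by (auto simp: curves_def)

lemma len_bdd_below: "bdd_below (len ` curves p q)"
  by (rule bdd_belowI[of _ 0]) (auto intro: len_nonneg)

lemma dst_le: "\<gamma> \<in> curves p q \<Longrightarrow> dst p q \<le> len \<gamma>"
  unfolding dst_def by (rule cInf_lower[OF _ len_bdd_below]) auto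

lemma dst_greatest: "p \<in> S \<Longrightarrow> q \<in> S \<Longrightarrow> (\<And>\<gamma>. \<gamma> \<in> curves p q \<Longrightarrow> b \<le> len \<gamma>) \<Longrightarrow> b \<le> dst p q"
  unfolding dst_def by (rule cInf_greatest) (use curves_nonempty in auto)

lemma dst_less: "p \<in> S \<Longrightarrow> q \<in> S \<Longrightarrow> dst p q < b \<Longrightarrow> \<exists>\<gamma>\<in>curves p q. len \<gamma> < b"
  unfolding dst_def using cInf_less_iff[OF _ len_bdd_below] curves_nonempty by fastforce

lemma curves_reverse: "\<gamma> \<in> curves p q \<Longrightarrow> reversepath \<gamma> \<in> curves q p \<and> len (reversepath \<gamma>) = len \<gamma>"
proof -
  assume \<gamma>: "\<gamma> \<in> curves p q"
  then obtain F where F: "C1_off F (\<zeta> \<circ> \<gamma>)" by (auto simp: curves_def)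
  have e: "\<zeta> \<circ> reversepath \<gamma> = reversepath (\<zeta> \<circ> \<gamma>)" by (auto simp: reversepath_def)
  have "reversepath \<gamma> \<in> curves q p"
  proof -
    have "path (reversepath \<gamma>)" "path_image (reversepath \<gamma>) \<subseteq> S" using \<gamma> by (auto simp: curves_def)
    moreover have "reversepath \<gamma> 0 = q" "reversepath \<gamma> 1 = p" using \<gamma> by (auto simp: curves_def reversepath_def)
    moreover have "C1_off ((\<lambda>t. 1 - t) ` F) (\<zeta> \<circ> reversepath \<gamma>)" unfolding e by (rule C1_off_reversepath[OF F])
    ultimately show ?thesis unfolding curves_def by blast
  qed
  moreover have "len (reversepath \<gamma>) = len \<gamma>"
    unfolding len_def[of "reversepath \<gamma>"] e
    by (rule integral_unique[OF speed_reversepath[OF len_has_integral[OF \<gamma>] F]])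
  ultimately show ?thesis by simp
qed

lemma curves_join: "\<gamma> \<in> curves p q \<Longrightarrow> \<gamma>' \<in> curves q r \<Longrightarrow> \<gamma> +++ \<gamma>' \<in> curves p r \<and> len (\<gamma> +++ \<gamma>') = len \<gamma> + len \<gamma>'"
proof -
  assume \<gamma>: "\<gamma> \<in> curves p q" and \<gamma>': "\<gamma>' \<in> curves q r"
  then obtain F F' where F: "C1_off F (\<zeta> \<circ> \<gamma>)" and F': "C1_off F' (\<zeta> \<circ> \<gamma>')" by (auto simp: curves_def)
  have e: "\<zeta> \<circ> (\<gamma> +++ \<gamma>') = (\<zeta> \<circ> \<gamma>) +++ (\<zeta> \<circ> \<gamma>')" by (auto simp: joinpaths_def)
  have m: "(\<zeta> \<circ> \<gamma>) 1 = (\<zeta> \<circ> \<gamma>') 0" using \<gamma> \<gamma>' by (auto simp: curves_def)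
  have pp: "path \<gamma>" "path_image \<gamma> \<subseteq> S" "\<gamma> 0 = p" "\<gamma> 1 = q" "path \<gamma>'" "path_image \<gamma>' \<subseteq> S" "\<gamma>' 0 = q" "\<gamma>' 1 = r"
    using \<gamma> \<gamma>' by (auto simp: curves_def)
  have "path (\<gamma> +++ \<gamma>')" using pp by (intro path_join_imp) (auto simp: pathstart_def pathfinish_def)
  moreover have "path_image (\<gamma> +++ \<gamma>') \<subseteq> S" using pp path_image_join_subset by blast
  moreover have "(\<gamma> +++ \<gamma>') 0 = p" "(\<gamma> +++ \<gamma>') 1 = r" using pp by (auto simp: joinpaths_def)
  moreover have "\<exists>G. C1_off G (\<zeta> \<circ> (\<gamma> +++ \<gamma>'))" unfolding e using C1_off_joinpaths[OF F F' m] by blast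
  ultimately have "\<gamma> +++ \<gamma>' \<in> curves p r" unfolding curves_def by blast
  moreover have "len (\<gamma> +++ \<gamma>') = len \<gamma> + len \<gamma>'"
    unfolding len_def[of "\<gamma> +++ \<gamma>'"] e
    by (rule integral_unique[OF speed_joinpaths[OF len_has_integral[OF \<gamma>] F len_has_integral[OF \<gamma>'] F']])
  ultimately show ?thesis by simp
qed

lemma dst_commute: "p \<in> S \<Longrightarrow> q \<in> S \<Longrightarrow> dst p q = dst q p"
proof -
  have "dst p q \<le> dst q p" if "p \<in> S" "q \<in> S" for p q
  proof (rule dst_greatest[OF that(2,1)])
    fix \<gamma> assume "\<gamma> \<in> curves q p"
    then show "dst p q \<le> len \<gamma>" using curves_reverse dst_le[of "reversepath \<gamma>" p q] by fastforce
  qed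
  then show "p \<in> S \<Longrightarrow> q \<in> S \<Longrightarrow> dst p q = dst q p" by (simp add: order_antisym)
qed

lemma dst_triangle:
  assumes "p \<in> S" "q \<in> S" "r \<in> S" shows "dst p r \<le> dst p q + dst q r"
proof -
  have "dst p r - len \<gamma> \<le> dst q r" if \<gamma>: "\<gamma> \<in> curves p q" for \<gamma>
  proof (rule dst_greatest)
    fix \<gamma>' assume "\<gamma>' \<in> curves q r"
    then show "dst p r - len \<gamma> \<le> len \<gamma>'" using curves_join[OF \<gamma>] dst_le by fastforce
  qed (use assms in auto)
  then have "dst p r - dst q r \<le> dst p q" using assms by (intro dst_greatest) (auto simp: algebra_simps)
  then show ?thesis by simp
qed

lemma dst_nonneg: "p \<in> S \<Longrightarrow> q \<in> S \<Longrightarrow> 0 \<le> dst p q"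
  by (rule dst_greatest) (auto intro: len_nonneg)

text \<open>
  The topology of \<open>S\<close> is at least as fine as the one of the distance: near \<open>q\<close> the segment in the coordinate lifts to a
  curve whose length is at most the maximum of the density times the length of the segment.
\<close>

lemma dst_tendsto_0:
  assumes \<sigma>: "\<And>n. \<sigma> n \<in> S" and q: "q \<in> S" and lim: "\<sigma> \<longlonglongrightarrow> q"
  shows "(\<lambda>n. dst (\<sigma> n) q) \<longlonglongrightarrow> 0"
proof -
  obtain r s where r: "r > 0" and s: "continuous_on (ball (\<zeta> q) r) s" "s (\<zeta> q) = q"
      "\<And>z. z \<in> ball (\<zeta> q) r \<Longrightarrow> s z \<in> S \<and> \<zeta> (s z) = z" "openin (top_of_set S) (s ` ball (\<zeta> q) r)"
    using local_section[OF q] by blast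
  have "s ` cball (\<zeta> q) (r/2) \<subseteq> S" using s(3) r by auto
  have "cball (\<zeta> q) (r/2) \<subseteq> \<zeta> ` S"
  proof
    fix z assume "z \<in> cball (\<zeta> q) (r/2)"
    then have "z \<in> ball (\<zeta> q) r" using r by auto
    then show "z \<in> \<zeta> ` S" using s(3) by (metis image_eqI)
  qed
  then have "compact (\<rho> ` cball (\<zeta> q) (r/2))"
    by (intro compact_continuous_image continuous_on_subset[OF density_cont] compact_cball)
  then obtain B where B: "\<And>z. z \<in> cball (\<zeta> q) (r/2) \<Longrightarrow> \<bar>\<rho> z\<bar> \<le> B"
    using compact_imp_bounded bounded_real by (metis imageI)
  have bound: "dst (s z) q \<le> B * cmod (\<zeta> q - z)" if z: "z \<in> ball (\<zeta> q) (r/2)" for z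
  proof -
    define \<gamma> where "\<gamma> = s \<circ> linepath z (\<zeta> q)"
    have seg: "linepath z (\<zeta> q) t \<in> ball (\<zeta> q) (r/2)" if "t \<in> {0..1}" for t
    proof -
      have "\<zeta> q \<in> ball (\<zeta> q) (r/2)" using r by simp
      then have "closed_segment z (\<zeta> q) \<subseteq> ball (\<zeta> q) (r/2)" using z by (intro closed_segment_subset) auto
      then show ?thesis using linepath_in_path[OF that, of z "\<zeta> q"] by blast
    qed
    then have seg': "linepath z (\<zeta> q) t \<in> ball (\<zeta> q) r" if "t \<in> {0..1}" for t using that r by fastforce
    have ez: "(\<zeta> \<circ> \<gamma>) t = linepath z (\<zeta> q) t" if "t \<in> {0..1}" for t
      using s(3)[OF seg'[OF that]] by (simp add: \<gamma>_def)
    have "C1_on a b (\<zeta> \<circ> \<gamma>)" if "0 \<le> a" "a < b" "b \<le> 1" for a b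
    proof (rule C1_on_cong)
      show "C1_on a b (linepath z (\<zeta> q))" unfolding C1_on_def
        by (intro exI[of _ "\<lambda>_. \<zeta> q - z"]) (auto intro: has_vector_derivative_linepath_within)
    qed (use ez that in auto)
    then have C1: "C1_off {} (\<zeta> \<circ> \<gamma>)" by (simp add: C1_off_def)
    have "path \<gamma>" unfolding \<gamma>_def path_def
    proof (rule continuous_on_compose)
      show "continuous_on (linepath z (\<zeta> q) ` {0..1}) s"
        by (rule continuous_on_subset[OF s(1)]) (use seg' in blast)
    qed (rule continuous_on_linepath)
    moreover have "path_image \<gamma> \<subseteq> S" using seg' s(3) by (auto simp: \<gamma>_def path_image_def)
    moreover have "\<gamma> 0 = s z" "\<gamma> 1 = q" using s(2) by (auto simp: \<gamma>_def linepath_def)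
    ultimately have cu: "\<gamma> \<in> curves (s z) q" using C1 by (auto simp: curves_def)
    have "len \<gamma> \<le> measure lborel {0..1::real} *\<^sub>R (B * cmod (\<zeta> q - z))"
    proof (rule has_integral_le[OF _ has_integral_const_real])
      show "((\<lambda>t. if t \<in> {0,1} then 0 else speed \<rho> (\<zeta> \<circ> \<gamma>) t) has_integral len \<gamma>) {0..1}"
        by (rule has_integral_spike_finite[OF _ _ len_has_integral[OF cu], of "{0,1}"]) auto
      fix t :: real assume t: "t \<in> {0..1}"
      have Bp: "0 \<le> B" using B[of "\<zeta> q"] r by (metis abs_ge_zero centre_in_cball dual_order.trans half_gt_zero less_imp_le)
      show "(if t \<in> {0,1} then 0 else speed \<rho> (\<zeta> \<circ> \<gamma>) t) \<le> B * cmod (\<zeta> q - z)"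
      proof (cases "t \<in> {0,1}")
        case False
        have "((\<zeta> \<circ> \<gamma>) has_vector_derivative (\<zeta> q - z)) (at t)"
          by (rule has_vector_derivative_transform_within_open[OF has_vector_derivative_linepath_within, of "{0<..<1}"])
            (use t False ez in auto)
        then have "vector_derivative (\<zeta> \<circ> \<gamma>) (at t) = \<zeta> q - z" by (rule vector_derivative_at)
        moreover have "\<rho> ((\<zeta> \<circ> \<gamma>) t) \<le> B" using B[of "linepath z (\<zeta> q) t"] seg[OF t] ez[OF t] by force
        ultimately show ?thesis using False by (simp add: speed_def mult_right_mono)
      qed (use Bp in auto)
    qed
    then show ?thesis using dst_le[OF cu] by simp
  qed
  have ev1: "eventually (\<lambda>n. \<sigma> n \<in> s ` ball (\<zeta> q) r) sequentially"
  proof -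
    obtain U where U: "open U" "s ` ball (\<zeta> q) r = S \<inter> U" using s(4) by (auto simp: openin_open)
    have "q \<in> s ` ball (\<zeta> q) r" using s(2) r by (metis centre_in_ball image_eqI)
    then have "eventually (\<lambda>n. \<sigma> n \<in> U) sequentially" using topological_tendstoD[OF lim U(1)] U(2) by blast
    then show ?thesis by eventually_elim (use U \<sigma> in auto)
  qed
  have z: "(\<lambda>n. \<zeta> (\<sigma> n)) \<longlonglongrightarrow> \<zeta> q"
    using coord_cont[unfolded continuous_on_sequentially] \<sigma> q lim by (auto simp: o_def)
  have ev2: "eventually (\<lambda>n. \<zeta> (\<sigma> n) \<in> ball (\<zeta> q) (r/2)) sequentially"
    using z r by (intro topological_tendstoD) auto
  have ev3: "eventually (\<lambda>n. dst (\<sigma> n) q \<le> B * cmod (\<zeta> q - \<zeta> (\<sigma> n))) sequentially"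
    using ev1 ev2
  proof eventually_elim
    case (elim n)
    then obtain z where "z \<in> ball (\<zeta> q) r" "\<sigma> n = s z" by auto
    then have "s (\<zeta> (\<sigma> n)) = \<sigma> n" using s(3) by simp
    then show ?case using bound[OF elim(2)] by simp
  qed
  have "(\<lambda>n. B * cmod (\<zeta> q - \<zeta> (\<sigma> n))) \<longlonglongrightarrow> B * cmod (\<zeta> q - \<zeta> q)"
    by (intro tendsto_intros z)
  then have lim0: "(\<lambda>n. B * cmod (\<zeta> q - \<zeta> (\<sigma> n))) \<longlonglongrightarrow> 0" by simp
  have "eventually (\<lambda>n. norm (dst (\<sigma> n) q) \<le> norm (B * cmod (\<zeta> q - \<zeta> (\<sigma> n))) * 1) sequentially"
    using ev3
  proof eventually_elim
    case (elim n)
    then show ?case using dst_nonneg[of "\<sigma> n" q] \<sigma> q by auto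
  qed
  then show ?thesis by (rule tendsto_0_le[OF lim0])
qed

text \<open>
  A criterion for completeness in terms of lengths only. The first condition makes the distance positive. By the second one, a
  sequence at bounded distance from its first point has a subsequence that converges in \<open>S\<close>, hence for the distance by
  \<open>dst_tendsto_0\<close>; a Cauchy sequence with a convergent subsequence converges. It suffices to bound lengths of curves
  from below and to extract limits in the surrounding metric space.
\<close>

theorem complete_surfaceI:
  assumes sep: "\<And>p q. p \<in> S \<Longrightarrow> q \<in> S \<Longrightarrow> p \<noteq> q \<Longrightarrow> \<exists>\<epsilon>>0. \<forall>\<gamma>\<in>curves p q. \<epsilon> \<le> len \<gamma>"
    and prec: "\<And>\<sigma> B. \<lbrakk>\<And>n. \<sigma> n \<in> S; \<And>n. \<exists>\<gamma>\<in>curves (\<sigma> 0) (\<sigma> n). len \<gamma> \<le> B\<rbrakk> \<Longrightarrow>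
       \<exists>r q. strict_mono (r :: nat \<Rightarrow> nat) \<and> q \<in> S \<and> (\<sigma> \<circ> r) \<longlonglongrightarrow> q"
  shows "complete_surface (top_of_set S) A ds"
proof -
  let ?d = "surface_dist (top_of_set S) A ds"
  have out: "p \<notin> S \<or> q \<notin> S \<Longrightarrow> ?d p q = 0" for p q by (auto simp: surface_dist_def)
  have zero: "dst p p = 0" if p: "p \<in> S" for p
  proof -
    have "(\<lambda>n::nat. dst p p) \<longlonglongrightarrow> 0" using dst_tendsto_0[of "\<lambda>_. p" p] p by simp
    then show ?thesis by (simp add: LIMSEQ_const_iff)
  qed
  interpret M: Metric_space "topspace (top_of_set S)" ?d
  proof
    show "0 \<le> ?d p q" for p q using out[of p q] dst_nonneg[of p q] surface_dist_eq[of p q] by (cases "p \<in> S \<and> q \<in> S") auto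
    show "?d p q = ?d q p" for p q
      using out[of p q] out[of q p] dst_commute[of p q] surface_dist_eq[of p q] surface_dist_eq[of q p] by (cases "p \<in> S \<and> q \<in> S") auto
    show "(?d p q = 0) = (p = q)" if "p \<in> topspace (top_of_set S)" "q \<in> topspace (top_of_set S)" for p q
    proof -
      have pq: "p \<in> S" "q \<in> S" using that by auto
      have "dst p q > 0" if ne: "p \<noteq> q"
      proof -
        obtain \<epsilon> where "\<epsilon> > 0" "\<forall>\<gamma>\<in>curves p q. \<epsilon> \<le> len \<gamma>" using sep[OF pq ne] by blast
        then have "\<epsilon> \<le> dst p q" using pq by (intro dst_greatest) auto
        then show ?thesis using \<open>\<epsilon> > 0\<close> by simp
      qed
      then show ?thesis using zero[of p] pq surface_dist_eq[OF pq] by fastforce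
    qed
    show "?d p r \<le> ?d p q + ?d q r" if "p \<in> topspace (top_of_set S)" "q \<in> topspace (top_of_set S)" "r \<in> topspace (top_of_set S)" for p q r
      using that dst_triangle[of p q r] surface_dist_eq by simp
  qed
  have "M.mcomplete"
    unfolding M.mcomplete_def
  proof (intro allI impI)
    fix \<sigma> assume C: "M.MCauchy \<sigma>"
    then have "range \<sigma> \<subseteq> topspace (top_of_set S)" unfolding M.MCauchy_def by blast
    then have \<sigma>: "\<sigma> n \<in> S" for n by auto
    have "\<forall>\<epsilon>>0. \<exists>N. \<forall>n n'. N \<le> n \<longrightarrow> N \<le> n' \<longrightarrow> ?d (\<sigma> n) (\<sigma> n') < \<epsilon>"
      using C unfolding M.MCauchy_def by (rule conjunct2)
    from this[rule_format, of 1] obtain N where "\<forall>n n'. N \<le> n \<longrightarrow> N \<le> n' \<longrightarrow> ?d (\<sigma> n) (\<sigma> n') < 1" by auto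
    then have N: "\<And>n n'. N \<le> n \<Longrightarrow> N \<le> n' \<Longrightarrow> ?d (\<sigma> n) (\<sigma> n') < 1" by blast
    define \<tau> where "\<tau> n = \<sigma> (N + n)" for n
    have "\<exists>\<gamma>\<in>curves (\<tau> 0) (\<tau> n). len \<gamma> \<le> 1" for n
    proof -
      have "dst (\<tau> 0) (\<tau> n) < 1" using N[of N "N + n"] surface_dist_eq \<sigma> by (simp add: \<tau>_def)
      then obtain \<gamma> where "\<gamma> \<in> curves (\<tau> 0) (\<tau> n)" "len \<gamma> < 1" using dst_less[of "\<tau> 0" "\<tau> n" 1] \<sigma> by (auto simp: \<tau>_def)
      then show ?thesis by (intro bexI[of _ \<gamma>]) auto
    qed
    then obtain r q where r: "strict_mono r" "q \<in> S" "(\<tau> \<circ> r) \<longlonglongrightarrow> q"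
      using prec[of \<tau> 1] \<sigma> by (auto simp: \<tau>_def)
    have "(\<lambda>n. dst ((\<tau> \<circ> r) n) q) \<longlonglongrightarrow> 0"
      by (rule dst_tendsto_0) (use r \<sigma> in \<open>simp_all add: \<tau>_def o_def\<close>)
    then have "(\<lambda>n. ?d ((\<tau> \<circ> r) n) q) \<longlonglongrightarrow> 0" using surface_dist_eq \<sigma> r(2) by (simp add: \<tau>_def)
    moreover have "\<tau> \<circ> r = \<sigma> \<circ> (\<lambda>n. N + r n)" by (auto simp: \<tau>_def)
    ultimately have "(\<lambda>n. ?d ((\<sigma> \<circ> (\<lambda>n. N + r n)) n) q) \<longlonglongrightarrow> 0" by simp
    then have "limitin M.mtopology (\<sigma> \<circ> (\<lambda>n. N + r n)) q sequentially"
      unfolding M.limitin_metric_dist_null using r(2) \<sigma> by (auto simp: o_def)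
    moreover have "strict_mono (\<lambda>n. N + r n)" using r(1) by (auto simp: strict_mono_def)
    ultimately have "limitin M.mtopology \<sigma> q sequentially" using M.MCauchy_convergent_subsequence[OF C] by blast
    then show "\<exists>x. limitin M.mtopology \<sigma> x sequentially" by blast
  qed
  then show ?thesis unfolding complete_surface_def using M.Metric_space_axioms by blast
qed

end

section \<open>The covering surface of the logarithms\<close>

text \<open>
  Over the plane without the points \<open>p i\<close>, the surface \<open>S\<close> carries all functions \<open>log (z - p i)\<close>: its points are pairs of \<open>z\<close> and a
  vector of logarithms. It is the covering with the group of periods \<open>(2 \<pi> \<i> \<int>)\<^sup>m\<close>.
\<close>

locale log_cover =
  fixes p :: "'m::finite \<Rightarrow> complex"
  assumes inj_p: "inj p"
begin

definition Omega :: "complex set" where "Omega = - range p"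

definition S :: "(complex \<times> (complex ^ 'm)) set" where
  "S = {q. \<forall>i. exp (snd q $ i) = fst q - p i}"

text \<open>
  The radius of the largest disc around \<open>z\<close> that avoids the points \<open>p i\<close>. There the quotients \<open>(z' - p i) / (z - p i)\<close> stay
  in the right half plane, so that the principal logarithm continues all coordinates at once.
\<close>

definition rad :: "complex \<Rightarrow> real" where "rad z = infdist z (range p)"

definition branch :: "complex \<times> (complex ^ 'm) \<Rightarrow> complex \<Rightarrow> complex \<times> (complex ^ 'm)" where
  "branch q z = (z, \<chi> i. snd q $ i + Ln ((z - p i) / (fst q - p i)))"

definition sheet :: "complex \<times> (complex ^ 'm) \<Rightarrow> (complex \<times> (complex ^ 'm)) set" where
  "sheet q = branch q ` ball (fst q) (rad (fst q))"

definition atlas :: "(complex \<times> (complex ^ 'm)) chart set" where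
  "atlas = (\<lambda>q. (sheet q, fst)) ` S"

lemma S_fst_ne: "q \<in> S \<Longrightarrow> fst q \<noteq> p i"
  using exp_not_eq_zero[of "snd q $ i"] by (auto simp: S_def)

lemma S_fst: "q \<in> S \<Longrightarrow> fst q \<in> Omega"
  unfolding Omega_def using S_fst_ne[of q] by (metis ComplI imageE)

lemma Omega_ne: "z \<in> Omega \<Longrightarrow> z \<noteq> p i" by (auto simp: Omega_def)

lemma open_Omega: "open Omega"
  unfolding Omega_def by (intro open_Compl finite_imp_closed) auto

lemma path_connected_Omega: "path_connected Omega"
  unfolding Omega_def by (rule path_connected_complement_countable) (auto intro: countable_finite)

lemma rad_le: "rad z \<le> cmod (z - p i)"
  unfolding rad_def using infdist_le[of "p i" "range p" z] by (simp add: dist_norm)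

lemma rad_pos: "z \<in> Omega \<Longrightarrow> 0 < rad z"
  unfolding rad_def Omega_def by (intro infdist_pos_not_in_closed finite_imp_closed) auto

lemma ratio_pos:
  assumes "cmod (z' - z) < cmod (z - a)"
  shows "0 < Re ((z' - a) / (z - a))" "(z' - a) / (z - a) \<noteq> 0"
proof -
  have ne: "z \<noteq> a" using assms by auto
  have "(z' - a) / (z - a) = 1 + (z' - z) / (z - a)" using ne by (simp add: field_simps)
  moreover have "cmod ((z' - z) / (z - a)) < 1" using assms ne by (simp add: norm_divide)
  then have "\<bar>Re ((z' - z) / (z - a))\<bar> < 1" using abs_Re_le_cmod by (rule le_less_trans[rotated])
  ultimately show "0 < Re ((z' - a) / (z - a))" by simp
  then show "(z' - a) / (z - a) \<noteq> 0" by auto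
qed

lemma ball_ratio:
  assumes "z' \<in> ball z (rad z)"
  shows "0 < Re ((z' - p i) / (z - p i))" "(z' - p i) / (z - p i) \<noteq> 0"
proof -
  have "cmod (z' - z) < cmod (z - p i)"
    using assms rad_le[of z i] by (simp add: dist_norm norm_minus_commute)
  then show "0 < Re ((z' - p i) / (z - p i))" "(z' - p i) / (z - p i) \<noteq> 0" using ratio_pos by blast+
qed

lemma ball_Omega: "ball z (rad z) \<subseteq> Omega"
  using ball_ratio(2)[of _ z] by (fastforce simp: Omega_def)

lemma branch_in:
  assumes q: "q \<in> S" and z: "z \<in> ball (fst q) (rad (fst q))"
  shows "branch q z \<in> S"
proof -
  have "exp (snd q $ i + Ln ((z - p i) / (fst q - p i))) = z - p i" for i
  proof -
    have "exp (snd q $ i + Ln ((z - p i) / (fst q - p i))) = exp (snd q $ i) * ((z - p i) / (fst q - p i))"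
      using ball_ratio(2)[OF z] by (simp add: exp_add)
    also have "\<dots> = z - p i" using q S_fst_ne[OF q, of i] by (simp add: S_def)
    finally show ?thesis .
  qed
  then show ?thesis by (simp add: S_def branch_def)
qed

lemma fst_branch [simp]: "fst (branch q z) = z" by (simp add: branch_def)

lemma branch_centre: "q \<in> S \<Longrightarrow> branch q (fst q) = q"
  using S_fst_ne[of q] by (simp add: branch_def prod_eq_iff vec_eq_iff Finite_Cartesian_Product.vec_eq_iff)

lemma continuous_on_branch: "continuous_on (ball (fst q) (rad (fst q))) (branch q)"
proof -
  have "continuous_on (ball (fst q) (rad (fst q))) (\<lambda>z. Ln ((z - p i) / (fst q - p i)))" for i
  proof (rule continuous_on_Ln')
    show "continuous_on (ball (fst q) (rad (fst q))) (\<lambda>z. (z - p i) / (fst q - p i))"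
      by (cases "fst q = p i") (auto intro!: continuous_intros)
    show "(z - p i) / (fst q - p i) \<notin> \<real>\<^sub>\<le>\<^sub>0" if "z \<in> ball (fst q) (rad (fst q))" for z
      using ball_ratio(1)[OF that, of i] by (auto simp: complex_nonpos_Reals_iff)
  qed
  then show ?thesis unfolding branch_def
    by (intro continuous_on_Pair continuous_on_id continuous_on_vec_lambda continuous_on_add continuous_on_const)
qed

text \<open>
  In \<open>S\<close>, points over the same \<open>z\<close> differ by multiples of \<open>2 \<pi> \<i>\<close>. So a bound on imaginary parts isolates one sheet,
  which shows that sheets are open.
\<close>

lemma sheet_eq:
  assumes q: "q \<in> S"
  shows "sheet q = S \<inter> {q'. fst q' \<in> ball (fst q) (rad (fst q)) \<and> (\<forall>i. \<bar>Im (snd q' $ i - snd q $ i)\<bar> < pi)}"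
proof (intro equalityI subsetI)
  fix q' assume "q' \<in> sheet q"
  then obtain z where z: "z \<in> ball (fst q) (rad (fst q))" "q' = branch q z" by (auto simp: sheet_def)
  have "\<bar>Im (Ln ((z - p i) / (fst q - p i)))\<bar> < pi" for i
  proof -
    have "\<bar>Im (Ln ((z - p i) / (fst q - p i)))\<bar> < pi / 2"
      using Re_Ln_pos_lt[OF ball_ratio(2)[OF z(1), of i]] ball_ratio(1)[OF z(1), of i] by simp
    then show ?thesis using pi_gt_zero by linarith
  qed
  then show "q' \<in> S \<inter> {q'. fst q' \<in> ball (fst q) (rad (fst q)) \<and> (\<forall>i. \<bar>Im (snd q' $ i - snd q $ i)\<bar> < pi)}"
    using z branch_in[OF q z(1)] by (simp add: branch_def)
next
  fix q' assume "q' \<in> S \<inter> {q'. fst q' \<in> ball (fst q) (rad (fst q)) \<and> (\<forall>i. \<bar>Im (snd q' $ i - snd q $ i)\<bar> < pi)}"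
  then have q': "q' \<in> S" "fst q' \<in> ball (fst q) (rad (fst q))" "\<And>i. \<bar>Im (snd q' $ i - snd q $ i)\<bar> < pi" by auto
  have "snd q' $ i = snd q $ i + Ln ((fst q' - p i) / (fst q - p i))" for i
  proof -
    have "exp (snd q' $ i - snd q $ i) = (fst q' - p i) / (fst q - p i)"
      using q q'(1) by (simp add: S_def exp_diff)
    then have "Ln ((fst q' - p i) / (fst q - p i)) = snd q' $ i - snd q $ i"
      using q'(3)[of i] by (metis Ln_exp abs_less_iff less_imp_le minus_less_iff)
    then show ?thesis by simp
  qed
  then have "q' = branch q (fst q')" by (simp add: branch_def prod_eq_iff Finite_Cartesian_Product.vec_eq_iff)
  then show "q' \<in> sheet q" using q'(2) unfolding sheet_def by (rule image_eqI)
qed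

lemma sheet_openin:
  assumes "q \<in> S" shows "openin (top_of_set S) (sheet q)"
proof -
  have "open {q'. fst q' \<in> ball (fst q) (rad (fst q)) \<and> (\<forall>i. \<bar>Im (snd q' $ i - snd q $ i)\<bar> < pi)}"
  proof -
    have "{q'. fst q' \<in> ball (fst q) (rad (fst q)) \<and> (\<forall>i. \<bar>Im (snd q' $ i - snd q $ i)\<bar> < pi)} =
      {q'. dist (fst q) (fst q') < rad (fst q)} \<inter> (\<Inter>i. {q'. \<bar>Im (snd q' $ i - snd q $ i)\<bar> < pi})" by auto
    also have "open \<dots>"
      by (intro open_Int open_INT ballI open_Collect_less continuous_intros) auto
    finally show ?thesis .
  qed
  then show ?thesis unfolding sheet_eq[OF assms] by (auto simp: openin_open)
qed

lemma sheet_sub: "q \<in> S \<Longrightarrow> sheet q \<subseteq> S" by (auto simp: sheet_eq)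

lemma sheet_self: "q \<in> S \<Longrightarrow> q \<in> sheet q"
  unfolding sheet_def using branch_centre rad_pos[OF S_fst] by (metis centre_in_ball image_eqI)

lemma inj_sheet: "inj_on fst (sheet q)"
  by (auto simp: sheet_def inj_on_def)

lemma fst_sheet: "fst ` sheet q = ball (fst q) (rad (fst q))"
  unfolding sheet_def image_image by simp

lemma param_sheet: "z \<in> ball (fst q) (rad (fst q)) \<Longrightarrow> param (sheet q, fst) z = branch q z"
  unfolding param_def using inv_into_f_eq[OF inj_sheet, of "branch q z" q z] by (simp add: sheet_def)

lemma coords_sheet: "coords (sheet q, fst) = ball (fst q) (rad (fst q))"
  by (simp add: coords_def fst_sheet)

text \<open>
  Connection by a curve that is piecewise smooth in the coordinate \<open>z\<close>, as it is required for the distance as well as for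
  connectedness.
\<close>

definition linked :: "complex \<times> (complex ^ 'm) \<Rightarrow> complex \<times> (complex ^ 'm) \<Rightarrow> bool" where
  "linked q q' \<longleftrightarrow> (\<exists>\<gamma> F. path \<gamma> \<and> path_image \<gamma> \<subseteq> S \<and> C1_off F (fst \<circ> \<gamma>) \<and> \<gamma> 0 = q \<and> \<gamma> 1 = q')"

lemma linked_sym: "linked q q' \<Longrightarrow> linked q' q"
proof -
  assume "linked q q'"
  then obtain \<gamma> F where \<gamma>: "path \<gamma>" "path_image \<gamma> \<subseteq> S" "C1_off F (fst \<circ> \<gamma>)" "\<gamma> 0 = q" "\<gamma> 1 = q'" by (auto simp: linked_def)
  have "fst \<circ> reversepath \<gamma> = reversepath (fst \<circ> \<gamma>)" by (auto simp: reversepath_def)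
  then have "C1_off ((\<lambda>t. 1 - t) ` F) (fst \<circ> reversepath \<gamma>)" using C1_off_reversepath[OF \<gamma>(3)] by simp
  moreover have "path (reversepath \<gamma>)" "path_image (reversepath \<gamma>) \<subseteq> S" using \<gamma> by auto
  moreover have "reversepath \<gamma> 0 = q'" "reversepath \<gamma> 1 = q" using \<gamma> by (auto simp: reversepath_def)
  ultimately show ?thesis unfolding linked_def by blast
qed

lemma linked_trans: "linked q q' \<Longrightarrow> linked q' q'' \<Longrightarrow> linked q q''"
proof -
  assume "linked q q'" "linked q' q''"
  then obtain \<gamma> F \<gamma>' F' where pp: "path \<gamma>" "path_image \<gamma> \<subseteq> S" "C1_off F (fst \<circ> \<gamma>)" "\<gamma> 0 = q" "\<gamma> 1 = q'"
    "path \<gamma>'" "path_image \<gamma>' \<subseteq> S" "C1_off F' (fst \<circ> \<gamma>')" "\<gamma>' 0 = q'" "\<gamma>' 1 = q''" unfolding linked_def by metis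
  have e: "fst \<circ> (\<gamma> +++ \<gamma>') = (fst \<circ> \<gamma>) +++ (fst \<circ> \<gamma>')" by (auto simp: joinpaths_def)
  have "path (\<gamma> +++ \<gamma>')" using pp by (intro path_join_imp) (auto simp: pathstart_def pathfinish_def)
  moreover have "path_image (\<gamma> +++ \<gamma>') \<subseteq> S" using pp path_image_join_subset by blast
  moreover have "(\<gamma> +++ \<gamma>') 0 = q" "(\<gamma> +++ \<gamma>') 1 = q''" using pp by (auto simp: joinpaths_def)
  moreover have "\<exists>G. C1_off G (fst \<circ> (\<gamma> +++ \<gamma>'))" unfolding e using C1_off_joinpaths[OF pp(3,8)] pp by auto
  ultimately show ?thesis unfolding linked_def by blast
qed

definition shift :: "complex ^ 'm \<Rightarrow> complex \<times> (complex ^ 'm) \<Rightarrow> complex \<times> (complex ^ 'm)" where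
  "shift v q = (fst q, snd q + v)"

definition periods :: "(complex ^ 'm) set" where "periods = {v. \<forall>i. exp (v $ i) = 1}"

lemma shift_in: "v \<in> periods \<Longrightarrow> q \<in> S \<Longrightarrow> shift v q \<in> S"
  by (auto simp: S_def shift_def periods_def exp_add)

lemma linked_shift:
  assumes "linked q q'" "v \<in> periods" shows "linked (shift v q) (shift v q')"
proof -
  obtain \<gamma> F where \<gamma>: "path \<gamma>" "path_image \<gamma> \<subseteq> S" "C1_off F (fst \<circ> \<gamma>)" "\<gamma> 0 = q" "\<gamma> 1 = q'" using assms by (auto simp: linked_def)
  have "path (shift v \<circ> \<gamma>)" using \<gamma>(1) unfolding path_def shift_def by (auto simp: o_def intro!: continuous_intros)
  moreover have "path_image (shift v \<circ> \<gamma>) \<subseteq> S"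
    using \<gamma>(2) shift_in[OF assms(2)] unfolding path_image_def image_subset_iff by simp
  moreover have "fst \<circ> (shift v \<circ> \<gamma>) = fst \<circ> \<gamma>" by (auto simp: shift_def)
  ultimately show ?thesis using \<gamma> unfolding linked_def by (intro exI[of _ "shift v \<circ> \<gamma>"] exI[of _ F]) auto
qed

lemma lift_curve:
  assumes g: "continuous_on {0..1} g" "\<And>t. t \<in> {0..1} \<Longrightarrow> g t \<in> Omega" "C1_off F g" and q: "q \<in> S" "fst q = g 0"
  shows "\<exists>q'. q' \<in> S \<and> fst q' = g 1 \<and> linked q q'"
proof -
  have "\<exists>L. continuous_on {0..1::real} L \<and> (\<forall>t\<in>{0..1}. g t - p i = exp (L t))" for i
  proof -
    have c: "continuous_on {0..1} (\<lambda>t. g t - p i)" by (intro continuous_intros g)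
    have n: "g t - p i \<noteq> 0" if "t \<in> {0..1}" for t using g(2)[OF that] Omega_ne[of "g t" i] by simp
    obtain L where "continuous_on {0..1::real} L" "\<And>t. t \<in> {0..1} \<Longrightarrow> g t - p i = exp (L t)"
      using continuous_logarithm_on_contractible[OF c convex_imp_contractible n] by auto
    then show ?thesis by blast
  qed
  then obtain L where L: "\<And>i. continuous_on {0..1::real} (L i)" "\<And>i t. t \<in> {0..1} \<Longrightarrow> g t - p i = exp (L i t)" by metis
  define \<gamma> where "\<gamma> t = (g t, \<chi> i. L i t + (snd q $ i - L i 0))" for t
  have \<gamma>S: "\<gamma> t \<in> S" if t: "t \<in> {0..1}" for t
  proof -
    have "exp (L i t + (snd q $ i - L i 0)) = g t - p i" for i
    proof -
      have "exp (snd q $ i) = exp (L i 0)" using q L(2)[of 0 i] by (simp add: S_def)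
      then show ?thesis using L(2)[OF t, of i] by (simp add: exp_add exp_diff)
    qed
    then show ?thesis by (simp add: S_def \<gamma>_def)
  qed
  have "path \<gamma>" unfolding path_def \<gamma>_def by (intro continuous_intros g L)
  moreover have "path_image \<gamma> \<subseteq> S" using \<gamma>S by (auto simp: path_image_def)
  moreover have "fst \<circ> \<gamma> = g" by (auto simp: \<gamma>_def)
  moreover have "\<gamma> 0 = q" using q by (simp add: \<gamma>_def prod_eq_iff Finite_Cartesian_Product.vec_eq_iff)
  ultimately have "linked q (\<gamma> 1)" unfolding linked_def using g(3) by blast
  then show ?thesis using \<gamma>S[of 1] by (intro exI[of _ "\<gamma> 1"]) (auto simp: \<gamma>_def)
qed

lemma lift_to:
  assumes "q \<in> S" "z \<in> Omega" shows "\<exists>q'. q' \<in> S \<and> fst q' = z \<and> linked q q'"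
proof -
  obtain g where g: "polynomial_function g" "path_image g \<subseteq> Omega" "pathstart g = fst q" "pathfinish g = z"
    using connected_open_polynomial_connected[OF open_Omega path_connected_imp_connected[OF path_connected_Omega] S_fst[OF assms(1)] assms(2)] by blast
  obtain g' where g': "polynomial_function g'" "\<And>x. (g has_vector_derivative (g' x)) (at x)"
    using has_vector_derivative_polynomial_function[OF g(1)] by blast
  have "C1_on a b g" for a b unfolding C1_on_def
    using g' by (intro exI[of _ g']) (auto intro: continuous_on_polymonial_function has_vector_derivative_at_within)
  then have "C1_off {} g" by (simp add: C1_off_def)
  then show ?thesis using lift_curve[of g "{}" q] g assms
    by (auto simp: path_image_def pathstart_def pathfinish_def image_subset_iff intro: continuous_on_polymonial_function)
qed

text \<open>
  A circle around \<open>p i\<close> that is small compared to the distance from the other punctures raises the logarithm at \<open>i\<close> by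
  \<open>2 \<pi> \<i>\<close> and returns the others to their values, since \<open>(g t - p j) / (fst q - p j)\<close> never leaves the right half plane.
\<close>

lemma linked_small_loop:
  assumes q: "q \<in> S" and near: "\<And>j. j \<noteq> i \<Longrightarrow> 2 * cmod (fst q - p i) < cmod (fst q - p j)"
  shows "linked q (shift (axis i (2 * of_real pi * \<i>)) q)"
proof -
  define g where "g t = p i + (fst q - p i) * exp (2 * of_real pi * \<i> * of_real t)" for t :: real
  define \<gamma> where "\<gamma> t = (g t, \<chi> j. if j = i then snd q $ i + 2 * of_real pi * \<i> * of_real t
     else snd q $ j + Ln ((g t - p j) / (fst q - p j)))" for t
  have gd: "cmod (g t - fst q) \<le> 2 * cmod (fst q - p i)" for t
  proof -
    have "g t - fst q = (fst q - p i) * (exp (2 * of_real pi * \<i> * of_real t) - 1)" by (simp add: g_def algebra_simps)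
    moreover have "cmod (exp (2 * of_real pi * \<i> * of_real t) - 1) \<le> 1 + 1"
      by (rule order.trans[OF norm_triangle_ineq4]) (simp add: norm_exp_eq_Re)
    ultimately show ?thesis using mult_left_mono[of "cmod (exp (2 * of_real pi * \<i> * of_real t) - 1)" 2 "cmod (fst q - p i)"]
      by (simp add: norm_mult mult.commute)
  qed
  have gr: "0 < Re ((g t - p j) / (fst q - p j))" "(g t - p j) / (fst q - p j) \<noteq> 0" if "j \<noteq> i" for t j
    using ratio_pos[of "g t" "fst q" "p j"] gd[of t] near[OF that] by auto
  have gc: "continuous_on X g" for X unfolding g_def by (intro continuous_intros)
  have \<gamma>S: "\<gamma> t \<in> S" for t
  proof -
    have "exp (snd (\<gamma> t) $ j) = g t - p j" for j
    proof (cases "j = i")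
      case True
      then show ?thesis using q by (simp add: \<gamma>_def g_def exp_add S_def)
    next
      case False
      then have "exp (snd (\<gamma> t) $ j) = exp (snd q $ j) * ((g t - p j) / (fst q - p j))"
        using gr(2)[OF False, of t] by (simp add: \<gamma>_def exp_add)
      then show ?thesis using q S_fst_ne[OF q, of j] by (simp add: S_def)
    qed
    then show ?thesis by (simp add: S_def) (simp add: \<gamma>_def)
  qed
  have "continuous_on {0..1} (\<lambda>t. if j = i then snd q $ i + 2 * of_real pi * \<i> * of_real t
     else snd q $ j + Ln ((g t - p j) / (fst q - p j)))" for j
  proof (cases "j = i")
    case True
    then show ?thesis by (auto intro!: continuous_intros)
  next
    case False
    have "continuous_on {0..1} (\<lambda>t. Ln ((g t - p j) / (fst q - p j)))"
    proof (rule continuous_on_Ln')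
      show "continuous_on {0..1} (\<lambda>t. (g t - p j) / (fst q - p j))"
        using S_fst_ne[OF q, of j] by (auto intro!: continuous_intros gc)
      show "(g t - p j) / (fst q - p j) \<notin> \<real>\<^sub>\<le>\<^sub>0" for t
        using gr(1)[OF False, of t] by (auto simp: complex_nonpos_Reals_iff)
    qed
    then show ?thesis using False by (auto intro!: continuous_intros)
  qed
  then have "path \<gamma>" unfolding path_def \<gamma>_def by (intro continuous_intros gc)
  moreover have "path_image \<gamma> \<subseteq> S" using \<gamma>S by (auto simp: path_image_def)
  moreover have "C1_off {} (fst \<circ> \<gamma>)"
  proof -
    have fg: "fst \<circ> \<gamma> = g" by (auto simp: \<gamma>_def)
    have "(g has_vector_derivative (fst q - p i) * (2 * of_real pi * \<i> * exp (2 * of_real pi * \<i> * of_real t))) (at t within X)" for t X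
      unfolding g_def by (rule has_vector_derivative_real_field) (auto intro!: derivative_eq_intros)
    then have "C1_on a b g" for a b unfolding C1_on_def
      by (intro exI[of _ "\<lambda>t. (fst q - p i) * (2 * of_real pi * \<i> * exp (2 * of_real pi * \<i> * of_real t))"]) (auto intro!: continuous_intros)
    then show ?thesis unfolding fg by (simp add: C1_off_def)
  qed
  moreover have "\<gamma> 0 = q"
    using S_fst_ne[OF q] by (simp add: \<gamma>_def g_def prod_eq_iff Finite_Cartesian_Product.vec_eq_iff)
  moreover have "\<gamma> 1 = shift (axis i (2 * of_real pi * \<i>)) q"
  proof -
    have "g 1 = fst q" by (simp add: g_def exp_two_pi_i)
    then show ?thesis using S_fst_ne[OF q]
      by (simp add: \<gamma>_def shift_def prod_eq_iff Finite_Cartesian_Product.vec_eq_iff axis_def)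
  qed
  ultimately show ?thesis unfolding linked_def by blast
qed

lemma axis_period: "axis i (2 * of_real pi * \<i>) \<in> periods"
  by (simp add: periods_def axis_def exp_two_pi_i)

text \<open>
  Conjugation by a path to a point near \<open>p i\<close> reduces the claim to a small circle.
\<close>

lemma linked_loop:
  assumes q: "q \<in> S" shows "linked q (shift (axis i (2 * of_real pi * \<i>)) q)"
proof -
  obtain d where d: "d > 0" "\<And>x. x \<in> range p \<Longrightarrow> x \<noteq> p i \<Longrightarrow> d \<le> dist (p i) x"
    using finite_set_avoid[of "range p" "p i"] by auto
  define z where "z = p i + of_real (d / 4)"
  have zi: "cmod (z - p i) = d / 4" using d by (simp add: z_def)
  have zj: "d * 3 / 4 \<le> cmod (z - p j)" if "j \<noteq> i" for j
  proof -
    have "p j \<noteq> p i" using that inj_p by (auto simp: inj_def)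
    then have "d \<le> cmod (p i - p j)" using d(2)[of "p j"] by (simp add: dist_norm)
    moreover have "cmod (p i - p j) \<le> cmod (p i - z) + cmod (z - p j)" using norm_triangle_ineq[of "p i - z" "z - p j"] by simp
    ultimately show ?thesis using zi by (simp add: norm_minus_commute)
  qed
  have "z \<noteq> p j" for j using zi zj[of j] d by (cases "j = i") auto
  then have "z \<in> Omega" by (auto simp: Omega_def)
  then obtain q' where q': "q' \<in> S" "fst q' = z" "linked q q'" using lift_to[OF q] by blast
  have "linked q' (shift (axis i (2 * of_real pi * \<i>)) q')"
  proof (rule linked_small_loop[OF q'(1)])
    fix j assume "j \<noteq> i"
    then show "2 * cmod (fst q' - p i) < cmod (fst q' - p j)" using zj[of j] zi d q' by simp
  qed
  moreover have "linked (shift (axis i (2 * of_real pi * \<i>)) q') (shift (axis i (2 * of_real pi * \<i>)) q)"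
    by (rule linked_shift[OF linked_sym[OF q'(3)] axis_period])
  ultimately show ?thesis using q'(3) linked_trans by blast
qed

text \<open>
  The periods that are realised by closed curves in the plane, independently of the base point.
\<close>

definition loops :: "(complex ^ 'm) set" where
  "loops = {v \<in> periods. \<forall>q\<in>S. linked q (shift v q)}"

lemma periods_add: "v \<in> periods \<Longrightarrow> u \<in> periods \<Longrightarrow> v + u \<in> periods"
  by (simp add: periods_def exp_add)
lemma periods_minus: "v \<in> periods \<Longrightarrow> - v \<in> periods"
  by (simp add: periods_def exp_minus)

lemma shift_shift: "shift v (shift u q) = shift (u + v) q" by (simp add: shift_def add.assoc)
lemma shift_0: "shift 0 q = q" by (simp add: shift_def)

lemma loops_add: "v \<in> loops \<Longrightarrow> u \<in> loops \<Longrightarrow> v + u \<in> loops"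
  unfolding loops_def using periods_add linked_trans shift_in shift_shift by (simp, metis)

lemma loops_minus: "v \<in> loops \<Longrightarrow> - v \<in> loops"
proof -
  assume v: "v \<in> loops"
  have "linked q (shift (- v) q)" if q: "q \<in> S" for q
  proof -
    have "shift (- v) q \<in> S" using v q by (auto simp: loops_def intro!: shift_in periods_minus)
    then have "linked (shift (- v) q) (shift v (shift (- v) q))" using v by (auto simp: loops_def)
    then show ?thesis by (simp add: shift_shift shift_0 linked_sym)
  qed
  then show ?thesis using v periods_minus by (auto simp: loops_def)
qed

lemma loops_axis_int: "axis i (2 * of_real pi * \<i> * of_int n) \<in> loops"
proof -
  have a: "axis i (2 * of_real pi * \<i>) \<in> loops" using axis_period linked_loop by (auto simp: loops_def)
  have z: "(0 :: complex ^ 'm) \<in> loops"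
    using loops_add[OF a loops_minus[OF a]] by simp
  have N: "axis i (2 * of_real pi * \<i> * of_nat k) \<in> loops" for k
  proof (induction k)
    case 0
    have a0: "axis i (0 :: complex) = (0 :: complex ^ 'm)"
      by (simp add: axis_def Finite_Cartesian_Product.vec_eq_iff)
    show ?case using z by (simp only: of_nat_0 mult_zero_right a0)
  next
    case (Suc k)
    have "axis i (2 * of_real pi * \<i> * of_nat (Suc k)) = axis i (2 * of_real pi * \<i> * of_nat k) + axis i (2 * of_real pi * \<i>)"
      by (simp add: axis_def Finite_Cartesian_Product.vec_eq_iff algebra_simps)
    then show ?case using loops_add[OF Suc a] by simp
  qed
  show ?thesis
  proof (cases n)
    case (nonneg k)
    then show ?thesis using N[of k] by simp
  next
    case (neg k)
    have n: "complex_of_int n = - of_nat (Suc k)" unfolding neg by (simp only: of_int_minus of_int_of_nat_eq)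
    have "axis i (2 * of_real pi * \<i> * of_int n) = - axis i (2 * of_real pi * \<i> * of_nat (Suc k))"
      unfolding n by (simp add: axis_def Finite_Cartesian_Product.vec_eq_iff del: of_nat_Suc)
    then show ?thesis using loops_minus[OF N[of "Suc k"]] by simp
  qed
qed

lemma loops_all: "v \<in> periods \<Longrightarrow> v \<in> loops"
proof -
  assume v: "v \<in> periods"
  have "\<exists>n::int. v $ i = 2 * of_real pi * \<i> * of_int n" for i
  proof -
    have "exp (v $ i) = exp 0" using v by (simp add: periods_def)
    then obtain n :: int where "v $ i = 0 + of_int (2 * n) * of_real pi * \<i>"
      unfolding exp_eq by (auto simp: mult.assoc)
    then show ?thesis by (intro exI[of _ n]) (simp add: algebra_simps)
  qed
  then obtain n :: "'m \<Rightarrow> int" where n: "\<And>i. v $ i = 2 * of_real pi * \<i> * of_int (n i)" by metis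
  have "(\<Sum>i\<in>I. axis i (2 * of_real pi * \<i> * of_int (n i))) \<in> loops" if "finite I" for I :: "'m set"
    using that
  proof (induction I rule: finite_induct)
    case empty
    show ?case using loops_add[OF loops_axis_int[of undefined 1] loops_minus[OF loops_axis_int[of undefined 1]]] by simp
  next
    case (insert i I)
    then show ?case using loops_add[OF loops_axis_int[of i "n i"] insert.IH] by simp
  qed
  then have "(\<Sum>i\<in>UNIV. axis i (2 * of_real pi * \<i> * of_int (n i))) \<in> loops" by simp
  also have "(\<Sum>i\<in>UNIV. axis i (2 * of_real pi * \<i> * of_int (n i))) = v"
    by (simp add: Finite_Cartesian_Product.vec_eq_iff axis_def n if_distrib sum.delta cong: if_cong)
  finally show ?thesis .
qed

text \<open>
  Lifting a path of the plane reaches the right fibre, and the remaining difference is a period.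
\<close>

lemma linked_all: "q \<in> S \<Longrightarrow> q' \<in> S \<Longrightarrow> linked q q'"
proof -
  assume q: "q \<in> S" and q': "q' \<in> S"
  obtain q'' where q'': "q'' \<in> S" "fst q'' = fst q'" "linked q q''" using lift_to[OF q S_fst[OF q']] by blast
  define v where "v = snd q' - snd q''"
  have "v \<in> periods" using q' q'' S_fst_ne[OF q'] by (simp add: v_def periods_def S_def exp_diff)
  then have "v \<in> loops" by (rule loops_all)
  then have "linked q'' (shift v q'')" using q''(1) by (auto simp: loops_def)
  moreover have "shift v q'' = q'" using q''(2) by (simp add: shift_def v_def prod_eq_iff)
  ultimately show ?thesis using q''(3) linked_trans by metis
qed

lemma S_nonempty: "S \<noteq> {}"
proof -
  obtain z where z: "z \<in> Omega"
  proof -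
    have "finite (range p)" by (rule finite_imageI) simp
    then have "range p \<noteq> UNIV" using infinite_UNIV_char_0[where 'a=complex] by metis
    then show thesis using that by (auto simp: Omega_def)
  qed
  have "(z, \<chi> i. Ln (z - p i)) \<in> S" using Omega_ne[OF z] by (simp add: S_def)
  then show ?thesis by blast
qed

lemma connected_S: "connected S"
proof (rule path_connected_imp_connected, unfold path_connected_def, intro ballI)
  fix q q' assume "q \<in> S" "q' \<in> S"
  then obtain \<gamma> where "path \<gamma>" "path_image \<gamma> \<subseteq> S" "\<gamma> 0 = q" "\<gamma> 1 = q'" using linked_all unfolding linked_def by blast
  then show "\<exists>g. path g \<and> path_image g \<subseteq> S \<and> pathstart g = q \<and> pathfinish g = q'"
    unfolding pathstart_def pathfinish_def by blast
qed

lemma homeomorphic_sheet: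
  assumes q: "q \<in> S"
  shows "homeomorphic_map (top_of_set (sheet q)) (top_of_set (ball (fst q) (rad (fst q)))) fst"
proof -
  have "homeomorphic_maps (top_of_set (sheet q)) (top_of_set (ball (fst q) (rad (fst q)))) fst (branch q)"
    unfolding homeomorphic_maps_def
  proof (intro conjI)
    show "continuous_map (top_of_set (sheet q)) (top_of_set (ball (fst q) (rad (fst q)))) fst"
      using fst_sheet[of q] by (auto simp: continuous_map_in_subtopology intro!: continuous_intros)
    show "continuous_map (top_of_set (ball (fst q) (rad (fst q)))) (top_of_set (sheet q)) (branch q)"
      using continuous_on_branch[of q] by (auto simp: continuous_map_in_subtopology sheet_def)
  qed (auto simp: sheet_def)
  then show ?thesis using homeomorphic_map_maps by blast
qed

theorem riemann_surface_cover: "riemann_surface (top_of_set S) atlas"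
  unfolding riemann_surface_def
proof (intro conjI ballI)
  show "topspace (top_of_set S) \<noteq> {}" using S_nonempty by simp
  show "connected_space (top_of_set S)" using connected_S connectedin_iff_connected[of S] by (simp add: connectedin_def)
  show "Hausdorff_space (top_of_set S)" by (simp add: Hausdorff_space_subtopology)
  show "(\<Union>C\<in>atlas. fst C) = topspace (top_of_set S)"
    using sheet_sub sheet_self by (force simp: atlas_def)
next
  fix C assume "C \<in> atlas"
  then obtain q where q: "q \<in> S" "C = (sheet q, fst)" by (auto simp: atlas_def)
  show "openin (top_of_set S) (fst C)" using q sheet_openin by simp
  show "open (coords C)" using q coords_sheet by simp
  show "homeomorphic_map (subtopology (top_of_set S) (fst C)) (top_of_set (coords C)) (snd C)"
    using homeomorphic_sheet[OF q(1)] sheet_sub[OF q(1)] q by (simp add: coords_sheet subtopology_subtopology inf_absorb2)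
  fix D assume "D \<in> atlas"
  then obtain q' where q': "D = (sheet q', fst)" by (auto simp: atlas_def)
  have "(\<lambda>z. z) holomorphic_on (snd C ` (fst C \<inter> fst D))" by (rule holomorphic_on_ident)
  then show "(snd D \<circ> param C) holomorphic_on (snd C ` (fst C \<inter> fst D))"
  proof (rule holomorphic_transform)
    fix z assume "z \<in> snd C ` (fst C \<inter> fst D)"
    then have "z \<in> fst ` sheet q" using q by force
    then have "z \<in> ball (fst q) (rad (fst q))" unfolding fst_sheet .
    then show "z = (snd D \<circ> param C) z" using param_sheet q q' by simp
  qed
qed

lemma atlas_cases: "C \<in> atlas \<Longrightarrow> (\<And>q. q \<in> S \<Longrightarrow> C = (sheet q, fst) \<Longrightarrow> thesis) \<Longrightarrow> thesis"
  by (auto simp: atlas_def)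

lemma conformal_coordinate_cover:
  assumes \<rho>: "continuous_on Omega \<rho>" "\<And>z. z \<in> Omega \<Longrightarrow> 0 < \<rho> z"
    and ds: "\<And>C q v. C \<in> atlas \<Longrightarrow> q \<in> fst C \<Longrightarrow> ds C (fst q) v = \<rho> (fst q) * cmod v"
  shows "conformal_coordinate S fst atlas ds \<rho> (\<lambda>_ z. z) (\<lambda>_ _. 1)"
proof
  show "continuous_on S fst" by (intro continuous_intros)
  show "(\<Union>C\<in>atlas. fst C) = S" using sheet_sub sheet_self by (force simp: atlas_def)
  show "openin (top_of_set S) (fst C)" if "C \<in> atlas" for C
    using that sheet_openin by (auto elim: atlas_cases)
  show "snd C q = fst q \<and> fst q = snd C q" if "C \<in> atlas" "q \<in> fst C" for C q using that by (auto simp: atlas_def)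
  show "((\<lambda>z. z) has_field_derivative 1) (at (fst q)) \<and> ((\<lambda>z. z) has_field_derivative 1) (at (snd C q))" for C :: "(complex \<times> (complex ^ 'm)) chart" and q
    by (auto intro!: derivative_eq_intros)
  show "continuous_on (fst ` fst C) (\<lambda>_. 1::complex) \<and> continuous_on (snd C ` fst C) (\<lambda>_. 1::complex)" for C :: "(complex \<times> (complex ^ 'm)) chart" by simp
  show "ds C (snd C q) v = \<rho> (fst q) * cmod (v * 1)" if "C \<in> atlas" "q \<in> fst C" for C q v
    using ds[OF that] that by (auto simp: atlas_def)
  show "continuous_on (fst ` S) \<rho>" using S_fst by (intro continuous_on_subset[OF \<rho>(1)]) auto
  show "0 < \<rho> (fst q)" if "q \<in> S" for q using \<rho>(2) S_fst that by blast
  show "\<exists>r>0. \<exists>s. continuous_on (ball (fst q) r) s \<and> s (fst q) = q \<and>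
        (\<forall>z\<in>ball (fst q) r. s z \<in> S \<and> fst (s z) = z) \<and> openin (top_of_set S) (s ` ball (fst q) r)" if q: "q \<in> S" for q
    using rad_pos[OF S_fst[OF q]] continuous_on_branch[of q] branch_centre[OF q] branch_in[OF q] sheet_openin[OF q]
    by (intro exI[of _ "rad (fst q)"] conjI exI[of _ "branch q"]) (auto simp: sheet_def)
  show "\<exists>\<gamma> F. path \<gamma> \<and> path_image \<gamma> \<subseteq> S \<and> C1_off F (fst \<circ> \<gamma>) \<and> \<gamma> 0 = q \<and> \<gamma> 1 = q'" if "q \<in> S" "q' \<in> S" for q q'
    using linked_all[OF that] by (simp add: linked_def)
qed

lemma log_derivative_along_curve:
  assumes \<gamma>: "path \<gamma>" "path_image \<gamma> \<subseteq> S" and t: "0 < t" "t < 1"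
    and d: "((fst \<circ> \<gamma>) has_vector_derivative D) (at t)"
  shows "((\<lambda>s. snd (\<gamma> s) $ i) has_vector_derivative D / (fst (\<gamma> t) - p i)) (at t)"
proof -
  have q: "\<gamma> t \<in> S" using \<gamma> t by (auto simp: path_image_def)
  let ?L = "\<lambda>z. snd (\<gamma> t) $ i + Ln ((z - p i) / (fst (\<gamma> t) - p i))"
  have "(?L has_field_derivative 1 / (fst (\<gamma> t) - p i)) (at (fst (\<gamma> t)))"
    using S_fst_ne[OF q, of i] by (auto intro!: derivative_eq_intros simp: complex_nonpos_Reals_iff)
  then have "((?L \<circ> (fst \<circ> \<gamma>)) has_vector_derivative D * (1 / (fst (\<gamma> t) - p i))) (at t)"
    by (intro field_vector_diff_chain_at[OF d]) (simp only: o_def)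
  then have L: "((?L \<circ> (fst \<circ> \<gamma>)) has_vector_derivative D / (fst (\<gamma> t) - p i)) (at t)" by simp
  have cont: "continuous_on {0<..<1} \<gamma>" using \<gamma>(1) unfolding path_def by (rule continuous_on_subset) auto
  obtain U where U: "open U" "sheet (\<gamma> t) = S \<inter> U" using sheet_openin[OF q] by (auto simp: openin_open)
  have "open ({0<..<1} \<inter> \<gamma> -` U)" using cont U(1) by (auto intro!: continuous_open_preimage)
  then show ?thesis
  proof (rule has_vector_derivative_transform_within_open[OF L])
    show "t \<in> {0<..<1} \<inter> \<gamma> -` U" using t sheet_self[OF q] U(2) by auto
    fix s assume "s \<in> {0<..<1} \<inter> \<gamma> -` U"
    moreover from this have "\<gamma> s \<in> S" using \<gamma>(2) by (auto simp: path_image_def)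
    ultimately have "\<gamma> s \<in> sheet (\<gamma> t)" using U by auto
    then have "\<gamma> s = branch (\<gamma> t) (fst (\<gamma> s))" by (auto simp: sheet_def)
    then have "snd (\<gamma> s) $ i = snd (branch (\<gamma> t) (fst (\<gamma> s))) $ i" by simp
    then show "(?L \<circ> (fst \<circ> \<gamma>)) s = snd (\<gamma> s) $ i" by (simp add: branch_def)
  qed
qed

text \<open>
  The logarithms \<open>w\<^sub>i\<close> are Lipschitz functions for the metric, since \<open>\<bar>dw\<^sub>i\<bar> = \<bar>dz\<bar> / \<bar>z - p i\<bar> \<le> \<rho>(z) \<bar>dz\<bar> / \<kappa>\<close>. So they remain bounded along a
  sequence at bounded distance, and a limit \<open>w\<close> of the logarithms determines the limit \<open>z = exp w\<^sub>i + p i\<close>, which is not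
  a puncture. Different points of \<open>S\<close> differ in some \<open>w\<^sub>i\<close>, as \<open>w\<close> determines \<open>z\<close>.
\<close>

theorem complete_cover:
  assumes \<rho>: "continuous_on Omega \<rho>" and \<kappa>: "0 < \<kappa>" "\<And>z i. z \<in> Omega \<Longrightarrow> \<kappa> / cmod (z - p i) \<le> \<rho> z"
    and ds: "\<And>C q v. C \<in> atlas \<Longrightarrow> q \<in> fst C \<Longrightarrow> ds C (fst q) v = \<rho> (fst q) * cmod v"
  shows "complete_surface (top_of_set S) atlas ds"
proof -
  have pos: "0 < \<rho> z" if "z \<in> Omega" for z
  proof -
    have "0 < \<kappa> / cmod (z - p undefined)" using \<kappa>(1) Omega_ne[OF that, of undefined] by simp
    then show ?thesis using \<kappa>(2)[OF that, of undefined] by linarith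
  qed
  interpret conformal_coordinate S fst atlas ds \<rho> "\<lambda>_ z. z" "\<lambda>_ _. 1"
    by (rule conformal_coordinate_cover[OF \<rho> pos ds])
  have lip: "cmod (snd q' $ i - snd q $ i) \<le> 1 / \<kappa> * len \<gamma>" if \<gamma>: "\<gamma> \<in> curves q q'" for q q' \<gamma> i
  proof -
    obtain F where g: "path \<gamma>" "path_image \<gamma> \<subseteq> S" "C1_off F (fst \<circ> \<gamma>)" "\<gamma> 0 = q" "\<gamma> 1 = q'" using \<gamma> by (auto simp: curves_def)
    define k where "k t = (if t \<in> {0..1} then speed \<rho> (fst \<circ> \<gamma>) t else 0)" for t
    have kint: "(k has_integral len \<gamma>) {0..1}"
      by (rule has_integral_eq[OF _ len_has_integral[OF \<gamma>]]) (simp add: k_def)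
    have "norm (snd (\<gamma> 1) $ i - snd (\<gamma> 0) $ i) \<le> 1 / \<kappa> * integral {0..1} k"
    proof (rule Lipschitz_along_curve[of F _ "\<lambda>t. vector_derivative (fst \<circ> \<gamma>) (at t) / (fst (\<gamma> t) - p i)"])
      show "finite F" using g by (simp add: C1_off_def)
      show "continuous_on {0..1} (\<lambda>t. snd (\<gamma> t) $ i)" using g(1) unfolding path_def by (intro continuous_intros)
      fix t assume t: "t \<in> {0<..<1} - F"
      then have "((fst \<circ> \<gamma>) has_vector_derivative vector_derivative (fst \<circ> \<gamma>) (at t)) (at t)"
        by (intro C1_off_derivative[OF g(3)]) auto
      then have 1: "((\<lambda>s. snd (\<gamma> s) $ i) has_vector_derivative vector_derivative (fst \<circ> \<gamma>) (at t) / (fst (\<gamma> t) - p i)) (at t)"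
        using t by (intro log_derivative_along_curve[OF g(1,2)]) auto
      have "\<gamma> t \<in> S" using t g by (auto simp: path_image_def)
      then have "\<kappa> / cmod (fst (\<gamma> t) - p i) \<le> \<rho> (fst (\<gamma> t))" by (intro \<kappa>(2) S_fst)
      then have "1 / cmod (fst (\<gamma> t) - p i) \<le> 1 / \<kappa> * \<rho> (fst (\<gamma> t))" using \<kappa>(1) by (simp add: field_simps)
      then have "cmod (vector_derivative (fst \<circ> \<gamma>) (at t)) * (1 / cmod (fst (\<gamma> t) - p i)) \<le>
          cmod (vector_derivative (fst \<circ> \<gamma>) (at t)) * (1 / \<kappa> * \<rho> (fst (\<gamma> t)))"
        by (rule mult_left_mono) simp
      then have 2: "norm (vector_derivative (fst \<circ> \<gamma>) (at t) / (fst (\<gamma> t) - p i)) \<le> 1 / \<kappa> * k t"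
        using t by (simp add: k_def speed_def norm_divide mult_ac)
      show "((\<lambda>s. snd (\<gamma> s) $ i) has_vector_derivative vector_derivative (fst \<circ> \<gamma>) (at t) / (fst (\<gamma> t) - p i)) (at t) \<and>
        norm (vector_derivative (fst \<circ> \<gamma>) (at t) / (fst (\<gamma> t) - p i)) \<le> 1 / \<kappa> * k t" using 1 2 by blast
    next
      show "k integrable_on {0..1}" using kint by blast
      show "0 \<le> k t" for t using speed_nonneg[OF \<gamma>, of t] by (simp add: k_def)
      show "0 \<le> 1 / \<kappa>" using \<kappa>(1) by simp
    qed
    then show ?thesis using g kint by (simp add: integral_unique)
  qed
  show ?thesis
  proof (rule complete_surfaceI)
    fix q q' assume q: "q \<in> S" "q' \<in> S" "q \<noteq> q'"
    have "\<exists>i. snd q $ i \<noteq> snd q' $ i"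
    proof (rule ccontr)
      assume "\<nexists>i. snd q $ i \<noteq> snd q' $ i"
      then have s: "snd q = snd q'" by (simp add: Finite_Cartesian_Product.vec_eq_iff)
      then have "fst q - p undefined = fst q' - p undefined" using q by (metis (mono_tags, lifting) S_def mem_Collect_eq)
      then show False using s q by (simp add: prod_eq_iff)
    qed
    then obtain i where i: "snd q $ i \<noteq> snd q' $ i" by blast
    show "\<exists>\<epsilon>>0. \<forall>\<gamma>\<in>curves q q'. \<epsilon> \<le> len \<gamma>"
    proof (intro exI conjI ballI)
      show "0 < \<kappa> * cmod (snd q' $ i - snd q $ i)" using i \<kappa>(1) by simp
      fix \<gamma> assume "\<gamma> \<in> curves q q'"
      from lip[OF this, of i] show "\<kappa> * cmod (snd q' $ i - snd q $ i) \<le> len \<gamma>" using \<kappa>(1) by (simp add: field_simps)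
    qed
  next
    fix \<sigma> :: "nat \<Rightarrow> complex \<times> (complex ^ 'm)" and B
    assume \<sigma>: "\<And>n. \<sigma> n \<in> S" and B: "\<And>n. \<exists>\<gamma>\<in>curves (\<sigma> 0) (\<sigma> n). len \<gamma> \<le> B"
    have b: "cmod (snd (\<sigma> n) $ i - snd (\<sigma> 0) $ i) \<le> 1 / \<kappa> * B" for n i
    proof -
      obtain \<gamma> where \<gamma>: "\<gamma> \<in> curves (\<sigma> 0) (\<sigma> n)" "len \<gamma> \<le> B" using B by blast
      have "1 / \<kappa> * len \<gamma> \<le> 1 / \<kappa> * B" using \<gamma> \<kappa>(1) by (intro mult_left_mono) auto
      then show ?thesis using lip[OF \<gamma>(1), of i] by linarith
    qed
    have "norm (snd (\<sigma> n)) \<le> (\<Sum>i\<in>UNIV. 1 / \<kappa> * B + cmod (snd (\<sigma> 0) $ i))" for n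
    proof -
      have "norm (snd (\<sigma> n)) \<le> (\<Sum>i\<in>UNIV. cmod (snd (\<sigma> n) $ i))" unfolding norm_vec_def by (rule L2_set_le_sum) simp
      also have "\<dots> \<le> (\<Sum>i\<in>UNIV. 1 / \<kappa> * B + cmod (snd (\<sigma> 0) $ i))"
      proof (rule sum_mono)
        fix i :: 'm
        show "cmod (snd (\<sigma> n) $ i) \<le> 1 / \<kappa> * B + cmod (snd (\<sigma> 0) $ i)"
          using norm_triangle_sub[of "snd (\<sigma> n) $ i" "snd (\<sigma> 0) $ i"] b[of n i] by linarith
      qed
      finally show ?thesis .
    qed
    then have "bounded (range (\<lambda>n. snd (\<sigma> n)))" by (auto simp: bounded_iff)
    then obtain w r where r: "strict_mono (r :: nat \<Rightarrow> nat)" "((\<lambda>n. snd (\<sigma> n)) \<circ> r) \<longlonglongrightarrow> w"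
      using bounded_imp_convergent_subsequence by blast
    have wi: "(\<lambda>n. exp (snd (\<sigma> (r n)) $ i)) \<longlonglongrightarrow> exp (w $ i)" for i
      using r(2) by (intro tendsto_intros) (simp add: o_def)
    have "(\<lambda>n. fst (\<sigma> (r n)) - p i) \<longlonglongrightarrow> exp (w $ i)" for i
      using wi[of i] \<sigma> by (simp add: S_def)
    then have z: "(\<lambda>n. fst (\<sigma> (r n))) \<longlonglongrightarrow> exp (w $ i) + p i" for i
      using tendsto_add[OF _ tendsto_const[of "p i"], of "\<lambda>n. fst (\<sigma> (r n)) - p i"] by simp
    define zz where "zz = exp (w $ undefined) + p undefined"
    have ez: "exp (w $ i) = zz - p i" for i
      using LIMSEQ_unique[OF z[of i] z[of undefined]] by (simp add: zz_def algebra_simps)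
    have "(zz, w) \<in> S" using ez by (simp add: S_def)
    moreover have "(\<lambda>n. (fst (\<sigma> (r n)), snd (\<sigma> (r n)))) \<longlonglongrightarrow> (zz, w)"
      using z[of undefined] r(2) by (intro tendsto_Pair) (simp_all add: zz_def o_def)
    ultimately show "\<exists>r q. strict_mono (r :: nat \<Rightarrow> nat) \<and> q \<in> S \<and> (\<sigma> \<circ> r) \<longlonglongrightarrow> q"
      using r(1) by (intro exI[of _ r] exI[of _ "(zz, w)"]) (simp add: o_def)
  qed
qed

end

section \<open>The punctured sphere\<close>

text \<open>
  The compactification has to live in the type of the covering surface. It is the round sphere in \<open>complex \<times> real\<close>, with
  the height repeated in all coordinates of the second component. One of the punctures is the origin, so that both poles are
  punctures and the coordinates \<open>z\<close> and \<open>1/z\<close> are defined on the whole punctured sphere \<open>M\<close>.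
\<close>

locale punctured_sphere = log_cover p for p :: "'m::finite \<Rightarrow> complex" +
  fixes i0 :: 'm
  assumes p_i0: "p i0 = 0"
begin

definition emb :: "complex \<times> real \<Rightarrow> complex \<times> (complex ^ 'm)" where
  "emb y = (fst y, \<chi> k. of_real (snd y))"

definition height :: "complex \<times> (complex ^ 'm) \<Rightarrow> real" where "height y = Re (snd y $ i0)"

definition Y :: "(complex \<times> (complex ^ 'm)) set" where "Y = emb ` sphere 0 1"

definition npole :: "complex \<times> (complex ^ 'm)" where "npole = emb (0, 1)"
definition spole :: "complex \<times> (complex ^ 'm)" where "spole = emb (0, -1)"

definition stereo :: "complex \<Rightarrow> complex \<times> (complex ^ 'm)" where
  "stereo z = emb (2 * z / of_real (1 + (cmod z)\<^sup>2), ((cmod z)\<^sup>2 - 1) / (1 + (cmod z)\<^sup>2))"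

text \<open>
  The inverse of the projection from the south pole, after complex conjugation; without the conjugation the change of
  coordinates would be antiholomorphic instead of \<open>z \<mapsto> 1/z\<close>.
\<close>

definition stereo' :: "complex \<Rightarrow> complex \<times> (complex ^ 'm)" where
  "stereo' u = emb (2 * cnj u / of_real (1 + (cmod u)\<^sup>2), (1 - (cmod u)\<^sup>2) / (1 + (cmod u)\<^sup>2))"

definition c1 :: "complex \<times> (complex ^ 'm) \<Rightarrow> complex" where "c1 y = fst y / of_real (1 - height y)"
definition c2 :: "complex \<times> (complex ^ 'm) \<Rightarrow> complex" where "c2 y = cnj (fst y) / of_real (1 + height y)"

definition B :: "(complex \<times> (complex ^ 'm)) chart set" where
  "B = {(Y - {npole}, c1), (Y - {spole}, c2)}"

definition P :: "(complex \<times> (complex ^ 'm)) set" where "P = insert npole (stereo ` range p)"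

definition M :: "(complex \<times> (complex ^ 'm)) set" where "M = stereo ` Omega"

lemma fst_emb [simp]: "fst (emb y) = fst y" and height_emb [simp]: "height (emb y) = snd y"
  by (simp_all add: emb_def height_def)

lemma sphere_iff: "(x, t) \<in> sphere (0 :: complex \<times> real) 1 \<longleftrightarrow> (cmod x)\<^sup>2 + t\<^sup>2 = 1"
  by (auto simp: dist_norm norm_prod_def real_sqrt_eq_1_iff)

lemma one_plus_sq: "1 + (cmod z)\<^sup>2 > 0" "1 + (cmod z)\<^sup>2 \<noteq> 0"
proof -
  show "1 + (cmod z)\<^sup>2 > 0" by (rule add_pos_nonneg) auto
  then show "1 + (cmod z)\<^sup>2 \<noteq> 0" by simp
qed

lemma YE:
  assumes "y \<in> Y" obtains x t where "y = emb (x, t)" "(cmod x)\<^sup>2 + t\<^sup>2 = 1"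
  using assms sphere_iff by (auto simp: Y_def)

lemma YI: "(cmod x)\<^sup>2 + t\<^sup>2 = 1 \<Longrightarrow> emb (x, t) \<in> Y"
  using sphere_iff by (auto simp: Y_def)

lemma sq_identity: "(2 * r / (1 + s))\<^sup>2 + ((s - 1) / (1 + s))\<^sup>2 = 1" if "s = r\<^sup>2" for r s :: real
proof -
  have "1 + s > 0" unfolding that by (rule add_pos_nonneg) auto
  then show ?thesis unfolding power_divide by (simp add: that field_simps) (simp add: power2_eq_square algebra_simps)
qed

lemma stereo_Y: "stereo z \<in> Y"
proof -
  have "cmod (2 * z / of_real (1 + (cmod z)\<^sup>2)) = 2 * cmod z / (1 + (cmod z)\<^sup>2)"
    using one_plus_sq(1)[of z] by (simp only: norm_divide norm_mult norm_of_real) simp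
  then show ?thesis unfolding stereo_def using sq_identity[of "(cmod z)\<^sup>2" "cmod z"] by (intro YI) simp
qed

lemma stereo'_Y: "stereo' z \<in> Y"
proof -
  have "cmod (2 * cnj z / of_real (1 + (cmod z)\<^sup>2)) = 2 * cmod z / (1 + (cmod z)\<^sup>2)"
    using one_plus_sq(1)[of z] by (simp only: norm_divide norm_mult norm_of_real complex_mod_cnj) simp
  moreover have "((1 - (cmod z)\<^sup>2) / (1 + (cmod z)\<^sup>2))\<^sup>2 = (((cmod z)\<^sup>2 - 1) / (1 + (cmod z)\<^sup>2))\<^sup>2"
    by (simp add: power_divide power2_commute)
  ultimately show ?thesis unfolding stereo'_def using sq_identity[of "(cmod z)\<^sup>2" "cmod z"] by (intro YI) simp
qed

lemma one_minus_height: "1 - height (stereo z) = 2 / (1 + (cmod z)\<^sup>2)"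
  "1 + height (stereo z) = 2 * (cmod z)\<^sup>2 / (1 + (cmod z)\<^sup>2)"
  "1 + height (stereo' z) = 2 / (1 + (cmod z)\<^sup>2)"
  using one_plus_sq(2)[of z] by (simp_all add: stereo_def stereo'_def field_simps)

lemma c1_stereo [simp]: "c1 (stereo z) = z"
proof -
  have "complex_of_real (1 + (cmod z)\<^sup>2) \<noteq> 0" using one_plus_sq(2)[of z] by (simp only: of_real_eq_0_iff not_False_eq_True)
  then show ?thesis unfolding c1_def one_minus_height by (simp add: stereo_def of_real_divide del: of_real_add)
qed

lemma c2_stereo' [simp]: "c2 (stereo' z) = z"
proof -
  have "complex_of_real (1 + (cmod z)\<^sup>2) \<noteq> 0" using one_plus_sq(2)[of z] by (simp only: of_real_eq_0_iff not_False_eq_True)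
  then show ?thesis unfolding c2_def one_minus_height by (simp add: stereo'_def of_real_divide del: of_real_add)
qed

lemma c2_stereo: "c2 (stereo z) = inverse z"
proof (cases "z = 0")
  case True
  then show ?thesis by (simp add: c2_def stereo_def)
next
  case False
  have ne: "complex_of_real (1 + (cmod z)\<^sup>2) \<noteq> 0" using one_plus_sq(2)[of z] by (simp only: of_real_eq_0_iff not_False_eq_True)
  have "c2 (stereo z) = cnj z / of_real ((cmod z)\<^sup>2)"
    unfolding c2_def one_minus_height using ne by (simp add: stereo_def of_real_divide del: of_real_add of_real_power)
  also have "\<dots> = inverse z" using False by (simp add: complex_norm_square field_simps del: of_real_power)
  finally show ?thesis .
qed

lemma height_1: "y \<in> Y \<Longrightarrow> height y = 1 \<Longrightarrow> y = npole"
  by (elim YE) (simp add: npole_def)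

lemma height_m1: "y \<in> Y \<Longrightarrow> height y = -1 \<Longrightarrow> y = spole"
  by (elim YE) (simp add: spole_def)

lemma stereo_c1:
  assumes "y \<in> Y" "y \<noteq> npole" shows "stereo (c1 y) = y"
proof -
  obtain x t where y: "y = emb (x, t)" "(cmod x)\<^sup>2 + t\<^sup>2 = 1" using YE[OF assms(1)] .
  have t: "1 - t \<noteq> 0" using height_1[OF assms(1)] assms(2) y by auto
  have s: "(cmod (c1 y))\<^sup>2 = (1 + t) / (1 - t)"
  proof -
    have "cmod (c1 y) = cmod x / \<bar>1 - t\<bar>" by (simp only: c1_def y fst_emb height_emb fst_conv snd_conv norm_divide norm_of_real)
    then have "(cmod (c1 y))\<^sup>2 = (1 - t\<^sup>2) / (1 - t)\<^sup>2" using y(2) by (simp add: power_divide)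
    also have "1 - t\<^sup>2 = (1 + t) * (1 - t)" by (simp add: power2_eq_square algebra_simps)
    finally show ?thesis using t by (simp add: power2_eq_square)
  qed
  have a: "1 + (cmod (c1 y))\<^sup>2 = 2 / (1 - t)" unfolding s using t by (simp add: field_simps)
  have b: "((cmod (c1 y))\<^sup>2 - 1) / (2 / (1 - t)) = t" unfolding s using t by (simp add: field_simps)
  have x: "2 * c1 y / of_real (2 / (1 - t)) = x"
  proof -
    have "complex_of_real (1 - t) \<noteq> 0" using t by (simp only: of_real_eq_0_iff not_False_eq_True)
    then show ?thesis by (simp add: c1_def y(1) of_real_divide del: of_real_diff)
  qed
  show ?thesis unfolding stereo_def a b x by (rule y(1)[symmetric])
qed

lemma stereo'_c2:
  assumes "y \<in> Y" "y \<noteq> spole" shows "stereo' (c2 y) = y"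
proof -
  obtain x t where y: "y = emb (x, t)" "(cmod x)\<^sup>2 + t\<^sup>2 = 1" using YE[OF assms(1)] .
  have t: "1 + t \<noteq> 0" using height_m1[OF assms(1)] assms(2) y by (auto simp: add_eq_0_iff)
  have s: "(cmod (c2 y))\<^sup>2 = (1 - t) / (1 + t)"
  proof -
    have "cmod (c2 y) = cmod x / \<bar>1 + t\<bar>" by (simp only: c2_def y fst_emb height_emb fst_conv snd_conv norm_divide norm_of_real complex_mod_cnj)
    then have "(cmod (c2 y))\<^sup>2 = (1 - t\<^sup>2) / (1 + t)\<^sup>2" using y(2) by (simp add: power_divide)
    also have "1 - t\<^sup>2 = (1 - t) * (1 + t)" by (simp add: power2_eq_square algebra_simps)
    finally show ?thesis using t by (simp add: power2_eq_square)
  qed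
  have a: "1 + (cmod (c2 y))\<^sup>2 = 2 / (1 + t)" unfolding s using t by (simp add: field_simps)
  have b: "(1 - (cmod (c2 y))\<^sup>2) / (2 / (1 + t)) = t" unfolding s using t by (simp add: field_simps)
  have x: "2 * cnj (c2 y) / of_real (2 / (1 + t)) = x"
  proof -
    have "complex_of_real (1 + t) \<noteq> 0" using t by (simp only: of_real_eq_0_iff not_False_eq_True)
    then show ?thesis by (simp add: c2_def y(1) of_real_divide del: of_real_add)
  qed
  show ?thesis unfolding stereo'_def a b x by (rule y(1)[symmetric])
qed

lemma stereo_ne: "stereo z \<noteq> npole"
proof
  assume "stereo z = npole"
  then have "1 - height (stereo z) = 0" by (simp add: npole_def)
  then show False unfolding one_minus_height using one_plus_sq(2)[of z] by simp
qed

lemma stereo'_ne: "stereo' z \<noteq> spole"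
proof
  assume "stereo' z = spole"
  then have "1 + height (stereo' z) = 0" by (simp add: spole_def)
  then show False unfolding one_minus_height using one_plus_sq(2)[of z] by simp
qed

lemma stereo_0: "stereo 0 = spole" by (simp add: stereo_def spole_def)

lemma inj_stereo: "stereo z = stereo z' \<longleftrightarrow> z = z'" by (metis c1_stereo)

lemma c1_stereo': "c1 (stereo' u) = inverse u"
proof (cases "stereo' u = npole")
  case True
  then have "c2 (stereo' u) = 0" by (simp add: npole_def c2_def)
  then have "u = 0" by simp
  then show ?thesis by (simp add: c1_def stereo'_def)
next
  case False
  then have "stereo (c1 (stereo' u)) = stereo' u" using stereo_c1 stereo'_Y by blast
  then have "c2 (stereo (c1 (stereo' u))) = u" by simp
  then have "inverse (c1 (stereo' u)) = u" by (simp only: c2_stereo)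
  then show ?thesis by (metis inverse_inverse_eq)
qed

lemma poles_ne: "npole \<noteq> spole"
proof
  assume "npole = spole"
  then have "height npole = height spole" by simp
  then show False by (simp add: npole_def spole_def)
qed

lemma c1_ne_c2: "c1 \<noteq> c2"
proof
  assume "c1 = c2"
  then have "c1 (stereo 2) = c2 (stereo 2)" by simp
  then show False by (simp add: c2_stereo)
qed

lemma continuous_emb: "continuous_on X emb"
  unfolding emb_def by (intro continuous_intros)

lemma continuous_stereo: "continuous_on X stereo"
  unfolding stereo_def
proof (rule continuous_on_compose2[OF continuous_emb[of UNIV]])
  have "complex_of_real (1 + (cmod x)\<^sup>2) \<noteq> 0" "1 + (cmod x)\<^sup>2 \<noteq> 0" for x
    using one_plus_sq(2)[of x] by (simp_all only: of_real_eq_0_iff not_False_eq_True)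
  then show "continuous_on X (\<lambda>z. (2 * z / of_real (1 + (cmod z)\<^sup>2), ((cmod z)\<^sup>2 - 1) / (1 + (cmod z)\<^sup>2)))"
    by (intro continuous_intros) auto
qed simp

lemma continuous_stereo': "continuous_on X stereo'"
  unfolding stereo'_def
proof (rule continuous_on_compose2[OF continuous_emb[of UNIV]])
  have "complex_of_real (1 + (cmod x)\<^sup>2) \<noteq> 0" "1 + (cmod x)\<^sup>2 \<noteq> 0" for x
    using one_plus_sq(2)[of x] by (simp_all only: of_real_eq_0_iff not_False_eq_True)
  then show "continuous_on X (\<lambda>z. (2 * cnj z / of_real (1 + (cmod z)\<^sup>2), (1 - (cmod z)\<^sup>2) / (1 + (cmod z)\<^sup>2)))"
    by (intro continuous_intros) auto
qed simp

lemma continuous_height: "continuous_on X height"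
  unfolding height_def by (intro continuous_intros)

lemma continuous_c1: "continuous_on (Y - {npole}) c1"
proof -
  have "complex_of_real (1 - height y) \<noteq> 0" if "y \<in> Y - {npole}" for y
  proof
    assume "complex_of_real (1 - height y) = 0"
    then have "1 - height y = 0" by (simp only: of_real_eq_0_iff)
    then show False using height_1[of y] that by simp
  qed
  then show ?thesis unfolding c1_def by (intro continuous_intros continuous_height) auto
qed

lemma continuous_c2: "continuous_on (Y - {spole}) c2"
proof -
  have "complex_of_real (1 + height y) \<noteq> 0" if "y \<in> Y - {spole}" for y
  proof
    assume "complex_of_real (1 + height y) = 0"
    then have "1 + height y = 0" by (simp only: of_real_eq_0_iff)
    then show False using height_m1[of y] that by (simp add: add_eq_0_iff)
  qed
  then show ?thesis unfolding c2_def by (intro continuous_intros continuous_height) auto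
qed

lemma compact_Y: "compact Y"
  unfolding Y_def by (intro compact_continuous_image continuous_emb compact_sphere)

lemma connected_Y: "connected Y"
  unfolding Y_def by (intro connected_continuous_image continuous_emb connected_sphere) simp

lemma image_c1: "c1 ` (Y - {npole}) = UNIV"
proof -
  have "z \<in> c1 ` (Y - {npole})" for z
    by (rule image_eqI[of _ _ "stereo z"]) (use stereo_Y stereo_ne in auto)
  then show ?thesis by auto
qed

lemma image_c2: "c2 ` (Y - {spole}) = UNIV"
proof -
  have "z \<in> c2 ` (Y - {spole})" for z
    by (rule image_eqI[of _ _ "stereo' z"]) (use stereo'_Y stereo'_ne in auto)
  then show ?thesis by auto
qed

lemma param_c1:
  assumes "X \<subseteq> Y - {npole}" "stereo z \<in> X" shows "param (X, c1) z = stereo z"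
proof -
  have "inj_on c1 X" by (rule inj_on_inverseI[of _ stereo]) (use assms stereo_c1 in blast)
  then show ?thesis unfolding param_def using inv_into_f_eq[of c1 X "stereo z" z] assms by simp
qed

lemma param_c2:
  assumes "X \<subseteq> Y - {spole}" "stereo' z \<in> X" shows "param (X, c2) z = stereo' z"
proof -
  have "inj_on c2 X" by (rule inj_on_inverseI[of _ stereo']) (use assms stereo'_c2 in blast)
  then show ?thesis unfolding param_def using inv_into_f_eq[of c2 X "stereo' z" z] assms by simp
qed

lemma homeomorphic_c1: "homeomorphic_map (top_of_set (Y - {npole})) (top_of_set UNIV) c1"
proof -
  have "homeomorphic_maps (top_of_set (Y - {npole})) (top_of_set UNIV) c1 stereo"
    unfolding homeomorphic_maps_def
    using continuous_c1 continuous_stereo[of UNIV] stereo_Y stereo_ne stereo_c1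
    by (auto simp: continuous_map_in_subtopology)
  then show ?thesis using homeomorphic_map_maps by blast
qed

lemma homeomorphic_c2: "homeomorphic_map (top_of_set (Y - {spole})) (top_of_set UNIV) c2"
proof -
  have "homeomorphic_maps (top_of_set (Y - {spole})) (top_of_set UNIV) c2 stereo'"
    unfolding homeomorphic_maps_def
    using continuous_c2 continuous_stereo'[of UNIV] stereo'_Y stereo'_ne stereo'_c2
    by (auto simp: continuous_map_in_subtopology)
  then show ?thesis using homeomorphic_map_maps by blast
qed

theorem riemann_surface_sphere: "riemann_surface (top_of_set Y) B"
  unfolding riemann_surface_def
proof (intro conjI ballI)
  show "topspace (top_of_set Y) \<noteq> {}" using stereo_Y by auto
  show "connected_space (top_of_set Y)" using connected_Y connectedin_iff_connected[of Y] by (simp add: connectedin_def)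
  show "Hausdorff_space (top_of_set Y)" by (simp add: Hausdorff_space_subtopology)
  show "(\<Union>C\<in>B. fst C) = topspace (top_of_set Y)" using poles_ne by (auto simp: B_def)
next
  fix C assume C: "C \<in> B"
  show "openin (top_of_set Y) (fst C)" using C by (auto simp: B_def intro!: openin_delete)
  show "open (coords C)" using C image_c1 image_c2 by (auto simp: B_def coords_def)
  show "homeomorphic_map (subtopology (top_of_set Y) (fst C)) (top_of_set (coords C)) (snd C)"
    using C homeomorphic_c1 homeomorphic_c2
    by (auto simp: B_def coords_def image_c1 image_c2 subtopology_subtopology Int_Diff inf_absorb2 Diff_subset)
  fix D assume D: "D \<in> B"
  from C D consider "C = (Y - {npole}, c1)" "D = (Y - {npole}, c1)" | "C = (Y - {npole}, c1)" "D = (Y - {spole}, c2)"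
    | "C = (Y - {spole}, c2)" "D = (Y - {npole}, c1)" | "C = (Y - {spole}, c2)" "D = (Y - {spole}, c2)"
    by (auto simp: B_def)
  then show "(snd D \<circ> param C) holomorphic_on (snd C ` (fst C \<inter> fst D))"
  proof cases
    case 1
    show ?thesis
      by (rule holomorphic_transform[OF holomorphic_on_ident]) (use 1 param_c1[of "Y - {npole}"] stereo_Y stereo_ne in auto)
  next
    case 2
    have "0 \<notin> snd C ` (fst C \<inter> fst D)"
    proof
      assume "0 \<in> snd C ` (fst C \<inter> fst D)"
      then obtain y where y: "y \<in> fst C \<inter> fst D" "0 = snd C y" by (rule imageE)
      then have "y \<in> Y" "y \<noteq> npole" "y \<noteq> spole" "c1 y = 0" using 2 by simp_all
      then show False using stereo_c1[of y] stereo_0 by simp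
    qed
    then have "inverse holomorphic_on (snd C ` (fst C \<inter> fst D))" by (intro holomorphic_intros) auto
    then show ?thesis
      by (rule holomorphic_transform) (use 2 param_c1[of "Y - {npole}"] stereo_Y stereo_ne in \<open>auto simp: c2_stereo\<close>)
  next
    case 3
    have "stereo' 0 = npole" by (simp add: stereo'_def npole_def)
    have "0 \<notin> snd C ` (fst C \<inter> fst D)"
    proof
      assume "0 \<in> snd C ` (fst C \<inter> fst D)"
      then obtain y where y: "y \<in> fst C \<inter> fst D" "0 = snd C y" by (rule imageE)
      then have "y \<in> Y" "y \<noteq> npole" "y \<noteq> spole" "c2 y = 0" using 3 by simp_all
      then show False using stereo'_c2[of y] \<open>stereo' 0 = npole\<close> by simp
    qed
    then have "inverse holomorphic_on (snd C ` (fst C \<inter> fst D))" by (intro holomorphic_intros) auto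
    then show ?thesis
      by (rule holomorphic_transform) (use 3 param_c2[of "Y - {spole}"] stereo'_Y stereo'_ne in \<open>auto simp: c1_stereo'\<close>)
  next
    case 4
    show ?thesis
      by (rule holomorphic_transform[OF holomorphic_on_ident]) (use 4 param_c2[of "Y - {spole}"] stereo'_Y stereo'_ne in auto)
  qed
qed

lemma compact_space_Y: "compact_space (top_of_set Y)"
  using compact_Y by (simp add: compact_space_subtopology)

lemma P_props: "finite P" "P \<subseteq> Y"
proof -
  show "finite P" by (simp add: P_def)
  have "npole \<in> Y" unfolding npole_def by (rule YI) simp
  then show "P \<subseteq> Y" using stereo_Y by (auto simp: P_def)
qed

lemma M_eq: "Y - P = M" "Y - {npole} - P = M" "Y - {spole} - P = M"
proof -
  show e: "Y - P = M"
  proof (intro equalityI subsetI)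
    fix y assume y: "y \<in> Y - P"
    then have "y = stereo (c1 y)" using stereo_c1 by (auto simp: P_def)
    moreover from this have "c1 y \<in> Omega" using y unfolding P_def Omega_def by (metis ComplI DiffE imageI insertCI)
    ultimately show "y \<in> M" unfolding M_def by blast
  next
    fix y assume "y \<in> M"
    then obtain z where z: "z \<in> Omega" "y = stereo z" by (auto simp: M_def)
    then have "stereo z \<noteq> stereo (p i)" for i using Omega_ne[of z i] inj_stereo by simp
    then show "y \<in> Y - P" using z stereo_Y stereo_ne by (auto simp: P_def)
  qed
  have "npole \<in> P" "spole \<in> P" using stereo_0 p_i0 by (auto simp: P_def intro!: image_eqI[of _ _ "0::complex"] rangeI)
  then show "Y - {npole} - P = M" "Y - {spole} - P = M" unfolding e[symmetric] by auto
qed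

lemma M_sub: "M \<subseteq> Y - {npole}" "M \<subseteq> Y - {spole}" "M \<subseteq> Y"
  using M_eq by blast+

definition BM :: "(complex \<times> (complex ^ 'm)) chart set" where "BM = {(M, c1), (M, c2)}"

lemma puncture_atlas_B: "puncture_atlas B P = BM"
  unfolding puncture_atlas_def B_def BM_def by (simp add: M_eq)

lemma M_topology: "subtopology (top_of_set Y) (topspace (top_of_set Y) - P) = top_of_set M"
  by (simp add: M_eq subtopology_subtopology inf_absorb2 M_sub)

lemma Omega_nz: "z \<in> Omega \<Longrightarrow> z \<noteq> 0" using Omega_ne[of z i0] p_i0 by simp

lemma c1_M: "y \<in> M \<Longrightarrow> c1 y \<in> Omega \<and> stereo (c1 y) = y \<and> c2 y = inverse (c1 y)"
  by (auto simp: M_def c2_stereo)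

lemma c1_image_M: "c1 ` M = Omega" by (auto simp: M_def image_iff)

lemma stereo'_inverse: "z \<noteq> 0 \<Longrightarrow> stereo' (inverse z) = stereo z"
proof -
  assume "z \<noteq> 0"
  then have "stereo z \<noteq> spole" using stereo_0 inj_stereo by metis
  then show ?thesis using stereo'_c2[OF stereo_Y] c2_stereo by metis
qed

lemma param_M1: "z \<in> Omega \<Longrightarrow> param (M, c1) z = stereo z"
  using param_c1[OF M_sub(1)] by (simp add: M_def)

lemma param_M2: "z \<in> Omega \<Longrightarrow> param (M, c2) (inverse z) = stereo z"
  using param_c2[OF M_sub(2), of "inverse z"] stereo'_inverse[OF Omega_nz, of z] by (simp add: M_def)

lemma stereo_ball_openin:
  assumes "ball z r \<subseteq> Omega" shows "openin (top_of_set M) (stereo ` ball z r)"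
proof -
  have "openin (top_of_set M) (M \<inter> c1 -` ball z r)"
    by (rule continuous_openin_preimage_gen[OF continuous_on_subset[OF continuous_c1 M_sub(1)]]) simp
  also have "M \<inter> c1 -` ball z r = stereo ` ball z r"
  proof (intro equalityI subsetI)
    fix y assume "y \<in> M \<inter> c1 -` ball z r"
    then show "y \<in> stereo ` ball z r" using c1_M[of y] by (intro image_eqI[of _ _ "c1 y"]) auto
  qed (use assms in \<open>auto simp: M_def\<close>)
  finally show ?thesis .
qed

definition proj :: "complex \<times> (complex ^ 'm) \<Rightarrow> complex \<times> (complex ^ 'm)" where "proj q = stereo (fst q)"

lemma Omega_lift: "z \<in> Omega \<Longrightarrow> (z, \<chi> i. Ln (z - p i)) \<in> S"
  using Omega_ne[of z] by (simp add: S_def)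

text \<open>
  Discs that avoid the punctures are evenly covered: the sheets over a disc are the branches through the points over its
  centre, and they are disjoint because a branch is determined by its value at the centre.
\<close>

theorem covering_proj: "covering_of (top_of_set S) (top_of_set M) proj"
  unfolding covering_of_def
proof (intro conjI ballI)
  have "continuous_on S proj" unfolding proj_def
    by (rule continuous_on_compose2[OF continuous_stereo[of UNIV]]) (auto intro!: continuous_intros)
  moreover have "proj ` S \<subseteq> M" using S_fst by (auto simp: proj_def M_def)
  ultimately show "continuous_map (top_of_set S) (top_of_set M) proj" by (auto simp: continuous_map_in_subtopology)
  show "proj ` topspace (top_of_set S) = topspace (top_of_set M)"
  proof -
    have "M \<subseteq> proj ` S"
    proof
      fix y assume "y \<in> M"
      then obtain z where z: "z \<in> Omega" "y = stereo z" by (auto simp: M_def)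
      then show "y \<in> proj ` S" using Omega_lift[OF z(1)] by (intro image_eqI[of _ _ "(z, \<chi> i. Ln (z - p i))"]) (auto simp: proj_def)
    qed
    then show ?thesis using \<open>proj ` S \<subseteq> M\<close> by auto
  qed
next
  fix y assume "y \<in> topspace (top_of_set M)"
  then obtain z where z: "z \<in> Omega" "y = stereo z" by (auto simp: M_def)
  define V where "V = stereo ` ball z (rad z)"
  define U where "U = sheet ` {q \<in> S. fst q = z}"
  have Vo: "openin (top_of_set M) V" unfolding V_def by (rule stereo_ball_openin[OF ball_Omega])
  have VM: "V \<subseteq> M" using ball_Omega by (auto simp: V_def M_def)
  have yV: "y \<in> V" using z rad_pos by (auto simp: V_def)
  have op: "openin (top_of_set S) X" if "X \<in> U" for X using that sheet_openin by (auto simp: U_def)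
  have dj: "pairwise disjnt U"
    unfolding pairwise_def
  proof (intro ballI impI)
    fix X X' assume X: "X \<in> U" "X' \<in> U" "X \<noteq> X'"
    then obtain q q' where q: "q \<in> S" "fst q = z" "X = sheet q" "q' \<in> S" "fst q' = z" "X' = sheet q'" by (auto simp: U_def)
    show "disjnt X X'"
    proof (rule ccontr)
      assume "\<not> disjnt X X'"
      then obtain x where "x \<in> sheet q" "x \<in> sheet q'" using q by (auto simp: disjnt_def)
      then have "x = branch q (fst x)" "x = branch q' (fst x)" by (auto simp: sheet_def branch_def)
      then have "branch q (fst x) = branch q' (fst x)" by simp
      then have "snd q = snd q'" using q by (simp add: branch_def Finite_Cartesian_Product.vec_eq_iff)
      then have "q = q'" using q by (simp add: prod_eq_iff)
      then show False using q X by simp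
    qed
  qed
  have un: "\<Union>U = {q \<in> topspace (top_of_set S). proj q \<in> V}"
  proof (intro equalityI subsetI)
    fix x assume "x \<in> \<Union>U"
    then obtain q where q: "q \<in> S" "fst q = z" "x \<in> sheet q" by (auto simp: U_def)
    then have "x \<in> S" using sheet_sub by blast
    moreover have "fst x \<in> ball z (rad z)" using q fst_sheet[of q] by blast
    ultimately show "x \<in> {q \<in> topspace (top_of_set S). proj q \<in> V}" by (auto simp: proj_def V_def)
  next
    fix x assume "x \<in> {q \<in> topspace (top_of_set S). proj q \<in> V}"
    then have x: "x \<in> S" "fst x \<in> ball z (rad z)" by (auto simp: proj_def V_def inj_stereo)
    define q where "q = (z, \<chi> i. snd x $ i - Ln ((fst x - p i) / (z - p i)))"
    have "exp (snd x $ i - Ln ((fst x - p i) / (z - p i))) = z - p i" for i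
    proof -
      have "exp (snd x $ i - Ln ((fst x - p i) / (z - p i))) = exp (snd x $ i) / ((fst x - p i) / (z - p i))"
        using ball_ratio(2)[OF x(2), of i] by (simp add: exp_diff)
      also have "\<dots> = z - p i" using x(1) S_fst_ne[OF x(1), of i] Omega_ne[OF z(1), of i] by (simp add: S_def)
      finally show ?thesis .
    qed
    then have qS: "q \<in> S" by (simp add: S_def q_def)
    have "branch q (fst x) = x" by (simp add: branch_def q_def prod_eq_iff Finite_Cartesian_Product.vec_eq_iff)
    then have "x \<in> sheet q" using x(2) unfolding sheet_def by (intro image_eqI[of _ _ "fst x"]) (auto simp: q_def)
    then show "x \<in> \<Union>U" using qS by (auto simp: U_def q_def)
  qed
  have hm: "homeomorphic_map (subtopology (top_of_set S) X) (subtopology (top_of_set M) V) proj" if "X \<in> U" for X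
  proof -
    from that obtain q where q: "q \<in> S" "fst q = z" "X = sheet q" by (auto simp: U_def)
    have "homeomorphic_maps (top_of_set (ball z (rad z))) (top_of_set V) stereo c1"
      unfolding homeomorphic_maps_def
      using continuous_stereo continuous_on_subset[OF continuous_c1, of V] VM M_sub
      by (auto simp: continuous_map_in_subtopology V_def)
    then have "homeomorphic_map (top_of_set (ball z (rad z))) (top_of_set V) stereo" using homeomorphic_map_maps by blast
    then have "homeomorphic_map (top_of_set X) (top_of_set V) (stereo \<circ> fst)"
      using homeomorphic_map_compose[OF homeomorphic_sheet[OF q(1)]] q by simp
    moreover have "stereo \<circ> fst = proj" by (auto simp: proj_def)
    ultimately show ?thesis using VM sheet_sub[OF q(1)] q(3) by (simp add: subtopology_subtopology inf_absorb2)
  qed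
  show "\<exists>V. openin (top_of_set M) V \<and> y \<in> V \<and>
        (\<exists>\<U>. (\<forall>U\<in>\<U>. openin (top_of_set S) U) \<and> pairwise disjnt \<U> \<and>
              \<Union>\<U> = {p \<in> topspace (top_of_set S). proj p \<in> V} \<and>
              (\<forall>U\<in>\<U>. homeomorphic_map (subtopology (top_of_set S) U) (subtopology (top_of_set M) V) proj))"
  proof (intro exI conjI)
    show "\<forall>X\<in>U. openin (top_of_set S) X" using op by blast
    show "\<forall>X\<in>U. homeomorphic_map (subtopology (top_of_set S) X) (subtopology (top_of_set M) V) proj"
      using hm by blast
  qed (fact Vo yV dj un)+
qed

lemma chart_proj_param:
  assumes "q \<in> S" "z \<in> ball (fst q) (rad (fst q))"
  shows "(c1 \<circ> proj \<circ> param (sheet q, fst)) z = z" "(c2 \<circ> proj \<circ> param (sheet q, fst)) z = inverse z"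
  using param_sheet[OF assms(2)] by (simp_all add: proj_def c2_stereo)

theorem holomorphic_proj: "holomorphic_surface_map (top_of_set S) atlas (top_of_set M) BM proj"
  unfolding holomorphic_surface_map_def
proof (intro conjI ballI)
  show "continuous_map (top_of_set S) (top_of_set M) proj" using covering_proj by (simp add: covering_of_def)
  fix C D assume C: "C \<in> atlas" and D: "D \<in> BM"
  then obtain q where q: "q \<in> S" "C = (sheet q, fst)" by (auto simp: atlas_def)
  let ?X = "snd C ` {x \<in> fst C. proj x \<in> fst D}"
  have "?X \<subseteq> fst ` sheet q" using q by (simp only: fst_conv snd_conv) blast
  then have X: "?X \<subseteq> ball (fst q) (rad (fst q))" unfolding fst_sheet .
  show "(snd D \<circ> proj \<circ> param C) holomorphic_on ?X"
  proof (cases "snd D = c1")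
    case True
    show ?thesis
      by (rule holomorphic_transform[OF holomorphic_on_ident]) (use X chart_proj_param(1)[OF q(1)] True q in force)
  next
    case False
    then have D2: "snd D = c2" using D by (auto simp: BM_def)
    have "inverse holomorphic_on ?X"
      using X ball_Omega Omega_nz by (intro holomorphic_intros) blast
    then show ?thesis
      by (rule holomorphic_transform) (use X chart_proj_param(2)[OF q(1)] D2 q in force)
  qed
qed

text \<open>
  The transition from the coordinate \<open>z\<close> to a chart of \<open>M\<close>, and its derivative.
\<close>

definition T :: "(complex \<times> (complex ^ 'm)) chart \<Rightarrow> complex \<Rightarrow> complex" where
  "T C = (if snd C = c1 then (\<lambda>z. z) else inverse)"
definition T' :: "(complex \<times> (complex ^ 'm)) chart \<Rightarrow> complex \<Rightarrow> complex" where
  "T' C z = (if snd C = c1 then 1 else - inverse (z\<^sup>2))"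

lemma conformal_coordinate_base:
  assumes \<rho>: "continuous_on Omega \<rho>" "\<And>z. z \<in> Omega \<Longrightarrow> 0 < \<rho> z"
    and ds1: "\<And>z v. z \<in> Omega \<Longrightarrow> ds (M, c1) z v = \<rho> z * cmod v"
    and ds2: "\<And>z v. z \<in> Omega \<Longrightarrow> ds (M, c2) (inverse z) v = \<rho> z * cmod v * (cmod z)\<^sup>2"
  shows "conformal_coordinate M c1 BM ds \<rho> T T'"
proof
  note c21 = c1_ne_c2[symmetric]
  show "continuous_on M c1" by (rule continuous_on_subset[OF continuous_c1 M_sub(1)])
  show "(\<Union>C\<in>BM. fst C) = M" by (simp add: BM_def)
  show "openin (top_of_set M) (fst C)" if "C \<in> BM" for C using that by (auto simp: BM_def)
  show "snd C q = T C (c1 q) \<and> c1 q = T C (snd C q)" if "C \<in> BM" "q \<in> fst C" for C q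
    using that c1_M[of q] c21 by (auto simp: BM_def T_def)
  have inv: "(inverse has_field_derivative - inverse (z\<^sup>2)) (at z)" if "z \<noteq> 0" for z :: complex
    using DERIV_inverse[OF that, of UNIV] by (simp add: power2_eq_square numeral_2_eq_2)
  show "(T C has_field_derivative T' C (c1 q)) (at (c1 q)) \<and> (T C has_field_derivative T' C (snd C q)) (at (snd C q))"
    if C: "C \<in> BM" and q: "q \<in> fst C" for C q
  proof (cases "snd C = c1")
    case True
    then show ?thesis by (auto simp: T_def T'_def intro!: derivative_eq_intros)
  next
    case False
    then have "snd C = c2" "q \<in> M" using C q by (auto simp: BM_def)
    then have "c1 q \<noteq> 0" "snd C q \<noteq> 0" using c1_M[of q] Omega_nz by auto
    then show ?thesis using False inv by (simp add: T_def T'_def[abs_def])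
  qed
  show "continuous_on (c1 ` fst C) (T' C) \<and> continuous_on (snd C ` fst C) (T' C)" if C: "C \<in> BM" for C
  proof (cases "snd C = c1")
    case True
    then show ?thesis by (simp add: T'_def[abs_def])
  next
    case False
    then have C2: "snd C = c2" "fst C = M" using C by (auto simp: BM_def)
    have "z\<^sup>2 \<noteq> 0" if "z \<in> c1 ` M \<union> c2 ` M" for z using that c1_M Omega_nz by fastforce
    then show ?thesis using False C2 unfolding T'_def[abs_def] by (auto intro!: continuous_intros)
  qed
  show "ds C (snd C q) v = \<rho> (c1 q) * cmod (v * T' C (snd C q))" if C: "C \<in> BM" and q: "q \<in> fst C" for C q v
  proof (cases "snd C = c1")
    case True
    then have "C = (M, c1)" "q \<in> M" using C q c21 by (auto simp: BM_def)
    then show ?thesis using ds1[of "c1 q" v] c1_M[of q] by (simp add: T'_def)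
  next
    case False
    then have "C = (M, c2)" "q \<in> M" using C q by (auto simp: BM_def)
    then show ?thesis using ds2[of "c1 q" v] c1_M[of q] c21
      by (simp add: T'_def norm_mult norm_power power_inverse norm_inverse)
  qed
  show "continuous_on (c1 ` M) \<rho>" using \<rho>(1) by (simp add: c1_image_M)
  show "0 < \<rho> (c1 q)" if "q \<in> M" for q using \<rho>(2) c1_M[OF that] by blast
  show "\<exists>r>0. \<exists>s. continuous_on (ball (c1 q) r) s \<and> s (c1 q) = q \<and>
        (\<forall>z\<in>ball (c1 q) r. s z \<in> M \<and> c1 (s z) = z) \<and> openin (top_of_set M) (s ` ball (c1 q) r)" if q: "q \<in> M" for q
    using rad_pos[of "c1 q"] continuous_stereo[of "ball (c1 q) (rad (c1 q))"] c1_M[OF q] ball_Omega[of "c1 q"] stereo_ball_openin[OF ball_Omega, of "c1 q"]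
    by (intro exI[of _ "rad (c1 q)"] conjI exI[of _ stereo]) (auto simp: M_def)
  show "\<exists>\<gamma> F. path \<gamma> \<and> path_image \<gamma> \<subseteq> M \<and> C1_off F (c1 \<circ> \<gamma>) \<and> \<gamma> 0 = q \<and> \<gamma> 1 = q'" if q: "q \<in> M" "q' \<in> M" for q q'
  proof -
    have z: "c1 q \<in> Omega" "c1 q' \<in> Omega" using c1_M q by auto
    obtain s where s: "s \<in> S" "fst s = c1 q" using Omega_lift[OF z(1)] by force
    obtain s' where s': "s' \<in> S" "fst s' = c1 q'" using Omega_lift[OF z(2)] by force
    obtain \<gamma> F where \<gamma>: "path \<gamma>" "path_image \<gamma> \<subseteq> S" "C1_off F (fst \<circ> \<gamma>)" "\<gamma> 0 = s" "\<gamma> 1 = s'"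
      using linked_all[OF s(1) s'(1)] unfolding linked_def by blast
    have "path (proj \<circ> \<gamma>)"
      using \<gamma>(1) unfolding path_def proj_def o_def
      by (intro continuous_on_compose2[OF continuous_stereo[of UNIV]] continuous_intros) auto
    moreover have "path_image (proj \<circ> \<gamma>) \<subseteq> M" using \<gamma>(2) S_fst unfolding path_image_def image_subset_iff by (simp add: proj_def M_def)
    moreover have "c1 \<circ> (proj \<circ> \<gamma>) = fst \<circ> \<gamma>" by (auto simp: proj_def)
    moreover have "(proj \<circ> \<gamma>) 0 = q" "(proj \<circ> \<gamma>) 1 = q'" using \<gamma> s s' c1_M q by (auto simp: proj_def)
    ultimately show ?thesis using \<gamma>(3) by (intro exI[of _ "proj \<circ> \<gamma>"] exI[of _ F]) auto
  qed
qed

text \<open>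
  On \<open>M\<close> itself only the absolute values of \<open>z - p i\<close> have logarithms. Both conditions of \<open>complete_surfaceI\<close> are obtained
  from Lipschitz functions \<open>ln (\<bar>z - a\<bar>\<^sup>2 + e)\<close>: with \<open>e = 1\<close> and \<open>a\<close> one of two given points it separates them, and with
  \<open>e = 0\<close> and \<open>a = p i\<close> it keeps sequences at bounded distance away from \<open>p i\<close> and, for the puncture at the origin, also
  from infinity.
\<close>

theorem complete_base:
  assumes \<rho>: "continuous_on Omega \<rho>" and \<kappa>: "0 < \<kappa>" "\<And>z i. z \<in> Omega \<Longrightarrow> \<kappa> / cmod (z - p i) \<le> \<rho> z"
    and ds1: "\<And>z v. z \<in> Omega \<Longrightarrow> ds (M, c1) z v = \<rho> z * cmod v"
    and ds2: "\<And>z v. z \<in> Omega \<Longrightarrow> ds (M, c2) (inverse z) v = \<rho> z * cmod v * (cmod z)\<^sup>2"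
  shows "complete_surface (top_of_set M) BM ds"
proof -
  have pos: "0 < \<rho> z" if "z \<in> Omega" for z
  proof -
    have "0 < \<kappa> / cmod (z - p i0)" using \<kappa>(1) Omega_ne[OF that, of i0] by simp
    then show ?thesis using \<kappa>(2)[OF that, of i0] by linarith
  qed
  interpret conformal_coordinate M c1 BM ds \<rho> T T'
    by (rule conformal_coordinate_base[OF \<rho> pos ds1 ds2])
  have lip: "\<bar>ln ((c1 q' - a) \<bullet> (c1 q' - a) + e) - ln ((c1 q - a) \<bullet> (c1 q - a) + e)\<bar> \<le> K * len \<gamma>"
    if \<gamma>: "\<gamma> \<in> curves q q'" and K: "0 \<le> K"
      and pos: "\<And>z. z \<in> Omega \<Longrightarrow> 0 < (z - a) \<bullet> (z - a) + e"
      and bd: "\<And>z. z \<in> Omega \<Longrightarrow> 2 * cmod (z - a) / ((z - a) \<bullet> (z - a) + e) \<le> K * \<rho> z" for q q' \<gamma> a e K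
  proof -
    define g where "g = c1 \<circ> \<gamma>"
    obtain F where g: "path \<gamma>" "path_image \<gamma> \<subseteq> M" "C1_off F g" "\<gamma> 0 = q" "\<gamma> 1 = q'" using \<gamma> by (auto simp: curves_def g_def)
    have gO: "g t \<in> Omega" if "t \<in> {0..1}" for t
    proof -
      have "\<gamma> t \<in> M" using g(2) that unfolding path_image_def by blast
      then show ?thesis using c1_M unfolding g_def o_def by blast
    qed
    have gc: "continuous_on {0..1} g" unfolding g_def by (rule coord_path_cont[OF g(1,2)])
    define k where "k t = (if t \<in> {0..1} then speed \<rho> g t else 0)" for t
    have kint: "(k has_integral len \<gamma>) {0..1}"
      by (rule has_integral_eq[OF _ len_has_integral[OF \<gamma>]]) (simp add: k_def g_def)
    have "norm (ln ((g 1 - a) \<bullet> (g 1 - a) + e) - ln ((g 0 - a) \<bullet> (g 0 - a) + e)) \<le> K * integral {0..1} k"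
    proof (rule Lipschitz_along_curve[of F "\<lambda>t. ln ((g t - a) \<bullet> (g t - a) + e)"
          "\<lambda>t. 2 * ((g t - a) \<bullet> vector_derivative g (at t)) / ((g t - a) \<bullet> (g t - a) + e)"])
      show "finite F" using g by (simp add: C1_off_def)
      have "(g t - a) \<bullet> (g t - a) + e \<noteq> 0" if "t \<in> {0..1}" for t using pos[OF gO[OF that]] by simp
      then show "continuous_on {0..1} (\<lambda>t. ln ((g t - a) \<bullet> (g t - a) + e))" by (intro continuous_intros gc) auto
      fix t assume t: "t \<in> {0<..<1} - F"
      then have t': "t \<in> {0..1}" by auto
      define D where "D = vector_derivative g (at t)"
      have d: "(g has_vector_derivative D) (at t)" unfolding D_def
        using t by (intro C1_off_derivative[OF g(3)]) auto
      have dd: "((\<lambda>t. (g t - a) \<bullet> (g t - a) + e) has_real_derivative 2 * ((g t - a) \<bullet> D)) (at t)"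
        unfolding has_field_derivative_def
        by (rule has_derivative_eq_rhs)
          (auto intro!: derivative_eq_intros d[unfolded has_vector_derivative_def] simp: fun_eq_iff inner_commute algebra_simps)
      have "((\<lambda>t. ln ((g t - a) \<bullet> (g t - a) + e)) has_real_derivative 1 / ((g t - a) \<bullet> (g t - a) + e) * (2 * ((g t - a) \<bullet> D))) (at t)"
        using pos[OF gO[OF t']] by (intro DERIV_chain2[OF DERIV_ln_divide dd])
      then have 1: "((\<lambda>t. ln ((g t - a) \<bullet> (g t - a) + e)) has_vector_derivative 2 * ((g t - a) \<bullet> D) / ((g t - a) \<bullet> (g t - a) + e)) (at t)"
        by (simp add: has_real_derivative_iff_has_vector_derivative)
      have "norm (2 * ((g t - a) \<bullet> D) / ((g t - a) \<bullet> (g t - a) + e)) \<le> 2 * cmod (g t - a) / ((g t - a) \<bullet> (g t - a) + e) * cmod D"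
        using pos[OF gO[OF t']] Cauchy_Schwarz_ineq2[of "g t - a" D]
        by (simp add: abs_mult divide_right_mono)
      also have "\<dots> \<le> K * \<rho> (g t) * cmod D" by (intro mult_right_mono bd gO t') simp
      finally have 2: "norm (2 * ((g t - a) \<bullet> D) / ((g t - a) \<bullet> (g t - a) + e)) \<le> K * k t"
        using t' by (simp add: k_def speed_def D_def mult_ac)
      show "((\<lambda>t. ln ((g t - a) \<bullet> (g t - a) + e)) has_vector_derivative 2 * ((g t - a) \<bullet> vector_derivative g (at t)) / ((g t - a) \<bullet> (g t - a) + e)) (at t) \<and>
        norm (2 * ((g t - a) \<bullet> vector_derivative g (at t)) / ((g t - a) \<bullet> (g t - a) + e)) \<le> K * k t"
        using 1 2 unfolding D_def by blast
    next
      show "k integrable_on {0..1}" using kint by blast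
      show "0 \<le> k t" for t using speed_nonneg[OF \<gamma>, of t] by (simp add: k_def g_def)
      show "0 \<le> K" by (rule K)
    qed
    then show ?thesis using g kint by (simp add: integral_unique g_def)
  qed
  show ?thesis
  proof (rule complete_surfaceI)
    fix q q' assume q: "q \<in> M" "q' \<in> M" "q \<noteq> q'"
    define a where "a = c1 q"
    define K where "K = 2 * (1 + cmod (a - p i0)) / \<kappa>"
    have K: "0 < K" using \<kappa>(1) by (auto simp: K_def intro!: divide_pos_pos add_pos_nonneg)
    have ne: "c1 q' \<noteq> a" using q c1_M by (metis a_def)
    have pos1: "0 < (z - a) \<bullet> (z - a) + 1" for z by (rule add_nonneg_pos) auto
    have bd: "2 * cmod (z - a) / ((z - a) \<bullet> (z - a) + 1) \<le> K * \<rho> z" if z: "z \<in> Omega" for z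
    proof -
      let ?u = "cmod (z - a)" and ?v = "cmod (z - p i0)" and ?c = "cmod (a - p i0)"
      have v: "0 < ?v" using Omega_ne[OF z, of i0] by simp
      have vu: "?v \<le> ?u + ?c" using norm_triangle_ineq[of "z - a" "a - p i0"] by simp
      have u1: "?u \<le> ?u\<^sup>2 + 1" using zero_le_power2[of "?u - 1/2"] by (simp add: power2_eq_square algebra_simps)
      have "?u * ?v \<le> ?u * (?u + ?c)" using vu by (rule mult_left_mono) simp
      also have "\<dots> = ?u\<^sup>2 + ?c * ?u" by (simp add: power2_eq_square algebra_simps)
      also have "\<dots> \<le> (?u\<^sup>2 + 1) + ?c * (?u\<^sup>2 + 1)" using u1 by (intro add_mono mult_left_mono) auto
      also have "\<dots> = (1 + ?c) * (?u\<^sup>2 + 1)" by (simp add: algebra_simps)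
      finally have *: "?u * ?v \<le> (1 + ?c) * (?u\<^sup>2 + 1)" .
      have s: "0 < ?u\<^sup>2 + 1" by (rule add_nonneg_pos) auto
      have "?u / (?u\<^sup>2 + 1) \<le> (1 + ?c) / ?v"
        unfolding pos_divide_le_eq[OF s] times_divide_eq_left pos_le_divide_eq[OF v] by (rule *)
      then have "2 * (?u / (?u\<^sup>2 + 1)) \<le> 2 * ((1 + ?c) / ?v)" by (rule mult_left_mono) simp
      then have "2 * ?u / (?u\<^sup>2 + 1) \<le> 2 * (1 + ?c) / ?v" by (simp only: times_divide_eq_right)
      also have "\<dots> = K * (\<kappa> / ?v)" using \<kappa>(1) by (simp add: K_def)
      also have "\<dots> \<le> K * \<rho> z" using K \<kappa>(2)[OF z, of i0] by (intro mult_left_mono) auto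
      finally show ?thesis by (simp add: dot_square_norm)
    qed
    show "\<exists>\<epsilon>>0. \<forall>\<gamma>\<in>curves q q'. \<epsilon> \<le> len \<gamma>"
    proof (intro exI conjI ballI)
      have "0 < (c1 q' - a) \<bullet> (c1 q' - a)" using ne by simp
      then have "0 < ln ((c1 q' - a) \<bullet> (c1 q' - a) + 1)" by (intro ln_gt_zero) simp
      then show "0 < ln ((c1 q' - a) \<bullet> (c1 q' - a) + 1) / K" using K by simp
      fix \<gamma> assume "\<gamma> \<in> curves q q'"
      from lip[OF this _ pos1 bd] K have "\<bar>ln ((c1 q' - a) \<bullet> (c1 q' - a) + 1) - ln ((c1 q - a) \<bullet> (c1 q - a) + 1)\<bar> \<le> K * len \<gamma>" by simp
      then have "ln ((c1 q' - a) \<bullet> (c1 q' - a) + 1) \<le> K * len \<gamma>" by (simp add: a_def)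
      then show "ln ((c1 q' - a) \<bullet> (c1 q' - a) + 1) / K \<le> len \<gamma>" using K by (simp add: divide_le_eq mult.commute)
    qed
  next
    fix \<sigma> :: "nat \<Rightarrow> complex \<times> (complex ^ 'm)" and Bd
    assume \<sigma>: "\<And>n. \<sigma> n \<in> M" and Bd: "\<And>n. \<exists>\<gamma>\<in>curves (\<sigma> 0) (\<sigma> n). len \<gamma> \<le> Bd"
    define z where "z n = c1 (\<sigma> n)" for n
    have zO: "z n \<in> Omega" for n using c1_M \<sigma> by (auto simp: z_def)
    define r where "r n i = (z n - p i) \<bullet> (z n - p i)" for n i
    have rpos: "0 < r n i" for n i using Omega_ne[OF zO[of n], of i] by (simp add: r_def)
    have bnd: "\<bar>ln (r n i) - ln (r 0 i)\<bar> \<le> 2 / \<kappa> * Bd" for n i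
    proof -
      obtain \<gamma> where \<gamma>: "\<gamma> \<in> curves (\<sigma> 0) (\<sigma> n)" "len \<gamma> \<le> Bd" using Bd by blast
      have "\<bar>ln ((c1 (\<sigma> n) - p i) \<bullet> (c1 (\<sigma> n) - p i) + 0) - ln ((c1 (\<sigma> 0) - p i) \<bullet> (c1 (\<sigma> 0) - p i) + 0)\<bar> \<le> 2 / \<kappa> * len \<gamma>"
      proof (rule lip[OF \<gamma>(1)])
        show "0 \<le> 2 / \<kappa>" using \<kappa>(1) by simp
        fix w assume w: "w \<in> Omega"
        then show "0 < (w - p i) \<bullet> (w - p i) + 0" using Omega_ne[OF w, of i] by simp
        have "2 * cmod (w - p i) / ((w - p i) \<bullet> (w - p i)) = 2 / \<kappa> * (\<kappa> / cmod (w - p i))"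
          using \<kappa>(1) Omega_ne[OF w, of i] by (simp add: dot_square_norm power2_eq_square)
        also have "\<dots> \<le> 2 / \<kappa> * \<rho> w" using \<kappa>(1) \<kappa>(2)[OF w, of i] by (intro mult_left_mono) auto
        finally show "2 * cmod (w - p i) / ((w - p i) \<bullet> (w - p i) + 0) \<le> 2 / \<kappa> * \<rho> w" by simp
      qed
      also have "\<dots> \<le> 2 / \<kappa> * Bd" using \<gamma>(2) \<kappa>(1) by (intro mult_left_mono) auto
      finally show ?thesis by (simp add: r_def z_def)
    qed
    have up: "r n i \<le> exp (ln (r 0 i) + 2 / \<kappa> * Bd)" for n i
    proof -
      have "ln (r n i) \<le> ln (r 0 i) + 2 / \<kappa> * Bd" using bnd[of n i] by linarith
      then show ?thesis using rpos[of n i] by (metis exp_le_cancel_iff exp_ln)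
    qed
    have lo: "exp (ln (r 0 i) - 2 / \<kappa> * Bd) \<le> r n i" for n i
    proof -
      have "ln (r 0 i) - 2 / \<kappa> * Bd \<le> ln (r n i)" using bnd[of n i] by linarith
      then show ?thesis using rpos[of n i] by (metis exp_le_cancel_iff exp_ln)
    qed
    have "bounded (range z)"
    proof -
      have "cmod (z n) \<le> sqrt (exp (ln (r 0 i0) + 2 / \<kappa> * Bd))" for n
        using up[of n i0] by (intro real_le_rsqrt) (simp add: r_def p_i0 dot_square_norm)
      then show ?thesis by (auto simp: bounded_iff)
    qed
    then obtain w s where s: "strict_mono (s :: nat \<Rightarrow> nat)" "(z \<circ> s) \<longlonglongrightarrow> w"
      using bounded_imp_convergent_subsequence by blast
    have wO: "w \<in> Omega"
    proof -
      have "w \<noteq> p i" for i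
      proof -
        have "(\<lambda>n. r (s n) i) \<longlonglongrightarrow> (w - p i) \<bullet> (w - p i)"
          using s(2) unfolding r_def by (intro tendsto_intros) (simp_all add: o_def)
        then have "exp (ln (r 0 i) - 2 / \<kappa> * Bd) \<le> (w - p i) \<bullet> (w - p i)"
          by (rule LIMSEQ_le_const) (use lo in auto)
        moreover have "0 < exp (ln (r 0 i) - 2 / \<kappa> * Bd)" by simp
        ultimately show ?thesis by auto
      qed
      then show ?thesis by (auto simp: Omega_def)
    qed
    have "(\<lambda>n. stereo ((z \<circ> s) n)) \<longlonglongrightarrow> stereo w"
      using continuous_stereo[of UNIV] s(2) by (metis UNIV_I continuous_on_tendsto_compose eventually_sequentiallyI)
    moreover have "stereo ((z \<circ> s) n) = (\<sigma> \<circ> s) n" for n using c1_M[OF \<sigma>[of "s n"]] by (simp add: z_def)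
    ultimately have "(\<sigma> \<circ> s) \<longlonglongrightarrow> stereo w" by (simp add: o_def)
    then show "\<exists>r q. strict_mono (r :: nat \<Rightarrow> nat) \<and> q \<in> M \<and> (\<sigma> \<circ> r) \<longlonglongrightarrow> q"
      using s(1) wO by (intro exI[of _ s] exI[of _ "stereo w"]) (auto simp: M_def)
  qed
qed

end

section \<open>Conformal harmonic maps\<close>

lemma vec_has_derivative_Re:
  fixes H :: "'m::finite \<Rightarrow> complex \<Rightarrow> complex"
  assumes T: "open T" "z \<in> T" and H: "\<And>k. (H k has_field_derivative H' k) (at z)"
    and g: "\<And>w. w \<in> T \<Longrightarrow> g w = (\<chi> k. Re (H k w))"
  shows "(g has_derivative (\<lambda>v. \<chi> k. Re (H' k * v))) (at z)"
proof -
  have "((\<lambda>w. \<chi> k. Re (H k w)) has_derivative (\<lambda>v. \<chi> k. Re (H' k * v))) (at z)"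
  proof (subst has_derivative_componentwise_within, rule ballI)
    fix b :: "real ^ 'm" assume "b \<in> Basis"
    then obtain i where b: "b = axis i 1" by (auto simp: Basis_vec_def)
    have "((\<lambda>w. Re (H i w)) has_derivative (\<lambda>v. Re (H' i * v))) (at z)"
      by (rule has_derivative_Re) (use H[of i] in \<open>simp add: has_field_derivative_def\<close>)
    then show "((\<lambda>x. (\<chi> k. Re (H k x)) \<bullet> b) has_derivative (\<lambda>x. (\<chi> k. Re (H' k * x)) \<bullet> b)) (at z)"
      by (simp add: b inner_axis)
  qed
  then show ?thesis by (rule has_derivative_transform_within_open[OF _ T]) (simp add: g)
qed

lemma vec_has_derivative_complex:
  fixes H :: "'m::finite \<Rightarrow> complex \<Rightarrow> complex"
  assumes T: "open T" "z \<in> T" and H: "\<And>k. (H k has_field_derivative H' k) (at z)"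
    and g: "\<And>w. w \<in> T \<Longrightarrow> g w = (\<chi> k. H k w)"
  shows "(g has_derivative (\<lambda>v. \<chi> k. H' k * v)) (at z)"
proof -
  have "((\<lambda>w. \<chi> k. H k w) has_derivative (\<lambda>v. \<chi> k. H' k * v)) (at z)"
  proof (subst has_derivative_componentwise_within, rule ballI)
    fix b :: "complex ^ 'm" assume "b \<in> Basis"
    then obtain i e where b: "b = axis i e" by (auto simp: Basis_vec_def)
    have "((\<lambda>w. H i w \<bullet> e) has_derivative (\<lambda>v. (H' i * v) \<bullet> e)) (at z)"
      by (rule has_derivative_inner_left) (use H[of i] in \<open>simp add: has_field_derivative_def\<close>)
    then show "((\<lambda>x. (\<chi> k. H k x) \<bullet> b) has_derivative (\<lambda>x. (\<chi> k. H' k * x) \<bullet> b)) (at z)"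
      by (simp add: b inner_axis)
  qed
  then show ?thesis by (rule has_derivative_transform_within_open[OF _ T]) (simp add: g)
qed

lemma pd_Re:
  assumes T: "open T" "z \<in> T" and H: "\<And>k. (H k has_field_derivative H' k) (at z)"
    and g: "\<And>w. w \<in> T \<Longrightarrow> g w = (\<chi> k. Re (H k w))"
  shows "pd e g z = (\<chi> k. Re (H' k * e))"
  unfolding pd_def using frechet_derivative_at[OF vec_has_derivative_Re[OF T H g]] by metis

lemma fold_pd_Re_differentiable:
  assumes T: "open T" "z \<in> T" and H: "\<And>k. H k holomorphic_on T"
    and g: "\<And>w. w \<in> T \<Longrightarrow> g w = (\<chi> k. Re (H k w))"
  shows "fold pd es g differentiable (at z)"
  using H g
proof (induction es arbitrary: g H)
  case Nil
  have "(g has_derivative (\<lambda>v. \<chi> k. Re (deriv (H k) z * v))) (at z)"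
    by (rule vec_has_derivative_Re[OF T _ Nil.prems(2)]) (use Nil.prems(1) T in \<open>auto intro: holomorphic_derivI\<close>)
  then show ?case by (auto simp: differentiable_def)
next
  case (Cons e es)
  have "fold pd es (pd e g) differentiable (at z)"
  proof (rule Cons.IH)
    show "(\<lambda>w. deriv (H k) w * e) holomorphic_on T" for k
      using Cons.prems(1)[of k] T(1) by (intro holomorphic_intros holomorphic_deriv)
    show "pd e g w = (\<chi> k. Re (deriv (H k) w * e))" if w: "w \<in> T" for w
      by (rule pd_Re[OF T(1) w _ Cons.prems(2)]) (use Cons.prems(1) T(1) w in \<open>auto intro: holomorphic_derivI\<close>)
  qed
  then show ?case by simp
qed

lemma closest_point_subspace_minus:
  fixes V :: "'a::euclidean_space set"
  assumes V: "subspace V" shows "closest_point V (- w) = - closest_point V w"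
proof -
  have cl: "closed V" and ne: "V \<noteq> {}" and cv: "convex V"
    using V closed_subspace subspace_0 subspace_imp_convex by auto
  have inV: "closest_point V w \<in> V" by (rule closest_point_in_set[OF cl ne])
  have "- closest_point V w = closest_point V (- w)"
  proof (rule closest_point_unique[OF cv cl])
    show "- closest_point V w \<in> V" using inV V by (simp add: subspace_neg)
    show "\<forall>z\<in>V. dist (- w) (- closest_point V w) \<le> dist (- w) z"
    proof
      fix z assume "z \<in> V"
      then have "dist w (closest_point V w) \<le> dist w (- z)" using V by (intro closest_point_le[OF cl]) (simp add: subspace_neg)
      also have "\<dots> = dist (- w) z" by (simp add: dist_norm norm_minus_commute) (metis add.commute diff_minus_eq_add minus_diff_eq norm_minus_cancel uminus_add_conv_diff)
      finally show "dist (- w) (- closest_point V w) \<le> dist (- w) z" by (simp add: dist_minus)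
    qed
  qed
  then show ?thesis ..
qed

lemma normal_part_minus: "normal_part g z (- w) = - normal_part g z w"
  unfolding normal_part_def by (simp add: closest_point_subspace_minus)

text \<open>
  The square of \<open>Re w\<close> is half the sum of \<open>\<bar>w\<bar>\<^sup>2\<close> and \<open>Re (w\<^sup>2)\<close>, and the second part cancels in the sum over a null vector.
\<close>

lemma null_vector_identities:
  fixes a :: "'m::finite \<Rightarrow> complex"
  assumes "(\<Sum>k\<in>UNIV. (a k)\<^sup>2) = 0"
  shows "(\<Sum>k\<in>UNIV. (Re (a k * v))\<^sup>2) = 1/2 * (\<Sum>k\<in>UNIV. (cmod (a k))\<^sup>2) * (cmod v)\<^sup>2"
    and "(\<Sum>k\<in>UNIV. (Re (a k))\<^sup>2) = (\<Sum>k\<in>UNIV. (Im (a k))\<^sup>2)"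
    and "(\<Sum>k\<in>UNIV. Re (a k) * Im (a k)) = 0"
proof -
  have e: "(Re w)\<^sup>2 = 1/2 * ((cmod w)\<^sup>2 + Re (w\<^sup>2))" for w
    unfolding cmod_power2 by (simp add: power2_eq_square)
  have "(\<Sum>k\<in>UNIV. (Re (a k * v))\<^sup>2) = 1/2 * ((\<Sum>k\<in>UNIV. (cmod (a k * v))\<^sup>2) + Re (\<Sum>k\<in>UNIV. (a k * v)\<^sup>2))"
    unfolding e by (simp add: sum.distrib sum_divide_distrib[symmetric] add_divide_distrib)
  also have "(\<Sum>k\<in>UNIV. (a k * v)\<^sup>2) = 0"
    using assms by (simp add: power_mult_distrib sum_distrib_right[symmetric])
  finally show "(\<Sum>k\<in>UNIV. (Re (a k * v))\<^sup>2) = 1/2 * (\<Sum>k\<in>UNIV. (cmod (a k))\<^sup>2) * (cmod v)\<^sup>2"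
    by (simp add: norm_mult power_mult_distrib sum_distrib_right)
  have "Re (\<Sum>k\<in>UNIV. (a k)\<^sup>2) = 0" "Im (\<Sum>k\<in>UNIV. (a k)\<^sup>2) = 0" using assms by simp_all
  then show "(\<Sum>k\<in>UNIV. (Re (a k))\<^sup>2) = (\<Sum>k\<in>UNIV. (Im (a k))\<^sup>2)" "(\<Sum>k\<in>UNIV. Re (a k) * Im (a k)) = 0"
    by (simp_all add: power2_eq_square sum_subtractf sum.distrib mult.commute)
       (simp_all add: sum_distrib_left[symmetric])
qed

lemma norm_Re_null_vector:
  assumes "(\<Sum>k\<in>UNIV. (a k)\<^sup>2) = 0"
  shows "norm (\<chi> k::'m::finite. Re (a k * v)) = sqrt (1/2 * (\<Sum>k\<in>UNIV. (cmod (a k))\<^sup>2)) * cmod v"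
proof -
  have "norm (\<chi> k::'m. Re (a k * v)) = sqrt (\<Sum>k\<in>UNIV. (Re (a k * v))\<^sup>2)"
    by (simp add: norm_vec_def L2_set_def)
  also have "\<dots> = sqrt (1/2 * (\<Sum>k\<in>UNIV. (cmod (a k))\<^sup>2) * (cmod v)\<^sup>2)"
    unfolding null_vector_identities(1)[OF assms] ..
  also have "\<dots> = sqrt (1/2 * (\<Sum>k\<in>UNIV. (cmod (a k))\<^sup>2)) * cmod v"
    unfolding real_sqrt_mult by simp
  finally show ?thesis .
qed

text \<open>
  The real part of a holomorphic null curve is conformal and harmonic. Conformality makes the mean curvature a multiple of
  the normal part of the Laplacian, and the second derivatives in the two directions are opposite to each other.
\<close>

lemma conformal_minimal_Re:
  fixes H :: "'m::finite \<Rightarrow> complex \<Rightarrow> complex"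
  assumes T: "open T" "z \<in> T" and H: "\<And>k. H k holomorphic_on T"
    and g: "\<And>w. w \<in> T \<Longrightarrow> g w = (\<chi> k. Re (H k w))"
    and null: "(\<Sum>k\<in>UNIV. (deriv (H k) z)\<^sup>2) = 0" and nz: "\<exists>k. deriv (H k) z \<noteq> 0"
  shows "inj (frechet_derivative g (at z))" "norm (pd 1 g z) = norm (pd \<i> g z)"
    "pd 1 g z \<bullet> pd \<i> g z = 0" "mean_curvature_vector g z = 0"
proof -
  define a where "a k = deriv (H k) z" for k
  have der: "(H k has_field_derivative deriv (H k) w) (at w)" if "w \<in> T" for k w
    using H T(1) that by (rule holomorphic_derivI)
  have fd: "frechet_derivative g (at z) = (\<lambda>v. \<chi> k. Re (a k * v))"
    using frechet_derivative_at[OF vec_has_derivative_Re[OF T der[OF T(2)] g]] by (simp add: a_def)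
  have pos: "0 < (\<Sum>k\<in>UNIV. (cmod (a k))\<^sup>2)"
  proof -
    obtain k where "a k \<noteq> 0" using nz by (auto simp: a_def)
    then show ?thesis by (intro sum_pos2[of _ k]) auto
  qed
  show "inj (frechet_derivative g (at z))"
  proof (rule injI)
    fix v w assume e: "frechet_derivative g (at z) v = frechet_derivative g (at z) w"
    have "(\<chi> k::'m. Re (a k * (v - w))) = 0"
      using e by (simp add: fd Finite_Cartesian_Product.vec_eq_iff algebra_simps)
    then have "sqrt (1/2 * (\<Sum>k\<in>UNIV. (cmod (a k))\<^sup>2)) * cmod (v - w) = 0"
      using norm_Re_null_vector[of a "v - w"] null by (simp add: a_def)
    then show "v = w" using pos by simp
  qed
  have p1: "pd e g w = (\<chi> k. Re (deriv (H k) w * e))" if "w \<in> T" for e w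
    by (rule pd_Re[OF T(1) that der[OF that] g])
  have a1: "pd 1 g z = (\<chi> k. Re (a k))" and ai: "pd \<i> g z = (\<chi> k. - Im (a k))"
    using p1[OF T(2)] by (simp_all add: a_def)
  note nid = null_vector_identities[of a, OF null[folded a_def]]
  show n: "norm (pd 1 g z) = norm (pd \<i> g z)"
    unfolding a1 ai using nid(2) by (simp add: norm_vec_def L2_set_def)
  show F: "pd 1 g z \<bullet> pd \<i> g z = 0"
    unfolding a1 ai inner_vec_def using nid(3) by (simp add: sum_negf)
  have EG: "pd 1 g z \<bullet> pd 1 g z = pd \<i> g z \<bullet> pd \<i> g z" using n by (simp add: dot_square_norm)
  have p2: "pd e' (pd e g) z = (\<chi> k. Re (deriv (deriv (H k)) z * e * e'))" for e e'
  proof (rule pd_Re[OF T])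
    show "((\<lambda>w. deriv (H k) w * e) has_field_derivative deriv (deriv (H k)) z * e) (at z)" for k
      by (rule DERIV_cmult_right) (use H T in \<open>auto intro!: holomorphic_derivI holomorphic_deriv\<close>)
    show "pd e g w = (\<chi> k. Re (deriv (H k) w * e))" if "w \<in> T" for w by (rule p1[OF that])
  qed
  have "pd \<i> (pd \<i> g) z = - pd 1 (pd 1 g) z" by (simp add: p2 Finite_Cartesian_Product.vec_eq_iff)
  then have "normal_part g z (pd \<i> (pd \<i> g) z) = - normal_part g z (pd 1 (pd 1 g) z)" by (simp add: normal_part_minus)
  then show "mean_curvature_vector g z = 0"
    unfolding mean_curvature_vector_def Let_def by (simp add: F EG)
qed

lemma proj_point_in_hyperplane:
  assumes "proj_point w \<in> proj_hyperplane a"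
  shows "(\<Sum>k\<in>UNIV. a $ k * w $ k) = 0"
proof -
  obtain w' where w': "proj_point w = proj_point w'" "(\<Sum>k\<in>UNIV. a $ k * w' $ k) = 0"
    using assms by (auto simp: proj_hyperplane_def)
  have "w \<in> vec.span {w'}" using w'(1) vec.span_base[of w "{w}"] by (auto simp: proj_point_def)
  then obtain c where "w = c *s w'" by (auto simp: vec.span_singleton)
  then have "(\<Sum>k\<in>UNIV. a $ k * w $ k) = c * (\<Sum>k\<in>UNIV. a $ k * w' $ k)"
    by (simp add: sum_distrib_left mult_ac)
  then show ?thesis using w' by simp
qed

section \<open>Surfaces from forms with simple poles\<close>

text \<open>
  The number \<open>c k i\<close> is the residue at \<open>p i\<close> of the \<open>k\<close>-th of \<open>m\<close> one-forms with at most simple poles.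
\<close>

locale weierstrass_data = punctured_sphere p i0 for p :: "'m::finite \<Rightarrow> complex" and i0 +
  fixes c :: "'m \<Rightarrow> 'm \<Rightarrow> complex"
  assumes c_inj: "(\<And>k. (\<Sum>i\<in>UNIV. c k i * x i) = 0) \<Longrightarrow> x i = 0"
begin

text \<open>
  The derivative of the curve \<open>f\<close>, as a function of \<open>z\<close>.
\<close>

definition R :: "'m \<Rightarrow> complex \<Rightarrow> complex" where "R k z = (\<Sum>i\<in>UNIV. c k i / (z - p i))"

definition f :: "complex \<times> (complex ^ 'm) \<Rightarrow> complex ^ 'm" where "f q = (\<chi> k. \<Sum>i\<in>UNIV. c k i * snd q $ i)"

text \<open>
  The expression of \<open>f\<close> in the chart around \<open>q\<close>.
\<close>

definition F :: "complex \<times> (complex ^ 'm) \<Rightarrow> 'm \<Rightarrow> complex \<Rightarrow> complex" where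
  "F q k z = (\<Sum>i\<in>UNIV. c k i * (snd q $ i + Ln ((z - p i) / (fst q - p i))))"

lemma f_branch: "f (branch q z) $ k = F q k z"
  by (simp add: f_def F_def branch_def)

lemma F_deriv:
  assumes "q \<in> S" "z \<in> ball (fst q) (rad (fst q))"
  shows "(F q k has_field_derivative R k z) (at z)"
proof -
  have "((\<lambda>z. c k i * (snd q $ i + Ln ((z - p i) / (fst q - p i)))) has_field_derivative c k i / (z - p i)) (at z)" for i
  proof -
    have "(z - p i) / (fst q - p i) \<notin> \<real>\<^sub>\<le>\<^sub>0" using ball_ratio(1)[OF assms(2), of i] by (auto simp: complex_nonpos_Reals_iff)
    then have "(Ln has_field_derivative inverse ((z - p i) / (fst q - p i))) (at ((z - p i) / (fst q - p i)))"
      by (rule has_field_derivative_Ln)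
    moreover have "((\<lambda>z. (z - p i) / (fst q - p i)) has_field_derivative (1 - 0) / (fst q - p i)) (at z)"
      by (intro DERIV_cdivide DERIV_diff DERIV_ident DERIV_const)
    ultimately have "((\<lambda>z. Ln ((z - p i) / (fst q - p i))) has_field_derivative
        inverse ((z - p i) / (fst q - p i)) * ((1 - 0) / (fst q - p i))) (at z)" by (rule DERIV_chain2)
    then have "((\<lambda>z. c k i * (snd q $ i + Ln ((z - p i) / (fst q - p i)))) has_field_derivative
        c k i * (0 + inverse ((z - p i) / (fst q - p i)) * ((1 - 0) / (fst q - p i)))) (at z)"
      by (intro DERIV_cmult DERIV_add DERIV_const)
    moreover have "c k i * (0 + inverse ((z - p i) / (fst q - p i)) * ((1 - 0) / (fst q - p i))) = c k i / (z - p i)"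
      using S_fst_ne[OF assms(1), of i] by (simp add: divide_simps)
    ultimately show ?thesis by simp
  qed
  then show ?thesis unfolding F_def[abs_def] R_def by (intro DERIV_sum)
qed

lemma F_holomorphic: "q \<in> S \<Longrightarrow> F q k holomorphic_on ball (fst q) (rad (fst q))"
  unfolding holomorphic_on_open[OF open_ball] using F_deriv by blast

lemma deriv_F: "q \<in> S \<Longrightarrow> z \<in> ball (fst q) (rad (fst q)) \<Longrightarrow> deriv (F q k) z = R k z"
  by (rule DERIV_imp_deriv[OF F_deriv])

lemma R_nonzero: "z \<in> Omega \<Longrightarrow> \<exists>k. R k z \<noteq> 0"
proof (rule ccontr)
  assume z: "z \<in> Omega" and "\<nexists>k. R k z \<noteq> 0"
  then have "1 / (z - p i0) = 0" by (intro c_inj[of "\<lambda>i. 1 / (z - p i)"]) (simp add: R_def)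
  then show False using Omega_ne[OF z] by simp
qed

lemma R_holomorphic: "R k holomorphic_on Omega"
  unfolding R_def[abs_def] using Omega_ne by (intro holomorphic_intros) auto

text \<open>
  The vector of the derivatives is the image of the vector \<open>(1 / (z - p i))\<^sub>i\<close> under the injective linear map \<open>c\<close>, so its norm
  is at least a constant multiple of the norm of that vector.
\<close>

lemma R_vec_lower_bound: "\<exists>\<kappa>>0. \<forall>z\<in>Omega. \<forall>i. \<kappa> / cmod (z - p i) \<le> norm (\<chi> k. R k z)"
proof -
  define L :: "complex ^ 'm \<Rightarrow> complex ^ 'm" where "L x = (\<chi> k. \<Sum>i\<in>UNIV. c k i * x $ i)" for x
  have "linear L"
    by (rule linearI) (simp_all add: L_def Finite_Cartesian_Product.vec_eq_iff sum.distrib distrib_left scaleR_sum_right)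
  moreover have "inj L"
  proof (rule injI)
    fix x y assume e: "L x = L y"
    have "x $ i - y $ i = 0" for i
      by (rule c_inj[of "\<lambda>i. x $ i - y $ i"])
        (use e in \<open>simp add: L_def Finite_Cartesian_Product.vec_eq_iff right_diff_distrib sum_subtractf\<close>)
    then show "x = y" by (simp add: Finite_Cartesian_Product.vec_eq_iff)
  qed
  ultimately obtain \<kappa> where \<kappa>: "\<kappa> > 0" "\<And>x. \<kappa> * norm x \<le> norm (L x)"
    using linear_inj_bounded_below_pos by blast
  have "\<kappa> / cmod (z - p i) \<le> norm (\<chi> k. R k z)" for z i
  proof -
    define x :: "complex ^ 'm" where "x = (\<chi> i. 1 / (z - p i))"
    have "1 / cmod (z - p i) = norm (x $ i)" by (simp add: x_def norm_divide)
    also have "\<dots> \<le> norm x" by (rule Finite_Cartesian_Product.norm_nth_le)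
    finally have "\<kappa> * (1 / cmod (z - p i)) \<le> \<kappa> * norm x" using \<kappa>(1) by (intro mult_left_mono) auto
    also have "\<dots> \<le> norm (L x)" by (rule \<kappa>(2))
    also have "L x = (\<chi> k. R k z)" by (simp add: L_def x_def R_def)
    finally show ?thesis by simp
  qed
  then show ?thesis using \<kappa>(1) by blast
qed

lemma R_vec_norm: "norm (\<chi> k. R k z) = sqrt (\<Sum>k\<in>UNIV. (cmod (R k z))\<^sup>2)"
  by (simp add: norm_vec_def L2_set_def)

lemma R_continuous: "continuous_on Omega (R k)"
  by (rule holomorphic_on_imp_continuous_on[OF R_holomorphic])

lemma chart_at_atlas:
  assumes "q \<in> S"
  shows "\<exists>q0\<in>S. chart_at atlas q = (sheet q0, fst) \<and> q \<in> sheet q0"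
proof -
  have "\<exists>C. C \<in> atlas \<and> q \<in> fst C" using assms sheet_self by (intro exI[of _ "(sheet q, fst)"]) (auto simp: atlas_def)
  then have "chart_at atlas q \<in> atlas \<and> q \<in> fst (chart_at atlas q)" unfolding chart_at_def by (rule someI_ex)
  then show ?thesis by (auto simp: atlas_def)
qed

lemma sheet_ball: "q \<in> sheet q0 \<Longrightarrow> fst q \<in> ball (fst q0) (rad (fst q0))"
  using fst_sheet by blast

lemma induced_metric_f:
  assumes "C \<in> atlas" "q \<in> fst C"
  shows "induced_metric f C (fst q) v = norm (\<chi> k. R k (fst q)) * cmod v"
proof -
  obtain q0 where q0: "q0 \<in> S" "C = (sheet q0, fst)" using assms by (auto simp: atlas_def)
  have z: "fst q \<in> ball (fst q0) (rad (fst q0))" using assms(2) q0 sheet_ball by auto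
  have "((f \<circ> param C) has_derivative (\<lambda>v. \<chi> k. R k (fst q) * v)) (at (fst q))"
    by (rule vec_has_derivative_complex[OF open_ball z, of "F q0"])
      (use F_deriv[OF q0(1) z] q0 param_sheet f_branch in \<open>auto simp: Finite_Cartesian_Product.vec_eq_iff\<close>)
  then have "frechet_derivative (f \<circ> param C) (at (fst q)) = (\<lambda>v. \<chi> k. R k (fst q) * v)"
    using frechet_derivative_at by metis
  then have "induced_metric f C (fst q) v = norm (\<chi> k. R k (fst q) * v)" by (simp add: induced_metric_def)
  also have "\<dots> = norm (\<chi> k. R k (fst q)) * cmod v"
    by (simp add: norm_vec_def norm_mult L2_set_left_distrib)
  finally show ?thesis .
qed

theorem complete_f: "complete_surface (top_of_set S) atlas (induced_metric f)"
proof -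
  obtain \<kappa> where \<kappa>: "\<kappa> > 0" "\<And>z i. z \<in> Omega \<Longrightarrow> \<kappa> / cmod (z - p i) \<le> norm (\<chi> k. R k z)"
    using R_vec_lower_bound by blast
  show ?thesis
    by (rule complete_cover[OF _ \<kappa> induced_metric_f]) (auto intro!: continuous_intros R_continuous)
qed

theorem immersion_f: "holomorphic_immersion atlas f"
  unfolding holomorphic_immersion_def
proof (intro ballI conjI allI)
  fix C assume "C \<in> atlas"
  then obtain q0 where q0: "q0 \<in> S" "C = (sheet q0, fst)" by (auto simp: atlas_def)
  have e: "f (param C z) $ k = F q0 k z" if "z \<in> ball (fst q0) (rad (fst q0))" for z k
    using that q0 param_sheet f_branch by simp
  show "(\<lambda>z. f (param C z) $ k) holomorphic_on coords C" for k
    by (rule holomorphic_transform[of "F q0 k"]) (use F_holomorphic[OF q0(1)] e q0 coords_sheet in auto)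
  fix z assume "z \<in> coords C"
  then have z: "z \<in> ball (fst q0) (rad (fst q0))" using q0 coords_sheet by simp
  obtain k where k: "R k z \<noteq> 0" using R_nonzero z ball_Omega by blast
  have "((\<lambda>z. f (param C z) $ k) has_field_derivative R k z) (at z)"
    by (rule has_field_derivative_transform_within_open[OF F_deriv[OF q0(1) z] open_ball z]) (simp add: e)
  then have "deriv (\<lambda>z. f (param C z) $ k) z = R k z" by (rule DERIV_imp_deriv)
  then show "\<exists>k. deriv (\<lambda>z. f (param C z) $ k) z \<noteq> 0" using k by metis
qed

lemma complex_gauss_map_f:
  assumes "q \<in> S" shows "complex_gauss_map atlas f q = proj_point (\<chi> k. R k (fst q))"
proof -
  obtain q0 where q0: "q0 \<in> S" "chart_at atlas q = (sheet q0, fst)" "q \<in> sheet q0" using chart_at_atlas[OF assms] by blast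
  have z: "fst q \<in> ball (fst q0) (rad (fst q0))" by (rule sheet_ball[OF q0(3)])
  have "((\<lambda>z. f (param (sheet q0, fst) z) $ k) has_field_derivative R k (fst q)) (at (fst q))" for k
    by (rule has_field_derivative_transform_within_open[OF F_deriv[OF q0(1) z] open_ball z]) (simp add: param_sheet f_branch)
  then have "deriv (\<lambda>z. f (param (sheet q0, fst) z) $ k) (fst q) = R k (fst q)" for k by (rule DERIV_imp_deriv)
  then show ?thesis by (simp add: complex_gauss_map_def q0)
qed

lemma omits_complex:
  assumes "\<And>z. z \<in> Omega \<Longrightarrow> (\<Sum>k\<in>UNIV. a $ k * R k z) \<noteq> 0"
  shows "omits_hyperplane (top_of_set S) (complex_gauss_map atlas f) a"
  unfolding omits_hyperplane_def
proof (rule equals0I)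
  fix y assume "y \<in> complex_gauss_map atlas f ` topspace (top_of_set S) \<inter> proj_hyperplane a"
  then obtain q where q: "q \<in> S" "proj_point (\<chi> k. R k (fst q)) \<in> proj_hyperplane a"
    using complex_gauss_map_f by auto
  then show False using proj_point_in_hyperplane[OF q(2)] assms[OF S_fst[OF q(1)]] by simp
qed

text \<open>
  If \<open>f\<close> satisfies an affine equation, its derivative satisfies the linear one.
\<close>

lemma not_in_affine_hyperplane:
  assumes nondeg: "\<And>a. a \<noteq> 0 \<Longrightarrow> \<exists>z\<in>Omega. (\<Sum>k\<in>UNIV. a $ k * R k z) \<noteq> 0"
  shows "\<not> in_affine_hyperplane (f ` S)"
proof
  assume "in_affine_hyperplane (f ` S)"
  then obtain a b where a: "a \<noteq> 0" "\<And>q. q \<in> S \<Longrightarrow> (\<Sum>k\<in>UNIV. a $ k * f q $ k) = b" by (auto simp: in_affine_hyperplane_def)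
  obtain z where z: "z \<in> Omega" "(\<Sum>k\<in>UNIV. a $ k * R k z) \<noteq> 0" using nondeg[OF a(1)] by blast
  obtain q where q: "q \<in> S" "fst q = z" using Omega_lift[OF z(1)] by force
  have zb: "z \<in> ball (fst q) (rad (fst q))" using q rad_pos[OF z(1)] by simp
  have "((\<lambda>w. \<Sum>k\<in>UNIV. a $ k * F q k w) has_field_derivative (\<Sum>k\<in>UNIV. a $ k * R k z)) (at z)"
    by (intro DERIV_sum DERIV_cmult F_deriv[OF q(1) zb])
  moreover have "((\<lambda>w. \<Sum>k\<in>UNIV. a $ k * F q k w) has_field_derivative 0) (at z)"
  proof (rule has_field_derivative_transform_within_open[OF _ open_ball zb])
    show "((\<lambda>_. b) has_field_derivative 0) (at z)" by simp
    fix w assume "w \<in> ball (fst q) (rad (fst q))"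
    then show "b = (\<Sum>k\<in>UNIV. a $ k * F q k w)" using a(2)[OF branch_in[OF q(1)]] by (simp add: f_branch)
  qed
  ultimately show False using z(2) DERIV_unique by blast
qed

definition x :: "complex \<times> (complex ^ 'm) \<Rightarrow> real ^ 'm" where "x q = (\<chi> k. Re (f q $ k))"

definition density :: "complex \<Rightarrow> real" where "density z = sqrt (1/2 * (\<Sum>k\<in>UNIV. (cmod (R k z))\<^sup>2))"

lemma density_continuous: "continuous_on Omega density"
  unfolding density_def by (intro continuous_intros R_continuous)

lemma density_lower_bound: "\<exists>\<kappa>>0. \<forall>z\<in>Omega. \<forall>i. \<kappa> / cmod (z - p i) \<le> density z"
proof -
  obtain \<kappa> where \<kappa>: "\<kappa> > 0" "\<And>z i. z \<in> Omega \<Longrightarrow> \<kappa> / cmod (z - p i) \<le> norm (\<chi> k. R k z)"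
    using R_vec_lower_bound by blast
  have d: "density z = sqrt (1/2) * norm (\<chi> k. R k z)" for z
    by (simp only: density_def R_vec_norm real_sqrt_mult)
  have "sqrt (1/2) * \<kappa> / cmod (z - p i) \<le> density z" if "z \<in> Omega" for z i
    unfolding d using mult_left_mono[OF \<kappa>(2)[OF that, of i], of "sqrt (1/2)"] by simp
  moreover have "sqrt (1/2) * \<kappa> > 0" using \<kappa>(1) by simp
  ultimately show ?thesis by blast
qed

context
  assumes null: "\<And>z. z \<in> Omega \<Longrightarrow> (\<Sum>k\<in>UNIV. (R k z)\<^sup>2) = 0"
begin

lemma x_param:
  assumes "q0 \<in> S" "z \<in> ball (fst q0) (rad (fst q0))"
  shows "(x \<circ> param (sheet q0, fst)) z = (\<chi> k. Re (F q0 k z))"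
  using param_sheet[OF assms(2)] by (simp add: x_def f_branch)

lemma induced_metric_x:
  assumes "C \<in> atlas" "q \<in> fst C"
  shows "induced_metric x C (fst q) v = density (fst q) * cmod v"
proof -
  obtain q0 where q0: "q0 \<in> S" "C = (sheet q0, fst)" using assms by (auto simp: atlas_def)
  have z: "fst q \<in> ball (fst q0) (rad (fst q0))" using assms(2) q0 sheet_ball by auto
  have "((x \<circ> param C) has_derivative (\<lambda>v. \<chi> k. Re (R k (fst q) * v))) (at (fst q))"
    unfolding q0(2) by (rule vec_has_derivative_Re[OF open_ball z F_deriv[OF q0(1) z] x_param[OF q0(1)]])
  then have "frechet_derivative (x \<circ> param C) (at (fst q)) = (\<lambda>v. \<chi> k. Re (R k (fst q) * v))"
    using frechet_derivative_at by metis
  then have "induced_metric x C (fst q) v = norm (\<chi> k. Re (R k (fst q) * v))" by (simp add: induced_metric_def)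
  moreover have "fst q \<in> Omega" using z ball_Omega by blast
  ultimately show ?thesis by (simp only: norm_Re_null_vector[OF null] density_def)
qed

theorem complete_minimal_x: "complete_minimal_surface (top_of_set S) atlas x"
  unfolding complete_minimal_surface_def
proof
  obtain \<kappa> where \<kappa>: "\<kappa> > 0" "\<And>z i. z \<in> Omega \<Longrightarrow> \<kappa> / cmod (z - p i) \<le> density z"
    using density_lower_bound by blast
  show "complete_surface (top_of_set S) atlas (induced_metric x)"
    by (rule complete_cover[OF density_continuous \<kappa> induced_metric_x])
  show "minimal_surface (top_of_set S) atlas x"
    unfolding minimal_surface_def
  proof (intro conjI ballI riemann_surface_cover)
    fix C assume "C \<in> atlas"
    then obtain q0 where q0: "q0 \<in> S" "C = (sheet q0, fst)" by (auto simp: atlas_def)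
    let ?b = "ball (fst q0) (rad (fst q0))"
    have co: "coords C = ?b" using q0 coords_sheet by simp
    note g = x_param[OF q0(1), folded q0(2)]
    note H = F_holomorphic[OF q0(1)]
    have "smooth_on_open (coords C) (x \<circ> param C)"
      unfolding smooth_on_open_def co using fold_pd_Re_differentiable[OF open_ball _ H g] by blast
    moreover have "inj (frechet_derivative (x \<circ> param C) (at z)) \<and> norm (pd 1 (x \<circ> param C) z) = norm (pd \<i> (x \<circ> param C) z) \<and>
      pd 1 (x \<circ> param C) z \<bullet> pd \<i> (x \<circ> param C) z = 0 \<and> mean_curvature_vector (x \<circ> param C) z = 0" if z: "z \<in> coords C" for z
    proof -
      have zb: "z \<in> ?b" using z co by simp
      have zO: "z \<in> Omega" using zb ball_Omega by blast
      have n: "(\<Sum>k\<in>UNIV. (deriv (F q0 k) z)\<^sup>2) = 0" using null[OF zO] by (simp add: deriv_F[OF q0(1) zb])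
      have "\<exists>k. deriv (F q0 k) z \<noteq> 0" using R_nonzero[OF zO] by (simp add: deriv_F[OF q0(1) zb])
      from conformal_minimal_Re[OF open_ball zb H g n this] show ?thesis by blast
    qed
    ultimately show "let g = x \<circ> param C in smooth_on_open (coords C) g \<and>
        (\<forall>z\<in>coords C. inj (frechet_derivative g (at z)) \<and>
           norm (pd 1 g z) = norm (pd \<i> g z) \<and> pd 1 g z \<bullet> pd \<i> g z = 0 \<and>
           mean_curvature_vector g z = 0)" unfolding Let_def by blast
  qed
qed

lemma gauss_map_x:
  assumes "q \<in> S" shows "gauss_map atlas x q = proj_point (\<chi> k. R k (fst q) / 2)"
proof -
  obtain q0 where q0: "q0 \<in> S" "chart_at atlas q = (sheet q0, fst)" "q \<in> sheet q0" using chart_at_atlas[OF assms] by blast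
  have z: "fst q \<in> ball (fst q0) (rad (fst q0))" by (rule sheet_ball[OF q0(3)])
  have "pd e (x \<circ> param (sheet q0, fst)) (fst q) = (\<chi> k. Re (R k (fst q) * e))" for e
    by (rule pd_Re[OF open_ball z F_deriv[OF q0(1) z] x_param[OF q0(1)]])
  then have "wirtinger (x \<circ> param (sheet q0, fst)) (fst q) = (\<chi> k. R k (fst q) / 2)"
    by (simp add: wirtinger_def Finite_Cartesian_Product.vec_eq_iff complex_eq_iff)
  then show ?thesis by (simp add: gauss_map_def q0)
qed

lemma gauss_hyperplane: "gauss_map atlas x q \<in> proj_hyperplane a \<Longrightarrow> q \<in> S \<Longrightarrow> (\<Sum>k\<in>UNIV. a $ k * R k (fst q)) = 0"
proof -
  assume "gauss_map atlas x q \<in> proj_hyperplane a" "q \<in> S"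
  then have "(\<Sum>k\<in>UNIV. a $ k * R k (fst q) / 2) = 0"
    using proj_point_in_hyperplane[of "\<chi> k. R k (fst q) / 2" a] by (simp add: gauss_map_x)
  then show ?thesis by (simp add: sum_divide_distrib[symmetric])
qed

lemma omits_x:
  assumes "\<And>z. z \<in> Omega \<Longrightarrow> (\<Sum>k\<in>UNIV. a $ k * R k z) \<noteq> 0"
  shows "omits_hyperplane (top_of_set S) (gauss_map atlas x) a"
  unfolding omits_hyperplane_def using gauss_hyperplane assms S_fst by fastforce

lemma nondegenerate_x:
  assumes "\<And>a. a \<noteq> 0 \<Longrightarrow> \<exists>z\<in>Omega. (\<Sum>k\<in>UNIV. a $ k * R k z) \<noteq> 0"
  shows "nondegenerate_map (top_of_set S) (gauss_map atlas x)"
  unfolding nondegenerate_map_def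
proof
  assume "\<exists>a. a \<noteq> 0 \<and> gauss_map atlas x ` topspace (top_of_set S) \<subseteq> proj_hyperplane a"
  then obtain a where a: "a \<noteq> 0" "\<And>q. q \<in> S \<Longrightarrow> gauss_map atlas x q \<in> proj_hyperplane a" by auto
  obtain z where z: "z \<in> Omega" "(\<Sum>k\<in>UNIV. a $ k * R k z) \<noteq> 0" using assms[OF a(1)] by blast
  obtain q where q: "q \<in> S" "fst q = z" using Omega_lift[OF z(1)] by force
  show False using gauss_hyperplane[OF a(2)[OF q(1)] q(1)] z(2) q(2) by simp
qed

text \<open>
  The form \<open>R\<^sub>k(z) dz\<close> in the coordinates \<open>z\<close> and \<open>u = 1/z\<close>.
\<close>

definition \<phi> :: "'m \<Rightarrow> (complex \<times> (complex ^ 'm)) one_form" where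
  "\<phi> k C u = (if snd C = c1 then R k u else - R k (inverse u) * inverse (u\<^sup>2))"

lemma coords_BM: "coords (M, c1) = Omega" "coords (M, c2) = inverse ` Omega"
proof -
  show "coords (M, c1) = Omega" by (simp add: coords_def c1_image_M)
  have "c2 ` M = inverse ` c1 ` M" unfolding image_image using c1_M by (intro image_cong) auto
  then show "coords (M, c2) = inverse ` Omega" by (simp add: coords_def c1_image_M)
qed

lemma open_inverse_Omega: "open (inverse ` Omega)"
proof -
  have "inverse ` Omega = inverse -` Omega - {0}"
  proof (intro equalityI subsetI)
    fix u assume "u \<in> inverse -` Omega - {0}"
    then show "u \<in> inverse ` Omega" by (intro image_eqI[of _ _ "inverse u"]) auto
  qed (use Omega_nz in auto)
  also have "\<dots> = (- {0}) \<inter> inverse -` Omega" by auto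
  also have "open \<dots>" by (rule continuous_open_preimage) (auto intro!: continuous_intros open_Omega)
  finally show ?thesis .
qed

lemma trans_BM:
  assumes C: "C \<in> BM" "D \<in> BM" and z: "z \<in> coords C"
  shows "(snd D \<circ> param C) z = (if snd C = snd D then z else inverse z)"
proof -
  have c21: "c2 \<noteq> c1" using c1_ne_c2 by metis
  consider "C = (M, c1)" | "C = (M, c2)" using C by (auto simp: BM_def)
  then show ?thesis
  proof cases
    case 1
    then have "z \<in> Omega" using z coords_BM by simp
    then show ?thesis using 1 C(2) c1_ne_c2 by (auto simp: BM_def param_M1 c2_stereo)
  next
    case 2
    then obtain w where w: "w \<in> Omega" "z = inverse w" using z coords_BM by auto
    then show ?thesis using 2 C(2) c21 by (auto simp: BM_def param_M2 c2_stereo)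
  qed
qed

lemma inverse_DERIV: "z \<noteq> 0 \<Longrightarrow> (inverse has_field_derivative - inverse (z\<^sup>2)) (at (z::complex))"
  using DERIV_inverse[of z UNIV] by (simp add: power2_eq_square numeral_2_eq_2)

lemma coords_nz: "C \<in> BM \<Longrightarrow> z \<in> coords C \<Longrightarrow> z \<noteq> 0"
  using coords_BM Omega_nz by (auto simp: BM_def)

lemma coords_open: "C \<in> BM \<Longrightarrow> open (coords C)"
  using coords_BM open_Omega open_inverse_Omega by (auto simp: BM_def)

lemma deriv_trans_BM:
  assumes C: "C \<in> BM" "D \<in> BM" and z: "z \<in> coords C"
  shows "deriv (snd D \<circ> param C) z = (if snd C = snd D then 1 else - inverse (z\<^sup>2))"
proof (cases "snd C = snd D")
  case True
  have "((snd D \<circ> param C) has_field_derivative 1) (at z)"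
    by (rule has_field_derivative_transform_within_open[OF DERIV_ident coords_open[OF C(1)] z])
      (use trans_BM[OF C] True in auto)
  then show ?thesis using True by (simp add: DERIV_imp_deriv)
next
  case False
  have "((snd D \<circ> param C) has_field_derivative - inverse (z\<^sup>2)) (at z)"
    by (rule has_field_derivative_transform_within_open[OF inverse_DERIV[OF coords_nz[OF C(1) z]] coords_open[OF C(1)] z])
      (use trans_BM[OF C] False in auto)
  then show ?thesis using False by (simp add: DERIV_imp_deriv)
qed

lemma \<phi>_change:
  "u \<noteq> 0 \<Longrightarrow> \<phi> k (X, c1) (inverse u) * (- inverse (u\<^sup>2)) = \<phi> k (X', c2) u"
  "u \<noteq> 0 \<Longrightarrow> \<phi> k (X, c2) (inverse u) * (- inverse (u\<^sup>2)) = \<phi> k (X', c1) u"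
  using c1_ne_c2 by (auto simp: \<phi>_def power_inverse)

lemma holomorphic_\<phi>: "holomorphic_form BM (\<phi> k)"
  unfolding holomorphic_form_def
proof (intro conjI ballI)
  fix C assume C: "C \<in> BM"
  show "\<phi> k C holomorphic_on coords C"
  proof (cases "snd C = c1")
    case True
    then have "coords C = Omega" using C c1_ne_c2 coords_BM by (auto simp: BM_def)
    then show ?thesis using True R_holomorphic by (simp add: \<phi>_def[abs_def])
  next
    case False
    then have co: "coords C = inverse ` Omega" using C coords_BM by (auto simp: BM_def)
    have nz: "u \<noteq> 0" if "u \<in> inverse ` Omega" for u using that Omega_nz by auto
    have "(R k \<circ> inverse) holomorphic_on (inverse ` Omega)"
    proof (rule holomorphic_on_compose)
      show "inverse holomorphic_on (inverse ` Omega)" using nz by (intro holomorphic_intros) auto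
      show "R k holomorphic_on (inverse ` inverse ` Omega)" using R_holomorphic by (simp add: image_image)
    qed
    then have "(\<lambda>u. R k (inverse u)) holomorphic_on (inverse ` Omega)" by (simp add: o_def)
    then have "(\<lambda>u. - R k (inverse u) * inverse (u\<^sup>2)) holomorphic_on (inverse ` Omega)"
      using nz by (intro holomorphic_intros) auto
    then show ?thesis using False co by (simp add: \<phi>_def[abs_def])
  qed
next
  fix C D z assume C: "C \<in> BM" "D \<in> BM" and z: "z \<in> snd C ` (fst C \<inter> fst D)"
  then have zc: "z \<in> coords C" by (auto simp: coords_def)
  note nz = coords_nz[OF C(1) zc]
  have "\<phi> k C z = \<phi> k D (if snd C = snd D then z else inverse z) * (if snd C = snd D then 1 else - inverse (z\<^sup>2))"
    using C c1_ne_c2 \<phi>_change[OF nz, of k M M] by (auto simp: BM_def)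
  then show "\<phi> k C z = \<phi> k D ((snd D \<circ> param C) z) * deriv (snd D \<circ> param C) z"
    unfolding trans_BM[OF C zc] deriv_trans_BM[OF C zc] .
qed

lemma meromorphic_\<phi>: "extends_meromorphically B P (\<phi> k)"
  unfolding extends_meromorphically_def
proof
  fix C assume "C \<in> B"
  show "\<phi> k (fst C - P, snd C) meromorphic_on coords C"
  proof (cases "snd C = c1")
    case True
    have "(\<lambda>u. \<Sum>i\<in>UNIV. c k i / (u - p i)) meromorphic_on coords C" by (intro meromorphic_intros)
    then show ?thesis using True by (simp add: \<phi>_def[abs_def] R_def)
  next
    case False
    have "(\<lambda>u. - (\<Sum>i\<in>UNIV. c k i / (inverse u - p i)) * inverse (u\<^sup>2)) meromorphic_on coords C" by (intro meromorphic_intros)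
    then show ?thesis using False by (simp add: \<phi>_def[abs_def] R_def)
  qed
qed

lemma sum_sq_\<phi>:
  assumes C: "C \<in> BM" and z: "z \<in> coords C"
  shows "\<exists>k. \<phi> k C z \<noteq> 0" "(\<Sum>k\<in>UNIV. (\<phi> k C z)\<^sup>2) = 0"
proof -
  have "(\<exists>k. \<phi> k C z \<noteq> 0) \<and> (\<Sum>k\<in>UNIV. (\<phi> k C z)\<^sup>2) = 0"
  proof (cases "snd C = c1")
    case True
    then have "z \<in> Omega" using C z c1_ne_c2 coords_BM by (auto simp: BM_def)
    then show ?thesis using True null R_nonzero by (simp add: \<phi>_def)
  next
    case False
    then obtain w where w: "w \<in> Omega" "z = inverse w" using C z coords_BM by (auto simp: BM_def)
    obtain k where k: "R k w \<noteq> 0" using R_nonzero w by blast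
    have "(\<Sum>k\<in>UNIV. (\<phi> k C z)\<^sup>2) = (\<Sum>k\<in>UNIV. (R k w)\<^sup>2) * (inverse (z\<^sup>2))\<^sup>2"
      using False w by (simp add: \<phi>_def sum_distrib_right power_mult_distrib)
    moreover have "\<phi> k C z \<noteq> 0" using False w k Omega_nz by (auto simp: \<phi>_def)
    ultimately show ?thesis using null[OF w(1)] by auto
  qed
  then show "\<exists>k. \<phi> k C z \<noteq> 0" "(\<Sum>k\<in>UNIV. (\<phi> k C z)\<^sup>2) = 0" by blast+
qed

lemma pullback_\<phi>:
  assumes q0: "q0 \<in> S" and z: "z \<in> ball (fst q0) (rad (fst q0))"
  shows "pullback_form BM proj (\<phi> k) (sheet q0, fst) z = R k z"
proof -
  have zO: "z \<in> Omega" using z ball_Omega by blast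
  define D where "D = chart_at BM (proj (param (sheet q0, fst) z))"
  have "proj (param (sheet q0, fst) z) \<in> M" using param_sheet[OF z] zO by (simp add: proj_def M_def)
  then have "\<exists>C. C \<in> BM \<and> proj (param (sheet q0, fst) z) \<in> fst C" by (auto simp: BM_def)
  then have "D \<in> BM" unfolding D_def chart_at_def by (metis (mono_tags, lifting) someI_ex)
  then consider "D = (M, c1)" | "D = (M, c2)" by (auto simp: BM_def)
  then have "\<phi> k D ((snd D \<circ> proj \<circ> param (sheet q0, fst)) z) * deriv (snd D \<circ> proj \<circ> param (sheet q0, fst)) z = R k z"
  proof cases
    case 1
    have "((c1 \<circ> proj \<circ> param (sheet q0, fst)) has_field_derivative 1) (at z)"
      by (rule has_field_derivative_transform_within_open[OF DERIV_ident open_ball z]) (use chart_proj_param(1)[OF q0] in simp)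
    then have "deriv (c1 \<circ> proj \<circ> param (sheet q0, fst)) z = 1" by (rule DERIV_imp_deriv)
    then show ?thesis unfolding 1 snd_conv chart_proj_param(1)[OF q0 z] by (simp add: \<phi>_def)
  next
    case 2
    have "((c2 \<circ> proj \<circ> param (sheet q0, fst)) has_field_derivative - inverse (z\<^sup>2)) (at z)"
      by (rule has_field_derivative_transform_within_open[OF inverse_DERIV[OF Omega_nz[OF zO]] open_ball z]) (use chart_proj_param(2)[OF q0] in simp)
    then have d: "deriv (c2 \<circ> proj \<circ> param (sheet q0, fst)) z = - inverse (z\<^sup>2)" by (rule DERIV_imp_deriv)
    show ?thesis unfolding 2 snd_conv chart_proj_param(2)[OF q0 z] d \<phi>_change(2)[OF Omega_nz[OF zO], of k M M] by (simp add: \<phi>_def)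
  qed
  then show ?thesis unfolding pullback_form_def Let_def D_def .
qed

text \<open>
  The integral is computed by the fundamental theorem from the logarithms, which are themselves coordinates of the curve
  in \<open>S\<close>; the charts that the definition selects at each time do not matter by \<open>pullback_\<phi>\<close>.
\<close>

lemma form_integral_\<phi>:
  assumes \<gamma>: "piecewise_C1_curve (top_of_set S) atlas \<gamma>"
  shows "x (\<gamma> 1) $ k - x (\<gamma> 0) $ k = Re (form_integral atlas (pullback_form BM proj (\<phi> k)) \<gamma>)"
proof -
  interpret cc: conformal_coordinate S fst atlas "\<lambda>C z v. cmod v" "\<lambda>_. 1" "\<lambda>_ z. z" "\<lambda>_ _. 1"
    by (rule conformal_coordinate_cover) auto
  obtain Fs where g: "path \<gamma>" "path_image \<gamma> \<subseteq> S" "C1_off Fs (fst \<circ> \<gamma>)"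
    using \<gamma> unfolding cc.piecewise_C1_curve_iff by blast
  define h where "h t = R k (fst (\<gamma> t)) * vector_derivative (fst \<circ> \<gamma>) (at t)" for t
  have "(h has_integral (f (\<gamma> 1) $ k - f (\<gamma> 0) $ k)) {0..1}"
  proof (rule fundamental_theorem_of_calculus_interior_strong[of Fs])
    show "finite Fs" using g by (simp add: C1_off_def)
    show "continuous_on {0..1} (\<lambda>t. f (\<gamma> t) $ k)"
      using g(1) unfolding path_def f_def by (auto intro!: continuous_intros)
    fix t :: real assume t: "t \<in> {0<..<1} - Fs"
    have "((fst \<circ> \<gamma>) has_vector_derivative vector_derivative (fst \<circ> \<gamma>) (at t)) (at t)"
      by (rule C1_off_derivative[OF g(3)]) (use t in auto)
    then have "((\<lambda>s. c k i * snd (\<gamma> s) $ i) has_vector_derivative c k i * (vector_derivative (fst \<circ> \<gamma>) (at t) / (fst (\<gamma> t) - p i))) (at t)" for i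
      using t by (intro has_vector_derivative_mult_right log_derivative_along_curve[OF g(1,2)]) auto
    then have "((\<lambda>s. \<Sum>i\<in>UNIV. c k i * snd (\<gamma> s) $ i) has_vector_derivative (\<Sum>i\<in>UNIV. c k i * (vector_derivative (fst \<circ> \<gamma>) (at t) / (fst (\<gamma> t) - p i)))) (at t)"
      by (intro has_vector_derivative_sum) auto
    also have "(\<Sum>i\<in>UNIV. c k i * (vector_derivative (fst \<circ> \<gamma>) (at t) / (fst (\<gamma> t) - p i))) = h t"
      by (simp add: h_def R_def sum_distrib_right)
    finally show "((\<lambda>t. f (\<gamma> t) $ k) has_vector_derivative h t) (at t)" by (simp add: f_def)
  qed simp
  then have "integral {0..1} h = f (\<gamma> 1) $ k - f (\<gamma> 0) $ k" by (rule integral_unique)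
  moreover have "form_integral atlas (pullback_form BM proj (\<phi> k)) \<gamma> = integral {0..1} h"
    unfolding form_integral_def
  proof (rule integral_cong)
    fix t :: real assume "t \<in> {0..1}"
    then have "\<gamma> t \<in> S" using g(2) by (auto simp: path_image_def)
    then obtain q0 where q0: "q0 \<in> S" "chart_at atlas (\<gamma> t) = (sheet q0, fst)" "\<gamma> t \<in> sheet q0"
      using chart_at_atlas by blast
    show "(let C = chart_at atlas (\<gamma> t) in pullback_form BM proj (\<phi> k) C (snd C (\<gamma> t)) * vector_derivative (snd C \<circ> \<gamma>) (at t)) = h t"
      using pullback_\<phi>[OF q0(1) sheet_ball[OF q0(3)]] by (simp add: q0(2) h_def)
  qed
  ultimately show ?thesis by (simp add: x_def)
qed

lemma complete_weierstrass: "complete_surface (top_of_set M) BM (weierstrass_metric \<phi>)"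
proof -
  obtain \<kappa> where \<kappa>: "\<kappa> > 0" "\<And>z i. z \<in> Omega \<Longrightarrow> \<kappa> / cmod (z - p i) \<le> density z"
    using density_lower_bound by blast
  show ?thesis
  proof (rule complete_base[OF density_continuous \<kappa>])
    show "weierstrass_metric \<phi> (M, c1) z v = density z * cmod v" for z v
      by (simp add: weierstrass_metric_def density_def \<phi>_def)
    fix z v assume z: "z \<in> Omega"
    have "cmod (\<phi> k (M, c2) (inverse z)) = cmod (R k z) * (cmod z)\<^sup>2" for k
      using c1_ne_c2 by (auto simp: \<phi>_def norm_mult power_inverse norm_power)
    then have "(\<Sum>k\<in>UNIV. (cmod (\<phi> k (M, c2) (inverse z)))\<^sup>2) = (\<Sum>k\<in>UNIV. (cmod (R k z))\<^sup>2) * ((cmod z)\<^sup>2)\<^sup>2"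
      by (simp add: power_mult_distrib sum_distrib_right)
    then have "weierstrass_metric \<phi> (M, c2) (inverse z) v = sqrt (1/2 * (\<Sum>k\<in>UNIV. (cmod (R k z))\<^sup>2) * ((cmod z)\<^sup>2)\<^sup>2) * cmod v"
      by (simp add: weierstrass_metric_def)
    also have "sqrt (1/2 * (\<Sum>k\<in>UNIV. (cmod (R k z))\<^sup>2) * ((cmod z)\<^sup>2)\<^sup>2) = density z * (cmod z)\<^sup>2"
      by (simp only: density_def real_sqrt_mult real_sqrt_abs abs_power2)
    finally show "weierstrass_metric \<phi> (M, c2) (inverse z) v = density z * cmod v * (cmod z)\<^sup>2" by simp
  qed
qed

theorem pseudo_algebraic_x: "pseudo_algebraic TYPE(complex \<times> (complex ^ 'm)) (top_of_set S) atlas x"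
  unfolding pseudo_algebraic_def
proof (intro conjI exI)
  show "complete_minimal_surface (top_of_set S) atlas x" by (rule complete_minimal_x)
  show "riemann_surface (top_of_set Y) B" by (rule riemann_surface_sphere)
  show "compact_space (top_of_set Y)" by (rule compact_space_Y)
  show "finite P" by (rule P_props)
  show "P \<subseteq> topspace (top_of_set Y)" using P_props by simp
  show "let M = subtopology (top_of_set Y) (topspace (top_of_set Y) - P); BM = puncture_atlas B P in
          covering_of (top_of_set S) M proj \<and> holomorphic_surface_map (top_of_set S) atlas M BM proj \<and>
          (\<forall>k. holomorphic_form BM (\<phi> k) \<and> extends_meromorphically B P (\<phi> k)) \<and>
          (\<forall>C\<in>BM. \<forall>z\<in>coords C.
             (\<exists>k. \<phi> k C z \<noteq> 0) \<and> (\<Sum>k\<in>UNIV. (\<phi> k C z)\<^sup>2) = 0) \<and>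
          (\<forall>\<gamma> k. piecewise_C1_curve (top_of_set S) atlas \<gamma> \<longrightarrow>
             x (\<gamma> 1) $ k - x (\<gamma> 0) $ k = Re (form_integral atlas (pullback_form BM proj (\<phi> k)) \<gamma>)) \<and>
          complete_surface M BM (weierstrass_metric \<phi>)"
    unfolding M_topology puncture_atlas_B Let_def
    using covering_proj holomorphic_proj holomorphic_\<phi> meromorphic_\<phi> sum_sq_\<phi> form_integral_\<phi> complete_weierstrass
    by blast
qed

end

end

section \<open>Omitted hyperplanes\<close>

text \<open>
  Lagrange interpolation of \<open>Q\<close> in the points \<open>p i\<close>, divided by \<open>\<Prod>\<^sub>i (z - p i)\<close>.
\<close>

lemma partial_fractions:
  fixes p :: "'m::finite \<Rightarrow> complex"
  assumes p: "inj p" and Q: "degree Q < CARD('m)" and z: "z \<notin> range p"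
  shows "(\<Sum>i\<in>UNIV. poly Q (p i) / (\<Prod>j\<in>-{i}. p i - p j) / (z - p i)) = poly Q z / (\<Prod>i\<in>UNIV. z - p i)"
proof -
  define L where "L i = (\<Prod>j\<in>-{i}. [:- p j, 1:])" for i
  have dL: "degree (L i) < CARD('m)" for i
  proof -
    have "degree (L i) = card (- {i})" by (simp add: L_def degree_prod_eq_sum_degree)
    also have "\<dots> < CARD('m)" by (intro psubset_card_mono) auto
    finally show ?thesis .
  qed
  have pL: "poly (L i) w = (\<Prod>j\<in>-{i}. w - p j)" for i w by (simp add: L_def poly_prod)
  have ne: "(\<Prod>j\<in>-{i}. p i - p j) \<noteq> 0" for i using p by (auto simp: inj_def)
  define K where "K = (\<Sum>i\<in>UNIV. smult (poly Q (p i) / (\<Prod>j\<in>-{i}. p i - p j)) (L i))"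
  have "K = Q"
  proof (rule poly_eqI_degree[of "range p"])
    have "card (range p) = CARD('m)" using p by (simp add: card_image)
    then show "degree Q < card (range p)" using Q by simp
    have "degree K \<le> CARD('m) - 1" unfolding K_def
      using dL by (intro degree_sum_le) (auto intro!: order.trans[OF degree_smult_le] simp: less_Suc_eq_le[symmetric])
    then show "degree K < card (range p)" using \<open>card (range p) = CARD('m)\<close> zero_less_card_finite[where 'a='m] by linarith
    fix w assume "w \<in> range p"
    then obtain i where i: "w = p i" by auto
    have "poly K w = (\<Sum>k\<in>UNIV. if k = i then poly Q (p i) else 0)"
      unfolding K_def poly_sum poly_smult
    proof (rule sum.cong[OF refl])
      fix k
      show "poly Q (p k) / (\<Prod>j\<in>-{k}. p k - p j) * poly (L k) w = (if k = i then poly Q (p i) else 0)"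
        using ne[of i] by (auto simp: pL i)
    qed
    then show "poly K w = poly Q w" by (simp add: i)
  qed
  then have "poly Q z = poly K z" by simp
  also have "\<dots> = (\<Sum>i\<in>UNIV. poly Q (p i) / (\<Prod>j\<in>-{i}. p i - p j) * (\<Prod>j\<in>-{i}. z - p j))"
    unfolding K_def poly_sum poly_smult pL ..
  finally have "poly Q z = (\<Sum>i\<in>UNIV. poly Q (p i) / (\<Prod>j\<in>-{i}. p i - p j) * (\<Prod>j\<in>-{i}. z - p j))" .
  then have "poly Q z / (\<Prod>i\<in>UNIV. z - p i) =
      (\<Sum>i\<in>UNIV. poly Q (p i) / (\<Prod>j\<in>-{i}. p i - p j) * (\<Prod>j\<in>-{i}. z - p j) / (\<Prod>i\<in>UNIV. z - p i))"
    by (simp add: sum_divide_distrib)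
  also have "\<dots> = (\<Sum>i\<in>UNIV. poly Q (p i) / (\<Prod>j\<in>-{i}. p i - p j) / (z - p i))"
  proof (rule sum.cong[OF refl])
    fix i
    have "(\<Prod>i\<in>UNIV. z - p i) = (z - p i) * (\<Prod>j\<in>-{i}. z - p j)"
      by (subst prod.remove[of _ i]) (auto simp: Compl_eq_Diff_UNIV)
    moreover have "(\<Prod>j\<in>-{i}. z - p j) \<noteq> 0" using z by auto
    ultimately show "poly Q (p i) / (\<Prod>j\<in>-{i}. p i - p j) * (\<Prod>j\<in>-{i}. z - p j) / (\<Prod>i\<in>UNIV. z - p i) =
        poly Q (p i) / (\<Prod>j\<in>-{i}. p i - p j) / (z - p i)" by simp
  qed
  finally show ?thesis ..
qed

text \<open>
  A null curve of polynomials whose combinations are all polynomials of degree less than \<open>m\<close>; \<open>dual Q\<close> gives the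
  coefficients of \<open>Q\<close>.
\<close>

locale polynomial_weierstrass_data =
  punctured_sphere p i0 for p :: "'m::finite \<Rightarrow> complex" and i0 +
  fixes g :: "'m \<Rightarrow> complex poly" and dual :: "complex poly \<Rightarrow> complex ^ 'm"
  assumes degree_g: "degree (g k) < CARD('m)"
    and null_g: "(\<Sum>k\<in>UNIV. (poly (g k) z)\<^sup>2) = 0"
    and dual: "degree Q < CARD('m) \<Longrightarrow> (\<Sum>k\<in>UNIV. dual Q $ k * poly (g k) z) = poly Q z"
    and independent_g: "(\<Sum>k\<in>UNIV. smult (a $ k) (g k)) = 0 \<Longrightarrow> a = 0"

text \<open>
  The residues of \<open>g\<^sub>k(z) dz / \<Prod>\<^sub>i (z - p i)\<close>. A linear relation between the columns of the residue matrix is tested on the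
  Lagrange basis polynomial that vanishes in all points except \<open>p i\<close>.
\<close>

sublocale polynomial_weierstrass_data \<subseteq> weierstrass_data p i0 "\<lambda>k i. poly (g k) (p i) / (\<Prod>j\<in>-{i}. p i - p j)"
proof
  fix x :: "'m \<Rightarrow> complex" and i
  assume x: "\<And>k. (\<Sum>i\<in>UNIV. poly (g k) (p i) / (\<Prod>j\<in>-{i}. p i - p j) * x i) = 0"
  define L where "L = (\<Prod>j\<in>-{i}. [:- p j, 1:])"
  have dL: "degree L < CARD('m)"
  proof -
    have "degree L = card (- {i})" by (simp add: L_def degree_prod_eq_sum_degree)
    also have "\<dots> < CARD('m)" by (intro psubset_card_mono) auto
    finally show ?thesis .
  qed
  have pL: "poly L w = (\<Prod>j\<in>-{i}. w - p j)" for w by (simp add: L_def poly_prod)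
  have ne: "(\<Prod>j\<in>-{i}. p i - p j) \<noteq> 0" using inj_p by (auto simp: inj_def)
  have "0 = (\<Sum>k\<in>UNIV. dual L $ k * (\<Sum>j\<in>UNIV. poly (g k) (p j) / (\<Prod>l\<in>-{j}. p j - p l) * x j))"
    by (simp only: x mult_zero_right sum.neutral_const)
  also have "\<dots> = (\<Sum>k\<in>UNIV. \<Sum>j\<in>UNIV. dual L $ k * poly (g k) (p j) * (x j / (\<Prod>l\<in>-{j}. p j - p l)))"
    unfolding sum_distrib_left by (intro sum.cong refl) simp
  also have "\<dots> = (\<Sum>j\<in>UNIV. \<Sum>k\<in>UNIV. dual L $ k * poly (g k) (p j) * (x j / (\<Prod>l\<in>-{j}. p j - p l)))"
    by (rule sum.swap)
  also have "\<dots> = (\<Sum>j\<in>UNIV. poly L (p j) * (x j / (\<Prod>l\<in>-{j}. p j - p l)))"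
    unfolding sum_distrib_right[symmetric] dual[OF dL] ..
  also have "\<dots> = (\<Sum>j\<in>UNIV. if j = i then x i else 0)"
    by (rule sum.cong[OF refl]) (use ne in \<open>auto simp: pL\<close>)
  also have "\<dots> = x i" by simp
  finally show "x i = 0" ..
qed

context polynomial_weierstrass_data
begin

lemma R_eq: "z \<in> Omega \<Longrightarrow> R k z = poly (g k) z / (\<Prod>i\<in>UNIV. z - p i)"
  unfolding R_def using partial_fractions[OF inj_p degree_g] by (simp add: Omega_def)

lemma null_R: "z \<in> Omega \<Longrightarrow> (\<Sum>k\<in>UNIV. (R k z)\<^sup>2) = 0"
  by (simp add: R_eq power_divide sum_divide_distrib[symmetric] null_g)

lemma combination_R: "z \<in> Omega \<Longrightarrow> (\<Sum>k\<in>UNIV. a $ k * R k z) = (\<Sum>k\<in>UNIV. a $ k * poly (g k) z) / (\<Prod>i\<in>UNIV. z - p i)"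
  by (simp add: R_eq sum_divide_distrib)

lemma nonzero_on_Omega:
  assumes "degree Q < CARD('m)" "\<And>z. poly Q z = 0 \<Longrightarrow> z \<in> range p" "z \<in> Omega"
  shows "(\<Sum>k\<in>UNIV. dual Q $ k * R k z) \<noteq> 0"
  using assms Omega_ne[OF assms(3)] by (auto simp: combination_R dual Omega_def)

lemma combination_R_nonzero:
  assumes "a \<noteq> 0" shows "\<exists>z\<in>Omega. (\<Sum>k\<in>UNIV. a $ k * R k z) \<noteq> 0"
proof (rule ccontr)
  assume n: "\<not> ?thesis"
  define G where "G = (\<Sum>k\<in>UNIV. smult (a $ k) (g k))"
  have "G \<noteq> 0" using independent_g assms by (auto simp: G_def)
  then have "finite ({z. poly G z = 0} \<union> range p)" using poly_roots_finite by auto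
  moreover have "UNIV = {z. poly G z = 0} \<union> range p"
  proof -
    have "poly G z = 0" if "z \<notin> range p" for z
    proof -
      have zO: "z \<in> Omega" using that by (simp add: Omega_def)
      then have "(\<Sum>k\<in>UNIV. a $ k * poly (g k) z) / (\<Prod>i\<in>UNIV. z - p i) = 0" using n combination_R[OF zO] by auto
      then show ?thesis using Omega_ne[OF zO] by (simp add: G_def poly_sum)
    qed
    then show ?thesis by auto
  qed
  ultimately have "finite (UNIV :: complex set)" by simp
  then show False using infinite_UNIV_char_0 by blast
qed

theorem minimal_surface_omitting:
  assumes gp: "in_general_position N (\<lambda>j. dual (Q j))"
    and Q: "\<And>j. j < N \<Longrightarrow> degree (Q j) < CARD('m)" "\<And>j z. j < N \<Longrightarrow> poly (Q j) z = 0 \<Longrightarrow> z \<in> range p"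
  shows "complete_minimal_surface (top_of_set S) atlas x \<and> nondegenerate_map (top_of_set S) (gauss_map atlas x) \<and>
      in_general_position N (\<lambda>j. dual (Q j)) \<and>
      (\<forall>j<N. omits_hyperplane (top_of_set S) (gauss_map atlas x) (dual (Q j))) \<and>
      pseudo_algebraic TYPE(complex \<times> (complex ^ 'm)) (top_of_set S) atlas x"
  using complete_minimal_x[OF null_R] nondegenerate_x[OF null_R combination_R_nonzero] gp
    omits_x[OF null_R nonzero_on_Omega] Q pseudo_algebraic_x[OF null_R] by blast

theorem holomorphic_curve_omitting:
  assumes gp: "in_general_position N (\<lambda>j. dual (Q j))"
    and Q: "\<And>j. j < N \<Longrightarrow> degree (Q j) < CARD('m)" "\<And>j z. j < N \<Longrightarrow> poly (Q j) z = 0 \<Longrightarrow> z \<in> range p"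
  shows "riemann_surface (top_of_set S) atlas \<and> holomorphic_immersion atlas f \<and>
      complete_surface (top_of_set S) atlas (induced_metric f) \<and>
      \<not> in_affine_hyperplane (f ` topspace (top_of_set S)) \<and>
      in_general_position N (\<lambda>j. dual (Q j)) \<and>
      (\<forall>j<N. omits_hyperplane (top_of_set S) (complex_gauss_map atlas f) (dual (Q j)))"
  using riemann_surface_cover immersion_f complete_f not_in_affine_hyperplane[OF combination_R_nonzero] gp
    omits_complex[OF nonzero_on_Omega] Q by simp

end

theorem corollary1p6:
  assumes "CARD('m::finite) \<ge> 3"
  shows "(\<exists>(X :: (complex \<times> (complex ^ 'm)) topology) A (x :: complex \<times> (complex ^ 'm) \<Rightarrow> real ^ 'm)
            (a :: nat \<Rightarrow> complex ^ 'm).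
            complete_minimal_surface X A x \<and>
            nondegenerate_map X (gauss_map A x) \<and>
            in_general_position (CARD('m) * (CARD('m) + 1) div 2) a \<and>
            (\<forall>j < CARD('m) * (CARD('m) + 1) div 2. omits_hyperplane X (gauss_map A x) (a j)) \<and>
            pseudo_algebraic TYPE(complex \<times> (complex ^ 'm)) X A x) \<and>
         (\<exists>(X :: (complex \<times> (complex ^ 'm)) topology) A (f :: complex \<times> (complex ^ 'm) \<Rightarrow> complex ^ 'm)
            (a :: nat \<Rightarrow> complex ^ 'm).
            riemann_surface X A \<and> holomorphic_immersion A f \<and>
            complete_surface X A (induced_metric f) \<and>
            \<not> in_affine_hyperplane (f ` topspace X) \<and>
            in_general_position (CARD('m) * (CARD('m) + 1) div 2) a \<and>
            (\<forall>j < CARD('m) * (CARD('m) + 1) div 2.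
               omits_hyperplane X (complex_gauss_map A f) (a j)))"
proof -
  define N where "N = CARD('m) * (CARD('m) + 1) div 2"
  obtain Z P where Z: "finite Z" "card Z = CARD('m)" "0 \<in> Z"
    and gp: "poly_general_position CARD('m) N P"
    and P: "\<And>j. j < N \<Longrightarrow> degree (P j) < CARD('m)" "\<And>j z. j < N \<Longrightarrow> poly (P j) z = 0 \<Longrightarrow> z \<in> Z"
    using exists_general_position_family[where 'm='m] assms unfolding N_def by fastforce
  obtain p :: "'m \<Rightarrow> complex" where p: "bij_betw p UNIV Z"
    using finite_same_card_bij[of "UNIV :: 'm set" Z] Z by auto
  then have rp: "inj p" "range p = Z" by (auto simp: bij_betw_def)
  then obtain i0 where i0: "p i0 = 0" using Z(3) by (metis imageE)
  interpret W: polynomial_weierstrass_data p i0 null_poly dual_vec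
    by unfold_locales
      (use rp i0 assms degree_null_poly sum_null_poly_squares dual_vec_null_poly null_polys_independent in blast)+
  have gpa: "in_general_position N (\<lambda>j. dual_vec (P j) :: complex ^ 'm)"
    by (rule general_position_dual_vec[OF assms gp P(1)])
  have zeros: "\<And>j z. j < N \<Longrightarrow> poly (P j) z = 0 \<Longrightarrow> z \<in> range p" using P(2) rp by simp
  show ?thesis
    unfolding N_def[symmetric]
    by (rule conjI)
      ((rule exI)+, rule W.minimal_surface_omitting[OF gpa P(1) zeros], assumption+,
       (rule exI)+, rule W.holomorphic_curve_omitting[OF gpa P(1) zeros], assumption+)
qed

end
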